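(* Let Assumption N1 hold with $N\ge2$. Then for all $t\ge T_0$: if $N=2$, $\|u(t)\|_{L^2}\le\|u(T_0)\|_{L^2}e^{-C(t-T_0)}$; if $N\ge3$, $$\|u(t)\|_{L^2}\le\frac{\|u(T_0)\|_{L^2}}{\Big(1+C\|u(T_0)\|_{L^2}^{\frac{(1-m)(N-2)}{2}}(t-T_0)\Big)^{\frac{2}{(1-m)(N-2)}}},$$ where $C>0$ depends (continuously) only on $\|\nabla u\|_{L^\infty((0,\infty);L^2)}$, $\Im(a)$, $N$, $m$ (and, if $m=0$, only on $\|\nabla u\|_{L^\infty((0,\infty);L^2)}$, $\Im(a)-\|f\|_{L^\infty((T_0,\infty)\times\Omega)}$ and $N$).
   Context: All functions are complex-valued; $\Omega\subseteq\mathbb{R}^N$ nonempty open. $C(m)=\{z\in\mathbb{C}:\Im z>0,\ 2\sqrt m\,\Im z\ge(1-m)|\Re z|\}$; for $0<m<1$, $D(m)=\{z:\Im z>0,\ 2\sqrt m\,\Im z=(1-m)\Re z\}$, $C_{\mathrm{int}}(m)=C(m)\setminus D(m)$. Assumption 1: $0\le m\le 1$; $|\Omega|<\infty$ if $m=0$; $a\in C(m)$ if $m\in\{0,1\}$, $a\in C_{\mathrm{int}}(m)$ if $0<m<1$; $V\in L^\infty(\Omega;\mathbb{R})+L^{p_V}(\Omega;\mathbb{R})$ with $p_V=2$ if $N=1$, $2+\beta$ ($\beta>0$) if $N=2$, $N$ if $N\ge3$. Problem (P): $\mathrm{i}u_t+\Delta u+Vu+a|u|^{-(1-m)}u=f$,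 $u=0$ on $\partial\Omega$, $u(0)=u_0$ ($|z|^{-(1-m)}z:=0$ at $0$ for $m>0$; for $m=0$ the term $|u|^{-1}u$ is replaced by some $U\in L^\infty$, $\|U\|_\infty\le1$, $U=u/|u|$ where $u\neq0$). A weak solution is the (unique) limit in $C([0,T];L^2(\Omega))$, for every $T>0$, of strong solutions $u_n$ with right-hand sides $f_n\to f$ in $L^1((0,T);L^2)$, with $u(0)=u_0$. Assumption N1: Assumption 1 holds with $0\le m<1$ and $V$ constant; $f\in L^1((0,\infty);H^1_0(\Omega))$, $u_0\in H^1_0(\Omega)$, $u$ is the weak solution of (P); and there is $T_0\ge0$ such that: if $m=0$, $f\in L^\infty((T_0,\infty)\times\Omega)$ with $\|f\|_{L^\infty((T_0,\infty)\times\Omega)}<\Im(a)$; if $0<m<1$, $f(t)=0$ for a.e. $t>T_0$. *)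

theory Defs
  imports "HOL-Probability.Probability"
begin

definition pd :: "'n::finite \<Rightarrow> (real^'n \<Rightarrow> 'b::real_normed_vector) \<Rightarrow> real^'n \<Rightarrow> 'b" where
  "pd j \<phi> x = frechet_derivative \<phi> (at x) (axis j 1)"

primrec Ck :: "nat \<Rightarrow> (real^'n::finite \<Rightarrow> 'b::real_normed_vector) \<Rightarrow> bool" where
  "Ck 0 \<phi> = continuous_on UNIV \<phi>"
| "Ck (Suc k) \<phi> = (continuous_on UNIV \<phi> \<and> (\<forall>x. \<phi> differentiable (at x)) \<and> (\<forall>j. Ck k (pd j \<phi>)))"

definition smooth_fun :: "(real^'n::finite \<Rightarrow> 'b::real_normed_vector) \<Rightarrow> bool" where
  "smooth_fun \<phi> \<longleftrightarrow> (\<forall>k. Ck k \<phi>)"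

definition test_fun :: "(real^'n::finite) set \<Rightarrow> (real^'n \<Rightarrow> complex) \<Rightarrow> bool" where
  "test_fun \<Omega> \<phi> \<longleftrightarrow> smooth_fun \<phi> \<and> (\<exists>K. compact K \<and> K \<subseteq> \<Omega> \<and> (\<forall>x. x \<notin> K \<longrightarrow> \<phi> x = 0))"

definition memL2 :: "(real^'n::finite) set \<Rightarrow> (real^'n \<Rightarrow> complex) \<Rightarrow> bool" where
  "memL2 \<Omega> v \<longleftrightarrow> v \<in> borel_measurable (lebesgue_on \<Omega>) \<and>
      integrable (lebesgue_on \<Omega>) (\<lambda>x. (cmod (v x))\<^sup>2)"

definition L2norm :: "(real^'n::finite) set \<Rightarrow> (real^'n \<Rightarrow> complex) \<Rightarrow> real" where
  "L2norm \<Omega> v = sqrt (integral\<^sup>L (lebesgue_on \<Omega>) (\<lambda>x. (cmod (v x))\<^sup>2))"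

definition weak_pd :: "(real^'n::finite) set \<Rightarrow> (real^'n \<Rightarrow> complex) \<Rightarrow> 'n \<Rightarrow> (real^'n \<Rightarrow> complex) \<Rightarrow> bool" where
  "weak_pd \<Omega> v j g \<longleftrightarrow> (\<forall>\<phi>. test_fun \<Omega> \<phi> \<longrightarrow>
      integrable (lebesgue_on \<Omega>) (\<lambda>x. v x * pd j \<phi> x) \<and>
      integrable (lebesgue_on \<Omega>) (\<lambda>x. g x * \<phi> x) \<and>
      integral\<^sup>L (lebesgue_on \<Omega>) (\<lambda>x. v x * pd j \<phi> x) = - integral\<^sup>L (lebesgue_on \<Omega>) (\<lambda>x. g x * \<phi> x))"

definition memH1 :: "(real^'n::finite) set \<Rightarrow> (real^'n \<Rightarrow> complex) \<Rightarrow> bool" where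
  "memH1 \<Omega> v \<longleftrightarrow> memL2 \<Omega> v \<and> (\<forall>j. \<exists>g. memL2 \<Omega> g \<and> weak_pd \<Omega> v j g)"

definition wgrad :: "(real^'n::finite) set \<Rightarrow> (real^'n \<Rightarrow> complex) \<Rightarrow> 'n \<Rightarrow> real^'n \<Rightarrow> complex" where
  "wgrad \<Omega> v j = (SOME g. memL2 \<Omega> g \<and> weak_pd \<Omega> v j g)"

definition gradL2sq :: "(real^'n::finite) set \<Rightarrow> (real^'n \<Rightarrow> complex) \<Rightarrow> real" where
  "gradL2sq \<Omega> v = (\<Sum>j\<in>UNIV. integral\<^sup>L (lebesgue_on \<Omega>) (\<lambda>x. (cmod (wgrad \<Omega> v j x))\<^sup>2))"

definition H1norm :: "(real^'n::finite) set \<Rightarrow> (real^'n \<Rightarrow> complex) \<Rightarrow> real" where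
  "H1norm \<Omega> v = sqrt ((L2norm \<Omega> v)\<^sup>2 + gradL2sq \<Omega> v)"

definition memH10 :: "(real^'n::finite) set \<Rightarrow> (real^'n \<Rightarrow> complex) \<Rightarrow> bool" where
  "memH10 \<Omega> v \<longleftrightarrow> memH1 \<Omega> v \<and> (\<exists>\<phi>s. (\<forall>k. test_fun \<Omega> (\<phi>s k)) \<and>
      (\<lambda>k. H1norm \<Omega> (\<lambda>x. \<phi>s k x - v x)) \<longlonglongrightarrow> 0)"

definition gradnorm :: "(real^'n::finite) set \<Rightarrow> (real^'n \<Rightarrow> complex) \<Rightarrow> ereal" where
  "gradnorm \<Omega> v = (if memH1 \<Omega> v then ereal (sqrt (gradL2sq \<Omega> v)) else \<infinity>)"

definition weak_lap :: "(real^'n::finite) set \<Rightarrow> (real^'n \<Rightarrow> complex) \<Rightarrow> (real^'n \<Rightarrow> complex) \<Rightarrow> bool" where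
  "weak_lap \<Omega> v w \<longleftrightarrow> (\<forall>\<phi>. test_fun \<Omega> \<phi> \<longrightarrow>
      integrable (lebesgue_on \<Omega>) (\<lambda>x. v x * (\<Sum>j\<in>UNIV. pd j (pd j \<phi>) x)) \<and>
      integrable (lebesgue_on \<Omega>) (\<lambda>x. w x * \<phi> x) \<and>
      integral\<^sup>L (lebesgue_on \<Omega>) (\<lambda>x. v x * (\<Sum>j\<in>UNIV. pd j (pd j \<phi>) x)) =
      integral\<^sup>L (lebesgue_on \<Omega>) (\<lambda>x. w x * \<phi> x))"

definition jmeas :: "real set \<Rightarrow> (real^'n::finite) set \<Rightarrow> (real \<Rightarrow> real^'n \<Rightarrow> complex) \<Rightarrow> bool" where
  "jmeas I \<Omega> u \<longleftrightarrow> (\<lambda>p. u (fst p) (snd p)) \<in> borel_measurable (lebesgue_on (I \<times> \<Omega>))"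

definition L1L2 :: "real set \<Rightarrow> (real^'n::finite) set \<Rightarrow> (real \<Rightarrow> real^'n \<Rightarrow> complex) \<Rightarrow> bool" where
  "L1L2 I \<Omega> w \<longleftrightarrow> jmeas I \<Omega> w \<and> (AE t in lebesgue_on I. memL2 \<Omega> (w t)) \<and>
     (\<integral>\<^sup>+ t. ennreal (L2norm \<Omega> (w t)) \<partial>lebesgue_on I) < \<infinity>"

definition L1H10 :: "real set \<Rightarrow> (real^'n::finite) set \<Rightarrow> (real \<Rightarrow> real^'n \<Rightarrow> complex) \<Rightarrow> bool" where
  "L1H10 I \<Omega> f \<longleftrightarrow> jmeas I \<Omega> f \<and> (AE t in lebesgue_on I. memH10 \<Omega> (f t)) \<and>
     (\<lambda>t. H1norm \<Omega> (f t)) \<in> borel_measurable (lebesgue_on I) \<and>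
     (\<integral>\<^sup>+ t. ennreal (H1norm \<Omega> (f t)) \<partial>lebesgue_on I) < \<infinity>"

definition CL2 :: "real \<Rightarrow> (real^'n::finite) set \<Rightarrow> (real \<Rightarrow> real^'n \<Rightarrow> complex) \<Rightarrow> bool" where
  "CL2 T \<Omega> u \<longleftrightarrow> (\<forall>t\<in>{0..T}. memL2 \<Omega> (u t)) \<and>
     (\<forall>t\<in>{0..T}. ((\<lambda>s. L2norm \<Omega> (\<lambda>x. u s x - u t x)) \<longlongrightarrow> 0) (at t within {0..T}))"

definition Cset :: "real \<Rightarrow> complex set" where
  "Cset m = {z. Im z > 0 \<and> 2 * sqrt m * Im z \<ge> (1 - m) * \<bar>Re z\<bar>}"

definition Dset :: "real \<Rightarrow> complex set" where
  "Dset m = {z. Im z > 0 \<and> 2 * sqrt m * Im z = (1 - m) * Re z}"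

definition Cint :: "real \<Rightarrow> complex set" where
  "Cint m = Cset m - Dset m"

definition nonlin :: "real \<Rightarrow> complex \<Rightarrow> complex" where
  "nonlin m z = (if z = 0 then 0 else complex_of_real (cmod z powr (m - 1)) * z)"

text \<open>Strong solution on (0,T) of  i u_t + Delta u + V u + a |u|^{-(1-m)} u = f  with Dirichlet
  boundary condition (encoded by u(t) in H^1_0), V a real constant.
  Regularity: u in C([0,T];L^2) cap W^{1,1}((0,T);L^2) cap L^infty((0,T);H^1_0), Delta u in L^1((0,T);L^2).
  For m = 0 the term |u|^{-1}u is replaced by some U in L^infty, |U| <= 1, U = u/|u| where u /= 0.\<close>
definition strong_sol :: "(real^'n::finite) set \<Rightarrow> real \<Rightarrow> complex \<Rightarrow> real \<Rightarrow> real \<Rightarrow>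
    (real \<Rightarrow> real^'n \<Rightarrow> complex) \<Rightarrow> (real \<Rightarrow> real^'n \<Rightarrow> complex) \<Rightarrow> bool" where
  "strong_sol \<Omega> V a m T f u \<longleftrightarrow>
     L1L2 {0<..<T} \<Omega> f \<and> CL2 T \<Omega> u \<and> jmeas {0<..<T} \<Omega> u \<and>
     (\<exists>B. AE t in lebesgue_on {0<..<T}. memH10 \<Omega> (u t) \<and> H1norm \<Omega> (u t) \<le> B) \<and>
     (\<exists>w lap U.
        L1L2 {0<..<T} \<Omega> w \<and>
        (\<forall>t\<in>{0..T}. AE x in lebesgue_on \<Omega>.
            integrable (lebesgue_on {0..t}) (\<lambda>s. w s x) \<and>
            u t x = u 0 x + integral\<^sup>L (lebesgue_on {0..t}) (\<lambda>s. w s x)) \<and>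
        L1L2 {0<..<T} \<Omega> lap \<and>
        (AE t in lebesgue_on {0<..<T}. weak_lap \<Omega> (u t) (lap t)) \<and>
        jmeas {0<..<T} \<Omega> U \<and>
        (if m = 0 then
           (AE p in lebesgue_on ({0<..<T} \<times> \<Omega>).
              cmod (U (fst p) (snd p)) \<le> 1 \<and>
              (u (fst p) (snd p) \<noteq> 0 \<longrightarrow>
                 U (fst p) (snd p) = u (fst p) (snd p) / complex_of_real (cmod (u (fst p) (snd p)))))
         else (\<forall>t x. U t x = nonlin m (u t x))) \<and>
        (AE t in lebesgue_on {0<..<T}. AE x in lebesgue_on \<Omega>.
           \<i> * w t x + lap t x + complex_of_real V * u t x + a * U t x = f t x))"

definition weak_sol :: "(real^'n::finite) set \<Rightarrow> real \<Rightarrow> complex \<Rightarrow> real \<Rightarrow>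
    (real \<Rightarrow> real^'n \<Rightarrow> complex) \<Rightarrow> (real^'n \<Rightarrow> complex) \<Rightarrow> (real \<Rightarrow> real^'n \<Rightarrow> complex) \<Rightarrow> bool" where
  "weak_sol \<Omega> V a m f u0 u \<longleftrightarrow>
     (AE x in lebesgue_on \<Omega>. u 0 x = u0 x) \<and>
     (\<forall>T>0. CL2 T \<Omega> u \<and> (\<exists>un fn. (\<forall>n. strong_sol \<Omega> V a m T (fn n) (un n)) \<and>
        (\<lambda>n. (SUP t\<in>{0..T}. ennreal (L2norm \<Omega> (\<lambda>x. un n t x - u t x)))) \<longlonglongrightarrow> 0 \<and>
        (\<lambda>n. \<integral>\<^sup>+ t. ennreal (L2norm \<Omega> (\<lambda>x. fn n t x - f t x)) \<partial>lebesgue_on {0<..<T}) \<longlonglongrightarrow> 0))"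

definition assumption_N1 :: "(real^'n::finite) set \<Rightarrow> real \<Rightarrow> complex \<Rightarrow> real \<Rightarrow>
    (real \<Rightarrow> real^'n \<Rightarrow> complex) \<Rightarrow> (real^'n \<Rightarrow> complex) \<Rightarrow> (real \<Rightarrow> real^'n \<Rightarrow> complex) \<Rightarrow> real \<Rightarrow> bool" where
  "assumption_N1 \<Omega> V a m f u0 u T0 \<longleftrightarrow>
     open \<Omega> \<and> \<Omega> \<noteq> {} \<and> 0 \<le> m \<and> m < 1 \<and>
     (m = 0 \<longrightarrow> emeasure lebesgue \<Omega> < \<infinity> \<and> a \<in> Cset 0) \<and>
     (0 < m \<longrightarrow> a \<in> Cint m) \<and>
     L1H10 {0<..} \<Omega> f \<and> memH10 \<Omega> u0 \<and> weak_sol \<Omega> V a m f u0 u \<and> T0 \<ge> 0 \<and>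
     (m = 0 \<longrightarrow> jmeas {T0<..} \<Omega> f \<and>
        esssup (lebesgue_on ({T0<..} \<times> \<Omega>)) (\<lambda>p. ereal (cmod (f (fst p) (snd p)))) < ereal (Im a)) \<and>
     (0 < m \<longrightarrow> (AE t in lebesgue_on {T0<..}. AE x in lebesgue_on \<Omega>. f t x = 0))"

definition grad_Linf :: "(real^'n::finite) set \<Rightarrow> (real \<Rightarrow> real^'n \<Rightarrow> complex) \<Rightarrow> ereal" where
  "grad_Linf \<Omega> u = esssup (lebesgue_on {0<..}) (\<lambda>t. gradnorm \<Omega> (u t))"

definition f_Linf :: "(real^'n::finite) set \<Rightarrow> real \<Rightarrow> (real \<Rightarrow> real^'n \<Rightarrow> complex) \<Rightarrow> ereal" where
  "f_Linf \<Omega> T0 f = esssup (lebesgue_on ({T0<..} \<times> \<Omega>)) (\<lambda>p. ereal (cmod (f (fst p) (snd p))))"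

definition decay_bound :: "nat \<Rightarrow> real \<Rightarrow> real \<Rightarrow> real \<Rightarrow> real \<Rightarrow> real" where
  "decay_bound N m C y0 s =
     (if N = 2 then y0 * exp (- C * s)
      else y0 / (1 + C * y0 powr ((1 - m) * (real N - 2) / 2) * s) powr (2 / ((1 - m) * (real N - 2))))"

end

theory Submission
  imports Defs "HOL-Real_Asymp.Real_Asymp"
begin

text \<open>
  Testing the equation with u and taking imaginary parts gives the dissipation inequality
  \<open>(d/dt) \<parallel>u\<parallel>\<^sup>2 \<le> - 2 \<delta> \<integral> \<bar>u\<bar>\<^bsup>1+m\<^esup>\<close> for \<open>t > T\<^sub>0\<close>, where \<open>\<delta>\<close> is \<open>Im a\<close>, diminished by the bound on f if \<open>m = 0\<close>.
  An interpolation inequality bounds the integral from below by a multiple of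
  \<open>\<parallel>u\<parallel>\<^bsup>2+\<alpha>\<^esup>\<close> with \<open>\<alpha> = (1 - m)(N - 2)/2\<close>, the constant depending on the gradient bound only; it follows from
  \<open>\<bar>u(x)\<bar>\<^sup>2 \<le> 4 \<bar>u(x) - u(x+h)\<bar>\<^sup>2 + 2 \<bar>u(x)\<bar>\<^sup>p \<bar>u(x+h)\<bar>\<^bsup>2-p\<^esup>\<close>, \<open>p = 1 + m\<close>, by averaging over h in a cube. The resulting
  differential inequality integrates to the exponential (\<open>\<alpha> = 0\<close>) or algebraic (\<open>\<alpha> > 0\<close>) decay.

  The gradient of a weak solution is bounded by means of the Moreau envelopes of the Dirichlet energy,
  \<open>E\<^sub>\<mu>(u) = inf (\<parallel>\<nabla>\<phi>\<parallel>\<^sup>2 + \<mu> \<parallel>\<phi> - u\<parallel>\<^sup>2)\<close>, which are continuous on \<open>L\<^sup>2\<close> and increase to \<open>\<parallel>\<nabla>u\<parallel>\<^sup>2\<close>. Along strong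
  solutions \<open>sqrt E\<^sub>\<mu>\<close> grows at most by a multiple of the time integral of \<open>\<parallel>\<nabla>f\<parallel>\<close>, up to an error controlled by the distance
  of the forcing terms; this passes to the limit of weak solutions, and then \<open>\<mu>\<close> tends to infinity.
\<close>

subsection \<open>The semi-inner product of L2\<close>

text \<open>Nothing controls the gradients of the strong approximants: their forcing is close to f
  in L2 only, and their initial gradients need not converge. So the gradient bound cannot be proved
  on them and passed to the limit; an L2-continuous substitute is needed, and its limit must also
  make the gradient norm measurable in time, or its essential supremum says nothing. The same lack
  of regularity keeps the energy and decay arguments in integrated form, as inequalities between two
  times whose quadratic remainders vanish under subdivision. Beyond \<open>Im a > 0\<close>, the
  cone condition enters through the real derivative of the power map, regularised by \<delta> so
  that it sends test functions to test functions. Limits are taken in a fixed order: the minimising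
  index, then \<delta>, then the strong approximants, then the envelope parameter. Translations
  stand in for a Sobolev embedding, so that N = 2 and N >= 3 are treated alike. The side of the cube
  is a multiple of the L2 norm divided by the gradient bound, chosen so that the gradient term
  absorbs half of the squared norm. The exponent 2 + \<alpha> arises as (1 + m) + N(1 -
  m)/2.\<close>

definition ip :: "(real^'n::finite) set \<Rightarrow> (real^'n \<Rightarrow> complex) \<Rightarrow> (real^'n \<Rightarrow> complex) \<Rightarrow> complex" where
  "ip \<Omega> f g = (\<integral>x. f x * cnj (g x) \<partial>lebesgue_on \<Omega>)"

lemma memL2_integrable_mult:
  assumes "memL2 \<Omega> f" "memL2 \<Omega> g"
  shows "integrable (lebesgue_on \<Omega>) (\<lambda>x. f x * g x)"
proof (rule Bochner_Integration.integrable_bound[of _ "\<lambda>x. (cmod (f x))\<^sup>2 + (cmod (g x))\<^sup>2"])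
  show "AE x in lebesgue_on \<Omega>. norm (f x * g x) \<le> norm ((cmod (f x))\<^sup>2 + (cmod (g x))\<^sup>2)"
  proof (rule AE_I2)
    fix x
    have "cmod (f x) * cmod (g x) \<le> (cmod (f x))\<^sup>2 + (cmod (g x))\<^sup>2"
      using sum_squares_bound[of "cmod (f x)" "cmod (g x)"] mult_nonneg_nonneg[of "cmod (f x)" "cmod (g x)"]
        norm_ge_zero[of "f x"] norm_ge_zero[of "g x"] by linarith
    then show "norm (f x * g x) \<le> norm ((cmod (f x))\<^sup>2 + (cmod (g x))\<^sup>2)"
      by (simp add: norm_mult)
  qed
qed (use assms in \<open>auto simp: memL2_def\<close>)

lemma memL2_cnj: "memL2 \<Omega> f \<Longrightarrow> memL2 \<Omega> (\<lambda>x. cnj (f x))"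
  unfolding memL2_def by (auto intro: borel_measurable_continuous_on[of cnj] continuous_intros)

lemma ip_integrable:
  "memL2 \<Omega> f \<Longrightarrow> memL2 \<Omega> g \<Longrightarrow> integrable (lebesgue_on \<Omega>) (\<lambda>x. f x * cnj (g x))"
  by (intro memL2_integrable_mult memL2_cnj)

lemma memL2_add:
  assumes "memL2 \<Omega> f" "memL2 \<Omega> g"
  shows "memL2 \<Omega> (\<lambda>x. f x + g x)"
proof -
  have "integrable (lebesgue_on \<Omega>) (\<lambda>x. (cmod (f x + g x))\<^sup>2)"
  proof (rule Bochner_Integration.integrable_bound[of _ "\<lambda>x. 2 * (cmod (f x))\<^sup>2 + 2 * (cmod (g x))\<^sup>2"])
    show "AE x in lebesgue_on \<Omega>. norm ((cmod (f x + g x))\<^sup>2) \<le> norm (2 * (cmod (f x))\<^sup>2 + 2 * (cmod (g x))\<^sup>2)"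
    proof (rule AE_I2)
      fix x
      have "(cmod (f x + g x))\<^sup>2 \<le> (cmod (f x) + cmod (g x))\<^sup>2"
        by (intro power_mono norm_triangle_ineq) auto
      also have "\<dots> \<le> 2 * (cmod (f x))\<^sup>2 + 2 * (cmod (g x))\<^sup>2"
        using sum_squares_bound[of "cmod (f x)" "cmod (g x)"] by (simp add: power2_sum)
      finally show "norm ((cmod (f x + g x))\<^sup>2) \<le> norm (2 * (cmod (f x))\<^sup>2 + 2 * (cmod (g x))\<^sup>2)"
        by simp
    qed
  qed (use assms in \<open>auto simp: memL2_def\<close>)
  then show ?thesis using assms by (auto simp: memL2_def)
qed

lemma memL2_cmult: "memL2 \<Omega> f \<Longrightarrow> memL2 \<Omega> (\<lambda>x. c * f x)"
  unfolding memL2_def by (auto simp: norm_mult power_mult_distrib)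

lemma memL2_uminus: "memL2 \<Omega> f \<Longrightarrow> memL2 \<Omega> (\<lambda>x. - f x)"
  using memL2_cmult[of \<Omega> f "-1"] by simp

lemma memL2_diff: "memL2 \<Omega> f \<Longrightarrow> memL2 \<Omega> g \<Longrightarrow> memL2 \<Omega> (\<lambda>x. f x - g x)"
  using memL2_add[of \<Omega> f "\<lambda>x. - g x"] memL2_uminus by auto

lemma memL2_zero [simp]: "memL2 \<Omega> (\<lambda>x. 0)"
  by (simp add: memL2_def)

lemmas memL2_rules = memL2_add memL2_diff memL2_cmult memL2_uminus memL2_cnj

lemma memL2_cong_AE:
  assumes "memL2 \<Omega> f" "AE x in lebesgue_on \<Omega>. f x = g x" "g \<in> borel_measurable (lebesgue_on \<Omega>)"
  shows "memL2 \<Omega> g"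
proof -
  have "integrable (lebesgue_on \<Omega>) (\<lambda>x. (cmod (g x))\<^sup>2)"
    by (rule integrable_cong_AE_imp[of _ "\<lambda>x. (cmod (f x))\<^sup>2"]) (use assms in \<open>auto simp: memL2_def\<close>)
  then show ?thesis using assms by (simp add: memL2_def)
qed

lemma L2norm_cong_AE:
  assumes "AE x in lebesgue_on \<Omega>. f x = g x" "f \<in> borel_measurable (lebesgue_on \<Omega>)"
    "g \<in> borel_measurable (lebesgue_on \<Omega>)"
  shows "L2norm \<Omega> f = L2norm \<Omega> g"
  unfolding L2norm_def
  by (rule arg_cong[of _ _ sqrt], rule integral_cong_AE) (use assms in auto)

lemma ip_cong_AE:
  assumes "AE x in lebesgue_on \<Omega>. f x = f' x" "memL2 \<Omega> f" "memL2 \<Omega> f'"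
    "AE x in lebesgue_on \<Omega>. g x = g' x" "memL2 \<Omega> g" "memL2 \<Omega> g'"
  shows "ip \<Omega> f g = ip \<Omega> f' g'"
  unfolding ip_def
proof (rule integral_cong_AE)
  show "AE x in lebesgue_on \<Omega>. f x * cnj (g x) = f' x * cnj (g' x)"
    using assms(1,4) by eventually_elim auto
qed (use assms ip_integrable borel_measurable_integrable in blast)+

lemma L2norm_nonneg [simp]: "0 \<le> L2norm \<Omega> f"
  by (simp add: L2norm_def)

lemma L2norm_sq: "(L2norm \<Omega> f)\<^sup>2 = (\<integral>x. (cmod (f x))\<^sup>2 \<partial>lebesgue_on \<Omega>)"
  by (simp add: L2norm_def)

lemma L2norm_zero [simp]: "L2norm \<Omega> (\<lambda>x. 0) = 0"
  by (simp add: L2norm_def)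

lemma ip_self: "ip \<Omega> f f = complex_of_real ((L2norm \<Omega> f)\<^sup>2)"
  by (simp add: ip_def L2norm_sq complex_mult_cnj cmod_power2
      flip: integral_complex_of_real of_real_power of_real_add)

lemma ip_add_left:
  "memL2 \<Omega> f \<Longrightarrow> memL2 \<Omega> g \<Longrightarrow> memL2 \<Omega> h \<Longrightarrow> ip \<Omega> (\<lambda>x. f x + g x) h = ip \<Omega> f h + ip \<Omega> g h"
  unfolding ip_def by (simp add: ring_distribs ip_integrable)

lemma ip_add_right:
  "memL2 \<Omega> f \<Longrightarrow> memL2 \<Omega> g \<Longrightarrow> memL2 \<Omega> h \<Longrightarrow> ip \<Omega> h (\<lambda>x. f x + g x) = ip \<Omega> h f + ip \<Omega> h g"
  unfolding ip_def by (simp add: ring_distribs ip_integrable)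

lemma ip_diff_left:
  "memL2 \<Omega> f \<Longrightarrow> memL2 \<Omega> g \<Longrightarrow> memL2 \<Omega> h \<Longrightarrow> ip \<Omega> (\<lambda>x. f x - g x) h = ip \<Omega> f h - ip \<Omega> g h"
  unfolding ip_def by (simp add: ring_distribs ip_integrable)

lemma ip_diff_right:
  "memL2 \<Omega> f \<Longrightarrow> memL2 \<Omega> g \<Longrightarrow> memL2 \<Omega> h \<Longrightarrow> ip \<Omega> h (\<lambda>x. f x - g x) = ip \<Omega> h f - ip \<Omega> h g"
  unfolding ip_def by (simp add: ring_distribs ip_integrable)

lemma ip_cmult_left: "ip \<Omega> (\<lambda>x. c * f x) h = c * ip \<Omega> f h"
  unfolding ip_def by (simp add: mult.assoc)

lemma ip_cmult_right: "ip \<Omega> h (\<lambda>x. c * f x) = cnj c * ip \<Omega> h f"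
  unfolding ip_def by (simp add: mult.left_commute[of _ "cnj c"])

lemma ip_commute: "ip \<Omega> g f = cnj (ip \<Omega> f g)"
  unfolding ip_def by (subst Bochner_Integration.integral_cnj[symmetric]) (simp add: mult.commute)

lemmas ip_lin = ip_add_left ip_add_right ip_diff_left ip_diff_right ip_cmult_left ip_cmult_right

lemma L2norm_cmult: "L2norm \<Omega> (\<lambda>x. c * f x) = cmod c * L2norm \<Omega> f"
  by (simp add: L2norm_def norm_mult power_mult_distrib real_sqrt_mult)

lemma L2norm_minus_commute: "L2norm \<Omega> (\<lambda>x. f x - g x) = L2norm \<Omega> (\<lambda>x. g x - f x)"
  by (simp add: L2norm_def norm_minus_commute)

lemma L2norm_add_sq:
  assumes "memL2 \<Omega> f" "memL2 \<Omega> g"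
  shows "(L2norm \<Omega> (\<lambda>x. f x + g x))\<^sup>2 = (L2norm \<Omega> f)\<^sup>2 + 2 * Re (ip \<Omega> f g) + (L2norm \<Omega> g)\<^sup>2"
proof -
  have "complex_of_real ((L2norm \<Omega> (\<lambda>x. f x + g x))\<^sup>2) = ip \<Omega> f f + (ip \<Omega> f g + ip \<Omega> g f) + ip \<Omega> g g"
    unfolding ip_self[symmetric] using assms by (simp add: ip_lin memL2_rules)
  also have "ip \<Omega> f g + ip \<Omega> g f = complex_of_real (2 * Re (ip \<Omega> f g))"
    by (subst ip_commute[of \<Omega> g f]) (simp add: complex_add_cnj)
  finally show ?thesis
    unfolding ip_self of_real_add[symmetric] of_real_eq_iff .
qed

text \<open>Only the directions \<tau> = -t b with real t matter: they leave a real quadratic in t,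
  to be evaluated at its minimum t = 1/S, while for S = 0 a large t is absurd unless b = 0. With
  \<epsilon> a squared norm this yields Cauchy-Schwarz; with \<epsilon> the excess over an infimum
  it bounds the Euler-Lagrange residual of a near-minimiser.\<close>

lemma discriminant_bound:
  fixes b :: complex and \<epsilon> S :: real
  assumes "\<And>\<tau>::complex. 0 \<le> \<epsilon> + 2 * Re (cnj \<tau> * b) + (cmod \<tau>)\<^sup>2 * S" "0 \<le> S"
  shows "(cmod b)\<^sup>2 \<le> \<epsilon> * S"
proof -
  have *: "0 \<le> \<epsilon> - 2 * t * (cmod b)\<^sup>2 + t\<^sup>2 * (cmod b)\<^sup>2 * S" for t :: real
  proof -
    have "0 \<le> \<epsilon> + 2 * Re (cnj (complex_of_real (-t) * b) * b) + (cmod (complex_of_real (-t) * b))\<^sup>2 * S"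
      by (rule assms(1))
    moreover have "Re (cnj (complex_of_real (-t) * b) * b) = - t * (cmod b)\<^sup>2"
      by (simp add: cmod_power2) (simp add: power2_eq_square algebra_simps)
    ultimately show ?thesis by (simp add: norm_mult power_mult_distrib)
  qed
  show ?thesis
  proof (cases "S = 0")
    case True
    have "b = 0"
    proof (rule ccontr)
      assume "b \<noteq> 0"
      then have "0 < (cmod b)\<^sup>2" by simp
      then have "0 \<le> \<epsilon> - 2 * ((\<bar>\<epsilon>\<bar> + 1) / (cmod b)\<^sup>2) * (cmod b)\<^sup>2"
        using *[of "(\<bar>\<epsilon>\<bar> + 1) / (cmod b)\<^sup>2"] True by simp
      also have "\<dots> = \<epsilon> - 2 * (\<bar>\<epsilon>\<bar> + 1)" using \<open>0 < (cmod b)\<^sup>2\<close> by simp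
      finally show False using abs_ge_self[of \<epsilon>] abs_ge_zero[of \<epsilon>] by argo
    qed
    then show ?thesis using True by simp
  next
    case False
    then have S: "S > 0" using assms(2) by simp
    have "0 \<le> \<epsilon> - 2 * (1/S) * (cmod b)\<^sup>2 + (1/S)\<^sup>2 * (cmod b)\<^sup>2 * S" by (rule *)
    also have "\<dots> = \<epsilon> - (cmod b)\<^sup>2 / S" using S by (simp add: field_simps power2_eq_square)
    finally show ?thesis using S by (simp add: field_simps)
  qed
qed

lemma L2norm_variation_sq:
  assumes "memL2 \<Omega> f" "memL2 \<Omega> g"
  shows "(L2norm \<Omega> (\<lambda>x. f x + \<tau> * g x))\<^sup>2
     = (L2norm \<Omega> f)\<^sup>2 + 2 * Re (cnj \<tau> * ip \<Omega> f g) + (cmod \<tau>)\<^sup>2 * (L2norm \<Omega> g)\<^sup>2"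
  using L2norm_add_sq[of \<Omega> f "\<lambda>x. \<tau> * g x"] assms memL2_cmult[of \<Omega> g \<tau>]
  by (simp add: ip_cmult_right L2norm_cmult power_mult_distrib)

lemma ip_cauchy_schwarz:
  assumes "memL2 \<Omega> f" "memL2 \<Omega> g"
  shows "cmod (ip \<Omega> f g) \<le> L2norm \<Omega> f * L2norm \<Omega> g"
proof -
  have "(cmod (ip \<Omega> f g))\<^sup>2 \<le> (L2norm \<Omega> f)\<^sup>2 * (L2norm \<Omega> g)\<^sup>2"
    by (rule discriminant_bound) (simp_all only: L2norm_variation_sq[OF assms, symmetric] zero_le_power2)
  then show ?thesis
    using power2_le_imp_le[of "cmod (ip \<Omega> f g)" "L2norm \<Omega> f * L2norm \<Omega> g"]
    by (simp add: power_mult_distrib)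
qed

lemma L2norm_triangle:
  assumes "memL2 \<Omega> f" "memL2 \<Omega> g"
  shows "L2norm \<Omega> (\<lambda>x. f x + g x) \<le> L2norm \<Omega> f + L2norm \<Omega> g"
proof (rule power2_le_imp_le)
  have "Re (ip \<Omega> f g) \<le> L2norm \<Omega> f * L2norm \<Omega> g"
    using ip_cauchy_schwarz[OF assms] complex_Re_le_cmod order_trans by blast
  then show "(L2norm \<Omega> (\<lambda>x. f x + g x))\<^sup>2 \<le> (L2norm \<Omega> f + L2norm \<Omega> g)\<^sup>2"
    unfolding L2norm_add_sq[OF assms] by (simp add: power2_sum)
qed auto

lemma L2norm_triangle_diff:
  assumes "memL2 \<Omega> f" "memL2 \<Omega> g"
  shows "L2norm \<Omega> (\<lambda>x. f x - g x) \<le> L2norm \<Omega> f + L2norm \<Omega> g"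
  using L2norm_triangle[of \<Omega> f "\<lambda>x. (-1) * g x"] memL2_cmult[of \<Omega> g "-1"] assms
  by (simp only: L2norm_cmult) simp

lemma L2norm_triangle_mid:
  assumes "memL2 \<Omega> f" "memL2 \<Omega> g" "memL2 \<Omega> h"
  shows "L2norm \<Omega> (\<lambda>x. f x - h x) \<le> L2norm \<Omega> (\<lambda>x. f x - g x) + L2norm \<Omega> (\<lambda>x. g x - h x)"
  using L2norm_triangle[of \<Omega> "\<lambda>x. f x - g x" "\<lambda>x. g x - h x"] assms by (simp add: memL2_rules)

lemma L2norm_triangle_abs:
  assumes "memL2 \<Omega> f" "memL2 \<Omega> g"
  shows "\<bar>L2norm \<Omega> f - L2norm \<Omega> g\<bar> \<le> L2norm \<Omega> (\<lambda>x. f x - g x)"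
  using L2norm_triangle_mid[OF assms memL2_zero] L2norm_triangle_mid[OF assms(2,1) memL2_zero]
  by (simp add: L2norm_minus_commute[of \<Omega> g f])

lemma tendsto_L2norm:
  assumes "\<And>k. memL2 \<Omega> (f k)" "memL2 \<Omega> g" "(\<lambda>k. L2norm \<Omega> (\<lambda>x. f k x - g x)) \<longlonglongrightarrow> 0"
  shows "(\<lambda>k. L2norm \<Omega> (f k)) \<longlonglongrightarrow> L2norm \<Omega> g"
  by (rule LIM_zero_cancel, rule Lim_null_comparison[OF _ assms(3)])
    (use L2norm_triangle_abs[OF assms(1,2)] in auto)

lemma tendsto_ip:
  assumes "\<And>k. memL2 \<Omega> (f k)" "memL2 \<Omega> f'" "(\<lambda>k. L2norm \<Omega> (\<lambda>x. f k x - f' x)) \<longlonglongrightarrow> 0"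
    and "\<And>k. memL2 \<Omega> (g k)" "memL2 \<Omega> g'" "(\<lambda>k. L2norm \<Omega> (\<lambda>x. g k x - g' x)) \<longlonglongrightarrow> 0"
  shows "(\<lambda>k. ip \<Omega> (f k) (g k)) \<longlonglongrightarrow> ip \<Omega> f' g'"
proof (rule LIM_zero_cancel, rule Lim_null_comparison)
  let ?F = "\<lambda>k. L2norm \<Omega> (\<lambda>x. f k x - f' x)" and ?G = "\<lambda>k. L2norm \<Omega> (\<lambda>x. g k x - g' x)"
  have "norm (ip \<Omega> (f k) (g k) - ip \<Omega> f' g') \<le> ?F k * L2norm \<Omega> (g k) + L2norm \<Omega> f' * ?G k" for k
  proof -
    have "ip \<Omega> (f k) (g k) - ip \<Omega> f' g'
        = ip \<Omega> (\<lambda>x. f k x - f' x) (g k) + ip \<Omega> f' (\<lambda>x. g k x - g' x)"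
      using assms by (simp add: ip_lin)
    also have "norm \<dots> \<le> ?F k * L2norm \<Omega> (g k) + L2norm \<Omega> f' * ?G k"
      by (rule order_trans[OF norm_triangle_ineq])
        (intro add_mono ip_cauchy_schwarz memL2_diff assms)
    finally show ?thesis .
  qed
  then show "\<forall>\<^sub>F k in sequentially. norm (ip \<Omega> (f k) (g k) - ip \<Omega> f' g')
      \<le> ?F k * L2norm \<Omega> (g k) + L2norm \<Omega> f' * ?G k" by simp
  have "(\<lambda>k. ?F k * L2norm \<Omega> (g k) + L2norm \<Omega> f' * ?G k) \<longlonglongrightarrow> 0 * L2norm \<Omega> g' + L2norm \<Omega> f' * 0"
    by (intro tendsto_intros tendsto_L2norm assms)
  then show "(\<lambda>k. ?F k * L2norm \<Omega> (g k) + L2norm \<Omega> f' * ?G k) \<longlonglongrightarrow> 0" by simp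
qed

lemma ip_tendsto_left:
  assumes "\<And>k. memL2 \<Omega> (f k)" "memL2 \<Omega> f'" "(\<lambda>k. L2norm \<Omega> (\<lambda>x. f k x - f' x)) \<longlonglongrightarrow> 0" "memL2 \<Omega> g"
  shows "(\<lambda>k. ip \<Omega> (f k) g) \<longlonglongrightarrow> ip \<Omega> f' g"
  using tendsto_ip[of \<Omega> f f' "\<lambda>_. g" g] assms by simp

lemma ip_tendsto_right:
  assumes "\<And>k. memL2 \<Omega> (f k)" "memL2 \<Omega> f'" "(\<lambda>k. L2norm \<Omega> (\<lambda>x. f k x - f' x)) \<longlonglongrightarrow> 0" "memL2 \<Omega> g"
  shows "(\<lambda>k. ip \<Omega> g (f k)) \<longlonglongrightarrow> ip \<Omega> g f'"
  using tendsto_ip[of \<Omega> "\<lambda>_. g" g f f'] assms by simp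

section \<open>Almost everywhere convergence and completeness of L2\<close>

lemma nn_integral_L2norm_sq:
  assumes "memL2 \<Omega> f"
  shows "(\<integral>\<^sup>+x. ennreal ((cmod (f x))\<^sup>2) \<partial>lebesgue_on \<Omega>) = ennreal ((L2norm \<Omega> f)\<^sup>2)"
  unfolding L2norm_sq using assms by (intro nn_integral_eq_integral) (auto simp: memL2_def)

lemma nn_integral_finite_memL2:
  assumes "f \<in> borel_measurable (lebesgue_on \<Omega>)"
    "(\<integral>\<^sup>+x. ennreal ((cmod (f x))\<^sup>2) \<partial>lebesgue_on \<Omega>) \<le> ennreal c"
  shows "memL2 \<Omega> f" "0 \<le> c \<Longrightarrow> (L2norm \<Omega> f)\<^sup>2 \<le> c"
proof -
  show *: "memL2 \<Omega> f"
    unfolding memL2_def integrable_iff_bounded using assms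
    by (auto intro: order.strict_trans1)
  show "(L2norm \<Omega> f)\<^sup>2 \<le> c" if "0 \<le> c"
    using assms(2) that unfolding nn_integral_L2norm_sq[OF *] by (simp add: ennreal_le_iff)
qed

text \<open>The weights 2^k are affordable because the squared norms decay like 4^(-k), so the
  weighted sum of squares is finite almost everywhere. Passing from squares to moduli this way needs
  no finite measure of \<Omega>.\<close>

lemma L2_AE_subseq:
  assumes "\<And>k. memL2 \<Omega> (d k)" "\<And>k. L2norm \<Omega> (d k) \<le> (1/2)^k"
  shows "AE x in lebesgue_on \<Omega>. summable (\<lambda>k. cmod (d k x))"
proof -
  have [measurable]: "d k \<in> borel_measurable (lebesgue_on \<Omega>)" for k
    using assms(1) by (auto simp: memL2_def)
  have "(\<integral>\<^sup>+x. (\<Sum>k. ennreal (2^k * (cmod (d k x))\<^sup>2)) \<partial>lebesgue_on \<Omega>)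
      = (\<Sum>k. \<integral>\<^sup>+x. ennreal (2^k * (cmod (d k x))\<^sup>2) \<partial>lebesgue_on \<Omega>)"
    by (rule nn_integral_suminf) measurable
  also have "\<dots> = (\<Sum>k. ennreal (2^k * (L2norm \<Omega> (d k))\<^sup>2))"
    by (simp add: ennreal_mult nn_integral_cmult nn_integral_L2norm_sq[OF assms(1)])
  also have "\<dots> \<le> (\<Sum>k. ennreal ((1/2)^k))"
  proof (intro suminf_le ennreal_leI)
    fix k
    have "(L2norm \<Omega> (d k))\<^sup>2 \<le> ((1/2)^k)\<^sup>2"
      by (rule power_mono) (use assms in auto)
    also have "\<dots> = (1/2)^k * (1/2)^k" by (simp add: power2_eq_square)
    finally show "2 ^ k * (L2norm \<Omega> (d k))\<^sup>2 \<le> (1 / 2) ^ k"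
      by (simp add: field_simps)
  qed auto
  also have "\<dots> = ennreal (\<Sum>k. (1/2)^k)"
    by (rule suminf_ennreal_eq) (auto intro: geometric_sums summable_sums summable_geometric)
  also have "\<dots> < \<infinity>" by simp
  finally have "AE x in lebesgue_on \<Omega>. (\<Sum>k. ennreal (2^k * (cmod (d k x))\<^sup>2)) \<noteq> \<infinity>"
    by (intro nn_integral_noteq_infinite) auto
  then show ?thesis
  proof eventually_elim
    case (elim x)
    let ?c = "\<lambda>k. 2^k * (cmod (d k x))\<^sup>2"
    have s: "summable ?c" by (rule summable_suminf_not_top) (use elim in auto)
    have s2: "summable (\<lambda>k. (1/2)^k + ?c k)" by (intro summable_add s summable_geometric) auto
    show "summable (\<lambda>k. cmod (d k x))"
    proof (rule summable_comparison_test'[OF s2, of 0])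
      fix k :: nat
      \<comment> \<open>Either the modulus is at most 2^(-k), or 2^k times it is at least 1 and the
        weighted square dominates it.\<close>
      have "cmod (d k x) \<le> (1/2)^k + ?c k"
      proof (cases "cmod (d k x) \<le> (1/2)^k")
        case True
        then show ?thesis by (smt (verit) zero_le_mult_iff zero_le_power zero_le_power2)
      next
        case False
        then have "1 \<le> 2^k * cmod (d k x)" by (simp add: field_simps)
        then have "cmod (d k x) * 1 \<le> cmod (d k x) * (2^k * cmod (d k x))"
          by (intro mult_left_mono) auto
        then have "cmod (d k x) \<le> ?c k" by (simp add: power2_eq_square algebra_simps)
        then show ?thesis by (simp add: add_increasing)
      qed
      then show "norm (cmod (d k x)) \<le> (1/2)^k + ?c k" by simp
    qed
  qed
qed

text \<open>Fatou applied to the squares. The bound is only required eventually, so that the lemma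
  applies to tails of a Cauchy sequence.\<close>

lemma L2_Fatou:
  assumes m: "\<And>k. memL2 \<Omega> (f k)" and g: "g \<in> borel_measurable (lebesgue_on \<Omega>)"
    and lim: "AE x in lebesgue_on \<Omega>. (\<lambda>k. f k x) \<longlonglongrightarrow> g x"
    and bd: "\<forall>\<^sub>F k in sequentially. L2norm \<Omega> (f k) \<le> c" and c: "0 \<le> c"
  shows "memL2 \<Omega> g" "L2norm \<Omega> g \<le> c"
proof -
  have [measurable]: "f k \<in> borel_measurable (lebesgue_on \<Omega>)" for k
    using m by (auto simp: memL2_def)
  have "(\<integral>\<^sup>+x. ennreal ((cmod (g x))\<^sup>2) \<partial>lebesgue_on \<Omega>)
     = (\<integral>\<^sup>+x. liminf (\<lambda>k. ennreal ((cmod (f k x))\<^sup>2)) \<partial>lebesgue_on \<Omega>)"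
  proof (rule nn_integral_cong_AE, use lim in eventually_elim)
    case (elim x)
    have "(\<lambda>k. ennreal ((cmod (f k x))\<^sup>2)) \<longlonglongrightarrow> ennreal ((cmod (g x))\<^sup>2)"
      by (intro tendsto_intros elim)
    from lim_imp_Liminf[OF trivial_limit_sequentially this] show ?case by (rule sym)
  qed
  also have "\<dots> \<le> liminf (\<lambda>k. \<integral>\<^sup>+x. ennreal ((cmod (f k x))\<^sup>2) \<partial>lebesgue_on \<Omega>)"
    by (rule nn_integral_liminf) measurable
  also have "\<dots> = liminf (\<lambda>k. ennreal ((L2norm \<Omega> (f k))\<^sup>2))"
    by (simp add: nn_integral_L2norm_sq m)
  also have "\<dots> \<le> limsup (\<lambda>k. ennreal ((L2norm \<Omega> (f k))\<^sup>2))"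
    by (rule Liminf_le_Limsup) simp
  also have "\<dots> \<le> ennreal (c\<^sup>2)"
    by (rule Limsup_bounded, use bd in eventually_elim) (auto intro!: ennreal_leI power_mono)
  finally have *: "(\<integral>\<^sup>+x. ennreal ((cmod (g x))\<^sup>2) \<partial>lebesgue_on \<Omega>) \<le> ennreal (c\<^sup>2)" .
  show "memL2 \<Omega> g" "L2norm \<Omega> g \<le> c"
    using nn_integral_finite_memL2[OF g *] c by (auto intro: power2_le_imp_le)
qed

lemma L2_subseq_choice:
  assumes "\<And>\<epsilon>. 0 < \<epsilon> \<Longrightarrow> \<exists>N. \<forall>k\<ge>N. \<forall>l\<ge>N. L2norm \<Omega> (\<lambda>x. f k x - f l x) < \<epsilon>"
  obtains r :: "nat \<Rightarrow> nat" where "strict_mono r"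
    "\<And>k. L2norm \<Omega> (\<lambda>x. f (r (Suc k)) x - f (r k) x) \<le> (1/2)^k"
proof -
  have "\<exists>N. \<forall>k\<ge>N. \<forall>l\<ge>N. L2norm \<Omega> (\<lambda>x. f k x - f l x) < (1/2)^j" for j :: nat
    by (rule assms) simp
  then obtain N where N: "\<And>j k l. k \<ge> N j \<Longrightarrow> l \<ge> N j \<Longrightarrow> L2norm \<Omega> (\<lambda>x. f k x - f l x) < (1/2)^j"
    by metis
  \<comment> \<open>The sum dominates every threshold up to k, and the summand k makes the choice
    strictly increasing.\<close>
  define r where "r k = k + (\<Sum>j\<le>k. N j)" for k
  have sm: "strict_mono r" by (rule strict_mono_Suc_iff[THEN iffD2]) (simp add: r_def)
  have Nr: "N k \<le> r k" for k
    unfolding r_def by (rule trans_le_add2) (rule member_le_sum, auto)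
  have "L2norm \<Omega> (\<lambda>x. f (r (Suc k)) x - f (r k) x) \<le> (1/2)^k" for k
    by (rule less_imp_le, rule N[OF order_trans[OF Nr] Nr]) (simp add: strict_mono_less_eq[OF sm])
  with sm show ?thesis by (rule that)
qed

text \<open>Riesz-Fischer for the seminorm on actual functions: the limit is the pointwise limit of
  a fast subsequence.\<close>

theorem L2_complete:
  assumes m: "\<And>k. memL2 \<Omega> (f k)"
    and cauchy: "\<And>\<epsilon>. 0 < \<epsilon> \<Longrightarrow> \<exists>N. \<forall>k\<ge>N. \<forall>l\<ge>N. L2norm \<Omega> (\<lambda>x. f k x - f l x) < \<epsilon>"
  shows "\<exists>g. memL2 \<Omega> g \<and> (\<lambda>k. L2norm \<Omega> (\<lambda>x. f k x - g x)) \<longlonglongrightarrow> 0"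
proof -
  obtain r where r: "strict_mono r"
    and rd: "\<And>k. L2norm \<Omega> (\<lambda>x. f (r (Suc k)) x - f (r k) x) \<le> (1/2)^k"
    using L2_subseq_choice[of \<Omega> f, OF cauchy] by blast
  have [measurable]: "f k \<in> borel_measurable (lebesgue_on \<Omega>)" for k
    using m by (auto simp: memL2_def)
  define g where "g x = lim (\<lambda>k. f (r k) x)" for x
  have gm[measurable]: "g \<in> borel_measurable (lebesgue_on \<Omega>)"
    unfolding g_def by measurable
  have "AE x in lebesgue_on \<Omega>. summable (\<lambda>k. cmod (f (r (Suc k)) x - f (r k) x))"
    by (rule L2_AE_subseq) (use m rd in \<open>auto intro: memL2_diff\<close>)
  then have lim: "AE x in lebesgue_on \<Omega>. (\<lambda>k. f (r k) x) \<longlonglongrightarrow> g x"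
  proof eventually_elim
    case (elim x)
    then have "summable (\<lambda>k. f (r (Suc k)) x - f (r k) x)" by (rule summable_norm_cancel)
    then have "convergent (\<lambda>n. \<Sum>k<n. f (r (Suc k)) x - f (r k) x)"
      by (simp add: summable_iff_convergent)
    then have "convergent (\<lambda>n. f (r n) x - f (r 0) x)"
      by (simp only: sum_lessThan_telescope[of "\<lambda>k. f (r k) x"])
    then have "convergent (\<lambda>n. (f (r n) x - f (r 0) x) + f (r 0) x)"
      by (intro convergent_add convergent_const)
    then show ?case unfolding g_def by (simp add: convergent_LIMSEQ_iff)
  qed
  \<comment> \<open>Fatou in the second index, along the subsequence, carries the Cauchy estimate of
    the whole sequence over to the limit.\<close>
  have main: "memL2 \<Omega> (\<lambda>x. f l x - g x) \<and> L2norm \<Omega> (\<lambda>x. f l x - g x) \<le> e"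
    if "0 < e" "\<forall>k\<ge>N. \<forall>l\<ge>N. L2norm \<Omega> (\<lambda>x. f k x - f l x) < e" "l \<ge> N" for e N l
  proof -
    have 1: "AE x in lebesgue_on \<Omega>. (\<lambda>k. f l x - f (r k) x) \<longlonglongrightarrow> f l x - g x"
      using lim by eventually_elim (intro tendsto_intros)
    have 2: "\<forall>\<^sub>F k in sequentially. L2norm \<Omega> (\<lambda>x. f l x - f (r k) x) \<le> e"
      using eventually_ge_at_top[of N]
    proof eventually_elim
      case (elim k)
      then have "r k \<ge> N" using seq_suble[OF r, of k] by linarith
      then show ?case using that by (auto intro: less_imp_le)
    qed
    show ?thesis
      using L2_Fatou[OF _ _ 1 2] m that(1) by (auto intro: memL2_diff)
  qed
  obtain N1 where "\<forall>k\<ge>N1. \<forall>l\<ge>N1. L2norm \<Omega> (\<lambda>x. f k x - f l x) < 1" using cauchy[of 1] by auto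
  then have "memL2 \<Omega> (\<lambda>x. f N1 x - g x)" using main[of 1 N1 N1] by auto
  from memL2_diff[OF m[of N1] this] have g: "memL2 \<Omega> g" by simp
  moreover have "(\<lambda>k. L2norm \<Omega> (\<lambda>x. f k x - g x)) \<longlonglongrightarrow> 0"
  proof (rule LIMSEQ_I)
    fix e :: real assume "0 < e"
    then obtain N where N: "\<forall>k\<ge>N. \<forall>l\<ge>N. L2norm \<Omega> (\<lambda>x. f k x - f l x) < e/2"
      using cauchy[of "e/2"] by auto
    have "norm (L2norm \<Omega> (\<lambda>x. f l x - g x) - 0) < e" if "l \<ge> N" for l
      using main[OF _ N that] \<open>0 < e\<close> by auto
    then show "\<exists>N. \<forall>l\<ge>N. norm (L2norm \<Omega> (\<lambda>x. f l x - g x) - 0) < e" by blast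
  qed
  ultimately show ?thesis by blast
qed

text \<open>Along indices with distance at most 2^(-k) the differences are absolutely summable
  almost everywhere, hence tend to 0.\<close>

lemma L2_AE_convergent_subseq:
  assumes m: "\<And>k. memL2 \<Omega> (f k)" and g: "memL2 \<Omega> g"
    and lim: "(\<lambda>k. L2norm \<Omega> (\<lambda>x. f k x - g x)) \<longlonglongrightarrow> 0"
  shows "\<exists>r. strict_mono r \<and> (AE x in lebesgue_on \<Omega>. (\<lambda>k. f (r k) x) \<longlonglongrightarrow> g x)"
proof -
  have "\<exists>n. \<forall>k\<ge>n. L2norm \<Omega> (\<lambda>x. f k x - g x) < (1/2)^j" for j :: nat
    using LIMSEQ_D[OF lim, of "(1/2)^j"] by auto
  then obtain n where n: "\<And>j k. k \<ge> n j \<Longrightarrow> L2norm \<Omega> (\<lambda>x. f k x - g x) < (1/2)^j" by metis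
  define r where "r k = k + (\<Sum>j\<le>k. n j)" for k
  have sm: "strict_mono r" by (rule strict_mono_Suc_iff[THEN iffD2]) (simp add: r_def)
  have nr: "n k \<le> r k" for k
    unfolding r_def by (rule trans_le_add2) (rule member_le_sum, auto)
  have small: "L2norm \<Omega> (\<lambda>x. f (r k) x - g x) \<le> (1/2)^k" for k
    by (rule less_imp_le, rule n, rule nr)
  have "AE x in lebesgue_on \<Omega>. summable (\<lambda>k. cmod (f (r k) x - g x))"
    by (rule L2_AE_subseq[OF memL2_diff[OF m g] small])
  then have "AE x in lebesgue_on \<Omega>. (\<lambda>k. f (r k) x) \<longlonglongrightarrow> g x"
  proof eventually_elim
    case (elim x)
    then have "(\<lambda>k. f (r k) x - g x) \<longlonglongrightarrow> 0"
      by (rule summable_LIMSEQ_zero[OF summable_norm_cancel])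
    then show ?case by (rule LIM_zero_cancel)
  qed
  with sm show ?thesis by blast
qed

subsection \<open>Smooth functions\<close>

lemma Ck_SucD: "Ck (Suc k) f \<Longrightarrow> Ck k f"
  by (induction k arbitrary: f) auto

lemma Ck_continuous: "Ck k f \<Longrightarrow> continuous_on UNIV f"
  by (cases k) auto

lemma Ck_const: "Ck k (\<lambda>x::real^'n::finite. c :: 'b::real_normed_vector)"
proof (induction k arbitrary: c)
  case (Suc k)
  have "pd j (\<lambda>x::real^'n. c) = (\<lambda>x. 0)" for j
    by (simp add: pd_def fun_eq_iff)
  then show ?case using Suc by simp
qed simp

lemma pd_eqI: "(f has_derivative D) (at x) \<Longrightarrow> pd j f x = D (axis j 1)"
  unfolding pd_def by (metis frechet_derivative_at)

lemma differentiable_has_fderivative: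
  "f differentiable (at x) \<Longrightarrow> (f has_derivative frechet_derivative f (at x)) (at x)"
  by (simp add: frechet_derivative_works)

lemma pd_add:
  assumes "f differentiable (at x)" "g differentiable (at x)"
  shows "pd j (\<lambda>x. f x + g x) x = pd j f x + pd j g x"
  by (rule pd_eqI[THEN trans], rule has_derivative_add)
    (use assms in \<open>auto intro: differentiable_has_fderivative simp: pd_def\<close>)

lemma Ck_add: "Ck k f \<Longrightarrow> Ck k g \<Longrightarrow> Ck k (\<lambda>x. f x + g x)"
proof (induction k arbitrary: f g)
  case (Suc k)
  have "pd j (\<lambda>x. f x + g x) = (\<lambda>x. pd j f x + pd j g x)" for j
    using Suc.prems by (auto intro!: ext pd_add)
  then show ?case using Suc by (auto intro!: continuous_on_add derivative_intros)
qed (auto intro: continuous_on_add)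

lemma pd_bounded_linear:
  assumes "bounded_linear L" "f differentiable (at x)"
  shows "pd j (\<lambda>x. L (f x)) x = L (pd j f x)"
  by (rule pd_eqI[THEN trans], rule bounded_linear.has_derivative[OF assms(1)])
    (use assms in \<open>auto intro: differentiable_has_fderivative simp: pd_def\<close>)

lemma Ck_bounded_linear:
  assumes L: "bounded_linear L"
  shows "Ck k f \<Longrightarrow> Ck k (\<lambda>x. L (f x))"
proof (induction k arbitrary: f)
  case 0
  then show ?case by (auto intro!: bounded_linear.continuous_on[OF L])
next
  case (Suc k)
  have "pd j (\<lambda>x. L (f x)) = (\<lambda>x. L (pd j f x))" for j
    using Suc.prems by (auto intro!: ext pd_bounded_linear[OF L])
  moreover have "(\<lambda>x. L (f x)) differentiable (at x)" for x
    by (rule differentiableI, rule bounded_linear.has_derivative[OF L differentiable_has_fderivative])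
      (use Suc.prems in auto)
  ultimately show ?case using Suc by (auto intro!: bounded_linear.continuous_on[OF L])
qed

lemma pd_mult:
  fixes f g :: "real^'n::finite \<Rightarrow> 'b::real_normed_algebra"
  assumes "f differentiable (at x)" "g differentiable (at x)"
  shows "pd j (\<lambda>x. f x * g x) x = f x * pd j g x + pd j f x * g x"
  by (rule pd_eqI[THEN trans], rule has_derivative_mult)
    (use assms in \<open>auto intro: differentiable_has_fderivative simp: pd_def\<close>)

lemma Ck_mult:
  fixes f g :: "real^'n::finite \<Rightarrow> 'b::real_normed_algebra"
  shows "Ck k f \<Longrightarrow> Ck k g \<Longrightarrow> Ck k (\<lambda>x. f x * g x)"
proof (induction k arbitrary: f g)
  case (Suc k)
  have "pd j (\<lambda>x. f x * g x) = (\<lambda>x. f x * pd j g x + pd j f x * g x)" for j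
    using Suc.prems by (auto intro!: ext pd_mult)
  then show ?case using Suc Ck_SucD[OF Suc.prems(1)] Ck_SucD[OF Suc.prems(2)]
    by (auto intro!: continuous_on_mult Ck_add derivative_intros)
qed (auto intro: continuous_on_mult)

primrec CkR :: "real set \<Rightarrow> nat \<Rightarrow> (real \<Rightarrow> real) \<Rightarrow> bool" where
  "CkR S 0 h = continuous_on S h"
| "CkR S (Suc k) h = (\<exists>h'. (\<forall>x\<in>S. (h has_real_derivative h' x) (at x)) \<and> CkR S k h')"

lemma CkR_continuous: "CkR S k h \<Longrightarrow> continuous_on S h"
  by (cases k) (auto intro: DERIV_isCont continuous_at_imp_continuous_on)

lemma CkR_lincomb: "CkR S k h1 \<Longrightarrow> CkR S k h2 \<Longrightarrow> CkR S k (\<lambda>x. c * h1 x + d * h2 x)"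
proof (induction k arbitrary: h1 h2)
  case (Suc k)
  then obtain h1' h2' where *: "\<forall>x\<in>S. (h1 has_real_derivative h1' x) (at x)" "CkR S k h1'"
    "\<forall>x\<in>S. (h2 has_real_derivative h2' x) (at x)" "CkR S k h2'" by auto
  show ?case
    unfolding CkR.simps by (rule exI[of _ "\<lambda>x. c * h1' x + d * h2' x"])
      (use * Suc.IH in \<open>auto intro!: derivative_eq_intros\<close>)
qed (auto intro!: continuous_intros)

lemma pd_compose_real:
  fixes s :: "real^'n::finite \<Rightarrow> real"
  assumes "(h has_real_derivative h') (at (s x))" "s differentiable (at x)"
  shows "pd j (\<lambda>x. h (s x)) x = h' * pd j s x"
proof -
  have "((\<lambda>x. h (s x)) has_derivative (\<lambda>y. h' * frechet_derivative s (at x) y)) (at x)"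
    using has_derivative_compose[OF differentiable_has_fderivative[OF assms(2)]
        assms(1)[unfolded has_field_derivative_def]] .
  then show ?thesis by (simp add: pd_eqI pd_def[of j s])
qed

lemma Ck_compose_real:
  fixes s :: "real^'n::finite \<Rightarrow> real"
  assumes "range s \<subseteq> S" "Ck k s" "CkR S k h"
  shows "Ck k (\<lambda>x. h (s x))"
  using assms
proof (induction k arbitrary: h)
  case 0
  then show ?case by (auto intro!: continuous_on_compose2[of S h])
next
  case (Suc k)
  then obtain h' where h': "\<forall>x\<in>S. (h has_real_derivative h' x) (at x)" "CkR S k h'" by auto
  have d: "s differentiable (at x)" for x using Suc.prems by auto
  have "pd j (\<lambda>x. h (s x)) = (\<lambda>x. h' (s x) * pd j s x)" for j
  proof
    fix x show "pd j (\<lambda>x. h (s x)) x = h' (s x) * pd j s x"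
      by (rule pd_compose_real) (use h' Suc.prems d in auto)
  qed
  moreover have "Ck k (\<lambda>x. h' (s x))" by (rule Suc.IH) (use Suc.prems h' Ck_SucD in auto)
  moreover have "(\<lambda>x. h (s x)) differentiable (at x)" for x
    using has_derivative_compose[OF differentiable_has_fderivative[OF d[of x]], of h "\<lambda>y. h' (s x) * y"]
      h' Suc.prems unfolding has_field_derivative_def differentiable_def by blast
  moreover have "continuous_on UNIV (\<lambda>x. h (s x))"
    using CkR_continuous[OF Suc.prems(3)] Ck_continuous[OF Suc.prems(2)] Suc.prems(1)
    by (auto intro!: continuous_on_compose2[of S h])
  ultimately show ?case using Suc.prems by (auto intro: Ck_mult)
qed

text \<open>The free factor c is what lets the induction absorb the exponent produced by each
  differentiation.\<close>

lemma CkR_powr: "CkR {0<..} k (\<lambda>s. c * s powr \<beta>)"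
proof (induction k arbitrary: c \<beta>)
  case (Suc k)
  show ?case unfolding CkR.simps
    by (rule exI[of _ "\<lambda>s. (c * \<beta>) * s powr (\<beta> - 1)"], intro conjI Suc)
      (auto intro!: derivative_eq_intros)
qed (auto intro!: continuous_intros)

text \<open>The division by powers of s makes the family closed under differentiation.\<close>

definition expinv :: "nat \<Rightarrow> real \<Rightarrow> real" where
  "expinv n s = (if s > 0 then exp (- (1 / s)) / s ^ n else 0)"

lemma expinv_tendsto_0: "(expinv n \<longlongrightarrow> 0) (at_right 0)"
proof -
  have "((\<lambda>s::real. exp (- (1 / s)) / s ^ n) \<longlongrightarrow> 0) (at_right 0)"
    by real_asymp
  then show ?thesis
    by (rule Lim_transform_eventually) (auto simp: eventually_at_filter expinv_def)
qed

lemma expinv_deriv: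
  "(expinv n has_real_derivative (- real n * expinv (Suc n) s + expinv (Suc (Suc n)) s)) (at s)"
proof -
  consider "s > 0" | "s < 0" | "s = 0" by linarith
  then show ?thesis
  proof cases
    case 1
    have "((\<lambda>s. exp (- (1 / s)) / s ^ n) has_real_derivative
       (- real n * expinv (Suc n) s + expinv (Suc (Suc n)) s)) (at s)"
      using 1 by (cases n) (auto intro!: derivative_eq_intros simp: expinv_def field_simps power2_eq_square,
        metis One_nat_def power_minus_mult mult.commute neq0_conv)
    then show ?thesis
      by (rule DERIV_cong_ev[THEN iffD1, rotated -1])
        (use 1 in \<open>auto intro!: eventually_nhds_in_open[of "{0<..}", THEN eventually_mono] simp: expinv_def\<close>)
  next
    case 2
    have "((\<lambda>s. 0) has_real_derivative (- real n * expinv (Suc n) s + expinv (Suc (Suc n)) s)) (at s)"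
      using 2 by (simp add: expinv_def)
    then show ?thesis
      by (rule DERIV_cong_ev[THEN iffD1, rotated -1])
        (use 2 in \<open>auto intro!: eventually_nhds_in_open[of "{..<0}", THEN eventually_mono] simp: expinv_def\<close>)
  next
    case 3
    have "((\<lambda>s. (expinv n s - expinv n 0) / (s - 0)) \<longlongrightarrow> 0) (at 0)"
    proof (rule filterlim_split_at)
      \<comment> \<open>To the right of 0 the difference quotient of \<open>expinv n\<close> at 0 is
        \<open>expinv (Suc n)\<close> itself.\<close>
      show "((\<lambda>s. (expinv n s - expinv n 0) / (s - 0)) \<longlongrightarrow> 0) (at_right 0)"
        by (rule Lim_transform_eventually[OF expinv_tendsto_0[of "Suc n"]])
          (auto simp: eventually_at_filter expinv_def)
      show "((\<lambda>s. (expinv n s - expinv n 0) / (s - 0)) \<longlongrightarrow> 0) (at_left 0)"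
        by (rule Lim_transform_eventually[OF tendsto_const])
          (auto simp: eventually_at_filter expinv_def)
    qed
    then show ?thesis using 3 by (simp add: has_field_derivative_iff expinv_def)
  qed
qed

lemma CkR_expinv: "CkR UNIV k (expinv n)"
proof (induction k arbitrary: n)
  case 0
  then show ?case by (auto intro: expinv_deriv DERIV_isCont continuous_at_imp_continuous_on)
next
  case (Suc k)
  have "CkR UNIV k (\<lambda>s. - real n * expinv (Suc n) s + 1 * expinv (Suc (Suc n)) s)"
    by (intro CkR_lincomb Suc)
  then show ?case unfolding CkR.simps
    by (intro exI[of _ "\<lambda>s. - real n * expinv (Suc n) s + expinv (Suc (Suc n)) s"])
      (use expinv_deriv[of n] in auto)
qed

lemma smooth_fun_compose_real:
  "range s \<subseteq> S \<Longrightarrow> smooth_fun s \<Longrightarrow> (\<And>k. CkR S k h) \<Longrightarrow> smooth_fun (\<lambda>x. h (s x))"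
  unfolding smooth_fun_def by (auto intro: Ck_compose_real)

lemma smooth_fun_const: "smooth_fun (\<lambda>x. c)"
  and smooth_fun_add: "smooth_fun f \<Longrightarrow> smooth_fun g \<Longrightarrow> smooth_fun (\<lambda>x. f x + g x)"
  and smooth_fun_bounded_linear: "bounded_linear L \<Longrightarrow> smooth_fun f \<Longrightarrow> smooth_fun (\<lambda>x. L (f x))"
  unfolding smooth_fun_def by (auto intro: Ck_const Ck_add Ck_bounded_linear)

lemma smooth_fun_mult:
  fixes f g :: "real^'n::finite \<Rightarrow> 'b::real_normed_algebra"
  shows "smooth_fun f \<Longrightarrow> smooth_fun g \<Longrightarrow> smooth_fun (\<lambda>x. f x * g x)"
  unfolding smooth_fun_def by (auto intro: Ck_mult)

lemma smooth_fun_prod: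
  fixes f :: "'i \<Rightarrow> real^'n::finite \<Rightarrow> 'b::{real_normed_algebra,comm_ring_1}"
  assumes "finite I" "\<And>i. i \<in> I \<Longrightarrow> smooth_fun (f i)"
  shows "smooth_fun (\<lambda>x. \<Prod>i\<in>I. f i x)"
  using assms by (induction I rule: finite_induct) (auto intro: smooth_fun_const smooth_fun_mult)

lemma smooth_fun_component: "smooth_fun (\<lambda>x::real^'n::finite. x $ i)"
proof -
  have pd: "pd j (\<lambda>x::real^'n. x $ i) = (\<lambda>x. axis j 1 $ i)" for j
    by (rule ext, rule pd_eqI, rule bounded_linear_imp_has_derivative, rule bounded_linear_vec_nth)
  have "Ck k (\<lambda>x::real^'n. x $ i)" for k
  proof (cases k)
    case (Suc l)
    have "(\<lambda>x::real^'n. x $ i) differentiable (at x)" for x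
      by (rule bounded_linear_imp_differentiable[OF bounded_linear_vec_nth])
    then show ?thesis using Suc by (auto simp: pd Ck_const intro!: continuous_intros)
  qed (auto intro!: continuous_intros)
  then show ?thesis by (simp add: smooth_fun_def)
qed

lemma smooth_fun_continuous: "smooth_fun f \<Longrightarrow> continuous_on UNIV f"
  unfolding smooth_fun_def using Ck_continuous by blast

lemma smooth_fun_differentiable: "smooth_fun f \<Longrightarrow> f differentiable (at x)"
  unfolding smooth_fun_def by (metis Ck.simps(2))

lemma smooth_fun_pd: "smooth_fun f \<Longrightarrow> smooth_fun (pd j f)"
  unfolding smooth_fun_def by (metis Ck.simps(2))

subsection \<open>Test functions\<close>

lemma test_fun_smooth: "test_fun \<Omega> \<phi> \<Longrightarrow> smooth_fun \<phi>"
  by (simp add: test_fun_def)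

lemma test_funE:
  assumes "test_fun \<Omega> \<phi>"
  obtains K where "compact K" "K \<subseteq> \<Omega>" "\<And>x. x \<notin> K \<Longrightarrow> \<phi> x = 0"
  using assms unfolding test_fun_def by blast

lemma test_fun_mono: "test_fun \<Omega> \<phi> \<Longrightarrow> \<Omega> \<subseteq> \<Omega>' \<Longrightarrow> test_fun \<Omega>' \<phi>"
  unfolding test_fun_def by blast

lemma test_fun_continuous: "test_fun \<Omega> \<phi> \<Longrightarrow> continuous_on UNIV \<phi>"
  by (intro smooth_fun_continuous test_fun_smooth)

lemma test_fun_differentiable: "test_fun \<Omega> \<phi> \<Longrightarrow> \<phi> differentiable (at x)"
  by (intro smooth_fun_differentiable test_fun_smooth)

lemma test_fun_zero: "test_fun \<Omega> (\<lambda>x. 0)"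
  unfolding test_fun_def by (auto intro: smooth_fun_const exI[of _ "{}"])

lemma test_fun_add:
  assumes "test_fun \<Omega> f" "test_fun \<Omega> g"
  shows "test_fun \<Omega> (\<lambda>x. f x + g x)"
proof -
  obtain K L where "compact K" "K \<subseteq> \<Omega>" "\<And>x. x \<notin> K \<Longrightarrow> f x = 0"
    "compact L" "L \<subseteq> \<Omega>" "\<And>x. x \<notin> L \<Longrightarrow> g x = 0"
    using assms by (meson test_funE)
  then have "compact (K \<union> L) \<and> K \<union> L \<subseteq> \<Omega> \<and> (\<forall>x. x \<notin> K \<union> L \<longrightarrow> f x + g x = 0)"
    by (auto intro: compact_Un)
  with assms show ?thesis unfolding test_fun_def by (blast intro: smooth_fun_add)
qed

lemma test_fun_smooth_mult:
  assumes "test_fun \<Omega> f" "smooth_fun g"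
  shows "test_fun \<Omega> (\<lambda>x. g x * f x)"
proof -
  obtain K where "compact K" "K \<subseteq> \<Omega>" "\<And>x. x \<notin> K \<Longrightarrow> f x = 0"
    using assms by (meson test_funE)
  then have "compact K \<and> K \<subseteq> \<Omega> \<and> (\<forall>x. x \<notin> K \<longrightarrow> g x * f x = 0)" by auto
  with assms show ?thesis unfolding test_fun_def by (blast intro: smooth_fun_mult)
qed

lemma test_fun_cmult: "test_fun \<Omega> f \<Longrightarrow> test_fun \<Omega> (\<lambda>x. c * f x)"
  by (rule test_fun_smooth_mult[OF _ smooth_fun_const])

lemma test_fun_diff: "test_fun \<Omega> f \<Longrightarrow> test_fun \<Omega> g \<Longrightarrow> test_fun \<Omega> (\<lambda>x. f x - g x)"
  using test_fun_add[of \<Omega> f "\<lambda>x. (-1) * g x"] test_fun_cmult[of \<Omega> g "-1"] by simp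

lemma test_fun_mult: "test_fun \<Omega> f \<Longrightarrow> test_fun \<Omega> g \<Longrightarrow> test_fun \<Omega> (\<lambda>x. f x * g x)"
  by (rule test_fun_smooth_mult[OF _ test_fun_smooth])

lemma test_fun_cnj:
  assumes "test_fun \<Omega> f"
  shows "test_fun \<Omega> (\<lambda>x. cnj (f x))"
proof -
  obtain K where "compact K" "K \<subseteq> \<Omega>" "\<And>x. x \<notin> K \<Longrightarrow> f x = 0"
    using assms by (meson test_funE)
  then have "compact K \<and> K \<subseteq> \<Omega> \<and> (\<forall>x. x \<notin> K \<longrightarrow> cnj (f x) = 0)" by auto
  moreover have "smooth_fun (\<lambda>x. cnj (f x))"
    by (rule smooth_fun_bounded_linear[OF bounded_linear_cnj test_fun_smooth[OF assms]])
  ultimately show ?thesis unfolding test_fun_def by blast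
qed

lemma pd_zero_outside:
  assumes "closed K" "\<And>x. x \<notin> K \<Longrightarrow> f x = 0" "x \<notin> K"
  shows "pd j f x = 0"
proof -
  have "(f has_derivative (\<lambda>h. 0)) (at x)"
    by (rule has_derivative_transform_within_open[OF has_derivative_const[of 0] open_Compl[OF assms(1)]])
      (use assms in auto)
  then show ?thesis by (rule pd_eqI)
qed

lemma test_fun_pd:
  assumes "test_fun \<Omega> f"
  shows "test_fun \<Omega> (pd j f)"
proof -
  obtain K where "compact K" "K \<subseteq> \<Omega>" "\<And>x. x \<notin> K \<Longrightarrow> f x = 0"
    using assms by (meson test_funE)
  then have "compact K \<and> K \<subseteq> \<Omega> \<and> (\<forall>x. x \<notin> K \<longrightarrow> pd j f x = 0)"
    using pd_zero_outside[OF compact_imp_closed] by blast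
  with assms show ?thesis unfolding test_fun_def by (blast intro: smooth_fun_pd)
qed

lemma pd_test_add: "test_fun \<Omega> f \<Longrightarrow> test_fun \<Omega> g \<Longrightarrow> pd j (\<lambda>x. f x + g x) = (\<lambda>x. pd j f x + pd j g x)"
  by (rule ext, rule pd_add) (auto intro: test_fun_differentiable)

lemma pd_test_cmult: "test_fun \<Omega> f \<Longrightarrow> pd j (\<lambda>x. c * f x) = (\<lambda>x. c * pd j f x)"
  by (rule ext, rule pd_bounded_linear) (auto intro: test_fun_differentiable bounded_linear_mult_right)

lemma pd_test_cnj: "test_fun \<Omega> f \<Longrightarrow> pd j (\<lambda>x. cnj (f x)) = (\<lambda>x. cnj (pd j f x))"
  by (rule ext, rule pd_bounded_linear) (auto intro: test_fun_differentiable bounded_linear_cnj)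

lemma pd_test_diff: "test_fun \<Omega> f \<Longrightarrow> test_fun \<Omega> g \<Longrightarrow> pd j (\<lambda>x. f x - g x) = (\<lambda>x. pd j f x - pd j g x)"
  using pd_test_add[of \<Omega> f "\<lambda>x. (-1) * g x" j] pd_test_cmult[of \<Omega> g j "-1"] test_fun_cmult[of \<Omega> g "-1"]
  by simp

lemma pd_test_mult:
  "test_fun \<Omega> f \<Longrightarrow> test_fun \<Omega> g \<Longrightarrow> pd j (\<lambda>x. f x * g x) = (\<lambda>x. f x * pd j g x + pd j f x * g x)"
  by (rule ext, rule pd_mult) (auto intro: test_fun_differentiable)

lemma test_fun_bounded:
  assumes "test_fun \<Omega> f"
  obtains B where "0 \<le> B" "\<And>x. cmod (f x) \<le> B"
proof -
  obtain K where K: "compact K" "\<And>x. x \<notin> K \<Longrightarrow> f x = 0" using assms by (meson test_funE)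
  have "compact (f ` K)"
    using test_fun_continuous[OF assms] K by (intro compact_continuous_image) (auto intro: continuous_on_subset)
  then obtain B where B: "\<And>y. y \<in> f ` K \<Longrightarrow> cmod y \<le> B"
    using compact_imp_bounded bounded_iff by metis
  have "cmod (f x) \<le> max 0 B" for x
    by (cases "x \<in> K") (auto simp: K intro: B max.coboundedI2)
  then show ?thesis by (intro that[of "max 0 B"]) auto
qed

lemma test_fun_support_ball:
  assumes "test_fun \<Omega> f"
  obtains R where "0 \<le> R" "\<And>x. R < norm x \<Longrightarrow> f x = 0"
proof -
  obtain K where K: "compact K" "\<And>x. x \<notin> K \<Longrightarrow> f x = 0" using assms by (meson test_funE)
  then obtain R where "\<And>x. x \<in> K \<Longrightarrow> norm x \<le> R" using compact_imp_bounded bounded_iff by metis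
  then show ?thesis using K by (intro that[of "max 0 R"]) force+
qed

lemma test_fun_borel [measurable_dest]: "test_fun \<Omega> f \<Longrightarrow> f \<in> borel_measurable borel"
  by (intro borel_measurable_continuous_onI test_fun_continuous)

lemma borel_measurable_lebesgue_on: "f \<in> borel_measurable borel \<Longrightarrow> f \<in> borel_measurable (lebesgue_on \<Omega>)"
  by (intro measurable_restrict_space1 measurable_completion) simp

lemma integrable_ball_const: "integrable lborel (\<lambda>x::real^'n::finite. (c::real) * indicator (cball 0 R) x)"
  by (intro integrable_mult_right integrable_real_indicator)
    (auto simp: emeasure_bounded_finite[OF bounded_cball, unfolded infinity_ennreal_def])

lemma test_fun_integrable_lborel:
  assumes "test_fun \<Omega> f"
  shows "integrable lborel f"
proof -
  obtain R where R: "\<And>x. R < norm x \<Longrightarrow> f x = 0" using test_fun_support_ball[OF assms] by metis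
  obtain B where B: "0 \<le> B" "\<And>x. cmod (f x) \<le> B" using test_fun_bounded[OF assms] by metis
  have "integrable lborel (\<lambda>x::real^'n. B * indicator (cball 0 R) x :: real)"
    by (rule integrable_ball_const)
  then show ?thesis
    by (rule Bochner_Integration.integrable_bound)
      (use test_fun_borel[OF assms] B R in \<open>auto simp: indicator_def not_le\<close>)
qed

text \<open>The definitions integrate over \<open>lebesgue_on \<Omega>\<close>, while translations
  and Fubini live on \<open>lborel\<close>; for Borel functions vanishing outside \<Omega> the two
  agree.\<close>

lemma integral_lebesgue_on_support:
  fixes f :: "real^'n::finite \<Rightarrow> 'b::{banach, second_countable_topology}"
  assumes "open \<Omega>" "f \<in> borel_measurable borel" "\<And>x. x \<notin> \<Omega> \<Longrightarrow> f x = 0"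
  shows "integral\<^sup>L (lebesgue_on \<Omega>) f = integral\<^sup>L lborel f"
    and "integrable (lebesgue_on \<Omega>) f \<longleftrightarrow> integrable lborel f"
proof -
  have eq: "(\<lambda>x. indicator \<Omega> x *\<^sub>R f x) = f" using assms(3) by (auto simp: indicator_def fun_eq_iff)
  have s: "\<Omega> \<inter> space lebesgue \<in> sets lebesgue" using assms(1) by (simp add: borel_open)
  show "integral\<^sup>L (lebesgue_on \<Omega>) f = integral\<^sup>L lborel f"
    using assms(2) by (subst integral_restrict_space[OF s]) (simp add: eq integral_completion)
  show "integrable (lebesgue_on \<Omega>) f \<longleftrightarrow> integrable lborel f"
    using assms(2) by (subst integrable_restrict_space[OF s]) (simp add: eq integrable_completion)
qed

lemma test_fun_zero_outside: "test_fun \<Omega> f \<Longrightarrow> x \<notin> \<Omega> \<Longrightarrow> f x = 0"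
  by (elim test_funE) auto

lemma test_fun_integral:
  assumes "open \<Omega>" "test_fun \<Omega> f"
  shows "integral\<^sup>L (lebesgue_on \<Omega>) f = integral\<^sup>L lborel f" "integrable (lebesgue_on \<Omega>) f"
  using integral_lebesgue_on_support[OF assms(1) test_fun_borel[OF assms(2)]]
    test_fun_zero_outside[OF assms(2)] test_fun_integrable_lborel[OF assms(2)] by auto

lemma test_fun_memL2:
  assumes "open \<Omega>" "test_fun \<Omega> f"
  shows "memL2 \<Omega> f"
proof -
  have "integrable (lebesgue_on \<Omega>) (\<lambda>x. f x * cnj (f x))"
    by (intro test_fun_integral test_fun_mult test_fun_cnj assms)
  then have "integrable (lebesgue_on \<Omega>) (\<lambda>x. cmod (f x * cnj (f x)))" by (rule integrable_norm)
  then show ?thesis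
    unfolding memL2_def using test_fun_borel[OF assms(2)]
    by (auto simp: norm_mult power2_eq_square intro: borel_measurable_lebesgue_on)
qed

section \<open>Directional derivatives, difference quotients and integration by parts\<close>

lemma frechet_derivative_expand:
  fixes f :: "real^'n::finite \<Rightarrow> complex"
  assumes "f differentiable (at x)"
  shows "frechet_derivative f (at x) h = (\<Sum>i\<in>UNIV. complex_of_real (h $ i) * pd i f x)"
proof -
  interpret bounded_linear "frechet_derivative f (at x)"
    using assms by (simp add: frechet_derivative_works has_derivative_bounded_linear)
  have "frechet_derivative f (at x) h = frechet_derivative f (at x) (\<Sum>i\<in>UNIV. (h $ i) *\<^sub>R axis i 1)"
    using basis_expansion[of h] by (simp add: scalar_mult_eq_scaleR)
  also have "\<dots> = (\<Sum>i\<in>UNIV. (h $ i) *\<^sub>R frechet_derivative f (at x) (axis i 1))"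
    by (simp only: sum scaleR)
  finally show ?thesis by (simp add: pd_def scaleR_conv_of_real)
qed

text \<open>The directional derivative along h, written through the partial derivatives so that
  measurability and Cauchy-Schwarz in h are immediate.\<close>

definition dird :: "real^'n::finite \<Rightarrow> (real^'n \<Rightarrow> complex) \<Rightarrow> real^'n \<Rightarrow> complex" where
  "dird h f x = (\<Sum>i\<in>UNIV. complex_of_real (h $ i) * pd i f x)"

lemma test_diff_quotient:
  assumes "test_fun \<Omega> f"
  shows "(\<lambda>k. of_nat (Suc k) * (f (x + h /\<^sub>R real (Suc k)) - f x)) \<longlonglongrightarrow> dird h f x"
proof -
  have D: "(f has_derivative (\<lambda>h. dird h f x)) (at (x + 0 *\<^sub>R h))"
    using differentiable_has_fderivative[OF test_fun_differentiable[OF assms, of x]]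
    unfolding dird_def frechet_derivative_expand[OF test_fun_differentiable[OF assms], symmetric] by simp
  have L: "((\<lambda>t. x + t *\<^sub>R h) has_derivative (\<lambda>t. t *\<^sub>R h)) (at 0)"
    by (auto intro!: derivative_eq_intros)
  have "((\<lambda>t::real. f (x + t *\<^sub>R h)) has_derivative (\<lambda>t. dird (t *\<^sub>R h) f x)) (at 0)"
    by (rule has_derivative_compose[OF L D])
  moreover have "dird (t *\<^sub>R h) f x = t *\<^sub>R dird h f x" for t
    by (simp add: dird_def scaleR_sum_right) (simp add: scaleR_conv_of_real mult.assoc)
  ultimately have "((\<lambda>t::real. f (x + t *\<^sub>R h)) has_vector_derivative dird h f x) (at 0)"
    by (simp add: has_vector_derivative_def)
  then have lim: "((\<lambda>t::real. norm (f (x + t *\<^sub>R h) - f x - t *\<^sub>R dird h f x) / norm t) \<longlongrightarrow> 0) (at 0)"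
    by (simp add: has_vector_derivative_def has_derivative_at)
  have "((\<lambda>t::real. (f (x + t *\<^sub>R h) - f x) /\<^sub>R t) \<longlongrightarrow> dird h f x) (at 0)"
  proof (rule LIM_zero_cancel, rule tendsto_norm_zero_cancel, rule Lim_transform_eventually[OF lim])
    have "norm (f (x + t *\<^sub>R h) - f x - t *\<^sub>R dird h f x) / norm t = norm ((f (x + t *\<^sub>R h) - f x) /\<^sub>R t - dird h f x)"
      if "t \<noteq> 0" for t :: real
    proof -
      have "(f (x + t *\<^sub>R h) - f x) /\<^sub>R t - dird h f x = (f (x + t *\<^sub>R h) - f x - t *\<^sub>R dird h f x) /\<^sub>R t"
        using that by (simp add: scaleR_diff_right)
      then show ?thesis by (simp add: divide_inverse mult.commute)
    qed
    then show "\<forall>\<^sub>F t in at 0. norm (f (x + t *\<^sub>R h) - f x - t *\<^sub>R dird h f x) / norm t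
        = norm ((f (x + t *\<^sub>R h) - f x) /\<^sub>R t - dird h f x)"
      by (simp add: eventually_at_filter)
  qed
  moreover have "filterlim (\<lambda>k. inverse (real (Suc k))) (at 0) sequentially"
    unfolding filterlim_at using LIMSEQ_inverse_real_of_nat by simp
  ultimately have "((\<lambda>k. (f (x + inverse (real (Suc k)) *\<^sub>R h) - f x) /\<^sub>R inverse (real (Suc k))) \<longlonglongrightarrow> dird h f x)"
    by (rule filterlim_compose)
  then show ?thesis by (simp add: scaleR_conv_of_real)
qed

lemma test_lipschitz:
  assumes "test_fun \<Omega> f"
  obtains B where "0 \<le> B" "\<And>x y. cmod (f y - f x) \<le> B * norm (y - x)"
proof -
  have "\<exists>B. \<forall>i. 0 \<le> B i \<and> (\<forall>x. cmod (pd i f x) \<le> B i)"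
    by (rule choice) (metis test_fun_bounded[OF test_fun_pd[OF assms]])
  then obtain b where b: "\<And>i. 0 \<le> b i" "\<And>i x. cmod (pd i f x) \<le> b i" by blast
  define B where "B = (\<Sum>i\<in>UNIV. b i)"
  have "onorm (frechet_derivative f (at x)) \<le> B" for x
  proof (rule onorm_bound)
    show "0 \<le> B" unfolding B_def by (intro sum_nonneg b)
    fix h
    have "norm (frechet_derivative f (at x) h) \<le> (\<Sum>i\<in>UNIV. norm (complex_of_real (h $ i) * pd i f x))"
      unfolding frechet_derivative_expand[OF test_fun_differentiable[OF assms]] by (rule norm_sum)
    also have "\<dots> \<le> (\<Sum>i\<in>UNIV. norm h * b i)"
      by (intro sum_mono) (auto simp: norm_mult intro!: mult_mono component_le_norm_cart b)
    finally show "norm (frechet_derivative f (at x) h) \<le> B * norm h"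
      by (simp add: B_def sum_distrib_left mult.commute)
  qed
  then have "cmod (f y - f x) \<le> B * norm (y - x)" for x y
    using differentiable_bound[of UNIV f "\<lambda>x. frechet_derivative f (at x)" B y x]
      differentiable_has_fderivative[OF test_fun_differentiable[OF assms]] by auto
  moreover have "0 \<le> B" unfolding B_def by (intro sum_nonneg b)
  ultimately show ?thesis using that by blast
qed

text \<open>The Lipschitz constant cancels the factor k + 1, and a shift by at most
  \<open>norm h\<close> enlarges the support ball by \<open>norm h\<close>. One integrable majorant
  thus serves all k in dominated convergence.\<close>

lemma test_diff_quotient_dominated:
  assumes "test_fun \<Omega> f"
  obtains B R where "0 \<le> B"
    "\<And>k x. cmod (of_nat (Suc k) * (f (x + h /\<^sub>R real (Suc k)) - f x)) \<le> B * indicator (cball 0 R) x"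
proof -
  obtain B where B: "0 \<le> B" "\<And>x y. cmod (f y - f x) \<le> B * norm (y - x)"
    using test_lipschitz[OF assms] by metis
  obtain R where R: "0 \<le> R" "\<And>x. R < norm x \<Longrightarrow> f x = 0"
    using test_fun_support_ball[OF assms] by metis
  have "cmod (of_nat (Suc k) * (f (x + h /\<^sub>R real (Suc k)) - f x)) \<le> (B * norm h) * indicator (cball 0 (R + norm h)) x"
    for k x
  proof (cases "norm x \<le> R + norm h")
    case True
    have "cmod (of_nat (Suc k) * (f (x + h /\<^sub>R real (Suc k)) - f x))
        \<le> real (Suc k) * (B * norm (h /\<^sub>R real (Suc k)))"
      unfolding norm_mult norm_of_nat using B(2)[of "x + h /\<^sub>R real (Suc k)" x]
      by (intro mult_left_mono) auto
    also have "\<dots> = B * norm h" by (simp add: field_simps)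
    finally show ?thesis using True by (simp add: indicator_def)
  next
    case False
    have "norm (h /\<^sub>R real (Suc k)) \<le> norm h" by (simp add: field_simps)
    then have "R < norm (x + h /\<^sub>R real (Suc k))"
      using False norm_triangle_ineq4[of "x + h /\<^sub>R real (Suc k)" "h /\<^sub>R real (Suc k)"] by simp
    moreover have "R < norm x" using False norm_ge_zero[of h] by linarith
    ultimately show ?thesis using R by (simp add: indicator_def B)
  qed
  then show ?thesis using B by (intro that[of "B * norm h"]) auto
qed

lemma lborel_integral_shift:
  fixes f :: "real^'n::finite \<Rightarrow> 'b::{banach, second_countable_topology}"
  assumes "f \<in> borel_measurable borel"
  shows "(\<integral>x. f (x + h) \<partial>lborel) = integral\<^sup>L lborel f"
proof -
  have "integral\<^sup>L (distr lborel borel ((+) h)) f = (\<integral>x. f (h + x) \<partial>lborel)"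
    by (rule integral_distr) (use assms in auto)
  then show ?thesis by (simp add: lborel_distr_plus add.commute)
qed

lemma lborel_integrable_shift:
  fixes f :: "real^'n::finite \<Rightarrow> 'b::{banach, second_countable_topology}"
  assumes "f \<in> borel_measurable borel"
  shows "integrable lborel (\<lambda>x. f (x + h)) \<longleftrightarrow> integrable lborel f"
proof -
  have "integrable (distr lborel borel ((+) h)) f \<longleftrightarrow> integrable lborel (\<lambda>x. f (h + x))"
    by (rule integrable_distr_eq) (use assms in auto)
  then show ?thesis by (simp add: lborel_distr_plus add.commute)
qed

text \<open>Differentiating the translation invariant integral under the integral sign.\<close>

lemma test_integral_dird:
  assumes "test_fun \<Omega> f"
  shows "(\<integral>x. dird h f x \<partial>lborel) = 0"
proof -
  obtain B R where BR: "0 \<le> B"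
    "\<And>k x. cmod (of_nat (Suc k) * (f (x + h /\<^sub>R real (Suc k)) - f x)) \<le> B * indicator (cball 0 R) x"
    using test_diff_quotient_dominated[OF assms, of h] by metis
  have [measurable]: "f \<in> borel_measurable borel" "\<And>j. pd j f \<in> borel_measurable borel"
    using test_fun_borel assms test_fun_pd by blast+
  have "(\<lambda>k. \<integral>x. of_nat (Suc k) * (f (x + h /\<^sub>R real (Suc k)) - f x) \<partial>lborel) \<longlonglongrightarrow> (\<integral>x. dird h f x \<partial>lborel)"
  proof (rule integral_dominated_convergence[where w = "\<lambda>x. B * indicator (cball 0 R) x"])
    show "dird h f \<in> borel_measurable lborel" unfolding dird_def by measurable
    show "AE x in lborel. (\<lambda>k. of_nat (Suc k) * (f (x + h /\<^sub>R real (Suc k)) - f x)) \<longlonglongrightarrow> dird h f x"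
      by (intro AE_I2 test_diff_quotient[OF assms])
  qed (use BR(2) integrable_ball_const in auto)
  moreover have "(\<integral>x. of_nat (Suc k) * (f (x + h /\<^sub>R real (Suc k)) - f x) \<partial>lborel) = 0" for k
    by (subst integral_mult_right_zero, subst Bochner_Integration.integral_diff)
      (auto simp: lborel_integrable_shift lborel_integral_shift test_fun_integrable_lborel[OF assms])
  ultimately have "(\<lambda>k::nat. 0) \<longlonglongrightarrow> (\<integral>x. dird h f x \<partial>lborel)" by (simp only:)
  then show ?thesis by (simp add: LIMSEQ_const_iff)
qed

lemma dird_axis: "dird (axis j 1) f x = pd j f x"
proof -
  have "dird (axis j 1) f x = (\<Sum>i\<in>UNIV. if i = j then pd i f x else 0)"
    unfolding dird_def by (rule sum.cong) (auto simp: axis_def)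
  then show ?thesis by simp
qed

lemma test_integral_pd: "test_fun \<Omega> f \<Longrightarrow> (\<integral>x. pd j f x \<partial>lborel) = 0"
  using test_integral_dird[of \<Omega> f "axis j 1"] by (simp add: dird_axis)

text \<open>The product rule, together with the fact that the derivative of a compactly supported
  function integrates to 0.\<close>

lemma weak_pd_test:
  assumes "open \<Omega>" "test_fun \<Omega> f"
  shows "weak_pd \<Omega> f j (pd j f)"
  unfolding weak_pd_def
proof (intro allI impI conjI)
  fix \<phi> assume \<phi>: "test_fun \<Omega> \<phi>"
  have t: "test_fun \<Omega> (\<lambda>x. f x * pd j \<phi> x)" "test_fun \<Omega> (\<lambda>x. pd j f x * \<phi> x)"
    by (intro test_fun_mult test_fun_pd assms \<phi>)+
  note i = test_fun_integral[OF assms(1) t(1)] test_fun_integral[OF assms(1) t(2)]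
  show "integrable (lebesgue_on \<Omega>) (\<lambda>x. f x * pd j \<phi> x)" "integrable (lebesgue_on \<Omega>) (\<lambda>x. pd j f x * \<phi> x)"
    using i by auto
  have "0 = (\<integral>x. pd j (\<lambda>x. f x * \<phi> x) x \<partial>lborel)"
    by (rule test_integral_pd[symmetric], rule test_fun_mult[OF assms(2) \<phi>])
  also have "\<dots> = (\<integral>x. f x * pd j \<phi> x \<partial>lborel) + (\<integral>x. pd j f x * \<phi> x \<partial>lborel)"
    unfolding pd_test_mult[OF assms(2) \<phi>]
    by (rule Bochner_Integration.integral_add) (intro test_fun_integrable_lborel[of \<Omega>] t)+
  finally show "(\<integral>x. f x * pd j \<phi> x \<partial>lebesgue_on \<Omega>) = - (\<integral>x. pd j f x * \<phi> x \<partial>lebesgue_on \<Omega>)"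
    using i by (simp add: eq_neg_iff_add_eq_0)
qed

text \<open>For a fixed test function both sides of the defining identity are L2-continuous, so weak
  differentiation is a closed operator.\<close>

lemma weak_pd_limit:
  assumes "open \<Omega>" "\<And>k. weak_pd \<Omega> (v k) j (g k)"
    and "\<And>k. memL2 \<Omega> (v k)" "memL2 \<Omega> v'" "(\<lambda>k. L2norm \<Omega> (\<lambda>x. v k x - v' x)) \<longlonglongrightarrow> 0"
    and "\<And>k. memL2 \<Omega> (g k)" "memL2 \<Omega> g'" "(\<lambda>k. L2norm \<Omega> (\<lambda>x. g k x - g' x)) \<longlonglongrightarrow> 0"
  shows "weak_pd \<Omega> v' j g'"
  unfolding weak_pd_def
proof (intro allI impI conjI)
  fix \<phi> assume \<phi>: "test_fun \<Omega> \<phi>"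
  have m: "memL2 \<Omega> \<phi>" "memL2 \<Omega> (pd j \<phi>)" by (intro test_fun_memL2 test_fun_pd \<phi> assms)+
  show "integrable (lebesgue_on \<Omega>) (\<lambda>x. v' x * pd j \<phi> x)" "integrable (lebesgue_on \<Omega>) (\<lambda>x. g' x * \<phi> x)"
    by (intro memL2_integrable_mult m assms)+
  have "(\<lambda>k. ip \<Omega> (v k) (\<lambda>x. cnj (pd j \<phi> x))) \<longlonglongrightarrow> ip \<Omega> v' (\<lambda>x. cnj (pd j \<phi> x))"
    by (intro ip_tendsto_left memL2_cnj m assms)
  moreover have "(\<lambda>k. - ip \<Omega> (g k) (\<lambda>x. cnj (\<phi> x))) \<longlonglongrightarrow> - ip \<Omega> g' (\<lambda>x. cnj (\<phi> x))"
    by (intro tendsto_minus ip_tendsto_left memL2_cnj m assms)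
  moreover have "ip \<Omega> (v k) (\<lambda>x. cnj (pd j \<phi> x)) = - ip \<Omega> (g k) (\<lambda>x. cnj (\<phi> x))" for k
    using assms(2)[of k] \<phi> unfolding weak_pd_def ip_def by simp
  ultimately show "(\<integral>x. v' x * pd j \<phi> x \<partial>lebesgue_on \<Omega>) = - (\<integral>x. g' x * \<phi> x \<partial>lebesgue_on \<Omega>)"
    using LIMSEQ_unique unfolding ip_def by (simp, blast)
qed

subsection \<open>Uniqueness of weak derivatives\<close>

text \<open>A product of factors exp(-1/s), two per coordinate, supported in a box. The factor k + 1
  steepens the flanks, so that the functions tend pointwise to the indicator of the open
  box.\<close>

definition bump :: "real^'n::finite \<Rightarrow> real^'n \<Rightarrow> nat \<Rightarrow> real^'n \<Rightarrow> real" where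
  "bump a b k x = (\<Prod>i\<in>UNIV. expinv 0 (real (Suc k) * (x $ i - a $ i)) * expinv 0 (real (Suc k) * (b $ i - x $ i)))"

lemma expinv0_bounds: "0 \<le> expinv 0 s" "expinv 0 s \<le> 1" "s \<le> 0 \<Longrightarrow> expinv 0 s = 0"
  by (auto simp: expinv_def)

lemma smooth_fun_bump: "smooth_fun (bump a b k)"
proof -
  have "smooth_fun (\<lambda>x::real^'n. expinv 0 (c * x $ i + d))" for c d i
  proof (rule smooth_fun_compose_real[OF _ _ CkR_expinv])
    have "smooth_fun (\<lambda>x::real^'n. c * x $ i)"
      by (rule smooth_fun_mult[OF smooth_fun_const smooth_fun_component])
    then show "smooth_fun (\<lambda>x::real^'n. c * x $ i + d)"
      by (rule smooth_fun_add[OF _ smooth_fun_const])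
  qed auto
  from this[of "real (Suc k)" _ "- real (Suc k) * a $ _"] this[of "- real (Suc k)" _ "real (Suc k) * b $ _"]
  have "smooth_fun (\<lambda>x. expinv 0 (real (Suc k) * (x $ i - a $ i)))"
    "smooth_fun (\<lambda>x. expinv 0 (real (Suc k) * (b $ i - x $ i)))" for i
    by (simp_all add: right_diff_distrib del: of_nat_Suc)
  then show ?thesis
    unfolding bump_def by (intro smooth_fun_prod smooth_fun_mult) auto
qed

lemma bump_bounds: "0 \<le> bump a b k x" "bump a b k x \<le> indicator (box a b) x"
proof -
  show "0 \<le> bump a b k x" unfolding bump_def by (intro prod_nonneg) (auto simp: expinv0_bounds)
  show "bump a b k x \<le> indicator (box a b) x"
  proof (cases "x \<in> box a b")
    case True
    then show ?thesis unfolding bump_def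
      by (auto intro!: prod_le_1 mult_le_one simp: expinv0_bounds)
  next
    case False
    then obtain i where "x $ i \<le> a $ i \<or> b $ i \<le> x $ i" by (auto simp: mem_box_cart not_less)
    then have "expinv 0 (real (Suc k) * (x $ i - a $ i)) * expinv 0 (real (Suc k) * (b $ i - x $ i)) = 0"
      by (auto simp: expinv0_bounds mult_nonneg_nonpos del: of_nat_Suc)
    then have "bump a b k x = 0" unfolding bump_def by (intro prod_zero) auto
    then show ?thesis by simp
  qed
qed

lemma bump_tendsto:
  fixes x :: "real^'n::finite"
  shows "(\<lambda>k. bump a b k x) \<longlonglongrightarrow> indicator (box a b) x"
proof (cases "x \<in> box a b")
  case True
  have *: "(\<lambda>k. expinv 0 (real (Suc k) * s)) \<longlonglongrightarrow> 1" if "0 < s" for s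
  proof -
    have "(\<lambda>k. exp (- (1 / (real (Suc k) * s)))) \<longlonglongrightarrow> 1"
      using that by real_asymp
    then show ?thesis using that by (simp add: expinv_def zero_less_mult_iff del: of_nat_Suc)
  qed
  have "(\<lambda>k. bump a b k x) \<longlonglongrightarrow> (\<Prod>i\<in>(UNIV::'n set). 1 * 1)"
    unfolding bump_def
  proof (rule tendsto_prod)
    fix i
    show "(\<lambda>k. expinv 0 (real (Suc k) * (x $ i - a $ i)) * expinv 0 (real (Suc k) * (b $ i - x $ i))) \<longlonglongrightarrow> 1 * 1"
      using True by (intro tendsto_mult *) (auto simp: mem_box_cart)
  qed
  then show ?thesis using True by simp
next
  case False
  then have "bump a b k x = 0" for k using bump_bounds[of a b k x] by simp
  then show ?thesis using False by simp
qed

lemma test_fun_bump: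
  assumes "cbox a b \<subseteq> \<Omega>"
  shows "test_fun \<Omega> (\<lambda>x. complex_of_real (bump a b k x))"
proof -
  have "bump a b k x = 0" if "x \<notin> cbox a b" for x
  proof -
    have "x \<notin> box a b" using that box_subset_cbox by blast
    then show ?thesis using bump_bounds[of a b k x] by simp
  qed
  then have "compact (cbox a b) \<and> cbox a b \<subseteq> \<Omega> \<and> (\<forall>x. x \<notin> cbox a b \<longrightarrow> complex_of_real (bump a b k x) = 0)"
    using assms by auto
  moreover have "smooth_fun (\<lambda>x. complex_of_real (bump a b k x))"
    by (rule smooth_fun_bounded_linear[OF bounded_linear_of_real smooth_fun_bump])
  ultimately show ?thesis unfolding test_fun_def by blast
qed

lemma integrable_box_L2:
  fixes G :: "real^'n::finite \<Rightarrow> complex"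
  assumes "G \<in> borel_measurable borel" "integrable lborel (\<lambda>x. (cmod (G x))\<^sup>2)"
  shows "integrable lborel (\<lambda>x. indicator (box a b) x + (cmod (G x))\<^sup>2)"
    and "set_integrable lborel (box a b) G"
proof -
  show *: "integrable lborel (\<lambda>x. indicator (box a b) x + (cmod (G x))\<^sup>2)"
    by (intro Bochner_Integration.integrable_add integrable_real_indicator assms)
      (auto simp: emeasure_bounded_finite[OF bounded_box, unfolded infinity_ennreal_def])
  show "set_integrable lborel (box a b) G"
    unfolding set_integrable_def
  proof (rule Bochner_Integration.integrable_bound[OF *])
    show "AE x in lborel. norm (indicat_real (box a b) x *\<^sub>R G x) \<le> norm (indicator (box a b) x + (cmod (G x))\<^sup>2)"
    proof (rule AE_I2)
      fix x
      have "2 * cmod (G x) * 1 \<le> (cmod (G x))\<^sup>2 + 1\<^sup>2" by (rule sum_squares_bound)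
      then have "cmod (G x) \<le> 1 + (cmod (G x))\<^sup>2" using norm_ge_zero[of "G x"] by (simp, linarith)
      then show "norm (indicat_real (box a b) x *\<^sub>R G x) \<le> norm (indicator (box a b) x + (cmod (G x))\<^sup>2)"
        by (auto simp: indicator_def)
    qed
  qed (use assms in auto)
qed

text \<open>The indicator of the box is a bounded pointwise limit of test functions. On the box, |G|
  is at most 1 + |G|^2, which serves as integrable majorant.\<close>

lemma orthogonal_test_box:
  fixes G :: "real^'n::finite \<Rightarrow> complex"
  assumes G: "G \<in> borel_measurable borel" "integrable lborel (\<lambda>x. (cmod (G x))\<^sup>2)"
    and z: "\<And>\<phi>. test_fun \<Omega> \<phi> \<Longrightarrow> (\<integral>x. G x * \<phi> x \<partial>lborel) = 0" and ab: "cbox a b \<subseteq> \<Omega>"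
  shows "(LINT x:box a b|lborel. G x) = 0"
proof -
  have "(\<lambda>k. \<integral>x. G x * complex_of_real (bump a b k x) \<partial>lborel) \<longlonglongrightarrow> (\<integral>x. indicat_real (box a b) x *\<^sub>R G x \<partial>lborel)"
  proof (rule integral_dominated_convergence[where w = "\<lambda>x. indicator (box a b) x + (cmod (G x))\<^sup>2"])
    show "(\<lambda>x. G x * complex_of_real (bump a b k x)) \<in> borel_measurable lborel" for k
      using G test_fun_borel[OF test_fun_bump[OF ab, of k]] by simp
    show "AE x in lborel. (\<lambda>k. G x * complex_of_real (bump a b k x)) \<longlonglongrightarrow> indicat_real (box a b) x *\<^sub>R G x"
      unfolding scaleR_conv_of_real mult.commute[of _ "G _"]
      by (intro AE_I2 tendsto_intros bump_tendsto)
    show "integrable lborel (\<lambda>x. indicator (box a b) x + (cmod (G x))\<^sup>2)" by (rule integrable_box_L2[OF G])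
    fix k
    show "AE x in lborel. norm (G x * complex_of_real (bump a b k x)) \<le> indicator (box a b) x + (cmod (G x))\<^sup>2"
    proof (rule AE_I2)
      fix x
      have "2 * cmod (G x) * 1 \<le> (cmod (G x))\<^sup>2 + 1\<^sup>2" by (rule sum_squares_bound)
      then have 1: "cmod (G x) \<le> 1 + (cmod (G x))\<^sup>2" using norm_ge_zero[of "G x"] by (simp, linarith)
      have "norm (G x * complex_of_real (bump a b k x)) \<le> cmod (G x) * indicator (box a b) x"
        using bump_bounds[of a b k x] by (simp add: norm_mult mult_left_mono)
      also have "\<dots> \<le> indicator (box a b) x + (cmod (G x))\<^sup>2" using 1 by (auto simp: indicator_def)
      finally show "norm (G x * complex_of_real (bump a b k x)) \<le> indicator (box a b) x + (cmod (G x))\<^sup>2" .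
    qed
  qed (use G in auto)
  moreover have "(\<integral>x. G x * complex_of_real (bump a b k x) \<partial>lborel) = 0" for k
    by (rule z[OF test_fun_bump[OF ab]])
  ultimately show ?thesis
    unfolding set_lebesgue_integral_def by (simp add: LIMSEQ_const_iff)
qed

text \<open>Dynkin's argument: open boxes are stable under intersection and generate the Borel sets.
  Cutting G off by a fixed box makes it integrable, which the complement and countable union steps
  require.\<close>

lemma orthogonal_test_borel:
  fixes G :: "real^'n::finite \<Rightarrow> complex"
  assumes G: "G \<in> borel_measurable borel" "integrable lborel (\<lambda>x. (cmod (G x))\<^sup>2)"
    and z: "\<And>\<phi>. test_fun \<Omega> \<phi> \<Longrightarrow> (\<integral>x. G x * \<phi> x \<partial>lborel) = 0" and ab: "cbox a b \<subseteq> \<Omega>"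
    and A: "A \<in> sets borel"
  shows "(LINT x:A|lborel. indicat_real (box a b) x *\<^sub>R G x) = 0"
proof -
  let ?E = "range (\<lambda>(c::real^'n, d). box c d)"
  let ?g = "\<lambda>x. indicat_real (box a b) x *\<^sub>R G x"
  have int: "integrable lborel ?g" using integrable_box_L2(2)[OF G] by (simp add: set_integrable_def)
  have sint: "set_integrable lborel A ?g" if "A \<in> sets borel" for A
    unfolding set_integrable_def using integrable_mult_indicator[OF _ int, of A] that by simp
  have sets: "sets borel = sigma_sets UNIV ?E" by (simp add: borel_eq_box)
  have Int: "Int_stable ?E"
    unfolding Int_stable_def
  proof clarify
    fix a b c d :: "real^'n"
    show "box a b \<inter> box c d \<in> ?E"
      unfolding box_Int_box by (rule range_eqI[of _ _ "(_, _)"], unfold prod.case, rule refl)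
  qed
  have eq: "indicat_real A x *\<^sub>R ?g x = indicat_real (box a b \<inter> A) x *\<^sub>R G x" for A x
    by (auto simp: indicator_def)
  have boxes: "(LINT x:box c d|lborel. ?g x) = 0" for c d
  proof -
    obtain c' d' where cd: "box a b \<inter> box c d = box c' d'" "cbox c' d' \<subseteq> cbox a b"
    proof
      show "box a b \<inter> box c d = box (\<chi> i. max (a $ i) (c $ i)) (\<chi> i. min (b $ i) (d $ i))"
        by (auto simp: mem_box_cart)
      show "cbox (\<chi> i. max (a $ i) (c $ i)) (\<chi> i. min (b $ i) (d $ i)) \<subseteq> cbox a b"
        by (auto simp: mem_box_cart)
    qed
    have "(LINT x:box c d|lborel. ?g x) = (LINT x:box c' d'|lborel. G x)"
      unfolding set_lebesgue_integral_def eq cd(1) ..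
    also have "\<dots> = 0" by (rule orthogonal_test_box[where \<Omega> = \<Omega>, OF G z]) (use ab cd(2) in auto)
    finally show ?thesis .
  qed
  have A': "A \<in> sigma_sets UNIV ?E" using A by (simp add: sets)
  have whole: "(LINT x:UNIV|lborel. ?g x) = 0"
    using orthogonal_test_box[where \<Omega> = \<Omega>, OF G z ab] by (simp add: set_lebesgue_integral_def)
  show ?thesis
  proof (rule sigma_sets_induct_disjoint[OF Int _ A'])
    show "?E \<subseteq> Pow UNIV" by simp
    show "(LINT x:A|lborel. ?g x) = 0" if "A \<in> ?E" for A using that boxes by auto
    show "(LINT x:{}|lborel. ?g x) = 0" by (simp add: set_lebesgue_integral_def)
    fix A assume A: "A \<in> sigma_sets UNIV ?E" "(LINT x:A|lborel. ?g x) = 0"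
    have "(LINT x:A \<union> (UNIV - A)|lborel. ?g x) = (LINT x:A|lborel. ?g x) + (LINT x:UNIV - A|lborel. ?g x)"
      using A(1) by (intro set_integral_Un sint) (auto simp: sets[symmetric])
    then show "(LINT x:UNIV - A|lborel. ?g x) = 0" using whole A(2) by simp
  next
    fix A :: "nat \<Rightarrow> (real^'n) set"
    assume A: "disjoint_family A" "range A \<subseteq> sigma_sets UNIV ?E" "\<And>i. (LINT x:A i|lborel. ?g x) = 0"
    have Am: "A i \<in> sets borel" for i using A(2) by (auto simp: sets)
    have "(LINT x:(\<Union>i. A i)|lborel. ?g x) = (\<Sum>i. LINT x:A i|lborel. ?g x)"
      by (rule lebesgue_integral_countable_add)
        (use Am A(1) sint in \<open>auto simp: disjoint_family_on_def\<close>)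
    then show "(LINT x:(\<Union>i. A i)|lborel. ?g x) = 0" using A(3) by simp
  qed
qed

section \<open>Borel representatives, and the vanishing of functions orthogonal to all test
  functions\<close>

lemma complex_borel_rep:
  fixes g :: "'a::euclidean_space \<Rightarrow> complex"
  assumes "g \<in> borel_measurable lebesgue"
  obtains g' where "g' \<in> borel_measurable borel" "AE x in lborel. g x = g' x"
proof -
  have "(\<lambda>x. Re (g x)) \<in> borel_measurable lebesgue" "(\<lambda>x. Im (g x)) \<in> borel_measurable lebesgue"
    using assms by measurable
  from completion_ex_borel_measurable_real[OF this(1)] completion_ex_borel_measurable_real[OF this(2)]
  obtain r i where ri[measurable]: "r \<in> borel_measurable lborel" "i \<in> borel_measurable lborel"
    and ae: "AE x in lborel. Re (g x) = r x" "AE x in lborel. Im (g x) = i x" by auto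
  show ?thesis
  proof
    have "(\<lambda>x. complex_of_real (r x) + \<i> * complex_of_real (i x)) \<in> borel_measurable lborel" by measurable
    then show "(\<lambda>x. complex_of_real (r x) + \<i> * complex_of_real (i x)) \<in> borel_measurable borel" by simp
    show "AE x in lborel. g x = complex_of_real (r x) + \<i> * complex_of_real (i x)"
      using ae by eventually_elim (simp add: complex_eq_iff)
  qed
qed

text \<open>Extension by zero followed by a change on a null set: the standard passage from
  functions on \<Omega> to Borel functions on the whole space, where shifts and product measures
  behave well.\<close>

lemma lebesgue_on_borel_rep:
  fixes g :: "'a::euclidean_space \<Rightarrow> complex"
  assumes "S \<in> sets lebesgue" "g \<in> borel_measurable (lebesgue_on S)"
  obtains g' where "g' \<in> borel_measurable borel" "AE x in lborel. (if x \<in> S then g x else 0) = g' x"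
    "AE x in lebesgue_on S. g x = g' x"
proof -
  have "(\<lambda>x. if x \<in> S then g x else 0) \<in> borel_measurable lebesgue"
    using assms borel_measurable_if_I by blast
  then obtain g' where g': "g' \<in> borel_measurable borel" "AE x in lborel. (if x \<in> S then g x else 0) = g' x"
    by (rule complex_borel_rep)
  have "AE x in lebesgue_on S. g x = g' x"
    using AE_completion[OF g'(2)] assms(1)
    by (subst AE_restrict_space_iff) (auto elim: eventually_mono)
  with g' show ?thesis by (rule that)
qed

lemma lebesgue_on_integral_rep:
  fixes f :: "'a::euclidean_space \<Rightarrow> 'b::{banach, second_countable_topology}"
  assumes "S \<in> sets lebesgue" "f' \<in> borel_measurable borel"
    "AE x in lborel. (if x \<in> S then f x else 0) = f' x" "f \<in> borel_measurable (lebesgue_on S)"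
  shows "integral\<^sup>L (lebesgue_on S) f = integral\<^sup>L lborel f'"
    "integrable (lebesgue_on S) f \<longleftrightarrow> integrable lborel f'"
proof -
  have s: "S \<inter> space lebesgue \<in> sets lebesgue" using assms(1) by simp
  have m: "(\<lambda>x. indicator S x *\<^sub>R f x) \<in> borel_measurable lebesgue"
    using assms(4) by (simp add: borel_measurable_restrict_space_iff[OF s])
  have ae: "AE x in lebesgue. indicator S x *\<^sub>R f x = f' x"
    using AE_completion[OF assms(3)] by eventually_elim (auto simp: indicator_def split: if_splits)
  have f': "f' \<in> borel_measurable lebesgue" using assms(2) by (intro measurable_completion) simp
  show "integral\<^sup>L (lebesgue_on S) f = integral\<^sup>L lborel f'"
    unfolding integral_restrict_space[OF s] integral_cong_AE[OF m f' ae]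
    by (rule integral_completion) (use assms(2) in simp)
  show "integrable (lebesgue_on S) f \<longleftrightarrow> integrable lborel f'"
    unfolding integrable_restrict_space[OF s] integrable_cong_AE[OF m f' ae]
    by (rule integrable_completion) (use assms(2) in simp)
qed

text \<open>The fundamental lemma of the calculus of variations: G vanishes almost everywhere on
  each closed box inside \<Omega>, and countably many rational boxes cover \<Omega>.\<close>

lemma orthogonal_test_zero:
  fixes \<Omega> :: "(real^'n::finite) set"
  assumes \<Omega>: "open \<Omega>" and g: "memL2 \<Omega> g"
    and z: "\<And>\<phi>. test_fun \<Omega> \<phi> \<Longrightarrow> (\<integral>x. g x * \<phi> x \<partial>lebesgue_on \<Omega>) = 0"
  shows "AE x in lebesgue_on \<Omega>. g x = 0"
proof -
  have S: "\<Omega> \<in> sets lebesgue" using \<Omega> by (simp add: borel_open)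
  have gm: "g \<in> borel_measurable (lebesgue_on \<Omega>)" using g by (simp add: memL2_def)
  obtain G where G[measurable]: "G \<in> borel_measurable borel"
    and eqG: "AE x in lborel. (if x \<in> \<Omega> then g x else 0) = G x" "AE x in lebesgue_on \<Omega>. g x = G x"
    by (rule lebesgue_on_borel_rep[OF S gm])
  have G2: "integrable lborel (\<lambda>x. (cmod (G x))\<^sup>2)"
  proof (rule lebesgue_on_integral_rep(2)[OF S, THEN iffD1])
    show "AE x in lborel. (if x \<in> \<Omega> then (cmod (g x))\<^sup>2 else 0) = (cmod (G x))\<^sup>2"
      using eqG(1) by eventually_elim (auto split: if_splits)
  qed (use g in \<open>auto simp: memL2_def\<close>)
  have zG: "(\<integral>x. G x * \<phi> x \<partial>lborel) = 0" if "test_fun \<Omega> \<phi>" for \<phi>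
  proof -
    have [measurable]: "\<phi> \<in> borel_measurable borel" by (rule test_fun_borel[OF that])
    have "(\<integral>x. g x * \<phi> x \<partial>lebesgue_on \<Omega>) = (\<integral>x. G x * \<phi> x \<partial>lborel)"
    proof (rule lebesgue_on_integral_rep[OF S])
      show "AE x in lborel. (if x \<in> \<Omega> then g x * \<phi> x else 0) = G x * \<phi> x"
        using eqG(1) by eventually_elim (auto split: if_splits)
    qed (use gm borel_measurable_lebesgue_on[of \<phi>] in auto)
    then show ?thesis using z[OF that] by simp
  qed
  have "AE x in lborel. indicat_real (box a b) x *\<^sub>R G x = 0" if "cbox a b \<subseteq> \<Omega>" for a b
  proof (rule sigma_finite_measure.density_zero[OF sigma_finite_lborel])
    show "integrable lborel (\<lambda>x. indicat_real (box a b) x *\<^sub>R G x)"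
      using integrable_box_L2(2)[OF G G2, of a b] by (simp only: set_integrable_def)
    show "(LINT x:A|lborel. indicat_real (box a b) x *\<^sub>R G x) = 0" if "A \<in> sets lborel" for A
    proof (rule orthogonal_test_borel)
      show "(\<integral>x. G x * \<phi> x \<partial>lborel) = 0" if "test_fun \<Omega> \<phi>" for \<phi> by (rule zG[OF that])
      show "A \<in> sets borel" using that by simp
    qed (rule G G2 \<open>cbox a b \<subseteq> \<Omega>\<close>)+
  qed
  moreover
  have "\<exists>F. countable F \<and> (\<forall>p\<in>F. cbox (fst p) (snd p) \<subseteq> \<Omega>) \<and> \<Omega> \<subseteq> (\<Union>p\<in>F. box (fst p) (snd p))"
  proof -
    define F where "F = {(a,b::real^'n). (\<forall>i. a $ i \<in> \<rat>) \<and> (\<forall>i. b $ i \<in> \<rat>) \<and> cbox a b \<subseteq> \<Omega>}"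
    have cV: "countable {a::real^'n. \<forall>i. a $ i \<in> \<rat>}"
      by (rule countable_vector) (simp add: countable_rat)
    have "countable F"
      by (rule countable_subset[OF _ countable_SIGMA[OF cV cV]]) (auto simp: F_def)
    moreover have "\<Omega> \<subseteq> (\<Union>p\<in>F. box (fst p) (snd p))"
    proof
      fix x assume "x \<in> \<Omega>"
      then obtain e where e: "e > 0" "cball x e \<subseteq> \<Omega>" using \<Omega> open_contains_cball by blast
      \<comment> \<open>Coordinate deviations of at most d add up to at most e in the l1 norm, which
        dominates the Euclidean one.\<close>
      define d where "d = e / real CARD('n)"
      have d: "d > 0" using e by (simp add: d_def)
      have "\<forall>i. \<exists>q\<in>\<rat>. x $ i - d < q \<and> q < x $ i" "\<forall>i. \<exists>q\<in>\<rat>. x $ i < q \<and> q < x $ i + d"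
        using Rats_dense_in_real d by (metis diff_less_eq less_add_same_cancel1)+
      then obtain a b where a: "\<And>i. a i \<in> \<rat> \<and> x $ i - d < a i \<and> a i < x $ i"
        and b: "\<And>i. b i \<in> \<rat> \<and> x $ i < b i \<and> b i < x $ i + d" by metis
      have "cbox (\<chi> i. a i) (\<chi> i. b i) \<subseteq> cball x e"
      proof
        fix y assume "y \<in> cbox (\<chi> i. a i) (\<chi> i. b i)"
        then have "\<bar>(y - x) $ i\<bar> \<le> d" for i
          using a[of i] b[of i] by (auto simp: mem_box_cart abs_le_iff dest!: spec[of _ i])
        then have "(\<Sum>i\<in>UNIV. \<bar>(y - x) $ i\<bar>) \<le> (\<Sum>i\<in>(UNIV::'n set). d)" by (intro sum_mono)
        then have "norm (y - x) \<le> e" using norm_le_l1_cart[of "y - x"] by (simp add: d_def)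
        then show "y \<in> cball x e" by (simp add: dist_norm norm_minus_commute)
      qed
      then have "((\<chi> i. a i), (\<chi> i. b i)) \<in> F" using a b e by (auto simp: F_def)
      moreover have "x \<in> box (\<chi> i. a i) (\<chi> i. b i)" using a b by (auto simp: mem_box_cart)
      ultimately show "x \<in> (\<Union>p\<in>F. box (fst p) (snd p))" by force
    qed
    ultimately show ?thesis by (intro exI[of _ F]) (auto simp: F_def)
  qed
  then obtain F where F: "countable F \<and> (\<forall>p\<in>F. cbox (fst p) (snd p) \<subseteq> \<Omega>) \<and> \<Omega> \<subseteq> (\<Union>p\<in>F. box (fst p) (snd p))"
    by (rule exE)
  ultimately have "AE x in lborel. \<forall>p\<in>F. indicat_real (box (fst p) (snd p)) x *\<^sub>R G x = 0"
    using F by (subst AE_ball_countable) auto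
  then have "AE x in lborel. x \<in> \<Omega> \<longrightarrow> G x = 0"
  proof eventually_elim
    case (elim x)
    show ?case
    proof
      assume "x \<in> \<Omega>"
      then obtain p where "p \<in> F" "x \<in> box (fst p) (snd p)" using F by force
      then show "G x = 0" using elim by auto
    qed
  qed
  then have "AE x in lebesgue_on \<Omega>. G x = 0"
    using AE_completion S by (subst AE_restrict_space_iff) auto
  with eqG(2) show ?thesis by eventually_elim simp
qed

lemma weak_pd_unique:
  assumes "open \<Omega>" "memL2 \<Omega> g" "weak_pd \<Omega> v j g" "memL2 \<Omega> h" "weak_pd \<Omega> v j h"
  shows "AE x in lebesgue_on \<Omega>. g x = h x"
proof -
  have "AE x in lebesgue_on \<Omega>. g x - h x = 0"
  proof (rule orthogonal_test_zero)
    fix \<phi> assume "test_fun \<Omega> \<phi>"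
    then show "(\<integral>x. (g x - h x) * \<phi> x \<partial>lebesgue_on \<Omega>) = 0"
      using assms(3,5) unfolding weak_pd_def by (simp add: left_diff_distrib)
  qed (use assms memL2_diff in auto)
  then show ?thesis by simp
qed

subsection \<open>Gradients\<close>

definition memG :: "(real^'n::finite) set \<Rightarrow> ('n \<Rightarrow> real^'n \<Rightarrow> complex) \<Rightarrow> bool" where
  "memG \<Omega> G \<longleftrightarrow> (\<forall>j. memL2 \<Omega> (G j))"

definition gnorm :: "(real^'n::finite) set \<Rightarrow> ('n \<Rightarrow> real^'n \<Rightarrow> complex) \<Rightarrow> real" where
  "gnorm \<Omega> G = L2_set (\<lambda>j. L2norm \<Omega> (G j)) UNIV"

definition gip :: "(real^'n::finite) set \<Rightarrow> ('n \<Rightarrow> real^'n \<Rightarrow> complex) \<Rightarrow> ('n \<Rightarrow> real^'n \<Rightarrow> complex) \<Rightarrow> complex" where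
  "gip \<Omega> G H = (\<Sum>j\<in>UNIV. ip \<Omega> (G j) (H j))"

abbreviation grd :: "(real^'n::finite \<Rightarrow> complex) \<Rightarrow> 'n \<Rightarrow> real^'n \<Rightarrow> complex" where
  "grd \<phi> \<equiv> (\<lambda>j. pd j \<phi>)"

text \<open>A relation rather than the choice function \<open>wgrad\<close>: classical gradients of
  test functions and L2 limits qualify directly, and \<open>isgrad_unique_gnorm\<close> transfers
  their norms to \<open>wgrad\<close>.\<close>

definition isgrad :: "(real^'n::finite) set \<Rightarrow> (real^'n \<Rightarrow> complex) \<Rightarrow> ('n \<Rightarrow> real^'n \<Rightarrow> complex) \<Rightarrow> bool" where
  "isgrad \<Omega> v G \<longleftrightarrow> memG \<Omega> G \<and> (\<forall>j. weak_pd \<Omega> v j (G j))"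

lemma gnorm_nonneg [simp]: "0 \<le> gnorm \<Omega> G"
  by (simp add: gnorm_def)

lemma gnorm_sq: "(gnorm \<Omega> G)\<^sup>2 = (\<Sum>j\<in>UNIV. (L2norm \<Omega> (G j))\<^sup>2)"
  by (simp add: gnorm_def L2_set_def sum_nonneg)

lemma gip_self: "gip \<Omega> G G = complex_of_real ((gnorm \<Omega> G)\<^sup>2)"
  by (simp add: gip_def ip_self gnorm_sq)

lemma gip_diff_left:
  "memG \<Omega> F \<Longrightarrow> memG \<Omega> G \<Longrightarrow> memG \<Omega> H \<Longrightarrow> gip \<Omega> (\<lambda>j x. F j x - G j x) H = gip \<Omega> F H - gip \<Omega> G H"
  by (simp add: gip_def memG_def ip_lin sum_subtractf)

lemma gip_diff_right:
  "memG \<Omega> F \<Longrightarrow> memG \<Omega> G \<Longrightarrow> memG \<Omega> H \<Longrightarrow> gip \<Omega> H (\<lambda>j x. F j x - G j x) = gip \<Omega> H F - gip \<Omega> H G"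
  by (simp add: gip_def memG_def ip_lin sum_subtractf)

lemma gip_commute: "gip \<Omega> H G = cnj (gip \<Omega> G H)"
  unfolding gip_def cnj_sum by (rule sum.cong) (auto intro: ip_commute)

lemma memG_add: "memG \<Omega> F \<Longrightarrow> memG \<Omega> G \<Longrightarrow> memG \<Omega> (\<lambda>j x. F j x + G j x)"
  and memG_diff: "memG \<Omega> F \<Longrightarrow> memG \<Omega> G \<Longrightarrow> memG \<Omega> (\<lambda>j x. F j x - G j x)"
  and memG_cmult: "memG \<Omega> F \<Longrightarrow> memG \<Omega> (\<lambda>j x. c * F j x)"
  by (simp_all add: memG_def memL2_rules)

lemma gnorm_variation_sq:
  assumes "memG \<Omega> F" "memG \<Omega> G"
  shows "(gnorm \<Omega> (\<lambda>j x. F j x + \<tau> * G j x))\<^sup>2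
     = (gnorm \<Omega> F)\<^sup>2 + 2 * Re (cnj \<tau> * gip \<Omega> F G) + (cmod \<tau>)\<^sup>2 * (gnorm \<Omega> G)\<^sup>2"
proof -
  have "(gnorm \<Omega> (\<lambda>j x. F j x + \<tau> * G j x))\<^sup>2
     = (\<Sum>j\<in>UNIV. (L2norm \<Omega> (F j))\<^sup>2 + 2 * Re (cnj \<tau> * ip \<Omega> (F j) (G j)) + (cmod \<tau>)\<^sup>2 * (L2norm \<Omega> (G j))\<^sup>2)"
    unfolding gnorm_sq by (rule sum.cong) (use assms in \<open>auto simp: memG_def L2norm_variation_sq\<close>)
  also have "\<dots> = (\<Sum>j\<in>UNIV. (L2norm \<Omega> (F j))\<^sup>2) + 2 * Re (\<Sum>j\<in>UNIV. cnj \<tau> * ip \<Omega> (F j) (G j))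
      + (cmod \<tau>)\<^sup>2 * (\<Sum>j\<in>UNIV. (L2norm \<Omega> (G j))\<^sup>2)"
    unfolding sum.distrib sum_distrib_left Re_sum ..
  finally show ?thesis unfolding gnorm_sq gip_def sum_distrib_left .
qed

lemma gip_cauchy_schwarz:
  assumes "memG \<Omega> F" "memG \<Omega> G"
  shows "cmod (gip \<Omega> F G) \<le> gnorm \<Omega> F * gnorm \<Omega> G"
proof -
  have "(cmod (gip \<Omega> F G))\<^sup>2 \<le> (gnorm \<Omega> F)\<^sup>2 * (gnorm \<Omega> G)\<^sup>2"
    by (rule discriminant_bound) (simp_all only: gnorm_variation_sq[OF assms, symmetric] zero_le_power2)
  then show ?thesis
    using power2_le_imp_le[of "cmod (gip \<Omega> F G)" "gnorm \<Omega> F * gnorm \<Omega> G"]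
    by (simp add: power_mult_distrib)
qed

lemma gnorm_triangle:
  assumes "memG \<Omega> F" "memG \<Omega> G"
  shows "gnorm \<Omega> (\<lambda>j x. F j x + G j x) \<le> gnorm \<Omega> F + gnorm \<Omega> G"
proof -
  have "gnorm \<Omega> (\<lambda>j x. F j x + G j x) \<le> L2_set (\<lambda>j. L2norm \<Omega> (F j) + L2norm \<Omega> (G j)) UNIV"
    unfolding gnorm_def by (rule L2_set_mono) (use assms in \<open>auto simp: memG_def L2norm_triangle\<close>)
  also have "\<dots> \<le> gnorm \<Omega> F + gnorm \<Omega> G" unfolding gnorm_def by (rule L2_set_triangle_ineq)
  finally show ?thesis .
qed

lemma gnorm_minus_commute: "gnorm \<Omega> (\<lambda>j x. F j x - G j x) = gnorm \<Omega> (\<lambda>j x. G j x - F j x)"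
  unfolding gnorm_def by (subst L2norm_minus_commute) (rule refl)

lemma gnorm_triangle_mid:
  assumes "memG \<Omega> F" "memG \<Omega> G" "memG \<Omega> H"
  shows "gnorm \<Omega> (\<lambda>j x. F j x - H j x) \<le> gnorm \<Omega> (\<lambda>j x. F j x - G j x) + gnorm \<Omega> (\<lambda>j x. G j x - H j x)"
  using gnorm_triangle[of \<Omega> "\<lambda>j x. F j x - G j x" "\<lambda>j x. G j x - H j x"] assms by (simp add: memG_diff)

lemma gnorm_triangle_abs:
  assumes "memG \<Omega> F" "memG \<Omega> G"
  shows "\<bar>gnorm \<Omega> F - gnorm \<Omega> G\<bar> \<le> gnorm \<Omega> (\<lambda>j x. F j x - G j x)"
proof -
  have z: "memG \<Omega> (\<lambda>j x. 0)" by (simp add: memG_def)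
  show ?thesis
    using gnorm_triangle_mid[OF assms z] gnorm_triangle_mid[OF assms(2,1) z]
    by (simp add: gnorm_minus_commute[of \<Omega> G F])
qed

lemma tendsto_gnorm:
  assumes "\<And>k. memG \<Omega> (F k)" "memG \<Omega> G" "(\<lambda>k. gnorm \<Omega> (\<lambda>j x. F k j x - G j x)) \<longlonglongrightarrow> 0"
  shows "(\<lambda>k. gnorm \<Omega> (F k)) \<longlonglongrightarrow> gnorm \<Omega> G"
  by (rule LIM_zero_cancel, rule Lim_null_comparison[OF _ assms(3)])
    (use gnorm_triangle_abs[OF assms(1,2)] in auto)

lemma gip_tendsto_right:
  assumes "\<And>k. memG \<Omega> (F k)" "memG \<Omega> F'" "(\<lambda>k. gnorm \<Omega> (\<lambda>j x. F k j x - F' j x)) \<longlonglongrightarrow> 0" "memG \<Omega> G"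
  shows "(\<lambda>k. gip \<Omega> G (F k)) \<longlonglongrightarrow> gip \<Omega> G F'"
proof (rule LIM_zero_cancel, rule Lim_null_comparison)
  have "norm (gip \<Omega> G (F k) - gip \<Omega> G F') \<le> gnorm \<Omega> G * gnorm \<Omega> (\<lambda>j x. F k j x - F' j x)" for k
    using gip_cauchy_schwarz[of \<Omega> G "\<lambda>j x. F k j x - F' j x"] assms
    by (simp add: gip_diff_right memG_diff)
  then show "\<forall>\<^sub>F k in sequentially. norm (gip \<Omega> G (F k) - gip \<Omega> G F')
      \<le> gnorm \<Omega> G * gnorm \<Omega> (\<lambda>j x. F k j x - F' j x)" by simp
  show "(\<lambda>k. gnorm \<Omega> G * gnorm \<Omega> (\<lambda>j x. F k j x - F' j x)) \<longlonglongrightarrow> 0"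
    using tendsto_mult_right_zero[OF assms(3)] .
qed

lemma L2norm_le_gnorm: "L2norm \<Omega> (G j) \<le> gnorm \<Omega> G"
  unfolding gnorm_def by (rule member_le_L2_set) auto

lemma gnorm_le_sum: "gnorm \<Omega> G \<le> (\<Sum>j\<in>UNIV. L2norm \<Omega> (G j))"
  unfolding gnorm_def by (rule L2_set_le_sum) simp

lemma memG_grd: "open \<Omega> \<Longrightarrow> test_fun \<Omega> \<phi> \<Longrightarrow> memG \<Omega> (grd \<phi>)"
  by (simp add: memG_def test_fun_memL2 test_fun_pd)

lemma isgrad_test: "open \<Omega> \<Longrightarrow> test_fun \<Omega> \<phi> \<Longrightarrow> isgrad \<Omega> \<phi> (grd \<phi>)"
  by (simp add: isgrad_def memG_grd weak_pd_test)

lemma weak_pd_diff: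
  assumes "weak_pd \<Omega> u j f" "weak_pd \<Omega> v j g"
  shows "weak_pd \<Omega> (\<lambda>x. u x - v x) j (\<lambda>x. f x - g x)"
  using assms unfolding weak_pd_def by (simp add: left_diff_distrib)

lemma isgrad_diff:
  "isgrad \<Omega> u F \<Longrightarrow> isgrad \<Omega> v G \<Longrightarrow> isgrad \<Omega> (\<lambda>x. u x - v x) (\<lambda>j x. F j x - G j x)"
  by (simp add: isgrad_def memG_diff weak_pd_diff)

lemma memH1_iff_isgrad: "memH1 \<Omega> v \<longleftrightarrow> memL2 \<Omega> v \<and> (\<exists>G. isgrad \<Omega> v G)"
  unfolding memH1_def isgrad_def memG_def by metis

lemma isgrad_wgrad: "isgrad \<Omega> v G \<Longrightarrow> isgrad \<Omega> v (wgrad \<Omega> v)"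
proof -
  assume *: "isgrad \<Omega> v G"
  have "memL2 \<Omega> (wgrad \<Omega> v j) \<and> weak_pd \<Omega> v j (wgrad \<Omega> v j)" for j
    unfolding wgrad_def by (rule someI[of _ "G j"]) (use * in \<open>auto simp: isgrad_def memG_def\<close>)
  then show ?thesis by (auto simp: isgrad_def memG_def)
qed

lemma gradL2sq_eq_wgrad: "gradL2sq \<Omega> v = (gnorm \<Omega> (wgrad \<Omega> v))\<^sup>2"
  by (simp add: gradL2sq_def gnorm_sq L2norm_sq)

lemma isgrad_unique_gnorm:
  assumes "open \<Omega>" "isgrad \<Omega> v F" "isgrad \<Omega> v G"
  shows "gnorm \<Omega> F = gnorm \<Omega> G"
proof -
  have "L2norm \<Omega> (F j) = L2norm \<Omega> (G j)" for j
    by (rule L2norm_cong_AE, rule weak_pd_unique[of \<Omega> _ v j])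
      (use assms in \<open>auto simp: isgrad_def memG_def memL2_def\<close>)
  then show ?thesis by (simp add: gnorm_def)
qed

lemma isgrad_gradL2sq:
  assumes "open \<Omega>" "isgrad \<Omega> v G"
  shows "gradL2sq \<Omega> v = (gnorm \<Omega> G)\<^sup>2"
  unfolding gradL2sq_eq_wgrad
  using isgrad_unique_gnorm[OF assms(1) isgrad_wgrad[OF assms(2)] assms(2)] by simp

section \<open>Approximation in H^1_0 and Green's formula\<close>

lemma memH10_isgrad: "memH10 \<Omega> v \<Longrightarrow> isgrad \<Omega> v (wgrad \<Omega> v)"
  unfolding memH10_def memH1_iff_isgrad using isgrad_wgrad by blast

lemma memH10_memL2: "memH10 \<Omega> v \<Longrightarrow> memL2 \<Omega> v"
  by (simp add: memH10_def memH1_def)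

lemma H1norm_isgrad:
  assumes "open \<Omega>" "isgrad \<Omega> v G"
  shows "H1norm \<Omega> v = sqrt ((L2norm \<Omega> v)\<^sup>2 + (gnorm \<Omega> G)\<^sup>2)"
  by (simp add: H1norm_def isgrad_gradL2sq[OF assms])

text \<open>\<open>H1norm\<close> of a difference involves an arbitrarily chosen gradient of that
  difference; uniqueness allows it to be replaced by the difference of the two gradients.\<close>

lemma memH10_approx:
  assumes \<Omega>: "open \<Omega>" and v: "memH10 \<Omega> v"
  obtains \<phi> where "\<And>k. test_fun \<Omega> (\<phi> k)" "(\<lambda>k. L2norm \<Omega> (\<lambda>x. \<phi> k x - v x)) \<longlonglongrightarrow> 0"
    "(\<lambda>k. gnorm \<Omega> (\<lambda>j x. pd j (\<phi> k) x - wgrad \<Omega> v j x)) \<longlonglongrightarrow> 0"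
proof -
  obtain \<phi> where \<phi>: "\<And>k. test_fun \<Omega> (\<phi> k)" and lim: "(\<lambda>k. H1norm \<Omega> (\<lambda>x. \<phi> k x - v x)) \<longlonglongrightarrow> 0"
    using v unfolding memH10_def by blast
  have eq: "H1norm \<Omega> (\<lambda>x. \<phi> k x - v x)
     = sqrt ((L2norm \<Omega> (\<lambda>x. \<phi> k x - v x))\<^sup>2 + (gnorm \<Omega> (\<lambda>j x. pd j (\<phi> k) x - wgrad \<Omega> v j x))\<^sup>2)" for k
    by (rule H1norm_isgrad[OF \<Omega> isgrad_diff[OF isgrad_test[OF \<Omega> \<phi>] memH10_isgrad[OF v]]])
  show ?thesis
  proof (rule that[OF \<phi>])
    show "(\<lambda>k. L2norm \<Omega> (\<lambda>x. \<phi> k x - v x)) \<longlonglongrightarrow> 0"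
      by (rule Lim_null_comparison[OF _ lim]) (simp add: eq real_sqrt_sum_squares_ge1)
    show "(\<lambda>k. gnorm \<Omega> (\<lambda>j x. pd j (\<phi> k) x - wgrad \<Omega> v j x)) \<longlonglongrightarrow> 0"
      by (rule Lim_null_comparison[OF _ lim]) (simp add: eq real_sqrt_sum_squares_ge2)
  qed
qed

text \<open>Completeness produces limits of the partial derivatives, and closedness of weak
  differentiation identifies them as the gradient of v.\<close>

lemma memH10_limit:
  assumes \<Omega>: "open \<Omega>" and \<phi>: "\<And>k. test_fun \<Omega> (\<phi> k)" and v: "memL2 \<Omega> v"
    and lim: "(\<lambda>k. L2norm \<Omega> (\<lambda>x. \<phi> k x - v x)) \<longlonglongrightarrow> 0"
    and cauchy: "\<And>\<epsilon>. 0 < \<epsilon> \<Longrightarrow> \<exists>N. \<forall>k\<ge>N. \<forall>l\<ge>N. gnorm \<Omega> (\<lambda>j x. pd j (\<phi> k) x - pd j (\<phi> l) x) < \<epsilon>"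
  shows "memH10 \<Omega> v" "(\<lambda>k. gnorm \<Omega> (grd (\<phi> k))) \<longlonglongrightarrow> sqrt (gradL2sq \<Omega> v)"
proof -
  have mem: "memL2 \<Omega> (\<phi> k)" "memL2 \<Omega> (pd j (\<phi> k))" for j k
    by (intro test_fun_memL2 test_fun_pd \<Omega> \<phi>)+
  have "\<exists>g. memL2 \<Omega> g \<and> (\<lambda>k. L2norm \<Omega> (\<lambda>x. pd j (\<phi> k) x - g x)) \<longlonglongrightarrow> 0" for j
  proof (rule L2_complete)
    fix e :: real assume "0 < e"
    from cauchy[OF this] obtain N where
      N: "\<And>k l. k \<ge> N \<Longrightarrow> l \<ge> N \<Longrightarrow> gnorm \<Omega> (\<lambda>j x. pd j (\<phi> k) x - pd j (\<phi> l) x) < e" by blast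
    then show "\<exists>N. \<forall>k\<ge>N. \<forall>l\<ge>N. L2norm \<Omega> (\<lambda>x. pd j (\<phi> k) x - pd j (\<phi> l) x) < e"
      using L2norm_le_gnorm[of \<Omega> "\<lambda>j x. pd j (\<phi> _) x - pd j (\<phi> _) x" j] order.strict_trans1 by blast
  qed (rule mem)
  then have "\<forall>j. \<exists>g. memL2 \<Omega> g \<and> (\<lambda>k. L2norm \<Omega> (\<lambda>x. pd j (\<phi> k) x - g x)) \<longlonglongrightarrow> 0" by blast
  from choice[OF this] obtain G where
    G: "\<And>j. memL2 \<Omega> (G j)" "\<And>j. (\<lambda>k. L2norm \<Omega> (\<lambda>x. pd j (\<phi> k) x - G j x)) \<longlonglongrightarrow> 0"
    by blast
  have grad: "isgrad \<Omega> v G"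
    unfolding isgrad_def memG_def
    using weak_pd_limit[OF \<Omega> weak_pd_test[OF \<Omega> \<phi>] mem(1) v lim mem(2) G] G(1) by blast
  have glim: "(\<lambda>k. gnorm \<Omega> (\<lambda>j x. pd j (\<phi> k) x - G j x)) \<longlonglongrightarrow> 0"
  proof (rule Lim_null_comparison)
    show "\<forall>\<^sub>F k in sequentially. norm (gnorm \<Omega> (\<lambda>j x. pd j (\<phi> k) x - G j x))
       \<le> (\<Sum>j\<in>UNIV. L2norm \<Omega> (\<lambda>x. pd j (\<phi> k) x - G j x))"
      by (simp add: gnorm_le_sum)
    show "(\<lambda>k. \<Sum>j\<in>UNIV. L2norm \<Omega> (\<lambda>x. pd j (\<phi> k) x - G j x)) \<longlonglongrightarrow> 0"
      by (rule tendsto_null_sum) (rule G)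
  qed
  have eq: "H1norm \<Omega> (\<lambda>x. \<phi> k x - v x)
     = sqrt ((L2norm \<Omega> (\<lambda>x. \<phi> k x - v x))\<^sup>2 + (gnorm \<Omega> (\<lambda>j x. pd j (\<phi> k) x - G j x))\<^sup>2)" for k
    by (rule H1norm_isgrad[OF \<Omega> isgrad_diff[OF isgrad_test[OF \<Omega> \<phi>] grad]])
  have "(\<lambda>k. H1norm \<Omega> (\<lambda>x. \<phi> k x - v x)) \<longlonglongrightarrow> sqrt (0\<^sup>2 + 0\<^sup>2)"
    unfolding eq by (intro tendsto_intros lim glim)
  then show "memH10 \<Omega> v"
    unfolding memH10_def memH1_iff_isgrad using v grad \<phi> by auto
  have "(\<lambda>k. gnorm \<Omega> (grd (\<phi> k))) \<longlonglongrightarrow> gnorm \<Omega> G"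
    by (rule tendsto_gnorm[OF memG_grd[OF \<Omega> \<phi>] _ glim]) (use grad in \<open>simp add: isgrad_def\<close>)
  then show "(\<lambda>k. gnorm \<Omega> (grd (\<phi> k))) \<longlonglongrightarrow> sqrt (gradL2sq \<Omega> v)"
    using isgrad_gradL2sq[OF \<Omega> grad] by simp
qed

text \<open>Weak derivatives are defined by a bilinear pairing, \<open>ip\<close> is sesquilinear:
  hence the conjugate of \<phi> and its partial derivatives serve as test functions.\<close>

lemma weak_lap_test:
  assumes \<Omega>: "open \<Omega>" and lap: "weak_lap \<Omega> u l" and G: "isgrad \<Omega> u G" and u: "memL2 \<Omega> u"
    and \<phi>: "test_fun \<Omega> \<phi>"
  shows "ip \<Omega> l \<phi> = - gip \<Omega> G (grd \<phi>)"
proof -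
  let ?c = "\<lambda>x. cnj (\<phi> x)"
  have c: "test_fun \<Omega> ?c" by (rule test_fun_cnj[OF \<phi>])
  have pdc: "pd j ?c = (\<lambda>x. cnj (pd j \<phi> x))" for j by (rule pd_test_cnj[OF \<phi>])
  have "ip \<Omega> l \<phi> = (\<integral>x. u x * (\<Sum>j\<in>UNIV. pd j (pd j ?c) x) \<partial>lebesgue_on \<Omega>)"
    using lap c unfolding weak_lap_def ip_def by simp
  also have "\<dots> = (\<integral>x. (\<Sum>j\<in>UNIV. u x * pd j (pd j ?c) x) \<partial>lebesgue_on \<Omega>)"
    by (simp add: sum_distrib_left)
  also have "\<dots> = (\<Sum>j\<in>UNIV. \<integral>x. u x * pd j (pd j ?c) x \<partial>lebesgue_on \<Omega>)"
    by (rule Bochner_Integration.integral_sum)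
      (intro memL2_integrable_mult u test_fun_memL2 test_fun_pd c \<Omega>)
  also have "\<dots> = (\<Sum>j\<in>UNIV. - ip \<Omega> (G j) (pd j \<phi>))"
  proof (rule sum.cong[OF refl])
    fix j
    have "weak_pd \<Omega> u j (G j)" using G by (simp add: isgrad_def)
    then show "(\<integral>x. u x * pd j (pd j ?c) x \<partial>lebesgue_on \<Omega>) = - ip \<Omega> (G j) (pd j \<phi>)"
      using test_fun_pd[OF c, of j] unfolding weak_pd_def ip_def pdc by blast
  qed
  finally show ?thesis by (simp add: gip_def sum_negf)
qed

text \<open>Both sides are continuous in v for the H^1 norm, so density of test functions suffices;
  this is where the Dirichlet condition enters.\<close>

lemma weak_lap_H10:
  assumes \<Omega>: "open \<Omega>" and lap: "weak_lap \<Omega> u l" and l: "memL2 \<Omega> l" and u: "memH10 \<Omega> u" and v: "memH10 \<Omega> v"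
  shows "ip \<Omega> l v = - gip \<Omega> (wgrad \<Omega> u) (wgrad \<Omega> v)"
proof -
  obtain \<phi> where \<phi>: "\<And>k. test_fun \<Omega> (\<phi> k)" "(\<lambda>k. L2norm \<Omega> (\<lambda>x. \<phi> k x - v x)) \<longlonglongrightarrow> 0"
    "(\<lambda>k. gnorm \<Omega> (\<lambda>j x. pd j (\<phi> k) x - wgrad \<Omega> v j x)) \<longlonglongrightarrow> 0"
    using memH10_approx[OF \<Omega> v] by blast
  have "(\<lambda>k. ip \<Omega> l (\<phi> k)) \<longlonglongrightarrow> ip \<Omega> l v"
    by (intro ip_tendsto_right test_fun_memL2 \<Omega> \<phi> l memH10_memL2 v)
  moreover have "(\<lambda>k. - gip \<Omega> (wgrad \<Omega> u) (grd (\<phi> k))) \<longlonglongrightarrow> - gip \<Omega> (wgrad \<Omega> u) (wgrad \<Omega> v)"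
    using memH10_isgrad[OF u] memH10_isgrad[OF v]
    by (intro tendsto_minus gip_tendsto_right memG_grd \<Omega> \<phi>) (auto simp: isgrad_def)
  ultimately show ?thesis
    using weak_lap_test[OF \<Omega> lap memH10_isgrad[OF u] memH10_memL2[OF u] \<phi>(1)] LIMSEQ_unique by simp
qed

subsection \<open>Translations\<close>

lemma memL2_UNIV_borel:
  assumes "f \<in> borel_measurable borel"
  shows "memL2 UNIV f \<longleftrightarrow> integrable lborel (\<lambda>x. (cmod (f x))\<^sup>2)"
    and "(L2norm UNIV f)\<^sup>2 = (\<integral>x. (cmod (f x))\<^sup>2 \<partial>lborel)"
  using integral_lebesgue_on_support[of UNIV "\<lambda>x. (cmod (f x))\<^sup>2"] assms borel_measurable_lebesgue_on[OF assms]
  by (auto simp: memL2_def L2norm_sq)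

lemma L2norm_shift:
  fixes f :: "real^'n::finite \<Rightarrow> complex"
  assumes "f \<in> borel_measurable borel"
  shows "L2norm UNIV (\<lambda>x. f (x + h)) = L2norm UNIV f"
    "memL2 UNIV f \<Longrightarrow> memL2 UNIV (\<lambda>x. f (x + h))"
proof -
  have m: "(\<lambda>x. f (x + h)) \<in> borel_measurable borel" using assms by measurable
  have "(L2norm UNIV (\<lambda>x. f (x + h)))\<^sup>2 = (L2norm UNIV f)\<^sup>2"
    unfolding memL2_UNIV_borel(2)[OF m] memL2_UNIV_borel(2)[OF assms]
    by (rule lborel_integral_shift[of "\<lambda>x. (cmod (f x))\<^sup>2"]) (use assms in measurable)
  then show "L2norm UNIV (\<lambda>x. f (x + h)) = L2norm UNIV f" by simp
  show "memL2 UNIV f \<Longrightarrow> memL2 UNIV (\<lambda>x. f (x + h))"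
    unfolding memL2_UNIV_borel(1)[OF m] memL2_UNIV_borel(1)[OF assms]
    by (subst lborel_integrable_shift[of "\<lambda>x. (cmod (f x))\<^sup>2" h]) (use assms in auto)
qed

lemma L2norm_test_UNIV:
  assumes "open \<Omega>" "test_fun \<Omega> f"
  shows "L2norm UNIV f = L2norm \<Omega> f"
  using integral_lebesgue_on_support(1)[OF assms(1), of "\<lambda>x. (cmod (f x))\<^sup>2"]
    integral_lebesgue_on_support(1)[OF open_UNIV, of "\<lambda>x. (cmod (f x))\<^sup>2"] test_fun_borel[OF assms(2)]
    test_fun_zero_outside[OF assms(2)]
  by (simp add: L2norm_def)

text \<open>Telescoping the translation by h into k translations by h/k and letting k tend to infinity.\<close>

lemma test_fun_translate:
  fixes f :: "real^'n::finite \<Rightarrow> complex"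
  assumes \<Omega>: "open \<Omega>" and f: "test_fun \<Omega> f"
  shows "L2norm UNIV (\<lambda>x. f (x + h) - f x) \<le> norm h * gnorm \<Omega> (grd f)"
proof -
  have [measurable]: "f \<in> borel_measurable borel" "pd j f \<in> borel_measurable borel" for j
    using test_fun_borel f test_fun_pd by blast+
  have fU: "test_fun UNIV f" "test_fun UNIV (pd j f)" for j
    using f test_fun_pd test_fun_mono subset_UNIV by metis+
  have mU: "memL2 UNIV f" "memL2 UNIV (pd j f)" for j
    by (intro test_fun_memL2 fU open_UNIV)+
  have shift: "memL2 UNIV (\<lambda>x. f (x + h))" for h by (rule L2norm_shift(2)) (use mU in auto)
  have int: "integrable lborel (\<lambda>x. (cmod (pd j f x))\<^sup>2)" for j
    using mU(2)[of j] memL2_UNIV_borel(1)[of "pd j f"] by simp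
  let ?q = "\<lambda>k x. of_nat (Suc k) * (f (x + h /\<^sub>R real (Suc k)) - f x)"
  have tel: "L2norm UNIV (\<lambda>x. f (x + real n *\<^sub>R d) - f x) \<le> real n * L2norm UNIV (\<lambda>x. f (x + d) - f x)" for n d
  proof (induction n)
    case (Suc n)
    let ?g = "\<lambda>x. f (x + d) - f x"
    have "L2norm UNIV (\<lambda>x. f (x + real (Suc n) *\<^sub>R d) - f x)
       \<le> L2norm UNIV (\<lambda>x. f (x + real (Suc n) *\<^sub>R d) - f (x + real n *\<^sub>R d)) + L2norm UNIV (\<lambda>x. f (x + real n *\<^sub>R d) - f x)"
      by (rule L2norm_triangle_mid) (auto intro: shift mU)
    also have "(\<lambda>x. f (x + real (Suc n) *\<^sub>R d) - f (x + real n *\<^sub>R d)) = (\<lambda>x. ?g (x + real n *\<^sub>R d))"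
      by (simp add: algebra_simps)
    also have "L2norm UNIV \<dots> = L2norm UNIV ?g"
      by (rule L2norm_shift(1)) measurable
    finally show ?case using Suc by (simp add: algebra_simps)
  qed simp
  have le: "L2norm UNIV (\<lambda>x. f (x + h) - f x) \<le> L2norm UNIV (?q k)" for k
  proof -
    have "real (Suc k) *\<^sub>R (h /\<^sub>R real (Suc k)) = h" by (simp del: of_nat_Suc)
    then show ?thesis
      using tel[of "Suc k" "h /\<^sub>R real (Suc k)"]
      unfolding L2norm_cmult norm_of_nat by (simp only:)
  qed
  obtain B R where BR: "0 \<le> B" "\<And>k x. cmod (?q k x) \<le> B * indicator (cball 0 R) x"
    using test_diff_quotient_dominated[OF f, of h] by metis
  have "(\<lambda>k. \<integral>x. (cmod (?q k x))\<^sup>2 \<partial>lborel) \<longlonglongrightarrow> (\<integral>x. (cmod (dird h f x))\<^sup>2 \<partial>lborel)"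
  proof (rule integral_dominated_convergence[where w = "\<lambda>x. B\<^sup>2 * indicator (cball 0 R) x"])
    show "(\<lambda>x. (cmod (dird h f x))\<^sup>2) \<in> borel_measurable lborel" unfolding dird_def by measurable
    show "AE x in lborel. (\<lambda>k. (cmod (?q k x))\<^sup>2) \<longlonglongrightarrow> (cmod (dird h f x))\<^sup>2"
      by (intro AE_I2 tendsto_intros test_diff_quotient[OF f])
    fix k
    show "AE x in lborel. norm ((cmod (?q k x))\<^sup>2) \<le> B\<^sup>2 * indicator (cball 0 R) x"
    proof (rule AE_I2)
      fix x
      have "(cmod (?q k x))\<^sup>2 \<le> (B * indicator (cball 0 R) x)\<^sup>2"
        by (rule power_mono[OF BR(2)]) simp
      then show "norm ((cmod (?q k x))\<^sup>2) \<le> B\<^sup>2 * indicator (cball 0 R) x"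
        by (auto simp: indicator_def)
    qed
  qed (use integrable_ball_const in auto)
  moreover have "(L2norm UNIV (\<lambda>x. f (x + h) - f x))\<^sup>2 \<le> (\<integral>x. (cmod (?q k x))\<^sup>2 \<partial>lborel)" for k
    using power_mono[OF le[of k], of 2] memL2_UNIV_borel(2)[of "?q k"] by (simp del: of_nat_Suc)
  ultimately have "(L2norm UNIV (\<lambda>x. f (x + h) - f x))\<^sup>2 \<le> (\<integral>x. (cmod (dird h f x))\<^sup>2 \<partial>lborel)"
    by (intro LIMSEQ_le_const) auto
  also have "\<dots> \<le> (\<integral>x. (norm h)\<^sup>2 * (\<Sum>j\<in>UNIV. (cmod (pd j f x))\<^sup>2) \<partial>lborel)"
  proof (rule integral_mono')
    show "integrable lborel (\<lambda>x. (norm h)\<^sup>2 * (\<Sum>j\<in>UNIV. (cmod (pd j f x))\<^sup>2))"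
      by (intro integrable_mult_right Bochner_Integration.integrable_sum int)
    show "0 \<le> (norm h)\<^sup>2 * (\<Sum>j\<in>UNIV. (cmod (pd j f x))\<^sup>2)" for x
      by (intro mult_nonneg_nonneg sum_nonneg) auto
    fix x
    have "cmod (dird h f x) \<le> (\<Sum>i\<in>UNIV. \<bar>h $ i\<bar> * \<bar>cmod (pd i f x)\<bar>)"
      unfolding dird_def by (rule order_trans[OF norm_sum]) (simp add: norm_mult)
    also have "\<dots> \<le> L2_set (\<lambda>i. \<bar>h $ i\<bar>) UNIV * L2_set (\<lambda>i. cmod (pd i f x)) UNIV"
      using L2_set_mult_ineq[of "\<lambda>i. \<bar>h $ i\<bar>" "\<lambda>i. cmod (pd i f x)" UNIV] by simp
    finally have "(cmod (dird h f x))\<^sup>2 \<le> (norm h * L2_set (\<lambda>i. cmod (pd i f x)) UNIV)\<^sup>2"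
      by (intro power_mono) (auto simp: norm_vec_def)
    then show "(cmod (dird h f x))\<^sup>2 \<le> (norm h)\<^sup>2 * (\<Sum>j\<in>UNIV. (cmod (pd j f x))\<^sup>2)"
      by (simp add: power_mult_distrib L2_set_def sum_nonneg)
  qed
  also have "\<dots> = (norm h)\<^sup>2 * (\<Sum>j\<in>UNIV. \<integral>x. (cmod (pd j f x))\<^sup>2 \<partial>lborel)"
    by (subst integral_mult_right_zero, subst Bochner_Integration.integral_sum) (auto intro: int)
  also have "\<dots> = (norm h * gnorm \<Omega> (grd f))\<^sup>2"
    unfolding power_mult_distrib gnorm_sq
    using L2norm_test_UNIV[OF \<Omega> test_fun_pd[OF f]] memL2_UNIV_borel(2)[of "pd _ f"] by simp
  finally show ?thesis by (rule power2_le_imp_le) simp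
qed

subsection \<open>An interpolation inequality of Gagliardo--Nirenberg type\<close>

text \<open>If b is at least a/2, then 2 - p of the two factors a are traded for 2b, at the price
  2^(2-p) <= 2; otherwise |a - b| is at least a/2.\<close>

lemma square_le_shifted:
  fixes a b p :: real
  assumes "0 \<le> a" "0 \<le> b" "1 \<le> p" "p < 2"
  shows "a\<^sup>2 \<le> 4 * (a - b)\<^sup>2 + 2 * (a powr p * b powr (2 - p))"
proof (cases "a \<le> 2 * b")
  case True
  show ?thesis
  proof (cases "a = 0")
    case False
    then have a: "a > 0" using assms by simp
    have "a\<^sup>2 = a powr p * a powr (2 - p)" using a by (simp flip: powr_add)
    also have "\<dots> \<le> a powr p * (2 * b) powr (2 - p)"
      using a True assms by (intro mult_left_mono powr_mono2) auto
    also have "\<dots> = a powr p * (2 powr (2 - p) * b powr (2 - p))" by (simp add: powr_mult assms)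
    also have "\<dots> \<le> a powr p * (2 * b powr (2 - p))"
      using powr_mono[of "2 - p" 1 "2::real"] assms by (intro mult_left_mono mult_right_mono) auto
    finally show ?thesis by (simp add: add_increasing)
  qed (use assms in simp)
next
  case False
  then have "a / 2 \<le> \<bar>a - b\<bar>" by linarith
  then have "(a / 2)\<^sup>2 \<le> \<bar>a - b\<bar>\<^sup>2" using assms by (intro power_mono) auto
  then show ?thesis by (simp add: power_divide add_increasing2)
qed

text \<open>Only the integral of |v|^p is available after averaging, not that of |v|^(2-p). As
  b^(2-p) is the power \<kappa> <= 1 of b^p, it lies below an affine function of b^p, split at the
  level M that remains to be chosen.\<close>

lemma powr_le_affine:
  fixes b M p :: real
  assumes "0 \<le> b" "0 < M" "1 \<le> p" "p < 2"
  defines "\<kappa> \<equiv> (2 - p) / p"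
  shows "b powr (2 - p) \<le> M powr \<kappa> + M powr (\<kappa> - 1) * b powr p"
proof -
  have \<kappa>: "0 < \<kappa>" "\<kappa> \<le> 1" and pk: "p * \<kappa> = 2 - p" using assms by (auto simp: field_simps)
  have eq: "b powr (2 - p) = (b powr p) powr \<kappa>" by (simp add: powr_powr pk)
  show ?thesis
  proof (cases "b powr p \<le> M")
    case True
    then have "(b powr p) powr \<kappa> \<le> M powr \<kappa>" using \<kappa> by (intro powr_mono2) auto
    then show ?thesis unfolding eq by (rule order_trans) simp
  next
    case False
    have "(b powr p) powr \<kappa> = (b powr p) powr (\<kappa> - 1) * b powr p"
      using False assms by (subst powr_mult_base'[symmetric] | simp add: powr_diff)+
    also have "\<dots> \<le> M powr (\<kappa> - 1) * b powr p"
      using False \<kappa> assms by (intro mult_right_mono powr_mono2') auto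
    finally show ?thesis unfolding eq by (simp add: add_increasing)
  qed
qed

lemma interpolation_pointwise:
  fixes z w :: complex and M p :: real
  assumes "0 < M" "1 \<le> p" "p < 2"
  defines "\<kappa> \<equiv> (2 - p) / p"
  shows "(cmod z)\<^sup>2 \<le> 4 * (cmod (w - z))\<^sup>2 + (2 * M powr \<kappa>) * cmod z powr p
     + (2 * M powr (\<kappa> - 1)) * (cmod z powr p * cmod w powr p)"
proof -
  have "(cmod z)\<^sup>2 \<le> 4 * (cmod z - cmod w)\<^sup>2 + 2 * (cmod z powr p * cmod w powr (2 - p))"
    by (rule square_le_shifted) (use assms in auto)
  also have "(cmod z - cmod w)\<^sup>2 \<le> (cmod (w - z))\<^sup>2"
    using power_mono[OF norm_triangle_ineq3[of w z], of 2] by (simp add: power2_commute)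
  also have "cmod z powr p * cmod w powr (2 - p) \<le> cmod z powr p * (M powr \<kappa> + M powr (\<kappa> - 1) * cmod w powr p)"
    unfolding \<kappa>_def by (intro mult_left_mono powr_le_affine) (use assms in auto)
  finally show ?thesis by (simp add: algebra_simps)
qed

lemma nn_integral_lborel_shift:
  fixes f :: "real^'n::finite \<Rightarrow> ennreal"
  assumes "f \<in> borel_measurable borel"
  shows "(\<integral>\<^sup>+h. f (x + h) \<partial>lborel) = (\<integral>\<^sup>+h. f h \<partial>lborel)"
proof -
  have "(\<integral>\<^sup>+h. f h \<partial>distr lborel borel ((+) x)) = (\<integral>\<^sup>+h. f (x + h) \<partial>lborel)"
    by (rule nn_integral_distr) (use assms in auto)
  then show ?thesis by (simp add: lborel_distr_plus)
qed

text \<open>Tonelli and translation invariance decouple the two factors once h runs over the whole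
  space.\<close>

lemma nn_integral_product_shift:
  fixes f :: "real^'n::finite \<Rightarrow> ennreal"
  assumes [measurable]: "f \<in> borel_measurable borel"
  shows "(\<integral>\<^sup>+h. (\<integral>\<^sup>+x. f x * f (x + h) \<partial>lborel) \<partial>lborel) = (\<integral>\<^sup>+x. f x \<partial>lborel) * (\<integral>\<^sup>+x. f x \<partial>lborel)"
proof -
  have "(\<integral>\<^sup>+h. (\<integral>\<^sup>+x. f x * f (x + h) \<partial>lborel) \<partial>lborel) = (\<integral>\<^sup>+x. (\<integral>\<^sup>+h. f x * f (x + h) \<partial>lborel) \<partial>lborel)"
    by (rule lborel_pair.Fubini') measurable
  also have "\<dots> = (\<integral>\<^sup>+x. f x * (\<integral>\<^sup>+h. f h \<partial>lborel) \<partial>lborel)"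
    by (simp add: nn_integral_cmult nn_integral_lborel_shift)
  also have "\<dots> = (\<integral>\<^sup>+x. f x \<partial>lborel) * (\<integral>\<^sup>+x. f x \<partial>lborel)"
    by (rule nn_integral_multc) measurable
  finally show ?thesis .
qed

lemma cube_norm:
  assumes "h \<in> cbox 0 (r *\<^sub>R One :: real^'n::finite)"
  shows "(norm h)\<^sup>2 \<le> real CARD('n) * r\<^sup>2"
proof -
  have "(norm h)\<^sup>2 = (\<Sum>b\<in>Basis. (h \<bullet> b)\<^sup>2)"
    by (subst power2_norm_eq_inner, subst euclidean_inner) (simp add: power2_eq_square)
  also have "\<dots> \<le> (\<Sum>b\<in>(Basis::(real^'n) set). r\<^sup>2)"
    using assms by (intro sum_mono power_mono) (auto simp: mem_box)
  finally show ?thesis by simp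
qed

text \<open>The pointwise inequality is integrated in x for each fixed shift h, then averaged over h
  in a cube of side r. The shift enters only through the translation modulus, hence through the
  gradient bound G.\<close>

lemma interpolation_borel:
  fixes v :: "real^'n::finite \<Rightarrow> complex" and G p r :: real
  assumes v[measurable]: "v \<in> borel_measurable borel" and L2: "memL2 UNIV v"
    and trans: "\<And>h. L2norm UNIV (\<lambda>x. v (x + h) - v x) \<le> norm h * G" and G: "0 \<le> G"
    and p: "1 \<le> p" "p < 2" and r: "0 < r"
    and P: "(\<integral>\<^sup>+x. ennreal (cmod (v x) powr p) \<partial>lborel) = ennreal P" "0 < P"
  shows "(L2norm UNIV v)\<^sup>2 \<le> 4 * real CARD('n) * r\<^sup>2 * G\<^sup>2 + 4 * P * (P / r ^ CARD('n)) powr ((2 - p) / p)"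
proof -
  define \<kappa> where "\<kappa> = (2 - p) / p"
  \<comment> \<open>This level bounds the mean of |v|^p over any cube of side r and balances the two
    halves of the affine bound: each contributes 2 P M^\<kappa>.\<close>
  define M where "M = P / r ^ CARD('n)"
  define L where "L = L2norm UNIV v"
  have M: "M > 0" using P r by (simp add: M_def)
  define f where "f x = ennreal (cmod (v x) powr p)" for x
  have [measurable]: "f \<in> borel_measurable borel" unfolding f_def by measurable
  define A where "A = 4 * (real CARD('n) * r\<^sup>2 * G\<^sup>2) + (2 * M powr \<kappa>) * P"
  define c where "c = 2 * M powr (\<kappa> - 1)"
  have A: "0 \<le> A" and c: "0 \<le> c" using P(2) by (auto simp: A_def c_def)
  define Q where "Q = (cbox 0 (r *\<^sub>R One) :: (real^'n) set)"
  have [measurable]: "Q \<in> sets borel" by (simp add: Q_def)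
  have nnL: "(\<integral>\<^sup>+x. ennreal ((cmod (g x))\<^sup>2) \<partial>lborel) = ennreal ((L2norm UNIV g)\<^sup>2)"
    if "memL2 UNIV g" "g \<in> borel_measurable borel" for g :: "real^'n \<Rightarrow> complex"
    unfolding memL2_UNIV_borel(2)[OF that(2)]
    by (rule nn_integral_eq_integral) (use that memL2_UNIV_borel(1)[OF that(2)] in auto)
  have fixed: "ennreal (L\<^sup>2) \<le> ennreal A + ennreal c * (\<integral>\<^sup>+x. f x * f (x + h) \<partial>lborel)" if h: "h \<in> Q" for h
  proof -
    let ?d = "\<lambda>x. v (x + h) - v x"
    have d: "memL2 UNIV ?d" by (intro memL2_diff L2 L2norm_shift(2) v)
    have "ennreal (L\<^sup>2) = (\<integral>\<^sup>+x. ennreal ((cmod (v x))\<^sup>2) \<partial>lborel)"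
      by (simp add: L_def nnL L2)
    also have "\<dots> \<le> (\<integral>\<^sup>+x. ennreal 4 * ennreal ((cmod (?d x))\<^sup>2) + ennreal (2 * M powr \<kappa>) * f x + ennreal c * (f x * f (x + h)) \<partial>lborel)"
    proof (rule nn_integral_mono)
      fix x
      have "ennreal ((cmod (v x))\<^sup>2) \<le> ennreal (4 * (cmod (?d x))\<^sup>2 + (2 * M powr \<kappa>) * cmod (v x) powr p
         + c * (cmod (v x) powr p * cmod (v (x + h)) powr p))"
        unfolding c_def \<kappa>_def by (intro ennreal_leI interpolation_pointwise M p)
      also have "\<dots> = ennreal 4 * ennreal ((cmod (?d x))\<^sup>2) + ennreal (2 * M powr \<kappa>) * f x + ennreal c * (f x * f (x + h))"
        using c by (simp add: f_def ennreal_plus ennreal_mult del: ennreal_numeral)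
      finally show "ennreal ((cmod (v x))\<^sup>2) \<le> ennreal 4 * ennreal ((cmod (?d x))\<^sup>2) + ennreal (2 * M powr \<kappa>) * f x + ennreal c * (f x * f (x + h))" .
    qed
    also have "\<dots> = ennreal 4 * ennreal ((L2norm UNIV ?d)\<^sup>2) + ennreal (2 * M powr \<kappa>) * ennreal P + ennreal c * (\<integral>\<^sup>+x. f x * f (x + h) \<partial>lborel)"
      using P(1) by (simp add: nn_integral_add nn_integral_cmult nnL d f_def[symmetric] del: ennreal_numeral)
    also have "\<dots> = ennreal (4 * (L2norm UNIV ?d)\<^sup>2 + (2 * M powr \<kappa>) * P) + ennreal c * (\<integral>\<^sup>+x. f x * f (x + h) \<partial>lborel)"
      using P(2) by (simp add: ennreal_plus ennreal_mult del: ennreal_numeral)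
    also have "\<dots> \<le> ennreal A + ennreal c * (\<integral>\<^sup>+x. f x * f (x + h) \<partial>lborel)"
    proof (intro add_right_mono ennreal_leI)
      have "(L2norm UNIV ?d)\<^sup>2 \<le> (norm h)\<^sup>2 * G\<^sup>2"
        using power_mono[OF trans[of h], of 2] by (simp add: power_mult_distrib)
      also have "\<dots> \<le> (real CARD('n) * r\<^sup>2) * G\<^sup>2"
        by (intro mult_right_mono cube_norm) (use h in \<open>auto simp: Q_def\<close>)
      finally show "4 * (L2norm UNIV ?d)\<^sup>2 + (2 * M powr \<kappa>) * P \<le> A" by (simp add: A_def)
    qed
    finally show ?thesis .
  qed
  have rN: "0 < r ^ CARD('n)" using r by simp
  \<comment> \<open>Integration over the cube. The product term is enlarged to all shifts, where it
    equals P^2.\<close>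
  have "ennreal (L\<^sup>2 * r ^ CARD('n)) = (\<integral>\<^sup>+h. ennreal (L\<^sup>2) * indicator Q h \<partial>lborel)"
    using r by (simp add: nn_integral_cmult Q_def ennreal_mult)
  also have "\<dots> \<le> (\<integral>\<^sup>+h. ennreal A * indicator Q h + ennreal c * (\<integral>\<^sup>+x. f x * f (x + h) \<partial>lborel) \<partial>lborel)"
    by (rule nn_integral_mono) (use fixed in \<open>auto simp: indicator_def\<close>)
  also have "\<dots> = ennreal A * ennreal (r ^ CARD('n)) + ennreal c * (ennreal P * ennreal P)"
    using r P(1) by (simp add: nn_integral_add nn_integral_cmult Q_def nn_integral_product_shift f_def[symmetric])
  also have "\<dots> = ennreal (A * r ^ CARD('n) + c * (P * P))"
    using A c P(2) r by (simp add: ennreal_plus ennreal_mult)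
  finally have "L\<^sup>2 * r ^ CARD('n) \<le> A * r ^ CARD('n) + c * (P * P)"
    by (rule iffD1[OF ennreal_le_iff, rotated]) (use A c P(2) r in auto)
  then have "L\<^sup>2 * r ^ CARD('n) \<le> (A + c * P * M) * r ^ CARD('n)"
    using rN r by (simp add: M_def distrib_right)
  then have "L\<^sup>2 \<le> A + c * P * M" using rN by (rule mult_right_le_imp_le)
  also have "c * P * M = 2 * M powr \<kappa> * P" using M by (simp add: c_def powr_diff)
  finally show ?thesis by (simp add: A_def L_def M_def \<kappa>_def algebra_simps)
qed

text \<open>The side r is such that 4 N r^2 G^2 is half of L^2 and can be absorbed on the left.
  Since 1 + \<kappa> = 2/(1 + m), the power (1 + m)/2 then isolates P.\<close>

lemma interpolation_algebra:
  fixes L G P m :: real and N :: nat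
  assumes L: "0 < L" and G: "0 < G" and P: "0 < P" and m: "0 \<le> m" "m < 1" and N: "0 < N"
  defines "r \<equiv> L / (G * sqrt (8 * real N))"
  assumes le: "L\<^sup>2 \<le> 4 * real N * r\<^sup>2 * G\<^sup>2 + 4 * P * (P / r ^ N) powr ((2 - (1 + m)) / (1 + m))"
  shows "(L / 4) powr (1 + m) * r powr (real N * (1 - m) / 2) \<le> P"
proof -
  define \<kappa> where "\<kappa> = (1 - m) / (1 + m)"
  have r: "r > 0" using L G N by (simp add: r_def)
  have "4 * real N * r\<^sup>2 * G\<^sup>2 = L\<^sup>2 / 2"
    using G N by (simp add: r_def power_divide power_mult_distrib field_simps)
  then have "L\<^sup>2 \<le> 8 * (P * (P / r ^ N) powr \<kappa>)" using le by (simp add: \<kappa>_def)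
  also have "P * (P / r ^ N) powr \<kappa> = P powr (1 + \<kappa>) / r powr (real N * \<kappa>)"
    using P r by (simp add: powr_divide powr_add powr_powr flip: powr_realpow)
  finally have "(L\<^sup>2 / 8) * r powr (real N * \<kappa>) \<le> P powr (1 + \<kappa>)"
    using r by (simp add: field_simps)
  \<comment> \<open>A deliberate loss, 1/16 instead of 1/8, to have a perfect square under the
    power.\<close>
  moreover have "(L / 4)\<^sup>2 \<le> L\<^sup>2 / 8" by (simp add: power_divide)
  ultimately have "(L / 4)\<^sup>2 * r powr (real N * \<kappa>) \<le> P powr (1 + \<kappa>)"
    using mult_right_mono[of "(L / 4)\<^sup>2" "L\<^sup>2 / 8" "r powr (real N * \<kappa>)"] by simp
  then have *: "((L / 4)\<^sup>2 * r powr (real N * \<kappa>)) powr ((1 + m) / 2) \<le> (P powr (1 + \<kappa>)) powr ((1 + m) / 2)"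
    using m L by (intro powr_mono2) auto
  have e: "(1 + \<kappa>) * ((1 + m) / 2) = 1" "(real N * \<kappa>) * ((1 + m) / 2) = real N * (1 - m) / 2"
    using m by (simp_all add: \<kappa>_def field_simps)
  have e2: "((L / 4)\<^sup>2) powr ((1 + m) / 2) = (L / 4) powr (1 + m)"
  proof -
    have "((L / 4)\<^sup>2) powr ((1 + m) / 2) = ((L / 4) powr 2) powr ((1 + m) / 2)" using L by simp
    also have "\<dots> = (L / 4) powr (2 * ((1 + m) / 2))" by (rule powr_powr)
    also have "2 * ((1 + m) / 2) = 1 + m" by simp
    finally show ?thesis .
  qed
  have "(L / 4) powr (1 + m) * r powr (real N * (1 - m) / 2) \<le> P powr 1"
    using * unfolding powr_mult e2 powr_powr e .
  then show ?thesis using P by simp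
qed

text \<open>The lower bound for the dissipation in terms of the L2 norm and a gradient bound. It is
  stated in \<open>ennreal\<close> because |v|^(1+m) need not be integrable for v in L2 when
  \<Omega> has infinite measure.\<close>

theorem gagliardo_nirenberg:
  fixes v :: "real^'n::finite \<Rightarrow> complex"
  assumes \<Omega>: "open \<Omega>" and v: "memH10 \<Omega> v" and G: "0 < G" "gradL2sq \<Omega> v \<le> G\<^sup>2"
    and m: "0 \<le> m" "m < 1"
  shows "ennreal ((L2norm \<Omega> v / 4) powr (1 + m) * (L2norm \<Omega> v / (G * sqrt (8 * real CARD('n)))) powr (real CARD('n) * (1 - m) / 2))
     \<le> (\<integral>\<^sup>+x. ennreal (cmod (v x) powr (1 + m)) \<partial>lebesgue_on \<Omega>)"
proof -
  have S: "\<Omega> \<in> sets lebesgue" using \<Omega> by (simp add: borel_open)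
  have vL: "memL2 \<Omega> v" by (rule memH10_memL2[OF v])
  have vm: "v \<in> borel_measurable (lebesgue_on \<Omega>)" using vL by (simp add: memL2_def)
  obtain w where w[measurable]: "w \<in> borel_measurable borel"
    and eq: "AE x in lborel. (if x \<in> \<Omega> then v x else 0) = w x"
    by (rule lebesgue_on_borel_rep[OF S vm])
  obtain \<phi> where \<phi>: "\<And>k. test_fun \<Omega> (\<phi> k)" "(\<lambda>k. L2norm \<Omega> (\<lambda>x. \<phi> k x - v x)) \<longlonglongrightarrow> 0"
    "(\<lambda>k. gnorm \<Omega> (\<lambda>j x. pd j (\<phi> k) x - wgrad \<Omega> v j x)) \<longlonglongrightarrow> 0"
    using memH10_approx[OF \<Omega> v] by blast
  have [measurable]: "\<phi> k \<in> borel_measurable borel" for k using test_fun_borel \<phi>(1) by blast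
  have L2eq: "L2norm \<Omega> g = L2norm UNIV h" "memL2 \<Omega> g \<Longrightarrow> memL2 UNIV h"
    if "AE x in lborel. (if x \<in> \<Omega> then g x else 0) = h x" "h \<in> borel_measurable borel"
      "g \<in> borel_measurable (lebesgue_on \<Omega>)" for g h
  proof -
    have ae: "AE x in lborel. (if x \<in> \<Omega> then (cmod (g x))\<^sup>2 else 0) = (cmod (h x))\<^sup>2"
      using that(1) by eventually_elim (auto split: if_splits)
    have "(L2norm \<Omega> g)\<^sup>2 = (\<integral>x. (cmod (h x))\<^sup>2 \<partial>lborel)"
      unfolding L2norm_sq by (rule lebesgue_on_integral_rep(1)[OF S _ ae]) (use that in auto)
    then have "(L2norm \<Omega> g)\<^sup>2 = (L2norm UNIV h)\<^sup>2" using memL2_UNIV_borel(2)[OF that(2)] by simp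
    then show "L2norm \<Omega> g = L2norm UNIV h" by simp
    show "memL2 \<Omega> g \<Longrightarrow> memL2 UNIV h"
      unfolding memL2_UNIV_borel(1)[OF that(2)]
      using lebesgue_on_integral_rep(2)[OF S _ ae] that by (simp add: memL2_def)
  qed
  have wL: "memL2 UNIV w" and Lw: "L2norm \<Omega> v = L2norm UNIV w"
    using L2eq[OF eq w vm] vL by auto
  have \<phi>U: "memL2 UNIV (\<phi> k)" for k
    by (rule test_fun_memL2[OF open_UNIV test_fun_mono[OF \<phi>(1)]]) simp
  have \<phi>w: "(\<lambda>k. L2norm UNIV (\<lambda>x. \<phi> k x - w x)) \<longlonglongrightarrow> 0"
  proof -
    have "L2norm \<Omega> (\<lambda>x. \<phi> k x - v x) = L2norm UNIV (\<lambda>x. \<phi> k x - w x)" for k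
    proof (rule L2eq(1))
      show "AE x in lborel. (if x \<in> \<Omega> then \<phi> k x - v x else 0) = \<phi> k x - w x"
        using eq by eventually_elim (auto split: if_splits simp: test_fun_zero_outside[OF \<phi>(1)])
    qed (use vm borel_measurable_lebesgue_on[of "\<phi> k"] in auto)
    then show ?thesis using \<phi>(2) by simp
  qed
  \<comment> \<open>The translation estimate is known for test functions; both sides pass to the
    limit along an approximation of v.\<close>
  have "L2norm UNIV (\<lambda>x. w (x + h) - w x) \<le> norm h * gnorm \<Omega> (wgrad \<Omega> v)" for h
  proof (rule LIMSEQ_le)
    have sh: "memL2 UNIV (\<lambda>x. \<phi> k (x + h))" "memL2 UNIV (\<lambda>x. w (x + h))" for k
      by (rule L2norm_shift(2); simp add: \<phi>U wL)+
    show "(\<lambda>k. L2norm UNIV (\<lambda>x. \<phi> k (x + h) - \<phi> k x)) \<longlonglongrightarrow> L2norm UNIV (\<lambda>x. w (x + h) - w x)"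
    proof (rule tendsto_L2norm)
      show "memL2 UNIV (\<lambda>x. \<phi> k (x + h) - \<phi> k x)" "memL2 UNIV (\<lambda>x. w (x + h) - w x)" for k
        by (intro memL2_diff sh \<phi>U wL)+
      let ?e = "\<lambda>k x. \<phi> k x - w x"
      have e: "memL2 UNIV (?e k)" "memL2 UNIV (\<lambda>x. ?e k (x + h))" for k
        by (intro memL2_diff sh \<phi>U wL)+
      have le: "L2norm UNIV (\<lambda>x. \<phi> k (x + h) - \<phi> k x - (w (x + h) - w x)) \<le> 2 * L2norm UNIV (?e k)" for k
      proof -
        have "(\<lambda>x. \<phi> k (x + h) - \<phi> k x - (w (x + h) - w x)) = (\<lambda>x. ?e k (x + h) - ?e k x)"
          by (simp add: algebra_simps)
        then have "L2norm UNIV (\<lambda>x. \<phi> k (x + h) - \<phi> k x - (w (x + h) - w x)) \<le> L2norm UNIV (\<lambda>x. ?e k (x + h)) + L2norm UNIV (?e k)"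
          using L2norm_triangle_diff[OF e(2,1)] by simp
        also have "L2norm UNIV (\<lambda>x. ?e k (x + h)) = L2norm UNIV (?e k)"
          by (rule L2norm_shift(1)) measurable
        finally show ?thesis by simp
      qed
      have lim0: "(\<lambda>k. 2 * L2norm UNIV (\<lambda>x. \<phi> k x - w x)) \<longlonglongrightarrow> 2 * 0"
        by (rule tendsto_mult[OF tendsto_const \<phi>w])
      show "(\<lambda>k. L2norm UNIV (\<lambda>x. \<phi> k (x + h) - \<phi> k x - (w (x + h) - w x))) \<longlonglongrightarrow> 0"
      proof (rule Lim_null_comparison)
        show "\<forall>\<^sub>F k in sequentially. norm (L2norm UNIV (\<lambda>x. \<phi> k (x + h) - \<phi> k x - (w (x + h) - w x)))
            \<le> 2 * L2norm UNIV (\<lambda>x. \<phi> k x - w x)"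
          unfolding real_norm_def abs_of_nonneg[OF L2norm_nonneg] by (rule always_eventually[OF allI[OF le]])
        show "(\<lambda>k. 2 * L2norm UNIV (\<lambda>x. \<phi> k x - w x)) \<longlonglongrightarrow> 0" using lim0 unfolding mult_zero_right .
      qed
    qed
    show "(\<lambda>k. norm h * gnorm \<Omega> (grd (\<phi> k))) \<longlonglongrightarrow> norm h * gnorm \<Omega> (wgrad \<Omega> v)"
      using memH10_isgrad[OF v] by (intro tendsto_intros tendsto_gnorm memG_grd \<Omega> \<phi>) (simp add: isgrad_def)
    show "\<exists>K. \<forall>k\<ge>K. L2norm UNIV (\<lambda>x. \<phi> k (x + h) - \<phi> k x) \<le> norm h * gnorm \<Omega> (grd (\<phi> k))"
      using test_fun_translate[OF \<Omega> \<phi>(1)] by blast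
  qed
  moreover have "gnorm \<Omega> (wgrad \<Omega> v) \<le> G"
    by (rule power2_le_imp_le) (use G in \<open>auto simp: gradL2sq_eq_wgrad\<close>)
  ultimately have trans: "L2norm UNIV (\<lambda>x. w (x + h) - w x) \<le> norm h * G" for h
    by (meson mult_left_mono norm_ge_zero order_trans)
  define J where "J = (\<integral>\<^sup>+x. ennreal (cmod (w x) powr (1 + m)) \<partial>lborel)"
  have Jeq: "(\<integral>\<^sup>+x. ennreal (cmod (v x) powr (1 + m)) \<partial>lebesgue_on \<Omega>) = J"
  proof -
    have "(\<integral>\<^sup>+x. ennreal (cmod (v x) powr (1 + m)) \<partial>lebesgue_on \<Omega>)
       = (\<integral>\<^sup>+x. ennreal (cmod (v x) powr (1 + m)) * indicator \<Omega> x \<partial>lebesgue)"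
      by (rule nn_integral_restrict_space) (use S in simp)
    also have "\<dots> = (\<integral>\<^sup>+x. ennreal (cmod (w x) powr (1 + m)) \<partial>lebesgue)"
      by (rule nn_integral_cong_AE, use AE_completion[OF eq] in eventually_elim)
        (auto simp: indicator_def split: if_splits)
    finally show ?thesis by (simp add: J_def nn_integral_completion)
  qed
  show ?thesis
  proof (cases "L2norm \<Omega> v = 0 \<or> J = \<infinity>")
    case True
    then show ?thesis using Jeq by auto
  next
    case False
    then have L: "0 < L2norm \<Omega> v" by (simp add: order.not_eq_order_implies_strict)
    obtain P where P: "J = ennreal P" "0 \<le> P" using False by (cases J) auto
    have "P \<noteq> 0"
    proof
      assume "P = 0"
      then have "(\<integral>\<^sup>+x. ennreal (cmod (w x) powr (1 + m)) \<partial>lborel) = 0" using P by (simp add: J_def)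
      then have "AE x in lborel. ennreal (cmod (w x) powr (1 + m)) = 0"
        by (subst (asm) nn_integral_0_iff_AE) auto
      then have "AE x in lborel. (cmod (w x))\<^sup>2 = 0" by eventually_elim simp
      then have "(L2norm UNIV w)\<^sup>2 = 0"
        unfolding memL2_UNIV_borel(2)[OF w] by (simp add: integral_eq_zero_AE)
      then show False using L Lw by simp
    qed
    then have P0: "0 < P" using P by simp
    have "(L2norm \<Omega> v / 4) powr (1 + m) * (L2norm \<Omega> v / (G * sqrt (8 * real CARD('n)))) powr (real CARD('n) * (1 - m) / 2) \<le> P"
    proof (rule interpolation_algebra[OF L G(1) P0 m])
      show "0 < CARD('n)" by simp
      show "(L2norm \<Omega> v)\<^sup>2 \<le> 4 * real CARD('n) * (L2norm \<Omega> v / (G * sqrt (8 * real CARD('n))))\<^sup>2 * G\<^sup>2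
         + 4 * P * (P / (L2norm \<Omega> v / (G * sqrt (8 * real CARD('n)))) ^ CARD('n)) powr ((2 - (1 + m)) / (1 + m))"
        unfolding Lw by (rule interpolation_borel[OF w wL trans]) (use G m L Lw P P0 in \<open>auto simp: J_def\<close>)
    qed
    then show ?thesis unfolding Jeq P(1) by (rule ennreal_leI)
  qed
qed

subsection \<open>The regularised nonlinearity\<close>

text \<open>The power map |z|^(m-1) z with |z|^2 replaced by |z|^2 + \<delta>, which is smooth
  across 0, so compositions with test functions are again test functions.\<close>

definition greg :: "real \<Rightarrow> real \<Rightarrow> complex \<Rightarrow> complex" where
  "greg \<delta> m z = complex_of_real (((cmod z)\<^sup>2 + \<delta>) powr ((m - 1) / 2)) * z"

definition dgreg :: "real \<Rightarrow> real \<Rightarrow> complex \<Rightarrow> complex \<Rightarrow> complex" where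
  "dgreg \<delta> m z \<xi> = complex_of_real (((cmod z)\<^sup>2 + \<delta>) powr ((m - 1) / 2)) * \<xi>
     + complex_of_real ((m - 1) * Re (cnj z * \<xi>) * ((cmod z)\<^sup>2 + \<delta>) powr ((m - 1) / 2 - 1)) * z"

lemma rho_pos: "0 < \<delta> \<Longrightarrow> 0 < (cmod z)\<^sup>2 + \<delta>"
  by (simp add: add_nonneg_pos)

lemma greg_has_derivative:
  assumes "0 < \<delta>"
  shows "(greg \<delta> m has_derivative dgreg \<delta> m z) (at z)"
proof -
  let ?\<beta> = "(m - 1) / 2" and ?\<rho> = "\<lambda>z. (cmod z)\<^sup>2 + \<delta>"
  have s: "(?\<rho> has_derivative (\<lambda>\<xi>. 2 * Re (cnj z * \<xi>))) (at z)"
    unfolding cmod_power2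
    by (auto intro!: derivative_eq_intros bounded_linear_imp_has_derivative[OF bounded_linear_Re]
        bounded_linear_imp_has_derivative[OF bounded_linear_Im] simp: algebra_simps)
  have p: "((\<lambda>s. s powr ?\<beta>) has_derivative (\<lambda>h. ?\<beta> * (?\<rho> z) powr (?\<beta> - 1) * h)) (at (?\<rho> z))"
    using has_real_derivative_powr[OF rho_pos[OF assms, of z], of ?\<beta>] unfolding has_field_derivative_def .
  have "((\<lambda>z. ?\<rho> z powr ?\<beta>) has_derivative (\<lambda>\<xi>. ?\<beta> * (?\<rho> z) powr (?\<beta> - 1) * (2 * Re (cnj z * \<xi>)))) (at z)"
    by (rule has_derivative_compose[OF s p])
  then have "((\<lambda>z. complex_of_real (?\<rho> z powr ?\<beta>)) has_derivative
      (\<lambda>\<xi>. complex_of_real (?\<beta> * (?\<rho> z) powr (?\<beta> - 1) * (2 * Re (cnj z * \<xi>))))) (at z)"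
    by (rule bounded_linear.has_derivative[OF bounded_linear_of_real])
  from has_derivative_mult[OF this has_derivative_ident]
  show ?thesis unfolding greg_def
    by (rule has_derivative_eq_rhs) (auto simp: dgreg_def fun_eq_iff field_simps)
qed

lemma Cset_imp:
  assumes "a \<in> Cset m"
  shows "0 < Im a" "(1 - m) * \<bar>Re a\<bar> \<le> 2 * sqrt m * Im a"
  using assms by (auto simp: Cset_def)

text \<open>The cone condition on the coefficient makes the monotonicity of the complex power map
  survive multiplication by it (the Liskevich--Perelmuter inequality).\<close>

lemma dgreg_sign:
  assumes a: "a \<in> Cset m" and m: "0 \<le> m" "m < 1" and \<delta>: "0 < \<delta>"
  shows "0 \<le> Im (a * (dgreg \<delta> m z \<xi> * cnj \<xi>))"
proof -
  define \<rho> where "\<rho> = (cmod z)\<^sup>2 + \<delta>"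
  define c where "c = \<rho> powr ((m - 1) / 2 - 1)"
  define x y where "x = Re (cnj z * \<xi>)" and "y = - Im (cnj z * \<xi>)"
  have \<rho>: "0 < \<rho>" using rho_pos[OF \<delta>] by (simp add: \<rho>_def)
  have c: "0 < c" using \<rho> by (simp add: c_def)
  have r: "\<rho> powr ((m - 1) / 2) = c * \<rho>" using \<rho> by (simp add: c_def powr_diff)
  have zxi: "z * cnj \<xi> = Complex x y" by (simp add: x_def y_def complex_eq_iff algebra_simps)
  have "dgreg \<delta> m z \<xi> * cnj \<xi> = complex_of_real (c * \<rho>) * (\<xi> * cnj \<xi>) + complex_of_real ((m - 1) * x * c) * (z * cnj \<xi>)"
    unfolding dgreg_def \<rho>_def[symmetric] r x_def[symmetric] c_def[symmetric] by (simp add: algebra_simps)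
  also have "\<dots> = Complex (c * (\<rho> * (cmod \<xi>)\<^sup>2 - (1 - m) * x\<^sup>2)) (- c * (1 - m) * x * y)"
    unfolding zxi complex_norm_square[symmetric] by (simp add: complex_eq_iff algebra_simps power2_eq_square)
  finally have "Im (a * (dgreg \<delta> m z \<xi> * cnj \<xi>)) = c * (Im a * (\<rho> * (cmod \<xi>)\<^sup>2 - (1 - m) * x\<^sup>2) - (1 - m) * Re a * x * y)"
    by (simp add: algebra_simps)
  also have "\<dots> \<ge> c * 0"
  proof (rule mult_left_mono)
    have "x\<^sup>2 + y\<^sup>2 = (cmod z)\<^sup>2 * (cmod \<xi>)\<^sup>2"
      using arg_cong[OF zxi, of "\<lambda>w. (cmod w)\<^sup>2"] by (simp add: norm_mult power_mult_distrib cmod_power2)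
    also have "\<dots> \<le> \<rho> * (cmod \<xi>)\<^sup>2" using \<delta> by (intro mult_right_mono) (auto simp: \<rho>_def)
    finally have "Im a * (m * x\<^sup>2 + y\<^sup>2) \<le> Im a * (\<rho> * (cmod \<xi>)\<^sup>2 - (1 - m) * x\<^sup>2)"
      using Cset_imp(1)[OF a] by (intro mult_left_mono) (auto simp: algebra_simps)
    \<comment> \<open>The cone condition replaces (1 - m)|Re a| by 2 sqrt(m) Im a, and the
      arithmetic-geometric mean of sqrt(m)|x| and |y| gives exactly the available form m x^2 +
      y^2.\<close>
    moreover have "(1 - m) * Re a * x * y \<le> Im a * (m * x\<^sup>2 + y\<^sup>2)"
    proof -
      have "(1 - m) * Re a * x * y \<le> \<bar>(1 - m) * Re a * x * y\<bar>" by simp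
      also have "\<dots> = ((1 - m) * \<bar>Re a\<bar>) * (\<bar>x\<bar> * \<bar>y\<bar>)" using m by (simp add: abs_mult)
      also have "\<dots> \<le> (2 * sqrt m * Im a) * (\<bar>x\<bar> * \<bar>y\<bar>)"
        by (rule mult_right_mono[OF Cset_imp(2)[OF a]]) simp
      also have "\<dots> = Im a * (2 * (sqrt m * \<bar>x\<bar>) * \<bar>y\<bar>)" by simp
      also have "\<dots> \<le> Im a * ((sqrt m * \<bar>x\<bar>)\<^sup>2 + \<bar>y\<bar>\<^sup>2)"
        using Cset_imp(1)[OF a] sum_squares_bound[of "sqrt m * \<bar>x\<bar>" "\<bar>y\<bar>"] by (intro mult_left_mono) auto
      also have "(sqrt m * \<bar>x\<bar>)\<^sup>2 + \<bar>y\<bar>\<^sup>2 = m * x\<^sup>2 + y\<^sup>2" using m by (simp add: power_mult_distrib)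
      finally show ?thesis .
    qed
    ultimately show "0 \<le> Im a * (\<rho> * (cmod \<xi>)\<^sup>2 - (1 - m) * x\<^sup>2) - (1 - m) * Re a * x * y" by linarith
  qed (use c in simp)
  finally show ?thesis by simp
qed

text \<open>The sign of the derivative, integrated along the segment from w to z.\<close>

lemma greg_monotone:
  assumes a: "a \<in> Cset m" and m: "0 \<le> m" "m < 1" and \<delta>: "0 < \<delta>"
  shows "0 \<le> Im (a * ((greg \<delta> m z - greg \<delta> m w) * cnj (z - w)))"
proof -
  let ?\<xi> = "z - w"
  let ?h = "\<lambda>t::real. Im (a * (greg \<delta> m (w + complex_of_real t * ?\<xi>) * cnj ?\<xi>))"
  have "(?h has_real_derivative Im (a * (dgreg \<delta> m (w + complex_of_real t * ?\<xi>) ?\<xi> * cnj ?\<xi>))) (at t)" for t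
  proof -
    have L: "((\<lambda>t. w + complex_of_real t * ?\<xi>) has_derivative (\<lambda>s. complex_of_real s * ?\<xi>)) (at t)"
      by (auto intro!: derivative_eq_intros bounded_linear_imp_has_derivative[OF bounded_linear_of_real])
    from has_derivative_compose[OF L greg_has_derivative[OF \<delta>]]
    have "((\<lambda>t. greg \<delta> m (w + complex_of_real t * ?\<xi>)) has_derivative
      (\<lambda>s. dgreg \<delta> m (w + complex_of_real t * ?\<xi>) (complex_of_real s * ?\<xi>))) (at t)" .
    moreover have "bounded_linear (\<lambda>g. Im (a * (g * cnj ?\<xi>)))"
      by (intro bounded_linear_compose[OF bounded_linear_Im] bounded_linear_compose[OF bounded_linear_mult_right]
          bounded_linear_mult_left)
    ultimately have "(?h has_derivative (\<lambda>s. Im (a * (dgreg \<delta> m (w + complex_of_real t * ?\<xi>) (complex_of_real s * ?\<xi>) * cnj ?\<xi>)))) (at t)"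
      by (rule bounded_linear.has_derivative[rotated])
    moreover have "dgreg \<delta> m q (complex_of_real s * ?\<xi>) = complex_of_real s * dgreg \<delta> m q ?\<xi>" for s q
      by (simp add: dgreg_def algebra_simps)
    ultimately show ?thesis
      unfolding has_field_derivative_def
      by (elim has_derivative_eq_rhs) (auto simp: fun_eq_iff algebra_simps)
  qed
  moreover have "0 \<le> Im (a * (dgreg \<delta> m (w + complex_of_real t * ?\<xi>) ?\<xi> * cnj ?\<xi>))" for t
    by (rule dgreg_sign[OF a m \<delta>])
  ultimately have "\<exists>y. (?h has_real_derivative y) (at t) \<and> 0 \<le> y" for t by blast
  then have "?h 0 \<le> ?h 1"
    by (intro DERIV_nonneg_imp_nondecreasing[of 0 1 ?h]) auto
  then have "0 \<le> ?h 1 - ?h 0" by simp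
  also have "?h 1 - ?h 0 = Im (a * ((greg \<delta> m z - greg \<delta> m w) * cnj ?\<xi>))"
    unfolding left_diff_distrib right_diff_distrib[of a] minus_complex.sel by simp
  finally show ?thesis .
qed

lemma greg_bounds:
  assumes "0 \<le> m" "m < 1" "0 < \<delta>"
  shows "cmod (greg \<delta> m z) \<le> \<delta> powr ((m - 1) / 2) * cmod z"
    and "cmod (dgreg \<delta> m z \<xi>) \<le> 2 * \<delta> powr ((m - 1) / 2) * cmod \<xi>"
proof -
  define \<rho> where "\<rho> = (cmod z)\<^sup>2 + \<delta>"
  have \<rho>: "0 < \<rho>" using rho_pos[OF assms(3)] by (simp add: \<rho>_def)
  have le: "\<rho> powr ((m - 1) / 2) \<le> \<delta> powr ((m - 1) / 2)"
    using assms by (intro powr_mono2') (auto simp: \<rho>_def)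
  show "cmod (greg \<delta> m z) \<le> \<delta> powr ((m - 1) / 2) * cmod z"
    using mult_right_mono[OF le norm_ge_zero[of z]] by (simp add: greg_def norm_mult \<rho>_def)
  have zz: "cmod z * cmod z \<le> \<rho>" using assms by (simp add: \<rho>_def power2_eq_square)
  have "cmod (dgreg \<delta> m z \<xi>) \<le> \<rho> powr ((m - 1) / 2) * cmod \<xi> + ((1 - m) * \<bar>Re (cnj z * \<xi>)\<bar> * \<rho> powr ((m - 1) / 2 - 1)) * cmod z"
    unfolding dgreg_def \<rho>_def[symmetric] using assms
    by (intro norm_triangle_le) (simp only: norm_mult norm_of_real, simp add: abs_mult)
  also have "((1 - m) * \<bar>Re (cnj z * \<xi>)\<bar> * \<rho> powr ((m - 1) / 2 - 1)) * cmod z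
      \<le> (1 * (cmod z * cmod \<xi>) * \<rho> powr ((m - 1) / 2 - 1)) * cmod z"
    using abs_Re_le_cmod[of "cnj z * \<xi>"] assms
    by (intro mult_right_mono mult_mono) (auto simp: norm_mult)
  also have "\<dots> = \<rho> powr ((m - 1) / 2 - 1) * (cmod z * cmod z) * cmod \<xi>" by simp
  also have "\<dots> \<le> \<rho> powr ((m - 1) / 2 - 1) * \<rho> * cmod \<xi>"
    by (intro mult_right_mono mult_left_mono zz) auto
  also have "\<rho> powr ((m - 1) / 2 - 1) * \<rho> = \<rho> powr ((m - 1) / 2)" using \<rho> by (simp add: powr_diff)
  finally have "cmod (dgreg \<delta> m z \<xi>) \<le> 2 * (\<rho> powr ((m - 1) / 2) * cmod \<xi>)" by (simp add: mult_ac)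
  also have "\<dots> \<le> 2 * (\<delta> powr ((m - 1) / 2) * cmod \<xi>)"
    using le by (intro mult_left_mono mult_right_mono) auto
  finally show "cmod (dgreg \<delta> m z \<xi>) \<le> 2 * \<delta> powr ((m - 1) / 2) * cmod \<xi>" by simp
qed

section \<open>The regularised nonlinearity along test functions\<close>

lemma test_fun_greg:
  assumes \<phi>: "test_fun \<Omega> \<phi>" and \<delta>: "0 < \<delta>"
  shows "test_fun \<Omega> (\<lambda>x. greg \<delta> m (\<phi> x))"
    and "pd j (\<lambda>x. greg \<delta> m (\<phi> x)) = (\<lambda>x. dgreg \<delta> m (\<phi> x) (pd j \<phi> x))"
proof -
  have sm: "smooth_fun \<phi>" by (rule test_fun_smooth[OF \<phi>])
  have re: "smooth_fun (\<lambda>x. Re (\<phi> x))" "smooth_fun (\<lambda>x. Im (\<phi> x))"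
    by (rule smooth_fun_bounded_linear[OF bounded_linear_Re sm], rule smooth_fun_bounded_linear[OF bounded_linear_Im sm])
  have "smooth_fun (\<lambda>x. Re (\<phi> x) * Re (\<phi> x) + Im (\<phi> x) * Im (\<phi> x) + \<delta>)"
    by (intro smooth_fun_add smooth_fun_mult re smooth_fun_const)
  moreover have "Re z * Re z + Im z * Im z = (cmod z)\<^sup>2" for z
    by (simp add: cmod_power2 power2_eq_square[of "Re z"] power2_eq_square[of "Im z"])
  ultimately have s: "smooth_fun (\<lambda>x. (cmod (\<phi> x))\<^sup>2 + \<delta>)" by simp
  have "smooth_fun (\<lambda>x. 1 * ((cmod (\<phi> x))\<^sup>2 + \<delta>) powr ((m - 1) / 2))"
    by (rule smooth_fun_compose_real[OF _ s CkR_powr]) (use rho_pos[OF \<delta>] in auto)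
  then have "smooth_fun (\<lambda>x. complex_of_real (1 * ((cmod (\<phi> x))\<^sup>2 + \<delta>) powr ((m - 1) / 2)))"
    by (rule smooth_fun_bounded_linear[OF bounded_linear_of_real])
  then show "test_fun \<Omega> (\<lambda>x. greg \<delta> m (\<phi> x))"
    unfolding greg_def using test_fun_smooth_mult[OF \<phi>] by simp
  show "pd j (\<lambda>x. greg \<delta> m (\<phi> x)) = (\<lambda>x. dgreg \<delta> m (\<phi> x) (pd j \<phi> x))"
    by (rule ext, rule pd_eqI[THEN trans], rule has_derivative_compose[OF _ greg_has_derivative[OF \<delta>]],
        rule differentiable_has_fderivative[OF test_fun_differentiable[OF \<phi>]]) (simp add: pd_def)
qed

lemma Im_mult_ip:
  assumes "memL2 \<Omega> f" "memL2 \<Omega> g"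
  shows "Im (a * ip \<Omega> f g) = (\<integral>x. Im (a * (f x * cnj (g x))) \<partial>lebesgue_on \<Omega>)"
    "integrable (lebesgue_on \<Omega>) (\<lambda>x. Im (a * (f x * cnj (g x))))"
proof -
  have i: "integrable (lebesgue_on \<Omega>) (\<lambda>x. a * (f x * cnj (g x)))"
    by (intro integrable_mult_right ip_integrable assms)
  show "Im (a * ip \<Omega> f g) = (\<integral>x. Im (a * (f x * cnj (g x))) \<partial>lebesgue_on \<Omega>)"
    unfolding ip_def integral_mult_right_zero[symmetric] by (rule integral_Im[OF i, symmetric])
  show "integrable (lebesgue_on \<Omega>) (\<lambda>x. Im (a * (f x * cnj (g x))))"
    by (rule integrable_Im[OF i])
qed

text \<open>\<open>dgreg_sign\<close> at z = \<phi>(x) in direction of the partial derivative,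
  integrated. It is the rigorous form of testing the nonlinearity with minus the Laplacian of
  \<phi>.\<close>

lemma ip_greg_sign:
  assumes \<Omega>: "open \<Omega>" and \<phi>: "test_fun \<Omega> \<phi>" and a: "a \<in> Cset m" and m: "0 \<le> m" "m < 1" and \<delta>: "0 < \<delta>"
  shows "0 \<le> Im (a * ip \<Omega> (pd j (\<lambda>x. greg \<delta> m (\<phi> x))) (pd j \<phi>))"
proof -
  have mem: "memL2 \<Omega> (pd j (\<lambda>x. greg \<delta> m (\<phi> x)))" "memL2 \<Omega> (pd j \<phi>)"
    by (intro test_fun_memL2 \<Omega> test_fun_pd test_fun_greg(1) \<phi> \<delta>)+
  have "0 \<le> (\<integral>x. Im (a * (pd j (\<lambda>x. greg \<delta> m (\<phi> x)) x * cnj (pd j \<phi> x))) \<partial>lebesgue_on \<Omega>)"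
  proof (rule Bochner_Integration.integral_nonneg)
    fix x
    show "0 \<le> Im (a * (pd j (\<lambda>x. greg \<delta> m (\<phi> x)) x * cnj (pd j \<phi> x)))"
      unfolding test_fun_greg(2)[OF \<phi> \<delta>] by (rule dgreg_sign[OF a m \<delta>])
  qed
  then show ?thesis using Im_mult_ip(1)[OF mem, of a] by simp
qed

lemma gip_greg_sign:
  assumes \<Omega>: "open \<Omega>" and \<phi>: "test_fun \<Omega> \<phi>" and a: "a \<in> Cset m" and m: "0 \<le> m" "m < 1" and \<delta>: "0 < \<delta>"
  shows "0 \<le> Im (a * gip \<Omega> (grd (\<lambda>x. greg \<delta> m (\<phi> x))) (grd \<phi>))"
proof -
  have "Im (a * gip \<Omega> (grd (\<lambda>x. greg \<delta> m (\<phi> x))) (grd \<phi>))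
      = (\<Sum>j\<in>UNIV. Im (a * ip \<Omega> (pd j (\<lambda>x. greg \<delta> m (\<phi> x))) (pd j \<phi>)))"
    by (simp only: gip_def sum_distrib_left Im_sum)
  then show ?thesis by (simp only: sum_nonneg[OF ip_greg_sign[OF assms]])
qed

text \<open>Only boundedness for fixed \<delta> matters. The constant blows up as \<delta> tends to
  0, which is why the minimising sequence is exhausted before \<delta> is removed.\<close>

lemma greg_norms:
  assumes \<Omega>: "open \<Omega>" and \<phi>: "test_fun \<Omega> \<phi>" and m: "0 \<le> m" "m < 1" and \<delta>: "0 < \<delta>"
  shows "gnorm \<Omega> (grd (\<lambda>x. greg \<delta> m (\<phi> x))) \<le> 2 * \<delta> powr ((m - 1) / 2) * gnorm \<Omega> (grd \<phi>)"
    "L2norm \<Omega> (\<lambda>x. greg \<delta> m (\<phi> x)) \<le> 2 * \<delta> powr ((m - 1) / 2) * L2norm \<Omega> \<phi>"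
proof -
  let ?c = "2 * \<delta> powr ((m - 1) / 2)"
  have mono: "L2norm \<Omega> f \<le> ?c * L2norm \<Omega> g"
    if "memL2 \<Omega> f" "memL2 \<Omega> g" "\<And>x. cmod (f x) \<le> ?c * cmod (g x)" for f g
  proof (rule power2_le_imp_le)
    have "(\<integral>x. (cmod (f x))\<^sup>2 \<partial>lebesgue_on \<Omega>) \<le> (\<integral>x. ?c\<^sup>2 * (cmod (g x))\<^sup>2 \<partial>lebesgue_on \<Omega>)"
    proof (rule integral_mono)
      fix x show "(cmod (f x))\<^sup>2 \<le> ?c\<^sup>2 * (cmod (g x))\<^sup>2"
        using power_mono[OF that(3)[of x], of 2] by (simp add: power_mult_distrib)
    qed (use that in \<open>auto simp: memL2_def\<close>)
    then show "(L2norm \<Omega> f)\<^sup>2 \<le> (?c * L2norm \<Omega> g)\<^sup>2"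
      by (simp add: L2norm_sq power_mult_distrib)
  qed simp
  have G: "L2norm \<Omega> (pd j (\<lambda>x. greg \<delta> m (\<phi> x))) \<le> ?c * L2norm \<Omega> (pd j \<phi>)" for j
    by (intro mono test_fun_memL2 \<Omega> test_fun_pd test_fun_greg(1) \<phi> \<delta>)
      (simp only: test_fun_greg(2)[OF \<phi> \<delta>] greg_bounds(2)[OF m \<delta>])
  have "gnorm \<Omega> (grd (\<lambda>x. greg \<delta> m (\<phi> x))) \<le> L2_set (\<lambda>j. ?c * L2norm \<Omega> (pd j \<phi>)) UNIV"
    unfolding gnorm_def by (rule L2_set_mono[OF G]) simp
  also have "\<dots> = ?c * gnorm \<Omega> (grd \<phi>)" unfolding gnorm_def by (rule L2_set_right_distrib[symmetric]) simp
  finally show "gnorm \<Omega> (grd (\<lambda>x. greg \<delta> m (\<phi> x))) \<le> ?c * gnorm \<Omega> (grd \<phi>)" .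
  show "L2norm \<Omega> (\<lambda>x. greg \<delta> m (\<phi> x)) \<le> ?c * L2norm \<Omega> \<phi>"
  proof (intro mono test_fun_memL2 \<Omega> test_fun_greg(1) \<phi> \<delta>)
    fix x
    have "cmod (greg \<delta> m (\<phi> x)) \<le> 1 * (\<delta> powr ((m - 1) / 2) * cmod (\<phi> x))"
      using greg_bounds(1)[OF m \<delta>] by simp
    also have "\<dots> \<le> 2 * (\<delta> powr ((m - 1) / 2) * cmod (\<phi> x))" by (rule mult_right_mono) auto
    finally show "cmod (greg \<delta> m (\<phi> x)) \<le> ?c * cmod (\<phi> x)" by simp
  qed
qed

lemma memL2_greg:
  assumes "memL2 \<Omega> u" and m: "0 \<le> m" "m < 1" and \<delta>: "0 < \<delta>"
  shows "memL2 \<Omega> (\<lambda>x. greg \<delta> m (u x))"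
proof -
  have um[measurable]: "u \<in> borel_measurable (lebesgue_on \<Omega>)" using assms by (simp add: memL2_def)
  have g: "(\<lambda>x. greg \<delta> m (u x)) \<in> borel_measurable (lebesgue_on \<Omega>)"
    unfolding greg_def by measurable
  have "integrable (lebesgue_on \<Omega>) (\<lambda>x. (cmod (greg \<delta> m (u x)))\<^sup>2)"
  proof (rule Bochner_Integration.integrable_bound)
    show "integrable (lebesgue_on \<Omega>) (\<lambda>x. (\<delta> powr ((m - 1) / 2))\<^sup>2 * (cmod (u x))\<^sup>2)"
      using assms by (intro integrable_mult_right) (simp add: memL2_def)
    show "AE x in lebesgue_on \<Omega>. norm ((cmod (greg \<delta> m (u x)))\<^sup>2) \<le> norm ((\<delta> powr ((m - 1) / 2))\<^sup>2 * (cmod (u x))\<^sup>2)"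
    proof (rule AE_I2)
      fix x
      show "norm ((cmod (greg \<delta> m (u x)))\<^sup>2) \<le> norm ((\<delta> powr ((m - 1) / 2))\<^sup>2 * (cmod (u x))\<^sup>2)"
        using power_mono[OF greg_bounds(1)[OF m \<delta>, of "u x"] norm_ge_zero, of 2] by (simp add: power_mult_distrib)
    qed
  qed (use g in measurable)
  with g show ?thesis by (simp add: memL2_def)
qed

text \<open>The nonlinear term at one fixed time. For m = 0 it is a selection of a multivalued sign,
  not a function of u, because U is free where u vanishes.\<close>

definition is_nonlin :: "(real^'n::finite) set \<Rightarrow> real \<Rightarrow> (real^'n \<Rightarrow> complex) \<Rightarrow> (real^'n \<Rightarrow> complex) \<Rightarrow> bool" where
  "is_nonlin \<Omega> m u U \<longleftrightarrow> (if m = 0 then AE x in lebesgue_on \<Omega>. cmod (U x) \<le> 1 \<and>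
       (u x \<noteq> 0 \<longrightarrow> U x = u x / complex_of_real (cmod (u x)))
     else \<forall>x. U x = nonlin m (u x))"

lemma mult_cnj_cmod: "z * cnj z = complex_of_real (cmod z) * complex_of_real (cmod z)"
  by (simp only: complex_norm_square[symmetric] power2_eq_square of_real_mult)

text \<open>Where u vanishes, the free value of U is multiplied by 0; so both cases yield the same
  real dissipation density.\<close>

lemma is_nonlin_mult_cnj:
  assumes "is_nonlin \<Omega> m u U" "0 \<le> m"
  shows "AE x in lebesgue_on \<Omega>. U x * cnj (u x) = complex_of_real (cmod (u x) powr (1 + m))"
proof (cases "m = 0")
  case True
  then have "AE x in lebesgue_on \<Omega>. cmod (U x) \<le> 1 \<and> (u x \<noteq> 0 \<longrightarrow> U x = u x / complex_of_real (cmod (u x)))"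
    using assms by (simp add: is_nonlin_def)
  then show ?thesis
  proof eventually_elim
    case (elim x)
    show ?case
    proof (cases "u x = 0")
      case False
      then have "U x * cnj (u x) = (u x * cnj (u x)) / complex_of_real (cmod (u x))" using elim by simp
      also have "\<dots> = complex_of_real (cmod (u x))" using False by (simp add: mult_cnj_cmod)
      finally show ?thesis using True False by simp
    qed simp
  qed
next
  case False
  have "U x * cnj (u x) = complex_of_real (cmod (u x) powr (1 + m))" for x
  proof (cases "u x = 0")
    case ux: False
    have "U x * cnj (u x) = complex_of_real (cmod (u x) powr (m - 1)) * (u x * cnj (u x))"
      using assms False ux by (simp add: is_nonlin_def nonlin_def)
    also have "u x * cnj (u x) = complex_of_real (cmod (u x) powr 2)"
      using ux by (simp add: complex_norm_square[symmetric])
    also have "complex_of_real (cmod (u x) powr (m - 1)) * \<dots> = complex_of_real (cmod (u x) powr (m - 1 + 2))"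
      unfolding of_real_mult[symmetric] powr_add[symmetric] ..
    also have "m - 1 + 2 = 1 + m" by simp
    finally show ?thesis .
  qed (use False assms in \<open>simp add: is_nonlin_def nonlin_def\<close>)
  then show ?thesis by simp
qed

lemma tendsto_greg:
  assumes "0 < m" "m < 1"
  shows "(\<lambda>n. greg (inverse (real (Suc n))) m z) \<longlonglongrightarrow> nonlin m z"
proof (cases "z = 0")
  case False
  have "(\<lambda>n. ((cmod z)\<^sup>2 + inverse (real (Suc n))) powr ((m - 1) / 2)) \<longlonglongrightarrow> ((cmod z)\<^sup>2 + 0) powr ((m - 1) / 2)"
    using False by (intro tendsto_intros LIMSEQ_inverse_real_of_nat) auto
  moreover have "((cmod z)\<^sup>2 + 0) powr ((m - 1) / 2) = cmod z powr (m - 1)"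
  proof -
    have "((cmod z)\<^sup>2 + 0) powr ((m - 1) / 2) = (cmod z powr 2) powr ((m - 1) / 2)" using False by simp
    also have "\<dots> = cmod z powr (2 * ((m - 1) / 2))" by (rule powr_powr)
    also have "2 * ((m - 1) / 2) = m - 1" by simp
    finally show ?thesis .
  qed
  ultimately show ?thesis using False unfolding greg_def nonlin_def by (auto intro!: tendsto_intros)
qed (simp add: greg_def nonlin_def)

text \<open>The regularised modulus lies between 0 and the singular one, as the exponent is
  negative. This is the majorant for letting \<delta> tend to 0.\<close>

lemma nonlin_minus_greg:
  assumes "0 < m" "m < 1" "0 < \<delta>"
  shows "cmod (nonlin m z - greg \<delta> m z) \<le> cmod (nonlin m z)"
proof (cases "z = 0")
  case False
  have "((cmod z)\<^sup>2 + \<delta>) powr ((m - 1) / 2) \<le> ((cmod z)\<^sup>2) powr ((m - 1) / 2)"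
    using assms False by (intro powr_mono2') auto
  also have "((cmod z)\<^sup>2) powr ((m - 1) / 2) = cmod z powr (m - 1)"
  proof -
    have "((cmod z)\<^sup>2) powr ((m - 1) / 2) = (cmod z powr 2) powr ((m - 1) / 2)" using False by simp
    also have "\<dots> = cmod z powr (2 * ((m - 1) / 2))" by (rule powr_powr)
    also have "2 * ((m - 1) / 2) = m - 1" by simp
    finally show ?thesis .
  qed
  finally have "\<bar>cmod z powr (m - 1) - ((cmod z)\<^sup>2 + \<delta>) powr ((m - 1) / 2)\<bar> \<le> \<bar>cmod z powr (m - 1)\<bar>"
    by simp
  from mult_right_mono[OF this norm_ge_zero[of z]] show ?thesis
    using False unfolding greg_def nonlin_def
    by (simp add: norm_mult flip: left_diff_distrib of_real_diff)
qed (simp add: greg_def nonlin_def)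

text \<open>Monotonicity would be exact if both values were signs. The regularised value g has
  modulus at most 1 but falls short of the sign of \<phi>: Re(g cnj \<phi>) may drop below |\<phi>|,
  though by no more than sqrt \<delta>.\<close>

lemma sign_defect_zero:
  fixes u U \<phi> :: complex
  assumes \<delta>: "0 < \<delta>" and U: "cmod U \<le> 1" "u \<noteq> 0 \<longrightarrow> U = u / complex_of_real (cmod u)"
  shows "- sqrt \<delta> \<le> Re ((U - greg \<delta> 0 \<phi>) * cnj (u - \<phi>))"
proof -
  define \<rho> where "\<rho> = (cmod \<phi>)\<^sup>2 + \<delta>"
  have \<rho>: "0 < \<rho>" using rho_pos[OF \<delta>] by (simp add: \<rho>_def)
  define g where "g = greg \<delta> 0 \<phi>"
  have g: "g = complex_of_real (1 / sqrt \<rho>) * \<phi>"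
    using \<rho> by (simp add: g_def greg_def \<rho>_def[symmetric] powr_minus_divide powr_half_sqrt)
  have sr: "sqrt \<rho> * sqrt \<rho> = \<rho>" using \<rho> by simp
  have le1: "cmod \<phi> \<le> sqrt \<rho>" using \<delta> by (intro real_le_rsqrt) (simp add: \<rho>_def)
  have le2: "sqrt \<delta> \<le> sqrt \<rho>" by (simp add: \<rho>_def)
  have g1: "cmod g \<le> 1" unfolding g norm_mult norm_of_real using le1 \<rho> by (simp add: field_simps)
  have "Re (U * cnj u) = cmod u"
  proof (cases "u = 0")
    case False
    then have "U * cnj u = (u * cnj u) / complex_of_real (cmod u)" using U by simp
    also have "u * cnj u = complex_of_real (cmod u) * complex_of_real (cmod u)" by (rule mult_cnj_cmod)
    finally show ?thesis using False by simp
  qed simp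
  moreover have "Re (U * cnj \<phi>) \<le> cmod \<phi>"
    using complex_Re_le_cmod[of "U * cnj \<phi>"] mult_right_mono[OF U(1) norm_ge_zero[of \<phi>]] by (simp add: norm_mult)
  moreover have "Re (g * cnj u) \<le> cmod u"
    using complex_Re_le_cmod[of "g * cnj u"] mult_right_mono[OF g1 norm_ge_zero[of u]] by (simp add: norm_mult)
  moreover have "cmod \<phi> - sqrt \<delta> \<le> Re (g * cnj \<phi>)"
  proof -
    have "g * cnj \<phi> = complex_of_real ((1 / sqrt \<rho>) * (cmod \<phi>)\<^sup>2)"
      unfolding g mult.assoc complex_norm_square[symmetric] of_real_mult[symmetric] ..
    then have "Re (g * cnj \<phi>) = (\<rho> - \<delta>) / sqrt \<rho>" by (simp add: \<rho>_def)
    also have "\<dots> = sqrt \<rho> - sqrt \<delta> * (sqrt \<delta> / sqrt \<rho>)" using \<rho> \<delta> sr by (simp add: field_simps)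
    also have "\<dots> \<ge> sqrt \<rho> - sqrt \<delta> * 1"
      using le2 \<rho> \<delta> by (intro diff_left_mono mult_left_mono) auto
    finally show ?thesis using le1 by simp
  qed
  moreover have "Re ((U - g) * cnj (u - \<phi>)) = Re (U * cnj u) - Re (U * cnj \<phi>) - Re (g * cnj u) + Re (g * cnj \<phi>)"
    by (simp add: algebra_simps)
  ultimately show ?thesis unfolding g_def[symmetric] by linarith
qed

text \<open>Compares U, taken at u, with the regularisation at an arbitrary \<phi>; the essential
  point is that \<eta> does not depend on \<phi>. For m = 0 the defect sqrt \<delta> is integrated
  over a set of finite measure. For m > 0 the regularisation is monotone, and its distance from U at
  u itself tends to 0 in L2.\<close>

lemma nonlin_defect:
  assumes \<Omega>: "open \<Omega>" and a: "a \<in> Cset m" and m: "0 \<le> m" "m < 1" and u: "memL2 \<Omega> u" and U: "memL2 \<Omega> U"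
    and nl: "is_nonlin \<Omega> m u U" and fin: "m = 0 \<longrightarrow> emeasure lebesgue \<Omega> < \<infinity>"
  obtains \<eta> where "\<eta> \<longlonglongrightarrow> 0"
    "\<And>n \<phi>. memL2 \<Omega> \<phi> \<Longrightarrow> - \<eta> n * (1 + L2norm \<Omega> (\<lambda>x. u x - \<phi> x))
       \<le> Im (a * ip \<Omega> (\<lambda>x. U x - greg (inverse (real (Suc n))) m (\<phi> x)) (\<lambda>x. u x - \<phi> x))"
proof (cases "m = 0")
  case True
  have Re0: "Re a = 0" and b: "0 < Im a" using Cset_imp[OF a] True by auto
  define K where "K = measure (lebesgue_on \<Omega>) (space (lebesgue_on \<Omega>))"
  have fm: "emeasure (lebesgue_on \<Omega>) (space (lebesgue_on \<Omega>)) < \<infinity>"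
    using fin True \<Omega> by (simp add: space_restrict_space emeasure_restrict_space borel_open)
  show ?thesis
  proof (rule that)
    have "(\<lambda>n. Im a * (sqrt (inverse (real (Suc n))) * K)) \<longlonglongrightarrow> Im a * (sqrt 0 * K)"
      by (intro tendsto_intros LIMSEQ_inverse_real_of_nat)
    then show "(\<lambda>n. Im a * (sqrt (inverse (real (Suc n))) * K)) \<longlonglongrightarrow> 0" by simp
    fix n \<phi> assume \<phi>: "memL2 \<Omega> \<phi>"
    let ?\<delta> = "inverse (real (Suc n))"
    have \<delta>: "0 < ?\<delta>" by simp
    have mem: "memL2 \<Omega> (\<lambda>x. U x - greg ?\<delta> m (\<phi> x))" "memL2 \<Omega> (\<lambda>x. u x - \<phi> x)"
      by (intro memL2_diff U u \<phi> memL2_greg m \<delta>)+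
    have "(\<integral>x. - (Im a * sqrt ?\<delta>) \<partial>lebesgue_on \<Omega>) \<le> Im (a * ip \<Omega> (\<lambda>x. U x - greg ?\<delta> m (\<phi> x)) (\<lambda>x. u x - \<phi> x))"
      unfolding Im_mult_ip(1)[OF mem]
    proof (rule integral_mono_AE)
      show "integrable (lebesgue_on \<Omega>) (\<lambda>x. - (Im a * sqrt ?\<delta>))"
        by (rule finite_measure.integrable_const, rule finite_measureI) (use fm in auto)
      have "AE x in lebesgue_on \<Omega>. cmod (U x) \<le> 1 \<and> (u x \<noteq> 0 \<longrightarrow> U x = u x / complex_of_real (cmod (u x)))"
        using nl True by (simp add: is_nonlin_def)
      then show "AE x in lebesgue_on \<Omega>. - (Im a * sqrt ?\<delta>) \<le> Im (a * ((U x - greg ?\<delta> m (\<phi> x)) * cnj (u x - \<phi> x)))"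
      proof eventually_elim
        case (elim x)
        have "Im a * (- sqrt ?\<delta>) \<le> Im a * Re ((U x - greg ?\<delta> 0 (\<phi> x)) * cnj (u x - \<phi> x))"
          by (rule mult_left_mono, rule sign_defect_zero[OF \<delta>]) (use elim b in auto)
        also have "\<dots> = Im (a * ((U x - greg ?\<delta> m (\<phi> x)) * cnj (u x - \<phi> x)))"
          using Re0 True by simp
        finally show ?case by simp
      qed
    qed (rule Im_mult_ip(2)[OF mem])
    also have "(\<integral>x. - (Im a * sqrt ?\<delta>) \<partial>lebesgue_on \<Omega>) = - (Im a * (sqrt ?\<delta> * K))"
      by (simp add: K_def)
    finally have 1: "- (Im a * (sqrt ?\<delta> * K)) \<le> Im (a * ip \<Omega> (\<lambda>x. U x - greg ?\<delta> m (\<phi> x)) (\<lambda>x. u x - \<phi> x))" .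
    have "0 \<le> (Im a * (sqrt ?\<delta> * K)) * L2norm \<Omega> (\<lambda>x. u x - \<phi> x)"
      using b by (intro mult_nonneg_nonneg) (auto simp: K_def)
    then show "- (Im a * (sqrt ?\<delta> * K)) * (1 + L2norm \<Omega> (\<lambda>x. u x - \<phi> x))
       \<le> Im (a * ip \<Omega> (\<lambda>x. U x - greg ?\<delta> m (\<phi> x)) (\<lambda>x. u x - \<phi> x))"
      using 1 by (simp add: distrib_left)
  qed
next
  case False
  then have m0: "0 < m" using m by simp
  have Ueq: "U = (\<lambda>x. nonlin m (u x))" using nl False by (simp add: is_nonlin_def fun_eq_iff)
  let ?D = "\<lambda>n x. U x - greg (inverse (real (Suc n))) m (u x)"
  have D: "memL2 \<Omega> (?D n)" for n by (intro memL2_diff U memL2_greg u m) simp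
  have lim: "(\<lambda>n. L2norm \<Omega> (?D n)) \<longlonglongrightarrow> 0"
  proof -
    have "(\<lambda>n. \<integral>x. (cmod (?D n x))\<^sup>2 \<partial>lebesgue_on \<Omega>) \<longlonglongrightarrow> (\<integral>x. 0 \<partial>lebesgue_on \<Omega>)"
    proof (rule integral_dominated_convergence[where w = "\<lambda>x. (cmod (U x))\<^sup>2"])
      show "integrable (lebesgue_on \<Omega>) (\<lambda>x. (cmod (U x))\<^sup>2)" using U by (simp add: memL2_def)
      show "(\<lambda>x. (cmod (?D n x))\<^sup>2) \<in> borel_measurable (lebesgue_on \<Omega>)" for n
        by (rule borel_measurable_integrable, rule conjunct2[OF D[unfolded memL2_def]])
      show "AE x in lebesgue_on \<Omega>. (\<lambda>n. (cmod (?D n x))\<^sup>2) \<longlonglongrightarrow> 0"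
      proof (rule AE_I2)
        fix x
        have "(\<lambda>n. (cmod (?D n x))\<^sup>2) \<longlonglongrightarrow> (cmod (U x - nonlin m (u x)))\<^sup>2"
          by (intro tendsto_intros tendsto_greg m0 m)
        then show "(\<lambda>n. (cmod (?D n x))\<^sup>2) \<longlonglongrightarrow> 0" by (simp add: Ueq)
      qed
      show "AE x in lebesgue_on \<Omega>. norm ((cmod (?D n x))\<^sup>2) \<le> (cmod (U x))\<^sup>2" for n
        unfolding Ueq using nonlin_minus_greg[OF m0 m(2)] by (auto intro!: power_mono AE_I2)
    qed auto
    from tendsto_real_sqrt[OF this] show ?thesis by (simp add: L2norm_def)
  qed
  show ?thesis
  proof (rule that)
    show "(\<lambda>n. cmod a * L2norm \<Omega> (?D n)) \<longlonglongrightarrow> 0" using tendsto_mult[OF tendsto_const lim] by simp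
    fix n \<phi> assume \<phi>: "memL2 \<Omega> \<phi>"
    let ?\<delta> = "inverse (real (Suc n))"
    have \<delta>: "0 < ?\<delta>" by simp
    have mem: "memL2 \<Omega> (\<lambda>x. U x - greg ?\<delta> m (\<phi> x))" "memL2 \<Omega> (\<lambda>x. u x - \<phi> x)"
      by (intro memL2_diff U u \<phi> memL2_greg m \<delta>)+
    have "Im (a * ip \<Omega> (?D n) (\<lambda>x. u x - \<phi> x)) \<le> Im (a * ip \<Omega> (\<lambda>x. U x - greg ?\<delta> m (\<phi> x)) (\<lambda>x. u x - \<phi> x))"
      unfolding Im_mult_ip(1)[OF mem] Im_mult_ip(1)[OF D mem(2)]
    proof (rule integral_mono)
      fix x
      have "0 \<le> Im (a * ((greg ?\<delta> m (u x) - greg ?\<delta> m (\<phi> x)) * cnj (u x - \<phi> x)))"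
        by (rule greg_monotone[OF a m \<delta>])
      also have "\<dots> = Im (a * ((U x - greg ?\<delta> m (\<phi> x)) * cnj (u x - \<phi> x))) - Im (a * (?D n x * cnj (u x - \<phi> x)))"
        by (simp add: algebra_simps)
      finally show "Im (a * (?D n x * cnj (u x - \<phi> x))) \<le> Im (a * ((U x - greg ?\<delta> m (\<phi> x)) * cnj (u x - \<phi> x)))"
        by simp
    qed (rule Im_mult_ip(2)[OF D mem(2)] Im_mult_ip(2)[OF mem])+
    moreover have "- (cmod a * L2norm \<Omega> (?D n) * L2norm \<Omega> (\<lambda>x. u x - \<phi> x)) \<le> Im (a * ip \<Omega> (?D n) (\<lambda>x. u x - \<phi> x))"
    proof -
      have "\<bar>Im (a * ip \<Omega> (?D n) (\<lambda>x. u x - \<phi> x))\<bar> \<le> cmod a * cmod (ip \<Omega> (?D n) (\<lambda>x. u x - \<phi> x))"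
        using abs_Im_le_cmod[of "a * ip \<Omega> (?D n) (\<lambda>x. u x - \<phi> x)"] by (simp only: norm_mult)
      also have "\<dots> \<le> cmod a * (L2norm \<Omega> (?D n) * L2norm \<Omega> (\<lambda>x. u x - \<phi> x))"
        by (intro mult_left_mono ip_cauchy_schwarz D mem) simp
      finally show ?thesis by (simp add: mult.assoc)
    qed
    moreover have "0 \<le> cmod a * L2norm \<Omega> (?D n)" by simp
    ultimately show "- (cmod a * L2norm \<Omega> (?D n)) * (1 + L2norm \<Omega> (\<lambda>x. u x - \<phi> x))
       \<le> Im (a * ip \<Omega> (\<lambda>x. U x - greg ?\<delta> m (\<phi> x)) (\<lambda>x. u x - \<phi> x))"
      by (simp only: distrib_left mult_1_right minus_mult_left[symmetric])
  qed
qed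

subsection \<open>The Moreau envelope of the Dirichlet energy\<close>

definition mq :: "(real^'n::finite) set \<Rightarrow> real \<Rightarrow> (real^'n \<Rightarrow> complex) \<Rightarrow> (real^'n \<Rightarrow> complex) \<Rightarrow> real" where
  "mq \<Omega> \<mu> u \<phi> = (gnorm \<Omega> (grd \<phi>))\<^sup>2 + \<mu> * (L2norm \<Omega> (\<lambda>x. \<phi> x - u x))\<^sup>2"

text \<open>The infimum runs over test functions only, so every competitor has classical derivatives
  and compact support.\<close>

definition menv :: "(real^'n::finite) set \<Rightarrow> real \<Rightarrow> (real^'n \<Rightarrow> complex) \<Rightarrow> real" where
  "menv \<Omega> \<mu> u = Inf (mq \<Omega> \<mu> u ` {\<phi>. test_fun \<Omega> \<phi>})"

text \<open>The quadratic part of \<open>mq\<close>, that is the coefficient of |\<tau>|^2 when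
  \<phi> is varied by \<tau> times \<psi>.\<close>

definition msq :: "(real^'n::finite) set \<Rightarrow> real \<Rightarrow> (real^'n \<Rightarrow> complex) \<Rightarrow> real" where
  "msq \<Omega> \<mu> \<psi> = (gnorm \<Omega> (grd \<psi>))\<^sup>2 + \<mu> * (L2norm \<Omega> \<psi>)\<^sup>2"

text \<open>The minimiser v is represented by a minimising sequence of test functions, which avoids weak
  compactness and any discussion of its weak gradient.\<close>

definition is_prox :: "(real^'n::finite) set \<Rightarrow> real \<Rightarrow> (real^'n \<Rightarrow> complex) \<Rightarrow> (nat \<Rightarrow> real^'n \<Rightarrow> complex) \<Rightarrow> (real^'n \<Rightarrow> complex) \<Rightarrow> bool" where
  "is_prox \<Omega> \<mu> u \<phi> v \<longleftrightarrow> (\<forall>k. test_fun \<Omega> (\<phi> k)) \<and> (\<lambda>k. mq \<Omega> \<mu> u (\<phi> k)) \<longlonglongrightarrow> menv \<Omega> \<mu> u \<and>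
     memL2 \<Omega> v \<and> (\<lambda>k. L2norm \<Omega> (\<lambda>x. \<phi> k x - v x)) \<longlonglongrightarrow> 0"

lemma Re_of_real_mult: "Re (complex_of_real r * z) = r * Re z"
  and Im_of_real_mult: "Im (complex_of_real r * z) = r * Im z"
  by simp_all

locale moreau =
  fixes \<Omega> :: "(real^'n::finite) set" and \<mu> :: real
  assumes \<Omega>: "open \<Omega>" and \<mu>: "0 < \<mu>"
begin

section \<open>Near-minimisers of the envelope and their Euler-Lagrange residual\<close>

lemma mq_nonneg: "0 \<le> mq \<Omega> \<mu> u \<phi>"
  using \<mu> by (simp add: mq_def)

lemma msq_nonneg: "0 \<le> msq \<Omega> \<mu> \<phi>"
  using \<mu> by (simp add: msq_def)

lemma menv_le: "test_fun \<Omega> \<phi> \<Longrightarrow> menv \<Omega> \<mu> u \<le> mq \<Omega> \<mu> u \<phi>"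
  unfolding menv_def by (rule cInf_lower) (auto intro!: bdd_belowI[of _ 0] mq_nonneg)

lemma menv_nonneg: "0 \<le> menv \<Omega> \<mu> u"
  unfolding menv_def by (rule cInf_greatest) (auto intro: mq_nonneg test_fun_zero)

lemma menv_le_L2: "menv \<Omega> \<mu> u \<le> \<mu> * (L2norm \<Omega> u)\<^sup>2"
proof -
  have "pd j (\<lambda>x::real^'n. 0::complex) = (\<lambda>x. 0)" for j by (simp add: pd_def fun_eq_iff)
  then have "gnorm \<Omega> (grd (\<lambda>x. 0)) = 0" by (simp add: gnorm_def L2_set_def)
  then have "mq \<Omega> \<mu> u (\<lambda>x. 0) = \<mu> * (L2norm \<Omega> u)\<^sup>2"
    by (simp add: mq_def L2norm_def)
  then show ?thesis using menv_le[OF test_fun_zero, of u] by simp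
qed

lemma mq_variation:
  assumes \<phi>: "test_fun \<Omega> \<phi>" and \<psi>: "test_fun \<Omega> \<psi>" and u: "memL2 \<Omega> u"
  shows "mq \<Omega> \<mu> u (\<lambda>x. \<phi> x + \<tau> * \<psi> x) = mq \<Omega> \<mu> u \<phi>
     + 2 * Re (cnj \<tau> * (gip \<Omega> (grd \<phi>) (grd \<psi>) + complex_of_real \<mu> * ip \<Omega> (\<lambda>x. \<phi> x - u x) \<psi>))
     + (cmod \<tau>)\<^sup>2 * msq \<Omega> \<mu> \<psi>"
proof -
  have mem: "memL2 \<Omega> (\<lambda>x. \<phi> x - u x)" "memL2 \<Omega> \<psi>"
    by (intro memL2_diff test_fun_memL2 \<Omega> \<phi> \<psi> u)+
  have e1: "(\<lambda>j. pd j (\<lambda>x. \<phi> x + \<tau> * \<psi> x)) = (\<lambda>j x. pd j \<phi> x + \<tau> * pd j \<psi> x)"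
    by (simp add: pd_test_add[OF \<phi> test_fun_cmult[OF \<psi>]] pd_test_cmult[OF \<psi>])
  have e2: "(\<lambda>x. \<phi> x + \<tau> * \<psi> x - u x) = (\<lambda>x. (\<phi> x - u x) + \<tau> * \<psi> x)" by (simp add: algebra_simps)
  show ?thesis
    unfolding mq_def msq_def e1 e2 gnorm_variation_sq[OF memG_grd[OF \<Omega> \<phi>] memG_grd[OF \<Omega> \<psi>]] L2norm_variation_sq[OF mem]
    by (simp add: algebra_simps)
qed

text \<open>No test function need attain the infimum, so the Euler-Lagrange equation holds only up
  to a residual. Variation in all complex directions bounds the residual by the excess of \<phi>
  over the infimum.\<close>

lemma euler_lagrange:
  assumes \<phi>: "test_fun \<Omega> \<phi>" and \<psi>: "test_fun \<Omega> \<psi>" and u: "memL2 \<Omega> u"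
  shows "(cmod (gip \<Omega> (grd \<phi>) (grd \<psi>) + complex_of_real \<mu> * ip \<Omega> (\<lambda>x. \<phi> x - u x) \<psi>))\<^sup>2
     \<le> (mq \<Omega> \<mu> u \<phi> - menv \<Omega> \<mu> u) * msq \<Omega> \<mu> \<psi>"
proof (rule discriminant_bound[OF _ msq_nonneg])
  fix \<tau>
  have "menv \<Omega> \<mu> u \<le> mq \<Omega> \<mu> u (\<lambda>x. \<phi> x + \<tau> * \<psi> x)"
    by (rule menv_le) (intro test_fun_add test_fun_cmult \<phi> \<psi>)
  then show "0 \<le> mq \<Omega> \<mu> u \<phi> - menv \<Omega> \<mu> u
     + 2 * Re (cnj \<tau> * (gip \<Omega> (grd \<phi>) (grd \<psi>) + complex_of_real \<mu> * ip \<Omega> (\<lambda>x. \<phi> x - u x) \<psi>))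
     + (cmod \<tau>)\<^sup>2 * msq \<Omega> \<mu> \<psi>"
    unfolding mq_variation[OF \<phi> \<psi> u] by linarith
qed

lemma euler_lagrange_H10:
  assumes \<phi>: "test_fun \<Omega> \<phi>" and \<psi>: "memH10 \<Omega> \<psi>" and u: "memL2 \<Omega> u"
  shows "(cmod (gip \<Omega> (grd \<phi>) (wgrad \<Omega> \<psi>) + complex_of_real \<mu> * ip \<Omega> (\<lambda>x. \<phi> x - u x) \<psi>))\<^sup>2
     \<le> (mq \<Omega> \<mu> u \<phi> - menv \<Omega> \<mu> u) * ((gnorm \<Omega> (wgrad \<Omega> \<psi>))\<^sup>2 + \<mu> * (L2norm \<Omega> \<psi>)\<^sup>2)"
proof -
  obtain \<zeta> where \<zeta>: "\<And>k. test_fun \<Omega> (\<zeta> k)" "(\<lambda>k. L2norm \<Omega> (\<lambda>x. \<zeta> k x - \<psi> x)) \<longlonglongrightarrow> 0"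
    "(\<lambda>k. gnorm \<Omega> (\<lambda>j x. pd j (\<zeta> k) x - wgrad \<Omega> \<psi> j x)) \<longlonglongrightarrow> 0"
    using memH10_approx[OF \<Omega> \<psi>] by blast
  have mem: "memL2 \<Omega> (\<lambda>x. \<phi> x - u x)" "memL2 \<Omega> (\<zeta> k)" "memG \<Omega> (grd \<phi>)" "memG \<Omega> (grd (\<zeta> k))" for k
    by (intro memL2_diff test_fun_memL2 \<Omega> \<phi> u \<zeta> memG_grd)+
  have mem': "memL2 \<Omega> \<psi>" "memG \<Omega> (wgrad \<Omega> \<psi>)"
    using memH10_isgrad[OF \<psi>] memH10_memL2[OF \<psi>] by (simp_all add: isgrad_def)
  note mem = mem mem'
  show ?thesis
  proof (rule LIMSEQ_le)
    show "(\<lambda>k. (cmod (gip \<Omega> (grd \<phi>) (grd (\<zeta> k)) + complex_of_real \<mu> * ip \<Omega> (\<lambda>x. \<phi> x - u x) (\<zeta> k)))\<^sup>2)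
      \<longlonglongrightarrow> (cmod (gip \<Omega> (grd \<phi>) (wgrad \<Omega> \<psi>) + complex_of_real \<mu> * ip \<Omega> (\<lambda>x. \<phi> x - u x) \<psi>))\<^sup>2"
      by (intro tendsto_intros gip_tendsto_right ip_tendsto_right mem \<zeta>)
    show "(\<lambda>k. (mq \<Omega> \<mu> u \<phi> - menv \<Omega> \<mu> u) * msq \<Omega> \<mu> (\<zeta> k))
      \<longlonglongrightarrow> (mq \<Omega> \<mu> u \<phi> - menv \<Omega> \<mu> u) * ((gnorm \<Omega> (wgrad \<Omega> \<psi>))\<^sup>2 + \<mu> * (L2norm \<Omega> \<psi>)\<^sup>2)"
      unfolding msq_def by (intro tendsto_intros tendsto_gnorm tendsto_L2norm mem \<zeta>)
    show "\<exists>N. \<forall>k\<ge>N. (cmod (gip \<Omega> (grd \<phi>) (grd (\<zeta> k)) + complex_of_real \<mu> * ip \<Omega> (\<lambda>x. \<phi> x - u x) (\<zeta> k)))\<^sup>2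
       \<le> (mq \<Omega> \<mu> u \<phi> - menv \<Omega> \<mu> u) * msq \<Omega> \<mu> (\<zeta> k)"
      using euler_lagrange[OF \<phi> \<zeta>(1) u] by blast
  qed
qed

text \<open>The midpoint of two competitors is a competitor, and its value is the mean of the two
  values minus a quarter of the quadratic part of the difference.\<close>

lemma msq_diff_le:
  assumes \<phi>: "test_fun \<Omega> \<phi>" and \<psi>: "test_fun \<Omega> \<psi>" and u: "memL2 \<Omega> u"
  shows "msq \<Omega> \<mu> (\<lambda>x. \<psi> x - \<phi> x) \<le> 2 * (mq \<Omega> \<mu> u \<phi> - menv \<Omega> \<mu> u) + 2 * (mq \<Omega> \<mu> u \<psi> - menv \<Omega> \<mu> u)"
proof -
  let ?\<eta> = "\<lambda>x. \<psi> x - \<phi> x"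
  have \<eta>: "test_fun \<Omega> ?\<eta>" by (rule test_fun_diff[OF \<psi> \<phi>])
  let ?B = "Re (gip \<Omega> (grd \<phi>) (grd ?\<eta>) + complex_of_real \<mu> * ip \<Omega> (\<lambda>x. \<phi> x - u x) ?\<eta>)"
  have "mq \<Omega> \<mu> u \<psi> = mq \<Omega> \<mu> u \<phi> + 2 * ?B + msq \<Omega> \<mu> ?\<eta>"
    using mq_variation[OF \<phi> \<eta> u, of 1] by simp
  moreover have "mq \<Omega> \<mu> u (\<lambda>x. \<phi> x + complex_of_real (1/2) * ?\<eta> x) = mq \<Omega> \<mu> u \<phi> + ?B + msq \<Omega> \<mu> ?\<eta> / 4"
    unfolding mq_variation[OF \<phi> \<eta> u] complex_cnj_complex_of_real norm_of_real Re_of_real_mult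
    by (simp add: power2_eq_square)
  moreover have "menv \<Omega> \<mu> u \<le> mq \<Omega> \<mu> u (\<lambda>x. \<phi> x + complex_of_real (1/2) * ?\<eta> x)"
    by (rule menv_le) (intro test_fun_add test_fun_cmult \<phi> \<eta>)
  moreover have "S \<le> 2 * (q - E) + 2 * (q' - E)" if "q' = q + 2 * B + S" "r = q + B + S / 4" "E \<le> r" for S q q' E B r :: real
    using that by argo
  ultimately show ?thesis by blast
qed

lemma L2norm_sq_le_msq: "\<mu> * (L2norm \<Omega> \<psi>)\<^sup>2 \<le> msq \<Omega> \<mu> \<psi>"
  by (simp add: msq_def)

text \<open>Uniform convexity (\<open>msq_diff_le\<close>) makes any minimising sequence Cauchy in
  L2, so completeness replaces a compactness argument.\<close>

lemma prox_exists:
  assumes u: "memL2 \<Omega> u"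
  shows "\<exists>\<phi> v. is_prox \<Omega> \<mu> u \<phi> v"
proof -
  have "\<exists>\<phi>. test_fun \<Omega> \<phi> \<and> mq \<Omega> \<mu> u \<phi> < menv \<Omega> \<mu> u + inverse (real (Suc k))" for k
  proof -
    have "Inf (mq \<Omega> \<mu> u ` {\<phi>. test_fun \<Omega> \<phi>}) < menv \<Omega> \<mu> u + inverse (real (Suc k))"
      by (simp add: menv_def)
    then show ?thesis
      by (subst (asm) cInf_less_iff) (auto intro!: bdd_belowI[of _ 0] mq_nonneg test_fun_zero)
  qed
  then obtain \<phi> where \<phi>: "\<And>k. test_fun \<Omega> (\<phi> k)"
    and q: "\<And>k. mq \<Omega> \<mu> u (\<phi> k) < menv \<Omega> \<mu> u + inverse (real (Suc k))" by metis
  have qlim: "(\<lambda>k. mq \<Omega> \<mu> u (\<phi> k)) \<longlonglongrightarrow> menv \<Omega> \<mu> u"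
  proof (rule real_tendsto_sandwich[where f = "\<lambda>k. menv \<Omega> \<mu> u" and h = "\<lambda>k. menv \<Omega> \<mu> u + inverse (real (Suc k))"])
    show "(\<lambda>k. menv \<Omega> \<mu> u + inverse (real (Suc k))) \<longlonglongrightarrow> menv \<Omega> \<mu> u"
      using tendsto_add[OF tendsto_const LIMSEQ_inverse_real_of_nat, of "menv \<Omega> \<mu> u"] by simp
    show "\<forall>\<^sub>F k in sequentially. mq \<Omega> \<mu> u (\<phi> k) \<le> menv \<Omega> \<mu> u + inverse (real (Suc k))"
      by (intro always_eventually allI less_imp_le q)
    show "\<forall>\<^sub>F k in sequentially. menv \<Omega> \<mu> u \<le> mq \<Omega> \<mu> u (\<phi> k)"
      by (intro always_eventually allI menv_le \<phi>)
  qed simp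
  have "\<exists>v. memL2 \<Omega> v \<and> (\<lambda>k. L2norm \<Omega> (\<lambda>x. \<phi> k x - v x)) \<longlonglongrightarrow> 0"
  proof (rule L2_complete)
    show "memL2 \<Omega> (\<phi> k)" for k by (rule test_fun_memL2[OF \<Omega> \<phi>])
    fix e :: real assume e: "0 < e"
    then have "0 < \<mu> * e\<^sup>2 / 4" using \<mu> by simp
    from LIMSEQ_D[OF qlim this] obtain N where
      N: "\<And>k. k \<ge> N \<Longrightarrow> \<bar>mq \<Omega> \<mu> u (\<phi> k) - menv \<Omega> \<mu> u\<bar> < \<mu> * e\<^sup>2 / 4" by auto
    have "L2norm \<Omega> (\<lambda>x. \<phi> k x - \<phi> l x) < e" if "k \<ge> N" "l \<ge> N" for k l
    proof -
      have "\<mu> * (L2norm \<Omega> (\<lambda>x. \<phi> k x - \<phi> l x))\<^sup>2 \<le> 2 * (mq \<Omega> \<mu> u (\<phi> l) - menv \<Omega> \<mu> u) + 2 * (mq \<Omega> \<mu> u (\<phi> k) - menv \<Omega> \<mu> u)"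
        by (rule order_trans[OF L2norm_sq_le_msq msq_diff_le[OF \<phi> \<phi> u]])
      also have "\<dots> < \<mu> * e\<^sup>2" using N[OF that(1)] N[OF that(2)] by argo
      finally have "(L2norm \<Omega> (\<lambda>x. \<phi> k x - \<phi> l x))\<^sup>2 < e\<^sup>2" using \<mu> by simp
      then show ?thesis by (rule power2_less_imp_less) (use e in simp)
    qed
    then show "\<exists>N. \<forall>k\<ge>N. \<forall>l\<ge>N. L2norm \<Omega> (\<lambda>x. \<phi> k x - \<phi> l x) < e" by blast
  qed
  then show ?thesis using \<phi> qlim unfolding is_prox_def by blast
qed

lemma is_proxD:
  assumes "is_prox \<Omega> \<mu> u \<phi> v"
  shows "test_fun \<Omega> (\<phi> k)" "memL2 \<Omega> (\<phi> k)" "memL2 \<Omega> v" "(\<lambda>k. mq \<Omega> \<mu> u (\<phi> k)) \<longlonglongrightarrow> menv \<Omega> \<mu> u"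
    "(\<lambda>k. L2norm \<Omega> (\<lambda>x. \<phi> k x - v x)) \<longlonglongrightarrow> 0"
  using assms unfolding is_prox_def by (auto intro: test_fun_memL2 \<Omega>)

lemma prox_msq_bounded:
  assumes p: "is_prox \<Omega> \<mu> u \<phi> v"
  obtains C where "0 \<le> C" "\<And>k. msq \<Omega> \<mu> (\<phi> k) \<le> C"
proof -
  have "Bseq (\<lambda>k. mq \<Omega> \<mu> u (\<phi> k))" by (rule convergent_imp_Bseq, rule convergentI, rule is_proxD(4)[OF p])
  then obtain A where A: "\<And>k. \<bar>mq \<Omega> \<mu> u (\<phi> k)\<bar> \<le> A" by (auto simp: Bseq_def)
  have "Bseq (\<lambda>k. L2norm \<Omega> (\<phi> k))"
    by (rule convergent_imp_Bseq, rule convergentI, rule tendsto_L2norm[OF is_proxD(2)[OF p] is_proxD(3)[OF p] is_proxD(5)[OF p]])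
  then obtain B where B: "\<And>k. \<bar>L2norm \<Omega> (\<phi> k)\<bar> \<le> B" by (auto simp: Bseq_def)
  have "msq \<Omega> \<mu> (\<phi> k) \<le> A + \<mu> * B\<^sup>2" for k
  proof -
    have "(gnorm \<Omega> (grd (\<phi> k)))\<^sup>2 \<le> mq \<Omega> \<mu> u (\<phi> k)" using \<mu> by (simp add: mq_def)
    moreover have "(L2norm \<Omega> (\<phi> k))\<^sup>2 \<le> B\<^sup>2" using B[of k] by (intro power_mono) auto
    then have "\<mu> * (L2norm \<Omega> (\<phi> k))\<^sup>2 \<le> \<mu> * B\<^sup>2" using \<mu> by simp
    ultimately show ?thesis using A[of k] by (simp add: msq_def)
  qed
  moreover have "0 \<le> A + \<mu> * B\<^sup>2" using A[of 0] \<mu> by (simp add: add_nonneg_nonneg)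
  ultimately show ?thesis using that by blast
qed

text \<open>The direction may vary with k as long as its energy stays bounded. This allows
  directions built from the minimising sequence itself, which stand for directions built from
  v.\<close>

lemma prox_el_tendsto:
  assumes p: "is_prox \<Omega> \<mu> u \<phi> v" and u: "memL2 \<Omega> u" and \<psi>: "\<And>k. test_fun \<Omega> (\<psi> k)" and C: "\<And>k. msq \<Omega> \<mu> (\<psi> k) \<le> C"
  shows "(\<lambda>k. gip \<Omega> (grd (\<phi> k)) (grd (\<psi> k)) + complex_of_real \<mu> * ip \<Omega> (\<lambda>x. \<phi> k x - u x) (\<psi> k)) \<longlonglongrightarrow> 0"
proof (rule tendsto_norm_zero_cancel, rule Lim_null_comparison)
  let ?B = "\<lambda>k. gip \<Omega> (grd (\<phi> k)) (grd (\<psi> k)) + complex_of_real \<mu> * ip \<Omega> (\<lambda>x. \<phi> k x - u x) (\<psi> k)"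
  let ?e = "\<lambda>k. mq \<Omega> \<mu> u (\<phi> k) - menv \<Omega> \<mu> u"
  have "cmod (?B k) \<le> sqrt (?e k * C)" for k
  proof (rule real_le_rsqrt)
    have "(cmod (?B k))\<^sup>2 \<le> ?e k * msq \<Omega> \<mu> (\<psi> k)" by (rule euler_lagrange[OF is_proxD(1)[OF p] \<psi> u])
    also have "\<dots> \<le> ?e k * C" using menv_le[OF is_proxD(1)[OF p]] by (intro mult_left_mono C) auto
    finally show "(cmod (?B k))\<^sup>2 \<le> ?e k * C" .
  qed
  then show "\<forall>\<^sub>F k in sequentially. norm (cmod (?B k)) \<le> sqrt (?e k * C)" by simp
  have "(\<lambda>k. sqrt (?e k * C)) \<longlonglongrightarrow> sqrt ((menv \<Omega> \<mu> u - menv \<Omega> \<mu> u) * C)"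
    by (intro tendsto_intros is_proxD(4)[OF p])
  then show "(\<lambda>k. sqrt (?e k * C)) \<longlonglongrightarrow> 0" by simp
qed

lemma prox_el_tendsto_H10:
  assumes p: "is_prox \<Omega> \<mu> u \<phi> v" and u: "memL2 \<Omega> u" and \<psi>: "memH10 \<Omega> \<psi>"
  shows "(\<lambda>k. gip \<Omega> (grd (\<phi> k)) (wgrad \<Omega> \<psi>) + complex_of_real \<mu> * ip \<Omega> (\<lambda>x. \<phi> k x - u x) \<psi>) \<longlonglongrightarrow> 0"
proof (rule tendsto_norm_zero_cancel, rule Lim_null_comparison)
  let ?B = "\<lambda>k. gip \<Omega> (grd (\<phi> k)) (wgrad \<Omega> \<psi>) + complex_of_real \<mu> * ip \<Omega> (\<lambda>x. \<phi> k x - u x) \<psi>"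
  let ?e = "\<lambda>k. mq \<Omega> \<mu> u (\<phi> k) - menv \<Omega> \<mu> u"
  let ?C = "(gnorm \<Omega> (wgrad \<Omega> \<psi>))\<^sup>2 + \<mu> * (L2norm \<Omega> \<psi>)\<^sup>2"
  show "\<forall>\<^sub>F k in sequentially. norm (cmod (?B k)) \<le> sqrt (?e k * ?C)"
    using euler_lagrange_H10[OF is_proxD(1)[OF p] \<psi> u] by (intro always_eventually) (auto intro: real_le_rsqrt)
  have "(\<lambda>k. sqrt (?e k * ?C)) \<longlonglongrightarrow> sqrt ((menv \<Omega> \<mu> u - menv \<Omega> \<mu> u) * ?C)"
    by (intro tendsto_intros is_proxD(4)[OF p])
  then show "(\<lambda>k. sqrt (?e k * ?C)) \<longlonglongrightarrow> 0" by simp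
qed

text \<open>The two Euler-Lagrange relations are subtracted and tested with the difference of the
  minimising sequences; the gradient term has a sign and is dropped, and Cauchy-Schwarz does the
  rest.\<close>

lemma prox_nonexpansive:
  assumes p: "is_prox \<Omega> \<mu> u \<phi> v" and u: "memL2 \<Omega> u" and p': "is_prox \<Omega> \<mu> u' \<phi>' v'" and u': "memL2 \<Omega> u'"
  shows "L2norm \<Omega> (\<lambda>x. v x - v' x) \<le> L2norm \<Omega> (\<lambda>x. u x - u' x)"
proof -
  let ?\<psi> = "\<lambda>k x. \<phi> k x - \<phi>' k x"
  have \<psi>: "test_fun \<Omega> (?\<psi> k)" for k by (intro test_fun_diff is_proxD(1)[OF p] is_proxD(1)[OF p'])
  obtain C C' where C: "0 \<le> C" "\<And>k. msq \<Omega> \<mu> (\<phi> k) \<le> C" and C': "0 \<le> C'" "\<And>k. msq \<Omega> \<mu> (\<phi>' k) \<le> C'"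
    using prox_msq_bounded[OF p] prox_msq_bounded[OF p'] by metis
  note mem = is_proxD(2,3)[OF p] is_proxD(2,3)[OF p'] u u'
  have g: "memG \<Omega> (grd (\<phi> k))" "memG \<Omega> (grd (\<phi>' k))" for k
    by (intro memG_grd \<Omega> is_proxD(1)[OF p] is_proxD(1)[OF p'])+
  have pdd: "(\<lambda>j. pd j (?\<psi> k)) = (\<lambda>j x. pd j (\<phi> k) x - pd j (\<phi>' k) x)" for k
    by (simp add: pd_test_diff[OF is_proxD(1)[OF p] is_proxD(1)[OF p']])
  have sq2: "(a + b)\<^sup>2 \<le> 2 * a\<^sup>2 + 2 * b\<^sup>2" for a b :: real
    using sum_squares_bound[of a b] by (simp add: power2_sum)
  have bd: "msq \<Omega> \<mu> (?\<psi> k) \<le> 2 * C + 2 * C'" for k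
  proof -
    have g2: "(gnorm \<Omega> (grd (?\<psi> k)))\<^sup>2 \<le> (gnorm \<Omega> (grd (\<phi> k)) + gnorm \<Omega> (grd (\<phi>' k)))\<^sup>2"
    proof (rule power_mono)
      have z: "memG \<Omega> (\<lambda>j x. 0)" by (simp add: memG_def)
      show "gnorm \<Omega> (grd (?\<psi> k)) \<le> gnorm \<Omega> (grd (\<phi> k)) + gnorm \<Omega> (grd (\<phi>' k))"
        using gnorm_triangle_mid[OF g(1) z g(2), of k k] gnorm_minus_commute[of \<Omega> "\<lambda>j x. 0" "grd (\<phi>' k)"]
        unfolding pdd by simp
    qed simp
    have "(L2norm \<Omega> (?\<psi> k))\<^sup>2 \<le> (L2norm \<Omega> (\<phi> k) + L2norm \<Omega> (\<phi>' k))\<^sup>2"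
      by (intro power_mono L2norm_triangle_diff mem) simp
    then have "\<mu> * (L2norm \<Omega> (?\<psi> k))\<^sup>2 \<le> \<mu> * (2 * (L2norm \<Omega> (\<phi> k))\<^sup>2 + 2 * (L2norm \<Omega> (\<phi>' k))\<^sup>2)"
      using \<mu> sq2 order_trans by (intro mult_left_mono) (blast, simp)
    also have "\<dots> = 2 * (\<mu> * (L2norm \<Omega> (\<phi> k))\<^sup>2) + 2 * (\<mu> * (L2norm \<Omega> (\<phi>' k))\<^sup>2)" by (simp add: algebra_simps)
    finally have "msq \<Omega> \<mu> (?\<psi> k) \<le> 2 * msq \<Omega> \<mu> (\<phi> k) + 2 * msq \<Omega> \<mu> (\<phi>' k)"
      using g2 sq2[of "gnorm \<Omega> (grd (\<phi> k))" "gnorm \<Omega> (grd (\<phi>' k))"] unfolding msq_def by argo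
    then show ?thesis using C(2)[of k] C'(2)[of k] by linarith
  qed
  let ?e = "\<lambda>k. (gip \<Omega> (grd (\<phi> k)) (grd (?\<psi> k)) + complex_of_real \<mu> * ip \<Omega> (\<lambda>x. \<phi> k x - u x) (?\<psi> k))
     - (gip \<Omega> (grd (\<phi>' k)) (grd (?\<psi> k)) + complex_of_real \<mu> * ip \<Omega> (\<lambda>x. \<phi>' k x - u' x) (?\<psi> k))"
  have "?e \<longlonglongrightarrow> 0 - 0"
    by (intro tendsto_diff prox_el_tendsto[OF p u] prox_el_tendsto[OF p' u'] \<psi>) (rule bd)+
  then have e0: "(\<lambda>k. Re (?e k)) \<longlonglongrightarrow> Re (0 - 0)" by (rule tendsto_Re)
  have le: "\<mu> * (L2norm \<Omega> (?\<psi> k))\<^sup>2 - \<mu> * Re (ip \<Omega> (\<lambda>x. u x - u' x) (?\<psi> k)) \<le> Re (?e k)" for k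
  proof -
    have "?e k = gip \<Omega> (\<lambda>j x. pd j (\<phi> k) x - pd j (\<phi>' k) x) (grd (?\<psi> k))
       + complex_of_real \<mu> * (ip \<Omega> (?\<psi> k) (?\<psi> k) - ip \<Omega> (\<lambda>x. u x - u' x) (?\<psi> k))"
      using mem g memG_grd[OF \<Omega> \<psi>] by (simp add: ip_lin gip_diff_left memL2_diff algebra_simps)
    then have "Re (?e k) = (gnorm \<Omega> (grd (?\<psi> k)))\<^sup>2 + \<mu> * ((L2norm \<Omega> (?\<psi> k))\<^sup>2 - Re (ip \<Omega> (\<lambda>x. u x - u' x) (?\<psi> k)))"
      unfolding pdd[symmetric] gip_self ip_self by simp
    then show ?thesis by (simp add: algebra_simps)
  qed
  have \<psi>lim: "(\<lambda>k. L2norm \<Omega> (\<lambda>x. ?\<psi> k x - (v x - v' x))) \<longlonglongrightarrow> 0"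
  proof (rule Lim_null_comparison)
    show "(\<lambda>k. L2norm \<Omega> (\<lambda>x. \<phi> k x - v x) + L2norm \<Omega> (\<lambda>x. \<phi>' k x - v' x)) \<longlonglongrightarrow> 0"
      using tendsto_add[OF is_proxD(5)[OF p] is_proxD(5)[OF p']] by simp
    have "L2norm \<Omega> (\<lambda>x. ?\<psi> k x - (v x - v' x)) \<le> L2norm \<Omega> (\<lambda>x. \<phi> k x - v x) + L2norm \<Omega> (\<lambda>x. \<phi>' k x - v' x)" for k
    proof -
      have "(\<lambda>x. ?\<psi> k x - (v x - v' x)) = (\<lambda>x. (\<phi> k x - v x) - (\<phi>' k x - v' x))" by (simp add: algebra_simps)
      then show ?thesis using L2norm_triangle_diff[of \<Omega> "\<lambda>x. \<phi> k x - v x" "\<lambda>x. \<phi>' k x - v' x"] mem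
        by (simp add: memL2_diff)
    qed
    then show "\<forall>\<^sub>F k in sequentially. norm (L2norm \<Omega> (\<lambda>x. ?\<psi> k x - (v x - v' x)))
        \<le> L2norm \<Omega> (\<lambda>x. \<phi> k x - v x) + L2norm \<Omega> (\<lambda>x. \<phi>' k x - v' x)" by simp
  qed
  have m2: "memL2 \<Omega> (\<lambda>x. v x - v' x)" "memL2 \<Omega> (\<lambda>x. u x - u' x)" "memL2 \<Omega> (?\<psi> k)" for k
    by (intro memL2_diff mem)+
  have "(\<lambda>k. \<mu> * (L2norm \<Omega> (?\<psi> k))\<^sup>2 - \<mu> * Re (ip \<Omega> (\<lambda>x. u x - u' x) (?\<psi> k)))
     \<longlonglongrightarrow> \<mu> * (L2norm \<Omega> (\<lambda>x. v x - v' x))\<^sup>2 - \<mu> * Re (ip \<Omega> (\<lambda>x. u x - u' x) (\<lambda>x. v x - v' x))"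
    by (intro tendsto_intros tendsto_L2norm ip_tendsto_right m2 \<psi>lim)
  from LIMSEQ_le[OF this e0] le
  have "\<mu> * (L2norm \<Omega> (\<lambda>x. v x - v' x))\<^sup>2 - \<mu> * Re (ip \<Omega> (\<lambda>x. u x - u' x) (\<lambda>x. v x - v' x)) \<le> 0" by simp
  then have "(L2norm \<Omega> (\<lambda>x. v x - v' x))\<^sup>2 \<le> Re (ip \<Omega> (\<lambda>x. u x - u' x) (\<lambda>x. v x - v' x))"
    using \<mu> by (simp flip: right_diff_distrib add: mult_le_0_iff)
  also have "\<dots> \<le> L2norm \<Omega> (\<lambda>x. u x - u' x) * L2norm \<Omega> (\<lambda>x. v x - v' x)"
    using ip_cauchy_schwarz[OF m2(2,1)] complex_Re_le_cmod order_trans by blast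
  finally have *: "L2norm \<Omega> (\<lambda>x. v x - v' x) * L2norm \<Omega> (\<lambda>x. v x - v' x) \<le> L2norm \<Omega> (\<lambda>x. u x - u' x) * L2norm \<Omega> (\<lambda>x. v x - v' x)"
    by (simp add: power2_eq_square)
  show ?thesis
  proof (cases "L2norm \<Omega> (\<lambda>x. v x - v' x) = 0")
    case False
    then have "0 < L2norm \<Omega> (\<lambda>x. v x - v' x)" by (simp add: order.not_eq_order_implies_strict)
    with * show ?thesis by (rule mult_right_le_imp_le)
  qed simp
qed

text \<open>Minimisers for u compete in the problem for u'. The resulting one-sided expansion, with
  remainder \<mu> times a squared norm, is the semi-concavity that replaces differentiability of the
  envelope in time.\<close>

lemma menv_increment:
  assumes p: "is_prox \<Omega> \<mu> u \<phi> v" and u: "memL2 \<Omega> u" and u': "memL2 \<Omega> u'"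
  shows "menv \<Omega> \<mu> u' \<le> menv \<Omega> \<mu> u
     + \<mu> * (2 * Re (ip \<Omega> (\<lambda>x. u x - v x) (\<lambda>x. u' x - u x)) + (L2norm \<Omega> (\<lambda>x. u' x - u x))\<^sup>2)"
proof (rule LIMSEQ_le_const)
  let ?d = "\<lambda>x. u' x - u x"
  note mem = is_proxD(2,3)[OF p] u u'
  have m: "memL2 \<Omega> (\<lambda>x. u x - \<phi> k x)" "memL2 \<Omega> ?d" "memL2 \<Omega> (\<lambda>x. u x - v x)" for k by (intro memL2_diff mem)+
  have lim: "(\<lambda>k. L2norm \<Omega> (\<lambda>x. (u x - \<phi> k x) - (u x - v x))) \<longlonglongrightarrow> 0"
    using is_proxD(5)[OF p] by (simp add: L2norm_minus_commute)
  show "(\<lambda>k. mq \<Omega> \<mu> u (\<phi> k) + \<mu> * (2 * Re (ip \<Omega> (\<lambda>x. u x - \<phi> k x) ?d) + (L2norm \<Omega> ?d)\<^sup>2))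
    \<longlonglongrightarrow> menv \<Omega> \<mu> u + \<mu> * (2 * Re (ip \<Omega> (\<lambda>x. u x - v x) ?d) + (L2norm \<Omega> ?d)\<^sup>2)"
    by (intro tendsto_intros is_proxD(4)[OF p] ip_tendsto_left m lim)
  have "menv \<Omega> \<mu> u' \<le> mq \<Omega> \<mu> u (\<phi> k) + \<mu> * (2 * Re (ip \<Omega> (\<lambda>x. u x - \<phi> k x) ?d) + (L2norm \<Omega> ?d)\<^sup>2)" for k
  proof -
    have "L2norm \<Omega> (\<lambda>x. \<phi> k x - u' x) = L2norm \<Omega> (\<lambda>x. (u x - \<phi> k x) + ?d x)"
      by (subst L2norm_minus_commute) simp
    then have "mq \<Omega> \<mu> u' (\<phi> k) = mq \<Omega> \<mu> u (\<phi> k) + \<mu> * (2 * Re (ip \<Omega> (\<lambda>x. u x - \<phi> k x) ?d) + (L2norm \<Omega> ?d)\<^sup>2)"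
      unfolding mq_def using L2norm_add_sq[OF m(1,2)] L2norm_minus_commute[of \<Omega> "\<phi> k" u] by (simp add: algebra_simps)
    then show ?thesis using menv_le[OF is_proxD(1)[OF p], of u' k] by simp
  qed
  then show "\<exists>N. \<forall>k\<ge>N. menv \<Omega> \<mu> u' \<le> mq \<Omega> \<mu> u (\<phi> k) + \<mu> * (2 * Re (ip \<Omega> (\<lambda>x. u x - \<phi> k x) ?d) + (L2norm \<Omega> ?d)\<^sup>2)"
    by blast
qed

lemma prox_dist:
  assumes p: "is_prox \<Omega> \<mu> u \<phi> v" and u: "memL2 \<Omega> u"
  shows "\<mu> * (L2norm \<Omega> (\<lambda>x. u x - v x))\<^sup>2 \<le> menv \<Omega> \<mu> u"
proof (rule LIMSEQ_le[OF _ is_proxD(4)[OF p]])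
  note mem = is_proxD(2,3)[OF p] u
  have lim: "(\<lambda>k. L2norm \<Omega> (\<lambda>x. (\<phi> k x - u x) - (v x - u x))) \<longlonglongrightarrow> 0"
    using is_proxD(5)[OF p] by simp
  have "(\<lambda>k. L2norm \<Omega> (\<lambda>x. \<phi> k x - u x)) \<longlonglongrightarrow> L2norm \<Omega> (\<lambda>x. v x - u x)"
    by (rule tendsto_L2norm[OF _ _ lim]) (intro memL2_diff mem)+
  then show "(\<lambda>k. \<mu> * (L2norm \<Omega> (\<lambda>x. \<phi> k x - u x))\<^sup>2) \<longlonglongrightarrow> \<mu> * (L2norm \<Omega> (\<lambda>x. u x - v x))\<^sup>2"
    unfolding L2norm_minus_commute[of \<Omega> u v] by (intro tendsto_intros)
  show "\<exists>N. \<forall>k\<ge>N. \<mu> * (L2norm \<Omega> (\<lambda>x. \<phi> k x - u x))\<^sup>2 \<le> mq \<Omega> \<mu> u (\<phi> k)" by (simp add: mq_def)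
qed

lemma prox_dist_L2:
  assumes p: "is_prox \<Omega> \<mu> u \<phi> v" and u: "memL2 \<Omega> u"
  shows "L2norm \<Omega> (\<lambda>x. u x - v x) \<le> L2norm \<Omega> u"
  using order_trans[OF prox_dist[OF p u] menv_le_L2] \<mu> by (auto intro: power2_le_imp_le)

text \<open>With the minimising sequence as its own direction, every term of the Euler-Lagrange
  relation is real except the pairing with u. This is what cancels the constant potential.\<close>

lemma prox_Im_zero:
  assumes p: "is_prox \<Omega> \<mu> u \<phi> v" and u: "memL2 \<Omega> u"
  shows "Im (ip \<Omega> u v) = 0"
proof -
  note mem = is_proxD(2,3)[OF p] u
  obtain C where C: "\<And>k. msq \<Omega> \<mu> (\<phi> k) \<le> C" using prox_msq_bounded[OF p] by metis
  have "(\<lambda>k. Im (gip \<Omega> (grd (\<phi> k)) (grd (\<phi> k)) + complex_of_real \<mu> * ip \<Omega> (\<lambda>x. \<phi> k x - u x) (\<phi> k))) \<longlonglongrightarrow> Im 0"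
    by (intro tendsto_Im prox_el_tendsto[OF p u is_proxD(1)[OF p] C])
  moreover have "Im (gip \<Omega> (grd (\<phi> k)) (grd (\<phi> k)) + complex_of_real \<mu> * ip \<Omega> (\<lambda>x. \<phi> k x - u x) (\<phi> k)) = - (\<mu> * Im (ip \<Omega> u (\<phi> k)))" for k
    using mem by (simp add: gip_self ip_diff_left ip_self del: of_real_power)
  moreover have "(\<lambda>k. - (\<mu> * Im (ip \<Omega> u (\<phi> k)))) \<longlonglongrightarrow> - (\<mu> * Im (ip \<Omega> u v))"
    by (intro tendsto_intros ip_tendsto_right mem is_proxD(5)[OF p])
  ultimately have "- (\<mu> * Im (ip \<Omega> u v)) = 0" using LIMSEQ_unique by fastforce
  then show ?thesis using \<mu> by simp
qed

text \<open>Both pairings are real: that with u by Green's formula, that with v because the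
  Euler-Lagrange relation in direction u turns it into \<mu> times the pairing of u with v - u,
  whose imaginary part vanishes by \<open>prox_Im_zero\<close>.\<close>

lemma prox_lap:
  assumes p: "is_prox \<Omega> \<mu> u \<phi> v" and u: "memH10 \<Omega> u" and lap: "weak_lap \<Omega> u l" and l: "memL2 \<Omega> l"
  shows "Im (ip \<Omega> l (\<lambda>x. u x - v x)) = 0"
proof -
  have uL: "memL2 \<Omega> u" by (rule memH10_memL2[OF u])
  note mem = is_proxD(2,3)[OF p] uL l
  have ul: "Im (ip \<Omega> l u) = 0"
    unfolding weak_lap_H10[OF \<Omega> lap l u u] by (simp add: gip_self del: of_real_power)
  have "ip \<Omega> l (\<phi> k) = - cnj (gip \<Omega> (grd (\<phi> k)) (wgrad \<Omega> u))" for k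
    unfolding weak_lap_test[OF \<Omega> lap memH10_isgrad[OF u] uL is_proxD(1)[OF p]] by (subst gip_commute) simp
  then have eq: "ip \<Omega> l (\<phi> k) = - cnj (gip \<Omega> (grd (\<phi> k)) (wgrad \<Omega> u) + complex_of_real \<mu> * ip \<Omega> (\<lambda>x. \<phi> k x - u x) u)
     + complex_of_real \<mu> * cnj (ip \<Omega> (\<lambda>x. \<phi> k x - u x) u)" for k
    by simp
  have lim: "(\<lambda>k. L2norm \<Omega> (\<lambda>x. (\<phi> k x - u x) - (v x - u x))) \<longlonglongrightarrow> 0"
    using is_proxD(5)[OF p] by simp
  have "(\<lambda>k. ip \<Omega> l (\<phi> k)) \<longlonglongrightarrow> - cnj 0 + complex_of_real \<mu> * cnj (ip \<Omega> (\<lambda>x. v x - u x) u)"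
    unfolding eq by (intro tendsto_intros prox_el_tendsto_H10[OF p uL u] ip_tendsto_left memL2_diff mem lim)
  moreover have "(\<lambda>k. ip \<Omega> l (\<phi> k)) \<longlonglongrightarrow> ip \<Omega> l v"
    by (intro ip_tendsto_right mem is_proxD(5)[OF p])
  ultimately have "ip \<Omega> l v = complex_of_real \<mu> * cnj (ip \<Omega> (\<lambda>x. v x - u x) u)"
    using LIMSEQ_unique by fastforce
  also have "cnj (ip \<Omega> (\<lambda>x. v x - u x) u) = ip \<Omega> u v - complex_of_real ((L2norm \<Omega> u)\<^sup>2)"
    unfolding ip_commute[of \<Omega> u "\<lambda>x. v x - u x", symmetric] using mem by (simp add: ip_diff_right ip_self)
  finally have "Im (ip \<Omega> l v) = 0" using prox_Im_zero[OF p uL] by (simp del: of_real_power)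
  then show ?thesis using ul mem by (simp add: ip_diff_right)
qed

text \<open>The Euler-Lagrange relation in direction f trades the factor \<mu> for a gradient of f,
  so the bound is uniform in \<mu>. The gradients of the minimising sequence are controlled by the
  envelope.\<close>

lemma prox_forcing:
  assumes p: "is_prox \<Omega> \<mu> u \<phi> v" and u: "memL2 \<Omega> u" and f: "memH10 \<Omega> f"
  shows "\<mu> * cmod (ip \<Omega> (\<lambda>x. u x - v x) f) \<le> sqrt (menv \<Omega> \<mu> u) * gnorm \<Omega> (wgrad \<Omega> f)"
proof -
  note mem = is_proxD(2,3)[OF p] u memH10_memL2[OF f]
  have lim: "(\<lambda>k. L2norm \<Omega> (\<lambda>x. (\<phi> k x - u x) - (v x - u x))) \<longlonglongrightarrow> 0"
    using is_proxD(5)[OF p] by simp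
  let ?B = "\<lambda>k. gip \<Omega> (grd (\<phi> k)) (wgrad \<Omega> f) + complex_of_real \<mu> * ip \<Omega> (\<lambda>x. \<phi> k x - u x) f"
  have "cmod (complex_of_real \<mu> * ip \<Omega> (\<lambda>x. v x - u x) f) \<le> 0 + sqrt (menv \<Omega> \<mu> u) * gnorm \<Omega> (wgrad \<Omega> f)"
  proof (rule LIMSEQ_le)
    show "(\<lambda>k. cmod (complex_of_real \<mu> * ip \<Omega> (\<lambda>x. \<phi> k x - u x) f)) \<longlonglongrightarrow> cmod (complex_of_real \<mu> * ip \<Omega> (\<lambda>x. v x - u x) f)"
      by (intro tendsto_intros ip_tendsto_left memL2_diff mem lim)
    show "(\<lambda>k. cmod (?B k) + sqrt (mq \<Omega> \<mu> u (\<phi> k)) * gnorm \<Omega> (wgrad \<Omega> f)) \<longlonglongrightarrow> 0 + sqrt (menv \<Omega> \<mu> u) * gnorm \<Omega> (wgrad \<Omega> f)"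
      by (intro tendsto_intros tendsto_norm_zero prox_el_tendsto_H10[OF p u f] is_proxD(4)[OF p])
    have "cmod (complex_of_real \<mu> * ip \<Omega> (\<lambda>x. \<phi> k x - u x) f) \<le> cmod (?B k) + sqrt (mq \<Omega> \<mu> u (\<phi> k)) * gnorm \<Omega> (wgrad \<Omega> f)" for k
    proof -
      have "cmod (complex_of_real \<mu> * ip \<Omega> (\<lambda>x. \<phi> k x - u x) f) = cmod (?B k - gip \<Omega> (grd (\<phi> k)) (wgrad \<Omega> f))" by simp
      also have "\<dots> \<le> cmod (?B k) + cmod (gip \<Omega> (grd (\<phi> k)) (wgrad \<Omega> f))" by (rule norm_triangle_ineq4)
      also have "cmod (gip \<Omega> (grd (\<phi> k)) (wgrad \<Omega> f)) \<le> gnorm \<Omega> (grd (\<phi> k)) * gnorm \<Omega> (wgrad \<Omega> f)"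
        by (rule gip_cauchy_schwarz[OF memG_grd[OF \<Omega> is_proxD(1)[OF p]]]) (use memH10_isgrad[OF f] in \<open>simp add: isgrad_def\<close>)
      also have "\<dots> \<le> sqrt (mq \<Omega> \<mu> u (\<phi> k)) * gnorm \<Omega> (wgrad \<Omega> f)"
        using \<mu> by (intro mult_right_mono real_le_rsqrt) (auto simp: mq_def)
      finally show ?thesis by simp
    qed
    then show "\<exists>N. \<forall>k\<ge>N. cmod (complex_of_real \<mu> * ip \<Omega> (\<lambda>x. \<phi> k x - u x) f) \<le> cmod (?B k) + sqrt (mq \<Omega> \<mu> u (\<phi> k)) * gnorm \<Omega> (wgrad \<Omega> f)"
      by blast
  qed
  moreover have "ip \<Omega> (\<lambda>x. v x - u x) f = - ip \<Omega> (\<lambda>x. u x - v x) f" using mem by (simp add: ip_diff_left)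
  ultimately show ?thesis using \<mu> by (simp add: norm_mult)
qed

text \<open>In the direction of the regularised nonlinearity of the minimising sequence, the
  Euler-Lagrange relation exposes the gradient pairing whose sign \<open>gip_greg_sign\<close>
  gives. \<open>nonlin_defect\<close> then replaces the regularised term by U.\<close>

lemma prox_nonlin:
  assumes p: "is_prox \<Omega> \<mu> u \<phi> v" and u: "memL2 \<Omega> u" and U: "memL2 \<Omega> U"
    and a: "a \<in> Cset m" and m: "0 \<le> m" "m < 1"
    and nl: "is_nonlin \<Omega> m u U" and fin: "m = 0 \<longrightarrow> emeasure lebesgue \<Omega> < \<infinity>"
  shows "0 \<le> Im (a * ip \<Omega> U (\<lambda>x. u x - v x))"
proof -
  note mem = is_proxD(2,3)[OF p] u U
  obtain \<eta> where \<eta>: "\<eta> \<longlonglongrightarrow> 0"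
    "\<And>n \<phi>. memL2 \<Omega> \<phi> \<Longrightarrow> - \<eta> n * (1 + L2norm \<Omega> (\<lambda>x. u x - \<phi> x))
       \<le> Im (a * ip \<Omega> (\<lambda>x. U x - greg (inverse (real (Suc n))) m (\<phi> x)) (\<lambda>x. u x - \<phi> x))"
    by (rule nonlin_defect[OF \<Omega> a m u U nl fin]) blast
  obtain C where C: "0 \<le> C" "\<And>k. msq \<Omega> \<mu> (\<phi> k) \<le> C" using prox_msq_bounded[OF p] by metis
  have lim: "(\<lambda>k. L2norm \<Omega> (\<lambda>x. (u x - \<phi> k x) - (u x - v x))) \<longlonglongrightarrow> 0"
    using is_proxD(5)[OF p] by (simp add: L2norm_minus_commute)
  have md: "memL2 \<Omega> (\<lambda>x. u x - \<phi> k x)" "memL2 \<Omega> (\<lambda>x. u x - v x)" for k by (intro memL2_diff mem)+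
  have n: "- \<eta> n * (1 + L2norm \<Omega> (\<lambda>x. u x - v x)) \<le> Im (a * ip \<Omega> U (\<lambda>x. u x - v x))" for n
  proof -
    let ?\<delta> = "inverse (real (Suc n))"
    let ?\<psi> = "\<lambda>k x. greg ?\<delta> m (\<phi> k x)"
    have \<delta>: "0 < ?\<delta>" by simp
    have \<psi>: "test_fun \<Omega> (?\<psi> k)" for k by (rule test_fun_greg(1)[OF is_proxD(1)[OF p] \<delta>])
    let ?c = "2 * ?\<delta> powr ((m - 1) / 2)"
    have S: "msq \<Omega> \<mu> (?\<psi> k) \<le> ?c\<^sup>2 * C" for k
    proof -
      note gn = greg_norms[OF \<Omega> is_proxD(1)[OF p] m \<delta>, of k]
      have "msq \<Omega> \<mu> (?\<psi> k) \<le> (?c * gnorm \<Omega> (grd (\<phi> k)))\<^sup>2 + \<mu> * (?c * L2norm \<Omega> (\<phi> k))\<^sup>2"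
        unfolding msq_def using \<mu> by (intro add_mono mult_left_mono power_mono gn) auto
      also have "\<dots> = ?c\<^sup>2 * msq \<Omega> \<mu> (\<phi> k)" by (simp add: msq_def power_mult_distrib algebra_simps)
      also have "\<dots> \<le> ?c\<^sup>2 * C" by (intro mult_left_mono C) simp
      finally show ?thesis .
    qed
    let ?B = "\<lambda>k. gip \<Omega> (grd (\<phi> k)) (grd (?\<psi> k)) + complex_of_real \<mu> * ip \<Omega> (\<lambda>x. \<phi> k x - u x) (?\<psi> k)"
    have Blim: "?B \<longlonglongrightarrow> 0" by (rule prox_el_tendsto[OF p u \<psi> S])
    \<comment> \<open>Two errors with different fates: the residual \<open>?B k\<close> vanishes as
      k grows with \<delta> fixed, while \<eta> vanishes only with \<delta>.\<close>
    have key: "- \<eta> n * (1 + L2norm \<Omega> (\<lambda>x. u x - \<phi> k x)) - cmod a * cmod (?B k) / \<mu> \<le> Im (a * ip \<Omega> U (\<lambda>x. u x - \<phi> k x))" for k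
    proof -
      have mp: "memL2 \<Omega> (?\<psi> k)" by (rule test_fun_memL2[OF \<Omega> \<psi>])
      have "complex_of_real \<mu> * ip \<Omega> (?\<psi> k) (\<lambda>x. u x - \<phi> k x) = gip \<Omega> (grd (?\<psi> k)) (grd (\<phi> k)) - cnj (?B k)"
      proof -
        have "ip \<Omega> (?\<psi> k) (\<lambda>x. u x - \<phi> k x) = - cnj (ip \<Omega> (\<lambda>x. \<phi> k x - u x) (?\<psi> k))"
          unfolding ip_commute[of \<Omega> "?\<psi> k" "\<lambda>x. \<phi> k x - u x", symmetric] using mem mp by (simp add: ip_diff_right)
        then show ?thesis by (subst gip_commute) simp
      qed
      then have "\<mu> * Im (a * ip \<Omega> (?\<psi> k) (\<lambda>x. u x - \<phi> k x)) = Im (a * (gip \<Omega> (grd (?\<psi> k)) (grd (\<phi> k)) - cnj (?B k)))"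
        by (simp only: Im_of_real_mult[symmetric] mult.left_commute[of "complex_of_real \<mu>" a])
      also have "\<dots> = Im (a * gip \<Omega> (grd (?\<psi> k)) (grd (\<phi> k))) - Im (a * cnj (?B k))"
        unfolding right_diff_distrib by (rule minus_complex.sel)
      also have "\<dots> \<ge> 0 - cmod a * cmod (?B k)"
      proof (rule diff_mono)
        show "0 \<le> Im (a * gip \<Omega> (grd (?\<psi> k)) (grd (\<phi> k)))" by (rule gip_greg_sign[OF \<Omega> is_proxD(1)[OF p] a m \<delta>])
        show "Im (a * cnj (?B k)) \<le> cmod a * cmod (?B k)"
          using abs_Im_le_cmod[of "a * cnj (?B k)"] unfolding norm_mult complex_mod_cnj by linarith
      qed
      finally have "- (cmod a * cmod (?B k) / \<mu>) \<le> Im (a * ip \<Omega> (?\<psi> k) (\<lambda>x. u x - \<phi> k x))"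
        using \<mu> by (simp add: field_simps)
      moreover have "Im (a * ip \<Omega> U (\<lambda>x. u x - \<phi> k x)) = Im (a * ip \<Omega> (\<lambda>x. U x - ?\<psi> k x) (\<lambda>x. u x - \<phi> k x)) + Im (a * ip \<Omega> (?\<psi> k) (\<lambda>x. u x - \<phi> k x))"
        unfolding ip_diff_left[OF U mp md(1)] by (simp add: algebra_simps)
      ultimately show ?thesis using \<eta>(2)[OF mem(1)[of k], of n] by linarith
    qed
    have "- \<eta> n * (1 + L2norm \<Omega> (\<lambda>x. u x - v x)) - cmod a * cmod 0 / \<mu> \<le> Im (a * ip \<Omega> U (\<lambda>x. u x - v x))"
    proof (rule LIMSEQ_le)
      show "(\<lambda>k. - \<eta> n * (1 + L2norm \<Omega> (\<lambda>x. u x - \<phi> k x)) - cmod a * cmod (?B k) / \<mu>)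
         \<longlonglongrightarrow> - \<eta> n * (1 + L2norm \<Omega> (\<lambda>x. u x - v x)) - cmod a * cmod 0 / \<mu>"
        using \<mu> by (intro tendsto_intros Blim tendsto_L2norm md lim) simp
      show "(\<lambda>k. Im (a * ip \<Omega> U (\<lambda>x. u x - \<phi> k x))) \<longlonglongrightarrow> Im (a * ip \<Omega> U (\<lambda>x. u x - v x))"
        by (intro tendsto_intros ip_tendsto_right md lim U)
    qed (use key in blast)
    then show ?thesis by simp
  qed
  have "(\<lambda>n. - \<eta> n * (1 + L2norm \<Omega> (\<lambda>x. u x - v x))) \<longlonglongrightarrow> - 0 * (1 + L2norm \<Omega> (\<lambda>x. u x - v x))"
    by (intro tendsto_intros \<eta>)
  then show ?thesis by (intro LIMSEQ_le_const2) (use n in auto)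
qed

text \<open>Formally \<open>\<mu> (u - v)\<close> is minus the Laplacian of the minimiser v: tested against it, the Laplacian and the
  potential contribute nothing and the nonlinearity has a sign, so only the forcing survives.\<close>

lemma prox_evolution:
  assumes p: "is_prox \<Omega> \<mu> u \<phi> v" and u: "memH10 \<Omega> u" and lap: "weak_lap \<Omega> u l" and l: "memL2 \<Omega> l"
    and U: "memL2 \<Omega> U" and g: "memL2 \<Omega> g" and f: "memH10 \<Omega> f"
    and a: "a \<in> Cset m" and m: "0 \<le> m" "m < 1"
    and nl: "is_nonlin \<Omega> m u U" and fin: "m = 0 \<longrightarrow> emeasure lebesgue \<Omega> < \<infinity>"
    and w: "memL2 \<Omega> w" and eq: "AE x in lebesgue_on \<Omega>. \<i> * w x + l x + complex_of_real V * u x + a * U x = g x"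
  shows "\<mu> * Re (ip \<Omega> (\<lambda>x. u x - v x) w)
     \<le> sqrt (menv \<Omega> \<mu> u) * (gnorm \<Omega> (wgrad \<Omega> f) + sqrt \<mu> * L2norm \<Omega> (\<lambda>x. g x - f x))"
proof -
  have uL: "memL2 \<Omega> u" and fL: "memL2 \<Omega> f" using memH10_memL2 u f by auto
  note mem = is_proxD(3)[OF p] uL fL l U g w
  let ?d = "\<lambda>x. u x - v x" and ?h = "\<lambda>x. g x - f x"
  have d: "memL2 \<Omega> ?d" and h: "memL2 \<Omega> ?h" by (intro memL2_diff mem)+
  have "ip \<Omega> w ?d = ip \<Omega> (\<lambda>x. \<i> * (l x + complex_of_real V * u x + a * U x - g x)) ?d"
  proof (rule ip_cong_AE)
    show "AE x in lebesgue_on \<Omega>. w x = \<i> * (l x + complex_of_real V * u x + a * U x - g x)"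
      using eq
    proof eventually_elim
      case (elim x)
      then have iw: "\<i> * w x = g x - (l x + complex_of_real V * u x + a * U x)"
        by (simp only: eq_diff_eq add.assoc)
      have "w x = - (\<i> * (\<i> * w x))" by simp
      also have "\<dots> = - (\<i> * (g x - (l x + complex_of_real V * u x + a * U x)))" by (simp only: iw)
      finally show ?case by (simp add: algebra_simps)
    qed
  qed (auto intro!: memL2_diff memL2_add memL2_cmult mem)
  also have "\<dots> = \<i> * (ip \<Omega> l ?d + complex_of_real V * ip \<Omega> u ?d + a * ip \<Omega> U ?d - ip \<Omega> g ?d)"
    by (simp add: ip_cmult_left ip_add_left ip_diff_left memL2_add memL2_diff memL2_cmult mem d)
  finally have wd: "Re (ip \<Omega> w ?d) = - Im (ip \<Omega> l ?d) - V * Im (ip \<Omega> u ?d) - Im (a * ip \<Omega> U ?d) + Im (ip \<Omega> g ?d)"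
    by simp
  have "Im (ip \<Omega> u ?d) = 0"
    using prox_Im_zero[OF p uL] mem by (simp add: ip_diff_right ip_self del: of_real_power)
  then have "Re (ip \<Omega> w ?d) \<le> Im (ip \<Omega> g ?d)"
    using wd prox_lap[OF p u lap l] prox_nonlin[OF p uL U a m nl fin] by simp
  also have "ip \<Omega> g ?d = ip \<Omega> f ?d + ip \<Omega> ?h ?d" using mem d by (simp add: ip_diff_left)
  also have "Im \<dots> \<le> cmod (ip \<Omega> f ?d) + cmod (ip \<Omega> ?h ?d)"
    using abs_Im_le_cmod[of "ip \<Omega> f ?d"] abs_Im_le_cmod[of "ip \<Omega> ?h ?d"] by simp
  also have "cmod (ip \<Omega> f ?d) = cmod (ip \<Omega> ?d f)" by (subst ip_commute) simp
  also have "cmod (ip \<Omega> ?h ?d) \<le> L2norm \<Omega> ?h * L2norm \<Omega> ?d" by (rule ip_cauchy_schwarz[OF h d])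
  finally have "\<mu> * Re (ip \<Omega> w ?d) \<le> \<mu> * (cmod (ip \<Omega> ?d f) + L2norm \<Omega> ?h * L2norm \<Omega> ?d)"
    using \<mu> by (intro mult_left_mono) auto
  also have "\<dots> = \<mu> * cmod (ip \<Omega> ?d f) + L2norm \<Omega> ?h * (\<mu> * L2norm \<Omega> ?d)"
    by (simp add: distrib_left)
  also have "\<mu> * cmod (ip \<Omega> ?d f) \<le> sqrt (menv \<Omega> \<mu> u) * gnorm \<Omega> (wgrad \<Omega> f)"
    by (rule prox_forcing[OF p uL f])
  \<comment> \<open>From \<open>prox_dist\<close>. An error of the forcing that is small in L2 only
    thus costs a factor sqrt \<mu>, harmless because the approximants converge while \<mu> is
    fixed.\<close>
  also have "\<mu> * L2norm \<Omega> ?d \<le> sqrt \<mu> * sqrt (menv \<Omega> \<mu> u)"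
  proof -
    have "sqrt (\<mu> * (L2norm \<Omega> ?d)\<^sup>2) \<le> sqrt (menv \<Omega> \<mu> u)" using prox_dist[OF p uL] by simp
    then have "sqrt \<mu> * (sqrt \<mu> * L2norm \<Omega> ?d) \<le> sqrt \<mu> * sqrt (menv \<Omega> \<mu> u)"
      using \<mu> by (intro mult_left_mono) (auto simp: real_sqrt_mult)
    then show ?thesis using \<mu> by (simp add: mult.assoc[symmetric])
  qed
  finally have "\<mu> * Re (ip \<Omega> w ?d) \<le> sqrt (menv \<Omega> \<mu> u) * gnorm \<Omega> (wgrad \<Omega> f) + L2norm \<Omega> ?h * (sqrt \<mu> * sqrt (menv \<Omega> \<mu> u))"
    by (simp add: mult_left_mono)
  moreover have "Re (ip \<Omega> ?d w) = Re (ip \<Omega> w ?d)" by (subst ip_commute) simp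
  ultimately show ?thesis by (simp add: algebra_simps)
qed

text \<open>Test functions approximating u in H^1 are competitors whose penalty term vanishes in the
  limit, whatever \<mu> is.\<close>

lemma menv_le_gradL2sq:
  assumes u: "memH10 \<Omega> u"
  shows "menv \<Omega> \<mu> u \<le> gradL2sq \<Omega> u"
proof -
  obtain \<phi> where \<phi>: "\<And>k. test_fun \<Omega> (\<phi> k)" "(\<lambda>k. L2norm \<Omega> (\<lambda>x. \<phi> k x - u x)) \<longlonglongrightarrow> 0"
    "(\<lambda>k. gnorm \<Omega> (\<lambda>j x. pd j (\<phi> k) x - wgrad \<Omega> u j x)) \<longlonglongrightarrow> 0"
    using memH10_approx[OF \<Omega> u] by blast
  have "(\<lambda>k. mq \<Omega> \<mu> u (\<phi> k)) \<longlonglongrightarrow> (gnorm \<Omega> (wgrad \<Omega> u))\<^sup>2 + \<mu> * 0\<^sup>2"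
    unfolding mq_def using memH10_isgrad[OF u]
    by (intro tendsto_intros tendsto_gnorm memG_grd \<Omega> \<phi>) (auto simp: isgrad_def)
  then have "menv \<Omega> \<mu> u \<le> (gnorm \<Omega> (wgrad \<Omega> u))\<^sup>2 + \<mu> * 0\<^sup>2"
    by (rule LIMSEQ_le_const) (use menv_le[OF \<phi>(1)] in auto)
  then show ?thesis by (simp add: gradL2sq_eq_wgrad)
qed

lemma menv_diff_le:
  assumes u: "memL2 \<Omega> u" and u': "memL2 \<Omega> u'"
  shows "menv \<Omega> \<mu> u' - menv \<Omega> \<mu> u \<le> \<mu> * (2 * L2norm \<Omega> u * L2norm \<Omega> (\<lambda>x. u' x - u x) + (L2norm \<Omega> (\<lambda>x. u' x - u x))\<^sup>2)"
proof -
  obtain \<phi> v where p: "is_prox \<Omega> \<mu> u \<phi> v" using prox_exists[OF u] by blast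
  let ?d = "\<lambda>x. u' x - u x"
  have m: "memL2 \<Omega> (\<lambda>x. u x - v x)" "memL2 \<Omega> ?d" by (intro memL2_diff u u' is_proxD(3)[OF p])+
  have "Re (ip \<Omega> (\<lambda>x. u x - v x) ?d) \<le> L2norm \<Omega> (\<lambda>x. u x - v x) * L2norm \<Omega> ?d"
    using ip_cauchy_schwarz[OF m] complex_Re_le_cmod order_trans by blast
  also have "\<dots> \<le> L2norm \<Omega> u * L2norm \<Omega> ?d" by (intro mult_right_mono prox_dist_L2[OF p u]) simp
  finally have "2 * Re (ip \<Omega> (\<lambda>x. u x - v x) ?d) + (L2norm \<Omega> ?d)\<^sup>2 \<le> 2 * L2norm \<Omega> u * L2norm \<Omega> ?d + (L2norm \<Omega> ?d)\<^sup>2"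
    by simp
  from mult_left_mono[OF this, of \<mu>] menv_increment[OF p u u'] \<mu> show ?thesis by linarith
qed

text \<open>For fixed \<mu> the envelope is locally Lipschitz on L2. This is used both along the
  approximating solutions and along times.\<close>

lemma menv_tendsto:
  assumes "\<And>k. memL2 \<Omega> (f k)" "memL2 \<Omega> u" "((\<lambda>k. L2norm \<Omega> (\<lambda>x. f k x - u x)) \<longlongrightarrow> 0) F"
  shows "((\<lambda>k. menv \<Omega> \<mu> (f k)) \<longlongrightarrow> menv \<Omega> \<mu> u) F"
proof (rule LIM_zero_cancel, rule Lim_null_comparison)
  let ?d = "\<lambda>k. L2norm \<Omega> (\<lambda>x. f k x - u x)"
  let ?b = "\<lambda>k. \<mu> * (2 * (L2norm \<Omega> u + ?d k) * ?d k + (?d k)\<^sup>2)"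
  have "\<bar>menv \<Omega> \<mu> (f k) - menv \<Omega> \<mu> u\<bar> \<le> ?b k" for k
  proof (rule abs_leI)
    have "menv \<Omega> \<mu> (f k) - menv \<Omega> \<mu> u \<le> \<mu> * (2 * L2norm \<Omega> u * ?d k + (?d k)\<^sup>2)"
      by (rule menv_diff_le[OF assms(2,1)])
    also have "\<dots> \<le> ?b k" using \<mu> by (intro mult_left_mono add_mono mult_right_mono) auto
    finally show "menv \<Omega> \<mu> (f k) - menv \<Omega> \<mu> u \<le> ?b k" .
    have "menv \<Omega> \<mu> u - menv \<Omega> \<mu> (f k) \<le> \<mu> * (2 * L2norm \<Omega> (f k) * ?d k + (?d k)\<^sup>2)"
      using menv_diff_le[OF assms(1,2), of k] unfolding L2norm_minus_commute[of \<Omega> u] .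
    also have "\<dots> \<le> ?b k"
      using \<mu> L2norm_triangle_abs[OF assms(1)[of k] assms(2)] by (intro mult_left_mono add_mono mult_right_mono) auto
    finally show "- (menv \<Omega> \<mu> (f k) - menv \<Omega> \<mu> u) \<le> ?b k" by simp
  qed
  then show "\<forall>\<^sub>F k in F. norm (menv \<Omega> \<mu> (f k) - menv \<Omega> \<mu> u) \<le> ?b k" by simp
  have "(?b \<longlongrightarrow> \<mu> * (2 * (L2norm \<Omega> u + 0) * 0 + 0\<^sup>2)) F" by (intro tendsto_intros assms)
  then show "(?b \<longlongrightarrow> 0) F" by simp
qed

end

text \<open>Near-minimisers for the parameters k form a Cauchy sequence in the energy norm, because the
  midpoint of two of them competes in the smaller of the two problems and the envelopes converge.\<close>

lemma memH10_of_menv_bounded: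
  fixes \<Omega> :: "(real^'n::finite) set"
  assumes \<Omega>: "open \<Omega>" and u: "memL2 \<Omega> u" and bd: "\<And>k. menv \<Omega> (real (Suc k)) u \<le> C"
  shows "memH10 \<Omega> u" "(\<lambda>k. menv \<Omega> (real (Suc k)) u) \<longlonglongrightarrow> gradL2sq \<Omega> u"
proof -
  have loc: "moreau \<Omega> (real (Suc k))" for k using \<Omega> by unfold_locales auto
  let ?E = "\<lambda>k. menv \<Omega> (real (Suc k)) u" and ?Q = "\<lambda>k. mq \<Omega> (real (Suc k)) u"
  have "\<exists>\<phi>. test_fun \<Omega> \<phi> \<and> ?Q k \<phi> \<le> ?E k + inverse (real (Suc k))" for k
  proof -
    obtain \<phi> v where "is_prox \<Omega> (real (Suc k)) u \<phi> v" using moreau.prox_exists[OF loc u] by blast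
    then have t: "\<And>j. test_fun \<Omega> (\<phi> j)" and l: "(\<lambda>j. ?Q k (\<phi> j)) \<longlonglongrightarrow> ?E k" by (auto simp: is_prox_def)
    have "\<forall>\<^sub>F j in sequentially. ?Q k (\<phi> j) < ?E k + inverse (real (Suc k))"
      by (rule order_tendstoD(2)[OF l]) simp
    then obtain j where "?Q k (\<phi> j) < ?E k + inverse (real (Suc k))"
      by (metis eventually_happens trivial_limit_sequentially)
    then show ?thesis using t by (intro exI[of _ "\<phi> j"]) auto
  qed
  then obtain \<phi> where \<phi>: "\<And>k. test_fun \<Omega> (\<phi> k)" and q: "\<And>k. ?Q k (\<phi> k) \<le> ?E k + inverse (real (Suc k))" by metis
  have Qmono: "mq \<Omega> (real (Suc k)) u \<psi> \<le> mq \<Omega> (real (Suc l)) u \<psi>" if "k \<le> l" for k l \<psi>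
    unfolding mq_def using that by (intro add_left_mono mult_right_mono) auto
  have Emono: "?E k \<le> ?E l" if "k \<le> l" for k l
    unfolding menv_def[of _ "real (Suc l)"]
  proof (rule cInf_greatest)
    fix y assume "y \<in> mq \<Omega> (real (Suc l)) u ` {\<phi>. test_fun \<Omega> \<phi>}"
    then obtain \<psi> where "test_fun \<Omega> \<psi>" "y = mq \<Omega> (real (Suc l)) u \<psi>" by blast
    then show "?E k \<le> y" using order_trans[OF moreau.menv_le[OF loc] Qmono[OF that]] by blast
  qed (use test_fun_zero in blast)
  have conv: "convergent ?E"
    by (rule Bseq_monoseq_convergent)
      (use bd moreau.menv_nonneg[OF loc] Emono in \<open>auto intro!: BseqI'[of _ C] simp: monoseq_def\<close>)
  then obtain L where L: "?E \<longlonglongrightarrow> L" by (auto simp: convergent_def)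
  have EL: "?E k \<le> L" for k by (rule incseq_le[OF monoI L]) (rule Emono)
  have mem: "memL2 \<Omega> (\<phi> k)" for k by (rule test_fun_memL2[OF \<Omega> \<phi>])
  \<comment> \<open>The penalty forces convergence to u: k + 1 times the squared distance stays
    below C + 1.\<close>
  have dist: "(L2norm \<Omega> (\<lambda>x. \<phi> k x - u x))\<^sup>2 \<le> (C + 1) * inverse (real (Suc k))" for k
  proof -
    have "real (Suc k) * (L2norm \<Omega> (\<lambda>x. \<phi> k x - u x))\<^sup>2 \<le> ?Q k (\<phi> k)" by (simp add: mq_def)
    also have "\<dots> \<le> ?E k + inverse (real (Suc k))" by (rule q)
    also have "\<dots> \<le> C + 1" using bd[of k] by (intro add_mono) (auto simp: inverse_le_1_iff)
    finally show ?thesis by (simp add: field_simps del: of_nat_Suc)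
  qed
  have lim: "(\<lambda>k. L2norm \<Omega> (\<lambda>x. \<phi> k x - u x)) \<longlonglongrightarrow> 0"
  proof (rule Lim_null_comparison)
    show "\<forall>\<^sub>F k in sequentially. norm (L2norm \<Omega> (\<lambda>x. \<phi> k x - u x)) \<le> sqrt ((C + 1) * inverse (real (Suc k)))"
      using dist by (intro always_eventually) (auto intro: real_le_rsqrt)
    have "(\<lambda>k. sqrt ((C + 1) * inverse (real (Suc k)))) \<longlonglongrightarrow> sqrt ((C + 1) * 0)"
      by (intro tendsto_intros LIMSEQ_inverse_real_of_nat)
    then show "(\<lambda>k. sqrt ((C + 1) * inverse (real (Suc k)))) \<longlonglongrightarrow> 0" by simp
  qed
  have pair: "(gnorm \<Omega> (\<lambda>j x. pd j (\<phi> l) x - pd j (\<phi> k) x))\<^sup>2 \<le> 4 * (L - ?E k + inverse (real (Suc k)))" if "k \<le> l" for k l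
  proof -
    have "(gnorm \<Omega> (\<lambda>j x. pd j (\<phi> l) x - pd j (\<phi> k) x))\<^sup>2 \<le> msq \<Omega> (real (Suc k)) (\<lambda>x. \<phi> l x - \<phi> k x)"
      unfolding msq_def pd_test_diff[OF \<phi> \<phi>] by simp
    also have "\<dots> \<le> 2 * (?Q k (\<phi> k) - ?E k) + 2 * (?Q k (\<phi> l) - ?E k)"
      by (rule moreau.msq_diff_le[OF loc \<phi> \<phi> u])
    also have "\<dots> \<le> 2 * inverse (real (Suc k)) + 2 * (L + inverse (real (Suc k)) - ?E k)"
    proof -
      have "?Q k (\<phi> l) \<le> ?Q l (\<phi> l)" by (rule Qmono[OF that])
      also have "\<dots> \<le> ?E l + inverse (real (Suc l))" by (rule q)
      also have "\<dots> \<le> L + inverse (real (Suc k))" using EL[of l] that by (intro add_mono) (auto simp: le_imp_inverse_le)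
      finally show ?thesis using q[of k] by argo
    qed
    also have "\<dots> \<le> 4 * (L - ?E k + inverse (real (Suc k)))" using EL[of k] by (simp del: of_nat_Suc)
    finally show ?thesis .
  qed
  have cauchy: "\<exists>N. \<forall>k\<ge>N. \<forall>l\<ge>N. gnorm \<Omega> (\<lambda>j x. pd j (\<phi> k) x - pd j (\<phi> l) x) < e" if e: "0 < e" for e
  proof -
    have "(\<lambda>k. 4 * (L - ?E k + inverse (real (Suc k)))) \<longlonglongrightarrow> 4 * (L - L + 0)"
      by (intro tendsto_intros L LIMSEQ_inverse_real_of_nat)
    then have "\<forall>\<^sub>F k in sequentially. 4 * (L - ?E k + inverse (real (Suc k))) < e\<^sup>2"
      by (rule order_tendstoD(2)) (use e in simp)
    then obtain N where N: "\<And>k. k \<ge> N \<Longrightarrow> 4 * (L - ?E k + inverse (real (Suc k))) < e\<^sup>2"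
      by (auto simp: eventually_sequentially)
    have *: "gnorm \<Omega> (\<lambda>j x. pd j (\<phi> l) x - pd j (\<phi> k) x) < e" if "k \<ge> N" "k \<le> l" for k l
      by (rule power2_less_imp_less[OF order.strict_trans1[OF pair[OF that(2)] N[OF that(1)]]]) (use e in simp)
    show ?thesis
    proof (intro exI[of _ N] allI impI)
      fix k l assume "k \<ge> N" "l \<ge> N"
      then show "gnorm \<Omega> (\<lambda>j x. pd j (\<phi> k) x - pd j (\<phi> l) x) < e"
        using *[of l k] *[of k l] gnorm_minus_commute[of \<Omega> "grd (\<phi> k)" "grd (\<phi> l)"] by (cases "k \<le> l") auto
    qed
  qed
  note H = memH10_limit[OF \<Omega> \<phi> u lim cauchy]
  show "memH10 \<Omega> u" by (rule H(1))
  have l1: "(\<lambda>k. (gnorm \<Omega> (grd (\<phi> k)))\<^sup>2) \<longlonglongrightarrow> (sqrt (gradL2sq \<Omega> u))\<^sup>2" by (intro tendsto_intros H(2))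
  have l2: "(\<lambda>k. ?E k + inverse (real (Suc k))) \<longlonglongrightarrow> L + 0" by (intro tendsto_intros L LIMSEQ_inverse_real_of_nat)
  have "(gnorm \<Omega> (grd (\<phi> k)))\<^sup>2 \<le> ?E k + inverse (real (Suc k))" for k
    using q[of k] unfolding mq_def by (rule order_trans[rotated]) simp
  then have "(sqrt (gradL2sq \<Omega> u))\<^sup>2 \<le> L + 0" by (intro LIMSEQ_le[OF l1 l2]) blast
  moreover have "0 \<le> gradL2sq \<Omega> u" by (simp add: gradL2sq_eq_wgrad)
  ultimately have "gradL2sq \<Omega> u \<le> L" by simp
  moreover have "L \<le> gradL2sq \<Omega> u"
    by (rule LIMSEQ_le_const2[OF L]) (use moreau.menv_le_gradL2sq[OF loc H(1)] in blast)
  ultimately show "?E \<longlonglongrightarrow> gradL2sq \<Omega> u" using L by simp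
qed

subsection \<open>Evolution in time\<close>

text \<open>On a subdivision fine enough for each increment of W to be below \<epsilon>, the squared
  increments sum to at most \<epsilon> times the total increment of W.\<close>

lemma increment_refine:
  fixes H R W :: "real \<Rightarrow> real"
  assumes st: "s \<le> t" and C: "0 \<le> C" and W: "continuous_on {s..t} W"
    and Wm: "\<And>p q. s \<le> p \<Longrightarrow> p \<le> q \<Longrightarrow> q \<le> t \<Longrightarrow> W p \<le> W q"
    and inc: "\<And>p q. s \<le> p \<Longrightarrow> p \<le> q \<Longrightarrow> q \<le> t \<Longrightarrow> H q - H p \<le> R q - R p + C * (W q - W p)\<^sup>2"
  shows "H t - H s \<le> R t - R s"
proof (rule field_le_epsilon)
  fix e :: real assume e: "0 < e"
  \<comment> \<open>The summand 1 keeps the denominator positive when C or the increment of W is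
    0.\<close>
  define \<epsilon> where "\<epsilon> = e / (C * (W t - W s) + 1)"
  have pos: "0 < C * (W t - W s) + 1" using C Wm[of s t] st by (simp add: add_nonneg_pos)
  have \<epsilon>: "0 < \<epsilon>" using e pos by (simp add: \<epsilon>_def)
  have "uniformly_continuous_on {s..t} W" by (rule compact_uniformly_continuous[OF W]) simp
  then obtain d where d: "0 < d" "\<And>p q. p \<in> {s..t} \<Longrightarrow> q \<in> {s..t} \<Longrightarrow> dist q p < d \<Longrightarrow> dist (W q) (W p) < \<epsilon>"
    unfolding uniformly_continuous_on_def using \<epsilon> by metis
  obtain n :: nat where n: "(t - s) / d < real n" using reals_Archimedean2 by blast
  have n0: "0 < n" using n d st by (cases n) (auto simp: divide_less_0_iff not_less field_simps)
  define r where "r = (t - s) / real n"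
  have r: "0 \<le> r" "r < d" using n n0 d st by (auto simp: r_def field_simps)
  define x where "x k = s + real k * r" for k :: nat
  have xn: "x n = t" "x 0 = s" using n0 by (auto simp: x_def r_def)
  have xmono: "x k \<le> x l" if "k \<le> l" for k l using that r by (simp add: x_def mult_right_mono)
  have xin: "s \<le> x k" "k \<le> n \<Longrightarrow> x k \<le> t" for k using xmono[of 0 k] xmono[of k n] xn by auto
  have step: "H (x (Suc k)) - H (x k) \<le> (R (x (Suc k)) - R (x k)) + C * \<epsilon> * (W (x (Suc k)) - W (x k))" if "k < n" for k
  proof -
    have le: "s \<le> x k" "x k \<le> x (Suc k)" "x (Suc k) \<le> t" using xin[of k] xin[of "Suc k"] xmono[of k "Suc k"] that by auto
    let ?D = "W (x (Suc k)) - W (x k)"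
    have D0: "0 \<le> ?D" using Wm[OF le] by simp
    have "dist (W (x (Suc k))) (W (x k)) < \<epsilon>"
      by (rule d(2)) (use le r in \<open>auto simp: dist_real_def x_def algebra_simps\<close>)
    then have "?D \<le> \<epsilon>" by (simp add: dist_real_def)
    then have "?D * ?D \<le> \<epsilon> * ?D" using D0 by (rule mult_right_mono)
    then have "C * ?D\<^sup>2 \<le> C * (\<epsilon> * ?D)" unfolding power2_eq_square using C by (rule mult_left_mono)
    then show ?thesis using inc[OF le] by (simp add: mult.assoc)
  qed
  have "H t - H s = (\<Sum>k<n. H (x (Suc k)) - H (x k))" by (subst sum_lessThan_telescope) (simp add: xn)
  also have "\<dots> \<le> (\<Sum>k<n. (R (x (Suc k)) - R (x k)) + C * \<epsilon> * (W (x (Suc k)) - W (x k)))"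
    by (rule sum_mono) (use step in auto)
  also have "\<dots> = (\<Sum>k<n. R (x (Suc k)) - R (x k)) + C * \<epsilon> * (\<Sum>k<n. W (x (Suc k)) - W (x k))"
    by (simp only: sum.distrib sum_distrib_left)
  also have "\<dots> = (R t - R s) + C * \<epsilon> * (W t - W s)"
    by (simp only: sum_lessThan_telescope[of "\<lambda>k. R (x k)"] sum_lessThan_telescope[of "\<lambda>k. W (x k)"] xn)
  also have "C * \<epsilon> * (W t - W s) \<le> e"
  proof -
    have "C * \<epsilon> * (W t - W s) = \<epsilon> * (C * (W t - W s))" by simp
    also have "\<dots> \<le> \<epsilon> * (C * (W t - W s) + 1)" using \<epsilon> by (intro mult_left_mono) auto
    also have "\<dots> = e" using pos by (simp add: \<epsilon>_def)
    finally show ?thesis .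
  qed
  finally show "H t - H s \<le> R t - R s + e" by simp
qed

text \<open>P itself need not be measurable, so Fubini is applied to a measurable null set
  containing its failures.\<close>

lemma AE_lborel_swap:
  fixes P :: "'a::euclidean_space \<times> 'b::euclidean_space \<Rightarrow> bool"
  assumes "AE p in lborel. P p"
  shows "AE x in lborel. AE y in lborel. P (x, y)" "AE y in lborel. AE x in lborel. P (x, y)"
proof -
  obtain N where N: "N \<in> null_sets lborel" "{p. \<not> P p} \<subseteq> N"
    using assms by (auto elim!: AE_E simp: null_sets_def)
  have ae: "AE p in lborel \<Otimes>\<^sub>M lborel. p \<notin> N" unfolding lborel_prod by (rule AE_not_in[OF N(1)])
  have 1: "AE x in lborel. AE y in lborel. (x, y) \<notin> N"
    by (rule lborel_pair.AE_pair[OF ae])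
  have "Measurable.pred (lborel \<Otimes>\<^sub>M lborel) (\<lambda>p. p \<notin> N)"
    using N(1) by (auto simp: null_sets_def lborel_prod)
  then have "{p \<in> space (lborel \<Otimes>\<^sub>M lborel). (fst p, snd p) \<notin> N} \<in> sets (lborel \<Otimes>\<^sub>M lborel)"
    by (simp add: pred_def)
  from lborel_pair.AE_commute[OF this] 1 have 2: "AE y in lborel. AE x in lborel. (x, y) \<notin> N" by simp
  show "AE x in lborel. AE y in lborel. P (x, y)"
    using 1 N(2) by (force elim: eventually_mono)
  show "AE y in lborel. AE x in lborel. P (x, y)"
    using 2 N(2) by (force elim: eventually_mono)
qed

lemma AE_lebesgue_on_open_iff:
  assumes "open S"
  shows "(AE x in lebesgue_on S. P x) \<longleftrightarrow> (AE x in lborel. x \<in> S \<longrightarrow> P x)"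
  using assms by (subst AE_restrict_space_iff) (auto simp: borel_open AE_completion_iff)

text \<open>One jointly Borel function has Borel slices in both variables, and it agrees with w for
  almost every slice in either order. This prepares the exchange of time and space
  integrals.\<close>

lemma jmeas_borel_rep:
  fixes \<Omega> :: "(real^'n::finite) set"
  assumes I: "open I" and \<Omega>: "open \<Omega>" and w: "jmeas I \<Omega> w"
  obtains w' :: "real \<Rightarrow> real^'n \<Rightarrow> complex" where "(\<lambda>p. w' (fst p) (snd p)) \<in> borel_measurable borel"
    "AE t in lborel. AE x in lborel. (if t \<in> I \<and> x \<in> \<Omega> then w t x else 0) = w' t x"
    "AE x in lborel. AE t in lborel. (if t \<in> I \<and> x \<in> \<Omega> then w t x else 0) = w' t x"
proof -
  have S: "I \<times> \<Omega> \<in> sets lebesgue" using I \<Omega> by (intro sets_completionI_sets) (simp add: borel_open open_Times)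
  obtain v where v: "v \<in> borel_measurable borel"
    "AE p in lborel. (if p \<in> I \<times> \<Omega> then w (fst p) (snd p) else 0) = v p"
    using lebesgue_on_borel_rep[OF S w[unfolded jmeas_def]] by blast
  have m: "(\<lambda>p. curry v (fst p) (snd p)) \<in> borel_measurable borel" using v(1) by simp
  show ?thesis
    by (rule that[of "curry v", OF m]) (use AE_lborel_swap[OF v(2)] in auto)
qed

text \<open>Measurability in time of the spatial norm comes from Tonelli for the Borel
  representative. The version g is nonnegative and vanishes off I everywhere, not just almost
  everywhere.\<close>

lemma L2norm_borel_rep:
  fixes \<Omega> :: "(real^'n::finite) set"
  assumes I: "open I" and \<Omega>: "open \<Omega>" and w: "jmeas I \<Omega> w" and mem: "AE t in lebesgue_on I. memL2 \<Omega> (w t)"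
  obtains g where "g \<in> borel_measurable borel" "\<And>t. 0 \<le> g t" "\<And>t. t \<notin> I \<Longrightarrow> g t = 0"
    "AE t in lborel. t \<in> I \<longrightarrow> g t = L2norm \<Omega> (w t)"
    "(\<integral>\<^sup>+t. ennreal (g t) \<partial>lborel) = (\<integral>\<^sup>+t. ennreal (L2norm \<Omega> (w t)) \<partial>lebesgue_on I)"
proof -
  obtain w' where w': "(\<lambda>p. w' (fst p) (snd p)) \<in> borel_measurable borel"
    "AE t in lborel. AE x in lborel. (if t \<in> I \<and> x \<in> \<Omega> then w t x else 0) = w' t x"
    using jmeas_borel_rep[OF I \<Omega> w] by blast
  define g where "g t = indicator I t * sqrt (enn2real (\<integral>\<^sup>+x. ennreal ((cmod (w' t x))\<^sup>2) \<partial>lborel))" for t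
  have [measurable]: "I \<in> sets borel" using I by simp
  have "(\<lambda>p. w' (fst p) (snd p)) \<in> borel_measurable (lborel \<Otimes>\<^sub>M lborel)" using w'(1) by (simp add: lborel_prod)
  then have "(\<lambda>p. ennreal ((cmod (w' (fst p) (snd p)))\<^sup>2)) \<in> borel_measurable (lborel \<Otimes>\<^sub>M lborel)" by measurable
  then have "(\<lambda>t. \<integral>\<^sup>+x. ennreal ((cmod (w' t x))\<^sup>2) \<partial>lborel) \<in> borel_measurable lborel"
    using lborel.borel_measurable_nn_integral[of "\<lambda>t x. ennreal ((cmod (w' t x))\<^sup>2)" lborel] by (simp add: case_prod_beta')
  then have [measurable]: "(\<lambda>t. \<integral>\<^sup>+x. ennreal ((cmod (w' t x))\<^sup>2) \<partial>lborel) \<in> borel_measurable borel" by simp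
  have gm: "g \<in> borel_measurable borel" unfolding g_def by measurable
  have ae: "AE t in lborel. t \<in> I \<longrightarrow> g t = L2norm \<Omega> (w t)"
    using w'(2) mem[unfolded AE_lebesgue_on_open_iff[OF I]]
  proof eventually_elim
    case (elim t)
    show ?case
    proof
      assume t: "t \<in> I"
      then have wt: "memL2 \<Omega> (w t)" using elim by simp
      have "ennreal ((L2norm \<Omega> (w t))\<^sup>2) = (\<integral>\<^sup>+x. ennreal ((cmod (w t x))\<^sup>2) \<partial>lebesgue_on \<Omega>)"
        by (rule nn_integral_L2norm_sq[OF wt, symmetric])
      also have "\<dots> = (\<integral>\<^sup>+x. ennreal ((cmod (w t x))\<^sup>2) * indicator \<Omega> x \<partial>lebesgue)"
        by (rule nn_integral_restrict_space) (use \<Omega> in \<open>simp add: borel_open\<close>)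
      also have "\<dots> = (\<integral>\<^sup>+x. ennreal ((cmod (w' t x))\<^sup>2) \<partial>lebesgue)"
        by (rule nn_integral_cong_AE, use AE_completion[OF elim(1)] in eventually_elim)
          (use t in \<open>auto simp: indicator_def split: if_splits\<close>)
      finally have "(\<integral>\<^sup>+x. ennreal ((cmod (w' t x))\<^sup>2) \<partial>lborel) = ennreal ((L2norm \<Omega> (w t))\<^sup>2)"
        by (simp add: nn_integral_completion)
      then show "g t = L2norm \<Omega> (w t)" using t by (simp add: g_def)
    qed
  qed
  show ?thesis
  proof (rule that[OF gm _ _ ae])
    show "0 \<le> g t" for t by (simp add: g_def)
    show "t \<notin> I \<Longrightarrow> g t = 0" for t by (simp add: g_def)
    have "(\<integral>\<^sup>+t. ennreal (L2norm \<Omega> (w t)) \<partial>lebesgue_on I) = (\<integral>\<^sup>+t. ennreal (L2norm \<Omega> (w t)) * indicator I t \<partial>lebesgue)"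
      by (rule nn_integral_restrict_space) (use I in \<open>simp add: borel_open\<close>)
    also have "\<dots> = (\<integral>\<^sup>+t. ennreal (g t) \<partial>lebesgue)"
      by (rule nn_integral_cong_AE, use AE_completion[OF ae] in eventually_elim) (auto simp: indicator_def g_def)
    finally show "(\<integral>\<^sup>+t. ennreal (g t) \<partial>lborel) = (\<integral>\<^sup>+t. ennreal (L2norm \<Omega> (w t)) \<partial>lebesgue_on I)"
      by (simp add: nn_integral_completion)
  qed
qed

lemma L1L2_borel_rep:
  fixes \<Omega> :: "(real^'n::finite) set"
  assumes I: "open I" and \<Omega>: "open \<Omega>" and w: "L1L2 I \<Omega> w"
  obtains g where "integrable lborel g" "\<And>t. 0 \<le> g t" "AE t in lborel. t \<in> I \<longrightarrow> memL2 \<Omega> (w t) \<and> g t = L2norm \<Omega> (w t)"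
proof -
  have w': "jmeas I \<Omega> w" "AE t in lebesgue_on I. memL2 \<Omega> (w t)"
    "(\<integral>\<^sup>+ t. ennreal (L2norm \<Omega> (w t)) \<partial>lebesgue_on I) < \<infinity>" using w by (auto simp: L1L2_def)
  obtain g where g: "g \<in> borel_measurable borel" "\<And>t. 0 \<le> g t" "AE t in lborel. t \<in> I \<longrightarrow> g t = L2norm \<Omega> (w t)"
    "(\<integral>\<^sup>+t. ennreal (g t) \<partial>lborel) = (\<integral>\<^sup>+t. ennreal (L2norm \<Omega> (w t)) \<partial>lebesgue_on I)"
    by (rule L2norm_borel_rep[OF I \<Omega> w'(1,2)]) blast
  have "integrable lborel g"
    by (rule integrableI_bounded) (use g w'(3) in auto)
  moreover have "AE t in lborel. t \<in> I \<longrightarrow> memL2 \<Omega> (w t) \<and> g t = L2norm \<Omega> (w t)"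
    using g(3) w'(2)[unfolded AE_lebesgue_on_open_iff[OF I]] by eventually_elim auto
  ultimately show ?thesis using that g(2) by blast
qed

text \<open>The evolution is given pointwise in x as a time integral. Pairing with a fixed \<psi>
  and exchanging the integrals gives a scalar absolutely continuous function, so no L2-valued
  integral is needed.\<close>

lemma evolution_pairing:
  fixes \<Omega> :: "(real^'n::finite) set" and u w :: "real \<Rightarrow> real^'n \<Rightarrow> complex"
  assumes \<Omega>: "open \<Omega>" and T: "0 < T" and w: "L1L2 {0<..<T} \<Omega> w"
    and u: "\<And>t. t \<in> {0..T} \<Longrightarrow> memL2 \<Omega> (u t)"
    and ev: "\<forall>t\<in>{0..T}. AE x in lebesgue_on \<Omega>. integrable (lebesgue_on {0..t}) (\<lambda>s. w s x) \<and>
            u t x = u 0 x + integral\<^sup>L (lebesgue_on {0..t}) (\<lambda>s. w s x)"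
    and \<psi>: "memL2 \<Omega> \<psi>"
  shows "\<exists>K. integrable lborel K \<and> (AE r in lborel. r \<in> {0<..<T} \<longrightarrow> K r = ip \<Omega> (w r) \<psi>) \<and>
    (\<forall>s t. 0 \<le> s \<longrightarrow> s \<le> t \<longrightarrow> t \<le> T \<longrightarrow> ip \<Omega> (\<lambda>x. u t x - u s x) \<psi> = (LINT r:{s<..<t}|lborel. K r))"
proof -
  let ?I = "{0<..<T}"
  have oI: "open ?I" by simp
  have SO: "\<Omega> \<in> sets lebesgue" using \<Omega> by (simp add: borel_open)
  obtain g where g: "integrable lborel g" "\<And>t. 0 \<le> g t" "AE t in lborel. t \<in> ?I \<longrightarrow> memL2 \<Omega> (w t) \<and> g t = L2norm \<Omega> (w t)"
    by (rule L1L2_borel_rep[OF oI \<Omega> w]) blast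
  obtain w' where w': "(\<lambda>p. w' (fst p) (snd p)) \<in> borel_measurable borel"
    "AE t in lborel. AE x in lborel. (if t \<in> ?I \<and> x \<in> \<Omega> then w t x else 0) = w' t x"
    "AE x in lborel. AE t in lborel. (if t \<in> ?I \<and> x \<in> \<Omega> then w t x else 0) = w' t x"
    using jmeas_borel_rep[OF oI \<Omega>] w unfolding L1L2_def by blast
  have wpair[measurable]: "(\<lambda>p. w' (fst p) (snd p)) \<in> borel_measurable (lborel \<Otimes>\<^sub>M lborel)" using w'(1) by (simp add: lborel_prod)
  have wx[measurable]: "(\<lambda>t. w' t x) \<in> borel_measurable borel" for x
    using measurable_compose[OF _ w'(1), of "\<lambda>t. (t, x)" borel] by simp
  have wt[measurable]: "w' t \<in> borel_measurable borel" for t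
    using measurable_compose[OF _ w'(1), of "\<lambda>x. (t, x)" borel] by simp
  have \<psi>m: "\<psi> \<in> borel_measurable (lebesgue_on \<Omega>)" using \<psi> by (simp add: memL2_def)
  obtain \<psi>' where \<psi>'[measurable]: "\<psi>' \<in> borel_measurable borel" and \<psi>eq: "AE x in lborel. (if x \<in> \<Omega> then \<psi> x else 0) = \<psi>' x"
    using lebesgue_on_borel_rep[OF SO \<psi>m] by blast
  define F where "F p = w' (fst p) (snd p) * cnj (\<psi>' (snd p))" for p
  have cnjm[measurable]: "(\<lambda>x. cnj (\<psi>' x)) \<in> borel_measurable borel"
    by (rule borel_measurable_continuous_on[OF _ \<psi>']) (intro continuous_intros)
  have Fm[measurable]: "F \<in> borel_measurable (lborel \<Otimes>\<^sub>M lborel)" unfolding F_def by measurable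
  have slice: "AE r in lborel. (r \<in> ?I \<longrightarrow> (\<integral>x. F (r, x) \<partial>lborel) = ip \<Omega> (w r) \<psi>)
     \<and> integrable lborel (\<lambda>x. F (r, x)) \<and> (\<integral>x. norm (F (r, x)) \<partial>lborel) \<le> g r * L2norm \<Omega> \<psi>"
    using w'(2) g(3)
  proof eventually_elim
    case (elim r)
    have Fr: "(\<lambda>x. F (r, x)) \<in> borel_measurable borel" unfolding F_def fst_conv snd_conv by measurable
    show ?case
    proof (cases "r \<in> ?I")
      case True
      then have wr: "memL2 \<Omega> (w r)" and gr: "g r = L2norm \<Omega> (w r)" using elim by auto
      have ae: "AE x in lborel. (if x \<in> \<Omega> then w r x * cnj (\<psi> x) else 0) = F (r, x)"
        using elim(1) \<psi>eq by eventually_elim (use True in \<open>auto simp: F_def split: if_splits\<close>)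
      have aen: "AE x in lborel. (if x \<in> \<Omega> then norm (w r x * cnj (\<psi> x)) else 0) = norm (F (r, x))"
        using ae by eventually_elim (auto split: if_splits)
      have i: "integrable (lebesgue_on \<Omega>) (\<lambda>x. w r x * cnj (\<psi> x))" by (rule ip_integrable[OF wr \<psi>])
      note rep = lebesgue_on_integral_rep[OF SO Fr ae borel_measurable_integrable[OF i]]
      have 1: "integrable lborel (\<lambda>x. F (r, x))" using rep(2) i by simp
      have 2: "(\<integral>x. F (r, x) \<partial>lborel) = ip \<Omega> (w r) \<psi>" using rep(1) by (simp add: ip_def)
      have "(\<integral>x. norm (F (r, x)) \<partial>lborel) = (\<integral>x. norm (w r x * cnj (\<psi> x)) \<partial>lebesgue_on \<Omega>)"
        by (rule lebesgue_on_integral_rep(1)[OF SO _ aen, symmetric])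
          (use Fr borel_measurable_integrable[OF i] in \<open>auto intro: borel_measurable_norm\<close>)
      also have "\<dots> = cmod (ip \<Omega> (\<lambda>x. complex_of_real (cmod (w r x))) (\<lambda>x. complex_of_real (cmod (\<psi> x))))"
        by (simp add: ip_def norm_mult flip: of_real_mult)
      also have "\<dots> \<le> L2norm \<Omega> (\<lambda>x. complex_of_real (cmod (w r x))) * L2norm \<Omega> (\<lambda>x. complex_of_real (cmod (\<psi> x)))"
        by (rule ip_cauchy_schwarz) (use wr \<psi> in \<open>auto simp: memL2_def\<close>)
      also have "\<dots> = g r * L2norm \<Omega> \<psi>" by (simp add: L2norm_def gr)
      finally show ?thesis using 1 2 by simp
    next
      case False
      then have z: "AE x in lborel. F (r, x) = 0"
        using elim(1) by (auto elim!: eventually_mono simp: F_def)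
      have i0: "integrable lborel (\<lambda>x. F (r, x))"
        by (rule integrable_cong_AE_imp[of lborel "\<lambda>x. 0"]) (use z Fr in \<open>auto elim: eventually_mono\<close>)
      have "(\<integral>x. norm (F (r, x)) \<partial>lborel) = 0"
        by (rule integral_eq_zero_AE) (use z in \<open>auto elim: eventually_mono\<close>)
      then show ?thesis using False i0 by (intro conjI impI) (simp_all add: g(2))
    qed
  qed
  have Fint: "integrable (lborel \<Otimes>\<^sub>M lborel) F"
  proof (rule lborel_pair.Fubini_integrable)
    show "integrable lborel (\<lambda>r. \<integral>x. norm (F (r, x)) \<partial>lborel)"
    proof (rule Bochner_Integration.integrable_bound)
      show "integrable lborel (\<lambda>r. g r * L2norm \<Omega> \<psi>)" using g(1) by simp
      have "(\<lambda>(r, x). norm (F (r, x))) \<in> borel_measurable (lborel \<Otimes>\<^sub>M lborel)" by measurable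
      then show "(\<lambda>r. \<integral>x. norm (F (r, x)) \<partial>lborel) \<in> borel_measurable lborel"
        by (rule lborel.borel_measurable_lebesgue_integral)
      show "AE r in lborel. norm (\<integral>x. norm (F (r, x)) \<partial>lborel) \<le> norm (g r * L2norm \<Omega> \<psi>)"
        using slice by eventually_elim (use g(2) in auto)
    qed
  qed (use slice in auto)
  define K where "K r = (\<integral>x. F (r, x) \<partial>lborel)" for r
  show ?thesis
  proof (intro exI conjI allI impI)
    show "integrable lborel K" unfolding K_def by (rule lborel_pair.integrable_fst'[OF Fint])
    show "AE r in lborel. r \<in> ?I \<longrightarrow> K r = ip \<Omega> (w r) \<psi>" using slice by eventually_elim (simp add: K_def)
    fix s t :: real assume st: "0 \<le> s" "s \<le> t" "t \<le> T"
    \<comment> \<open>The endpoints of the closed interval are null and are removed, since the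
      representative \<open>w'\<close> is tied to w on the open interval only.\<close>
    have rep: "AE x in lborel. x \<in> \<Omega> \<longrightarrow> integrable lborel (\<lambda>r. indicat_real {0<..<t} r *\<^sub>R w' r x) \<and>
        u t x - u 0 x = (\<integral>r. indicat_real {0<..<t} r *\<^sub>R w' r x \<partial>lborel)" if t: "0 \<le> t" "t \<le> T" for t
    proof -
      have tT: "t \<in> {0..T}" using t by simp
      show ?thesis using bspec[OF ev tT, unfolded AE_lebesgue_on_open_iff[OF \<Omega>]] w'(3)
    proof eventually_elim
      case (elim x)
      show ?case
      proof
        assume x: "x \<in> \<Omega>"
        have i: "integrable (lebesgue_on {0..t}) (\<lambda>s. w s x)" and ux: "u t x = u 0 x + integral\<^sup>L (lebesgue_on {0..t}) (\<lambda>s. w s x)"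
          using elim x by auto
        have ae: "AE r in lborel. (if r \<in> {0..t} then w r x else 0) = indicat_real {0<..<t} r *\<^sub>R w' r x"
          using elim(2) AE_lborel_singleton[of 0] AE_lborel_singleton[of t]
          by eventually_elim (use x t in \<open>auto simp: indicator_def split: if_splits\<close>)
        have m: "(\<lambda>r. indicat_real {0<..<t} r *\<^sub>R w' r x) \<in> borel_measurable borel" by measurable
        note R = lebesgue_on_integral_rep[OF _ m ae borel_measurable_integrable[OF i]]
        show "integrable lborel (\<lambda>r. indicat_real {0<..<t} r *\<^sub>R w' r x) \<and>
          u t x - u 0 x = (\<integral>r. indicat_real {0<..<t} r *\<^sub>R w' r x \<partial>lborel)"
          using R i ux by simp
      qed
    qed
    qed
    have diff: "AE x in lborel. x \<in> \<Omega> \<longrightarrow> u t x - u s x = (\<integral>r. indicat_real {s<..<t} r *\<^sub>R w' r x \<partial>lborel)"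
      using rep[OF order_trans[OF st(1,2)] st(3)] rep[OF st(1) order_trans[OF st(2,3)]]
    proof eventually_elim
      case (elim x)
      show ?case
      proof
        assume x: "x \<in> \<Omega>"
        have "u t x - u s x = (u t x - u 0 x) - (u s x - u 0 x)" by simp
        also have "\<dots> = (\<integral>r. indicat_real {0<..<t} r *\<^sub>R w' r x - indicat_real {0<..<s} r *\<^sub>R w' r x \<partial>lborel)"
          using elim x by (subst Bochner_Integration.integral_diff) auto
        also have "\<dots> = (\<integral>r. indicat_real {s<..<t} r *\<^sub>R w' r x \<partial>lborel)"
        proof (rule integral_cong_AE)
          show "AE r in lborel. indicat_real {0<..<t} r *\<^sub>R w' r x - indicat_real {0<..<s} r *\<^sub>R w' r x = indicat_real {s<..<t} r *\<^sub>R w' r x"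
            using AE_lborel_singleton[of s] by eventually_elim (use st in \<open>auto simp: indicator_def\<close>)
        qed measurable
        finally show "u t x - u s x = (\<integral>r. indicat_real {s<..<t} r *\<^sub>R w' r x \<partial>lborel)" .
      qed
    qed
    have ut: "memL2 \<Omega> (\<lambda>x. u t x - u s x)" by (intro memL2_diff u) (use st in auto)
    have m: "(\<lambda>p. indicat_real {s<..<t} (fst p) *\<^sub>R F p) \<in> borel_measurable (lborel \<Otimes>\<^sub>M lborel)" by measurable
    have mx: "(\<lambda>x. \<integral>r. indicat_real {s<..<t} r *\<^sub>R F (r, x) \<partial>lborel) \<in> borel_measurable borel"
    proof -
      have "(\<lambda>(x, r). indicat_real {s<..<t} r *\<^sub>R F (r, x)) \<in> borel_measurable (lborel \<Otimes>\<^sub>M lborel)" by measurable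
      from lborel.borel_measurable_lebesgue_integral[OF this] show ?thesis by simp
    qed
    have "ip \<Omega> (\<lambda>x. u t x - u s x) \<psi> = (\<integral>x. (\<integral>r. indicat_real {s<..<t} r *\<^sub>R F (r, x) \<partial>lborel) \<partial>lborel)"
      unfolding ip_def
    proof (rule lebesgue_on_integral_rep(1)[OF SO mx])
      show "AE x in lborel. (if x \<in> \<Omega> then (u t x - u s x) * cnj (\<psi> x) else 0) = (\<integral>r. indicat_real {s<..<t} r *\<^sub>R F (r, x) \<partial>lborel)"
        using diff \<psi>eq
      proof eventually_elim
        case (elim x)
        have "(\<integral>r. indicat_real {s<..<t} r *\<^sub>R F (r, x) \<partial>lborel) = (\<integral>r. (indicat_real {s<..<t} r *\<^sub>R w' r x) * cnj (\<psi>' x) \<partial>lborel)"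
          by (simp add: F_def)
        also have "\<dots> = (\<integral>r. indicat_real {s<..<t} r *\<^sub>R w' r x \<partial>lborel) * cnj (\<psi>' x)" by (rule integral_mult_left_zero)
        finally show ?case using elim by (auto split: if_splits)
      qed
    qed (rule borel_measurable_integrable[OF ip_integrable[OF ut \<psi>]])
    also have "\<dots> = (\<integral>r. (\<integral>x. indicat_real {s<..<t} r *\<^sub>R F (r, x) \<partial>lborel) \<partial>lborel)"
    proof (rule lborel_pair.Fubini_integral)
      have "integrable (lborel \<Otimes>\<^sub>M lborel) (\<lambda>p. indicat_real ({s<..<t} \<times> UNIV) p *\<^sub>R F p)"
        by (rule integrable_mult_indicator[OF _ Fint]) (simp add: lborel_prod borel_open open_Times)
      then show "integrable (lborel \<Otimes>\<^sub>M lborel) (\<lambda>(r, x). indicat_real {s<..<t} r *\<^sub>R F (r, x))"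
        by (simp add: case_prod_beta' indicator_times)
    qed
    also have "\<dots> = (LINT r:{s<..<t}|lborel. K r)"
      unfolding set_lebesgue_integral_def K_def by simp
    finally show "ip \<Omega> (\<lambda>x. u t x - u s x) \<psi> = (LINT r:{s<..<t}|lborel. K r)" .
  qed
qed

lemma evolution_bound:
  fixes \<Omega> :: "(real^'n::finite) set" and u w :: "real \<Rightarrow> real^'n \<Rightarrow> complex"
  assumes \<Omega>: "open \<Omega>" and T: "0 < T" and w: "L1L2 {0<..<T} \<Omega> w"
    and u: "\<And>t. t \<in> {0..T} \<Longrightarrow> memL2 \<Omega> (u t)"
    and ev: "\<forall>t\<in>{0..T}. AE x in lebesgue_on \<Omega>. integrable (lebesgue_on {0..t}) (\<lambda>s. w s x) \<and>
            u t x = u 0 x + integral\<^sup>L (lebesgue_on {0..t}) (\<lambda>s. w s x)"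
    and \<psi>: "memL2 \<Omega> \<psi>" and st: "0 \<le> s" "s \<le> t" "t \<le> T"
    and B: "integrable lborel B" and le: "AE r in lborel. r \<in> {s<..<t} \<longrightarrow> Re (ip \<Omega> (w r) \<psi>) \<le> B r"
  shows "Re (ip \<Omega> (\<lambda>x. u t x - u s x) \<psi>) \<le> (LINT r:{s<..<t}|lborel. B r)"
proof -
  obtain K where K: "integrable lborel K" "AE r in lborel. r \<in> {0<..<T} \<longrightarrow> K r = ip \<Omega> (w r) \<psi>"
    and eq: "\<And>s t. 0 \<le> s \<Longrightarrow> s \<le> t \<Longrightarrow> t \<le> T \<Longrightarrow> ip \<Omega> (\<lambda>x. u t x - u s x) \<psi> = (LINT r:{s<..<t}|lborel. K r)"
    using evolution_pairing[OF \<Omega> T w u ev \<psi>] by auto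
  have Ki: "integrable lborel (\<lambda>r. indicat_real {s<..<t} r *\<^sub>R K r)"
    by (rule integrable_mult_indicator[OF _ K(1)]) simp
  have "Re (LINT r:{s<..<t}|lborel. K r) = (\<integral>r. Re (indicat_real {s<..<t} r *\<^sub>R K r) \<partial>lborel)"
    unfolding set_lebesgue_integral_def by (rule integral_Re[OF Ki, symmetric])
  also have "\<dots> \<le> (\<integral>r. indicat_real {s<..<t} r *\<^sub>R B r \<partial>lborel)"
  proof (rule integral_mono_AE)
    show "AE r in lborel. Re (indicat_real {s<..<t} r *\<^sub>R K r) \<le> indicat_real {s<..<t} r *\<^sub>R B r"
      using K(2) le by eventually_elim (use st in \<open>auto simp: indicator_def\<close>)
    show "integrable lborel (\<lambda>r. Re (indicat_real {s<..<t} r *\<^sub>R K r))" by (rule integrable_Re[OF Ki])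
    show "integrable lborel (\<lambda>r. indicat_real {s<..<t} r *\<^sub>R B r)" by (rule integrable_mult_indicator[OF _ B]) simp
  qed
  finally show ?thesis unfolding eq[OF st] set_lebesgue_integral_def .
qed

section \<open>Integrals over time intervals, and functionals along an evolution\<close>

lemma set_integral_split:
  fixes g :: "real \<Rightarrow> real"
  assumes g: "integrable lborel g" and "s \<le> t" "t \<le> q"
  shows "(LINT r:{s<..<q}|lborel. g r) = (LINT r:{s<..<t}|lborel. g r) + (LINT r:{t<..<q}|lborel. g r)"
proof -
  have i: "integrable lborel (\<lambda>r. indicat_real A r *\<^sub>R g r)" if "A \<in> sets borel" for A
    by (rule integrable_mult_indicator[OF _ g]) (use that in simp)
  have "(LINT r:{s<..<q}|lborel. g r) = (\<integral>r. indicat_real {s<..<t} r *\<^sub>R g r + indicat_real {t<..<q} r *\<^sub>R g r \<partial>lborel)"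
    unfolding set_lebesgue_integral_def
  proof (rule integral_cong_AE)
    show "AE r in lborel. indicat_real {s<..<q} r *\<^sub>R g r = indicat_real {s<..<t} r *\<^sub>R g r + indicat_real {t<..<q} r *\<^sub>R g r"
      using AE_lborel_singleton[of t] by eventually_elim (use assms in \<open>auto simp: indicator_def\<close>)
  qed (use g in \<open>auto dest: borel_measurable_integrable\<close>)
  then show ?thesis unfolding set_lebesgue_integral_def by (simp add: i del: real_scaleR_def)
qed

lemma set_integral_continuous:
  fixes g :: "real \<Rightarrow> real"
  assumes g: "integrable lborel g"
  shows "continuous_on {s..t} (\<lambda>q. LINT r:{s<..<q}|lborel. g r)"
  unfolding continuous_on_sequentially
proof (intro allI ballI impI, elim conjE)
  fix X :: "nat \<Rightarrow> real" and q assume X: "X \<longlonglongrightarrow> q"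
  have gm[measurable]: "g \<in> borel_measurable borel" using g by (auto dest: borel_measurable_integrable)
  have "(\<lambda>n. \<integral>r. indicat_real {s<..<X n} r *\<^sub>R g r \<partial>lborel) \<longlonglongrightarrow> (\<integral>r. indicat_real {s<..<q} r *\<^sub>R g r \<partial>lborel)"
  proof (rule integral_dominated_convergence[where w = "\<lambda>r. \<bar>g r\<bar>"])
    show "AE r in lborel. (\<lambda>n. indicat_real {s<..<X n} r *\<^sub>R g r) \<longlonglongrightarrow> indicat_real {s<..<q} r *\<^sub>R g r"
      using AE_lborel_singleton[of q]
    proof eventually_elim
      case (elim r)
      have "\<forall>\<^sub>F n in sequentially. indicat_real {s<..<X n} r *\<^sub>R g r = indicat_real {s<..<q} r *\<^sub>R g r"
      proof (cases "r < q")
        case True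
        have "\<forall>\<^sub>F n in sequentially. r < X n" by (rule order_tendstoD(1)[OF X True])
        then show ?thesis by eventually_elim (use True in \<open>auto simp: indicator_def\<close>)
      next
        case False
        then have "q < r" using elim by simp
        from order_tendstoD(2)[OF X this] show ?thesis
          by eventually_elim (use False in \<open>auto simp: indicator_def\<close>)
      qed
      then show ?case by (rule tendsto_eventually)
    qed
  qed (use g in \<open>auto simp: indicator_def\<close>)
  then show "((\<lambda>q. LINT r:{s<..<q}|lborel. g r) \<circ> X) \<longlonglongrightarrow> (LINT r:{s<..<q}|lborel. g r)"
    unfolding set_lebesgue_integral_def comp_def .
qed

lemma set_integral_nonneg_mono:
  fixes g :: "real \<Rightarrow> real"
  assumes g: "integrable lborel g" "\<And>r. 0 \<le> g r"
  shows "0 \<le> (LINT r:A|lborel. g r)" "A \<in> sets borel \<Longrightarrow> (LINT r:A|lborel. g r) \<le> (\<integral>r. g r \<partial>lborel)"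
proof -
  show "0 \<le> (LINT r:A|lborel. g r)"
    unfolding set_lebesgue_integral_def by (rule Bochner_Integration.integral_nonneg) (use g in auto)
  show "(LINT r:A|lborel. g r) \<le> (\<integral>r. g r \<partial>lborel)" if "A \<in> sets borel"
    unfolding set_lebesgue_integral_def
    by (rule integral_mono) (use g integrable_mult_indicator[OF _ g(1), of A] that in \<open>auto simp: indicator_def\<close>)
qed

text \<open>An integrated chain rule for semi-concave functionals. It needs no differentiability of H, because
  the quadratic remainders disappear when the time interval is subdivided.\<close>

lemma evolution_functional:
  fixes \<Omega> :: "(real^'n::finite) set" and u w \<Phi> :: "real \<Rightarrow> real^'n \<Rightarrow> complex" and H :: "real \<Rightarrow> real"
  assumes \<Omega>: "open \<Omega>" and T: "0 < T" and w: "L1L2 {0<..<T} \<Omega> w"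
    and u: "\<And>t. t \<in> {0..T} \<Longrightarrow> memL2 \<Omega> (u t)"
    and ev: "\<forall>t\<in>{0..T}. AE x in lebesgue_on \<Omega>. integrable (lebesgue_on {0..t}) (\<lambda>s. w s x) \<and>
            u t x = u 0 x + integral\<^sup>L (lebesgue_on {0..t}) (\<lambda>s. w s x)"
    and \<Phi>: "\<And>t. t \<in> {0..T} \<Longrightarrow> memL2 \<Omega> (\<Phi> t)"
    and lip: "\<And>s t. s \<in> {0..T} \<Longrightarrow> t \<in> {0..T} \<Longrightarrow> L2norm \<Omega> (\<lambda>x. \<Phi> s x - \<Phi> t x) \<le> D * L2norm \<Omega> (\<lambda>x. u s x - u t x)"
    and nn: "0 \<le> c" "0 \<le> C" "0 \<le> D"
    and H: "\<And>s t. 0 \<le> s \<Longrightarrow> s \<le> t \<Longrightarrow> t \<le> T \<Longrightarrow> H t - H s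
       \<le> c * Re (ip \<Omega> (\<lambda>x. u t x - u s x) (\<Phi> s)) + C * (L2norm \<Omega> (\<lambda>x. u t x - u s x))\<^sup>2"
    and st: "0 \<le> s" "s \<le> t" "t \<le> T"
    and \<rho>: "integrable lborel \<rho>" and le: "AE r in lborel. r \<in> {s<..<t} \<longrightarrow> c * Re (ip \<Omega> (w r) (\<Phi> r)) \<le> \<rho> r"
  shows "H t - H s \<le> (LINT r:{s<..<t}|lborel. \<rho> r)"
proof -
  obtain g where g: "integrable lborel g" "\<And>t. 0 \<le> g t"
    "AE t in lborel. t \<in> {0<..<T} \<longrightarrow> memL2 \<Omega> (w t) \<and> g t = L2norm \<Omega> (w t)"
    by (rule L1L2_borel_rep[OF open_greaterThanLessThan \<Omega> w]) blast
  define W where "W q = (LINT r:{s<..<q}|lborel. g r)" for q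
  define R where "R q = (LINT r:{s<..<q}|lborel. \<rho> r)" for q
  note bound = evolution_bound[OF \<Omega> T w u ev]
  have Wd: "W q - W p = (LINT r:{p<..<q}|lborel. g r)" if "s \<le> p" "p \<le> q" for p q
    using set_integral_split[OF g(1) that] by (simp add: W_def)
  have Rd: "R q - R p = (LINT r:{p<..<q}|lborel. \<rho> r)" if "s \<le> p" "p \<le> q" for p q
    using set_integral_split[OF \<rho> that] by (simp add: R_def)
  have Wmono: "W p \<le> W q" if "s \<le> p" "p \<le> q" for p q
    using Wd[OF that] set_integral_nonneg_mono(1)[OF g(1,2), of "{p<..<q}"] by simp
  \<comment> \<open>The increment is paired with itself, then one factor of its norm is divided
    out.\<close>
  have norm: "L2norm \<Omega> (\<lambda>x. u q x - u p x) \<le> W q - W p" if pq: "s \<le> p" "p \<le> q" "q \<le> t" for p q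
  proof -
    let ?d = "\<lambda>x. u q x - u p x"
    have d: "memL2 \<Omega> ?d" by (intro memL2_diff u) (use pq st in auto)
    have "Re (ip \<Omega> ?d ?d) \<le> (LINT r:{p<..<q}|lborel. g r * L2norm \<Omega> ?d)"
    proof (rule bound[OF _ d])
      show "AE r in lborel. r \<in> {p<..<q} \<longrightarrow> Re (ip \<Omega> (w r) ?d) \<le> g r * L2norm \<Omega> ?d"
        using g(3)
      proof eventually_elim
        case (elim r)
        show ?case
        proof
          assume "r \<in> {p<..<q}"
          then have "memL2 \<Omega> (w r)" "g r = L2norm \<Omega> (w r)" using elim pq st by auto
          then show "Re (ip \<Omega> (w r) ?d) \<le> g r * L2norm \<Omega> ?d"
            using ip_cauchy_schwarz[OF _ d, of "w r"] complex_Re_le_cmod[of "ip \<Omega> (w r) ?d"] by simp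
        qed
      qed
    qed (use pq st g in auto)
    also have "\<dots> = (W q - W p) * L2norm \<Omega> ?d" by (simp add: Wd pq)
    finally have "L2norm \<Omega> ?d * L2norm \<Omega> ?d \<le> (W q - W p) * L2norm \<Omega> ?d"
      by (simp add: ip_self power2_eq_square)
    then show ?thesis
      using Wmono[OF pq(1,2)] by (cases "L2norm \<Omega> ?d = 0") (auto simp: mult_le_cancel_right dest: order.not_eq_order_implies_strict)
  qed
  have Wn: "L2norm \<Omega> (\<lambda>x. u p x - u q x) \<le> W q - W p" if pq: "s \<le> p" "p \<le> q" "q \<le> t" for p q
    using norm[OF that] by (subst L2norm_minus_commute)
  have "H t - H s \<le> R t - R s"
  proof (rule increment_refine[where C = "c * D + C" and W = W])
    show "continuous_on {s..t} W" unfolding W_def by (rule set_integral_continuous[OF g(1)])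
    fix p q assume pq: "s \<le> p" "p \<le> q" "q \<le> t"
    \<comment> \<open>Freezing \<Phi> at the left endpoint p costs at most D times the increment of
      W, multiplied by the norm of w(r); integrated, this is quadratic in the increment.\<close>
    let ?B = "\<lambda>r. \<rho> r + c * D * (W q - W p) * g r"
    have \<Phi>p: "memL2 \<Omega> (\<Phi> p)" by (rule \<Phi>) (use pq st in auto)
    have c\<Phi>: "memL2 \<Omega> (\<lambda>x. complex_of_real c * \<Phi> p x)" by (rule memL2_cmult[OF \<Phi>p])
    have "Re (ip \<Omega> (\<lambda>x. u q x - u p x) (\<lambda>x. complex_of_real c * \<Phi> p x)) \<le> (LINT r:{p<..<q}|lborel. ?B r)"
    proof (rule bound[OF _ c\<Phi>])
      show "integrable lborel ?B" using \<rho> g(1) by simp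
      show "AE r in lborel. r \<in> {p<..<q} \<longrightarrow> Re (ip \<Omega> (w r) (\<lambda>x. complex_of_real c * \<Phi> p x)) \<le> ?B r"
        using g(3) le
      proof eventually_elim
        case (elim r)
        show ?case
        proof
          assume r: "r \<in> {p<..<q}"
          then have wr: "memL2 \<Omega> (w r)" and gr: "g r = L2norm \<Omega> (w r)" and lr: "c * Re (ip \<Omega> (w r) (\<Phi> r)) \<le> \<rho> r"
            using elim pq st by auto
          have \<Phi>r: "memL2 \<Omega> (\<Phi> r)" by (rule \<Phi>) (use r pq st in auto)
          have m: "memL2 \<Omega> (\<lambda>x. \<Phi> p x - \<Phi> r x)" by (rule memL2_diff[OF \<Phi>p \<Phi>r])
          have "Re (ip \<Omega> (w r) (\<lambda>x. \<Phi> p x - \<Phi> r x)) \<le> L2norm \<Omega> (w r) * L2norm \<Omega> (\<lambda>x. \<Phi> p x - \<Phi> r x)"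
            using ip_cauchy_schwarz[OF wr m] complex_Re_le_cmod order_trans by blast
          also have "\<dots> \<le> g r * (D * (W q - W p))"
          proof -
            have "L2norm \<Omega> (\<lambda>x. \<Phi> p x - \<Phi> r x) \<le> D * L2norm \<Omega> (\<lambda>x. u p x - u r x)"
              by (rule lip) (use r pq st in auto)
            also have "\<dots> \<le> D * (W q - W p)"
            proof (rule mult_left_mono[OF _ nn(3)])
              have "L2norm \<Omega> (\<lambda>x. u p x - u r x) \<le> W r - W p" by (rule Wn) (use r pq in auto)
              also have "\<dots> \<le> W q - W p" using Wmono[of r q] r pq by simp
              finally show "L2norm \<Omega> (\<lambda>x. u p x - u r x) \<le> W q - W p" .
            qed
            finally show ?thesis unfolding gr by (rule mult_left_mono) simp
          qed
          finally have "c * Re (ip \<Omega> (w r) (\<lambda>x. \<Phi> p x - \<Phi> r x)) \<le> c * (g r * (D * (W q - W p)))"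
            by (rule mult_left_mono[OF _ nn(1)])
          then show "Re (ip \<Omega> (w r) (\<lambda>x. complex_of_real c * \<Phi> p x)) \<le> ?B r"
            using lr by (simp add: ip_cmult_right ip_diff_right[OF \<Phi>p \<Phi>r wr] algebra_simps)
        qed
      qed
    qed (use pq st in auto)
    also have "(LINT r:{p<..<q}|lborel. ?B r) = (R q - R p) + c * D * (W q - W p) * (W q - W p)"
    proof -
      have i: "set_integrable lborel {p<..<q} \<rho>" "set_integrable lborel {p<..<q} (\<lambda>r. c * D * (W q - W p) * g r)"
        unfolding set_integrable_def using \<rho> g(1) by (auto intro!: integrable_mult_indicator simp del: real_scaleR_def)
      show ?thesis
        unfolding set_integral_add(2)[OF i] set_integral_mult_right Wd[OF pq(1,2), symmetric] Rd[OF pq(1,2), symmetric] ..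
    qed
    finally have "c * Re (ip \<Omega> (\<lambda>x. u q x - u p x) (\<Phi> p)) \<le> (R q - R p) + c * D * (W q - W p)\<^sup>2"
      by (simp add: ip_cmult_right power2_eq_square mult.assoc)
    moreover have "C * (L2norm \<Omega> (\<lambda>x. u q x - u p x))\<^sup>2 \<le> C * (W q - W p)\<^sup>2"
      by (intro mult_left_mono power_mono norm pq nn) simp
    moreover have "H q - H p \<le> c * Re (ip \<Omega> (\<lambda>x. u q x - u p x) (\<Phi> p)) + C * (L2norm \<Omega> (\<lambda>x. u q x - u p x))\<^sup>2"
      by (rule H) (use pq st in auto)
    ultimately show "H q - H p \<le> R q - R p + (c * D + C) * (W q - W p)\<^sup>2"
      unfolding distrib_right by linarith
  qed (use st nn Wmono in auto)
  also have "R t - R s = (LINT r:{s<..<t}|lborel. \<rho> r)" by (rule Rd) (use st in auto)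
  finally show ?thesis .
qed

subsection \<open>Estimates for strong solutions\<close>

lemma CL2_tendsto:
  assumes "CL2 T \<Omega> u" "t \<in> {0..T}"
  shows "((\<lambda>s. L2norm \<Omega> (\<lambda>x. u s x - u t x)) \<longlongrightarrow> 0) (at t within {0..T})"
  using assms by (simp add: CL2_def)

lemma CL2_continuous_L2norm:
  assumes "CL2 T \<Omega> u"
  shows "continuous_on {0..T} (\<lambda>t. L2norm \<Omega> (u t))"
  unfolding continuous_on_def
proof
  fix t assume t: "t \<in> {0..T}"
  have mem: "memL2 \<Omega> (u s)" if "s \<in> {0..T}" for s using assms that by (auto simp: CL2_def)
  show "((\<lambda>t. L2norm \<Omega> (u t)) \<longlongrightarrow> L2norm \<Omega> (u t)) (at t within {0..T})"
  proof (rule LIM_zero_cancel, rule Lim_null_comparison[OF _ CL2_tendsto[OF assms t]])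
    show "\<forall>\<^sub>F s in at t within {0..T}. norm (L2norm \<Omega> (u s) - L2norm \<Omega> (u t)) \<le> L2norm \<Omega> (\<lambda>x. u s x - u t x)"
      unfolding eventually_at_filter
      by (rule always_eventually) (use L2norm_triangle_abs[OF mem mem[OF t]] in auto)
  qed
qed

lemma CL2_bounded:
  assumes "CL2 T \<Omega> u"
  obtains B where "0 \<le> B" "\<And>t. t \<in> {0..T} \<Longrightarrow> L2norm \<Omega> (u t) \<le> B"
proof -
  have "compact ((\<lambda>t. L2norm \<Omega> (u t)) ` {0..T})"
    by (rule compact_continuous_image[OF CL2_continuous_L2norm[OF assms]]) simp
  then obtain B where "\<And>y. y \<in> (\<lambda>t. L2norm \<Omega> (u t)) ` {0..T} \<Longrightarrow> norm y \<le> B"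
    using compact_imp_bounded bounded_iff by metis
  then have "L2norm \<Omega> (u t) \<le> max 0 B" if "t \<in> {0..T}" for t using that by fastforce
  then show ?thesis by (intro that[of "max 0 B"]) auto
qed

lemma nonlin_measurable [measurable]:
  assumes [measurable]: "v \<in> borel_measurable M"
  shows "(\<lambda>x. nonlin m (v x)) \<in> borel_measurable M"
  unfolding nonlin_def by measurable

text \<open>All almost-everywhere statements in time are collected on one set of full measure, with
  the nonlinear term known to be in L2 on each slice.\<close>

lemma strong_sol_slices:
  fixes \<Omega> :: "(real^'n::finite) set"
  assumes \<Omega>: "open \<Omega>" and T: "0 < T" and a: "a \<noteq> 0" and sol: "strong_sol \<Omega> V a m T f u"
  shows "\<exists>w. L1L2 {0<..<T} \<Omega> w \<and>
     (\<forall>t\<in>{0..T}. AE x in lebesgue_on \<Omega>. integrable (lebesgue_on {0..t}) (\<lambda>s. w s x) \<and>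
            u t x = u 0 x + integral\<^sup>L (lebesgue_on {0..t}) (\<lambda>s. w s x)) \<and>
     (AE r in lborel. r \<in> {0<..<T} \<longrightarrow> memH10 \<Omega> (u r) \<and> memL2 \<Omega> (w r) \<and> memL2 \<Omega> (f r) \<and>
        (\<exists>l U. memL2 \<Omega> l \<and> weak_lap \<Omega> (u r) l \<and> memL2 \<Omega> U \<and> is_nonlin \<Omega> m (u r) U \<and>
          (AE x in lebesgue_on \<Omega>. \<i> * w r x + l x + complex_of_real V * u r x + a * U x = f r x)))"
proof -
  let ?I = "{0<..<T}"
  obtain B where f: "L1L2 ?I \<Omega> f" and H: "AE t in lebesgue_on ?I. memH10 \<Omega> (u t) \<and> H1norm \<Omega> (u t) \<le> B"
    using sol unfolding strong_sol_def by blast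
  from sol obtain w lap U where w: "L1L2 ?I \<Omega> w" and
    ev: "\<forall>t\<in>{0..T}. AE x in lebesgue_on \<Omega>. integrable (lebesgue_on {0..t}) (\<lambda>s. w s x) \<and>
            u t x = u 0 x + integral\<^sup>L (lebesgue_on {0..t}) (\<lambda>s. w s x)" and
    lap: "L1L2 ?I \<Omega> lap" "AE t in lebesgue_on ?I. weak_lap \<Omega> (u t) (lap t)" and
    U: "if m = 0 then
           (AE p in lebesgue_on (?I \<times> \<Omega>).
              cmod (U (fst p) (snd p)) \<le> 1 \<and>
              (u (fst p) (snd p) \<noteq> 0 \<longrightarrow>
                 U (fst p) (snd p) = u (fst p) (snd p) / complex_of_real (cmod (u (fst p) (snd p)))))
         else (\<forall>t x. U t x = nonlin m (u t x))" and
    eq: "AE t in lebesgue_on ?I. AE x in lebesgue_on \<Omega>.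
           \<i> * w t x + lap t x + complex_of_real V * u t x + a * U t x = f t x"
    unfolding strong_sol_def by blast
  have mems: "AE t in lebesgue_on ?I. memL2 \<Omega> (w t)" "AE t in lebesgue_on ?I. memL2 \<Omega> (lap t)"
    "AE t in lebesgue_on ?I. memL2 \<Omega> (f t)"
    using w lap f by (auto simp: L1L2_def)
  have U0: "AE r in lborel. r \<in> ?I \<longrightarrow> m = 0 \<longrightarrow> (AE x in lebesgue_on \<Omega>. cmod (U r x) \<le> 1 \<and> (u r x \<noteq> 0 \<longrightarrow> U r x = u r x / complex_of_real (cmod (u r x))))"
  proof (cases "m = 0")
    case True
    have o: "open (?I \<times> \<Omega>)" using \<Omega> by (simp add: open_Times)
    from U True have "AE p in lborel. p \<in> ?I \<times> \<Omega> \<longrightarrow> (cmod (U (fst p) (snd p)) \<le> 1 \<and>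
              (u (fst p) (snd p) \<noteq> 0 \<longrightarrow>
                 U (fst p) (snd p) = u (fst p) (snd p) / complex_of_real (cmod (u (fst p) (snd p)))))"
      unfolding AE_lebesgue_on_open_iff[OF o] by simp
    from AE_lborel_swap(1)[OF this] show ?thesis
    proof eventually_elim
      case (elim r)
      show ?case
      proof (intro impI)
        assume "r \<in> ?I"
        show "AE x in lebesgue_on \<Omega>. cmod (U r x) \<le> 1 \<and> (u r x \<noteq> 0 \<longrightarrow> U r x = u r x / complex_of_real (cmod (u r x)))"
          unfolding AE_lebesgue_on_open_iff[OF \<Omega>] using elim by eventually_elim (use \<open>r \<in> ?I\<close> in auto)
      qed
    qed
  qed simp
  have "AE r in lborel. r \<in> ?I \<longrightarrow> memH10 \<Omega> (u r) \<and> memL2 \<Omega> (w r) \<and> memL2 \<Omega> (f r) \<and>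
        (\<exists>l U. memL2 \<Omega> l \<and> weak_lap \<Omega> (u r) l \<and> memL2 \<Omega> U \<and> is_nonlin \<Omega> m (u r) U \<and>
          (AE x in lebesgue_on \<Omega>. \<i> * w r x + l x + complex_of_real V * u r x + a * U x = f r x))"
    using H[unfolded AE_lebesgue_on_open_iff[OF open_greaterThanLessThan]] mems[unfolded AE_lebesgue_on_open_iff[OF open_greaterThanLessThan]]
      lap(2)[unfolded AE_lebesgue_on_open_iff[OF open_greaterThanLessThan]] eq[unfolded AE_lebesgue_on_open_iff[OF open_greaterThanLessThan]] U0
  proof eventually_elim
    case (elim r)
    show ?case
    proof
      assume r: "r \<in> ?I"
      then have h: "memH10 \<Omega> (u r)" "memL2 \<Omega> (w r)" "memL2 \<Omega> (lap r)" "memL2 \<Omega> (f r)" "weak_lap \<Omega> (u r) (lap r)"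
        "AE x in lebesgue_on \<Omega>. \<i> * w r x + lap r x + complex_of_real V * u r x + a * U r x = f r x"
        "m = 0 \<longrightarrow> (AE x in lebesgue_on \<Omega>. cmod (U r x) \<le> 1 \<and> (u r x \<noteq> 0 \<longrightarrow> U r x = u r x / complex_of_real (cmod (u r x))))"
        using elim by auto
      have uL: "memL2 \<Omega> (u r)" by (rule memH10_memL2[OF h(1)])
      \<comment> \<open>Joint measurability alone does not place a slice of U in L2. Solving the
        equation for it does, since a is nonzero and all other terms are in L2.\<close>
      define U' where "U' x = (1 / a) * (f r x - \<i> * w r x - lap r x - complex_of_real V * u r x)" for x
      have U'L: "memL2 \<Omega> U'" unfolding U'_def by (intro memL2_cmult memL2_diff h uL)
      have UU: "AE x in lebesgue_on \<Omega>. U' x = U r x"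
        using h(6)
      proof eventually_elim
        case (elim x)
        have "f r x - \<i> * w r x - lap r x - complex_of_real V * u r x = a * U r x"
          unfolding elim[symmetric] by simp
        then show ?case using a by (simp add: U'_def)
      qed
      have "\<exists>U. memL2 \<Omega> U \<and> is_nonlin \<Omega> m (u r) U \<and>
          (AE x in lebesgue_on \<Omega>. \<i> * w r x + lap r x + complex_of_real V * u r x + a * U x = f r x)"
      proof (cases "m = 0")
        case True
        have "is_nonlin \<Omega> m (u r) U'"
        proof -
          have "AE x in lebesgue_on \<Omega>. cmod (U' x) \<le> 1 \<and> (u r x \<noteq> 0 \<longrightarrow> U' x = u r x / complex_of_real (cmod (u r x)))"
            using mp[OF h(7) True] UU by eventually_elim simp
          then show ?thesis using True by (simp add: is_nonlin_def)
        qed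
        moreover have "AE x in lebesgue_on \<Omega>. \<i> * w r x + lap r x + complex_of_real V * u r x + a * U' x = f r x"
          using h(6) UU by eventually_elim simp
        ultimately show ?thesis using U'L by blast
      next
        case False
        \<comment> \<open>For m > 0 \<open>is_nonlin\<close> demands equality everywhere, so U
          itself is kept and inherits membership in L2 from \<open>U'\<close>.\<close>
        have nl: "U r x = nonlin m (u r x)" for x using U False by simp
        have um: "u r \<in> borel_measurable (lebesgue_on \<Omega>)" using uL by (simp add: memL2_def)
        have "memL2 \<Omega> (U r)"
          by (rule memL2_cong_AE[OF U'L UU]) (use nonlin_measurable[OF um] in \<open>simp add: nl[abs_def]\<close>)
        moreover have "is_nonlin \<Omega> m (u r) (U r)" using False nl by (simp add: is_nonlin_def)
        ultimately show ?thesis using h(6) by blast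
      qed
      then show "memH10 \<Omega> (u r) \<and> memL2 \<Omega> (w r) \<and> memL2 \<Omega> (f r) \<and>
        (\<exists>l U. memL2 \<Omega> l \<and> weak_lap \<Omega> (u r) l \<and> memL2 \<Omega> U \<and> is_nonlin \<Omega> m (u r) U \<and>
          (AE x in lebesgue_on \<Omega>. \<i> * w r x + l x + complex_of_real V * u r x + a * U x = f r x))"
        using h by blast
    qed
  qed
  with w ev show ?thesis by blast
qed

lemma strong_sol_CL2: "strong_sol \<Omega> V a m T f u \<Longrightarrow> CL2 T \<Omega> u"
  by (simp add: strong_sol_def)

lemma Cset_nonzero: "a \<in> Cset m \<Longrightarrow> a \<noteq> 0"
  by (auto simp: Cset_def)

text \<open>Formally the square root of the envelope grows at rate k + sqrt \<mu> h. As that root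
  may vanish, the envelope itself is estimated with the root replaced by its supremum, and the
  resulting quadratic inequality is solved; this is the origin of the factor 2.\<close>

lemma strong_menv_bound:
  fixes \<Omega> :: "(real^'n::finite) set"
  assumes \<Omega>: "open \<Omega>" and T: "0 < T" and a: "a \<in> Cset m" and m: "0 \<le> m" "m < 1"
    and fin: "m = 0 \<longrightarrow> emeasure lebesgue \<Omega> < \<infinity>" and sol: "strong_sol \<Omega> V a m T g u" and \<mu>: "0 < \<mu>"
    and f: "AE r in lborel. r \<in> {0<..<T} \<longrightarrow> memH10 \<Omega> (f r) \<and> gnorm \<Omega> (wgrad \<Omega> (f r)) \<le> k r"
    and h: "AE r in lborel. r \<in> {0<..<T} \<longrightarrow> L2norm \<Omega> (\<lambda>x. g r x - f r x) \<le> h r"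
    and k: "integrable lborel k" "\<And>r. 0 \<le> k r" and hi: "integrable lborel h" "\<And>r. 0 \<le> h r"
    and t: "t \<in> {0..T}"
  shows "sqrt (menv \<Omega> \<mu> (u t)) \<le> sqrt (menv \<Omega> \<mu> (u 0)) + 2 * ((\<integral>r. k r \<partial>lborel) + sqrt \<mu> * (\<integral>r. h r \<partial>lborel))"
proof -
  interpret moreau \<Omega> \<mu> using \<Omega> \<mu> by unfold_locales
  obtain w where w: "L1L2 {0<..<T} \<Omega> w" and
    ev: "\<forall>t\<in>{0..T}. AE x in lebesgue_on \<Omega>. integrable (lebesgue_on {0..t}) (\<lambda>s. w s x) \<and>
            u t x = u 0 x + integral\<^sup>L (lebesgue_on {0..t}) (\<lambda>s. w s x)" and
    sl: "AE r in lborel. r \<in> {0<..<T} \<longrightarrow> memH10 \<Omega> (u r) \<and> memL2 \<Omega> (w r) \<and> memL2 \<Omega> (g r) \<and>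
        (\<exists>l U. memL2 \<Omega> l \<and> weak_lap \<Omega> (u r) l \<and> memL2 \<Omega> U \<and> is_nonlin \<Omega> m (u r) U \<and>
          (AE x in lebesgue_on \<Omega>. \<i> * w r x + l x + complex_of_real V * u r x + a * U x = g r x))"
    using strong_sol_slices[OF \<Omega> T Cset_nonzero[OF a] sol] by blast
  note cl = strong_sol_CL2[OF sol]
  have uL: "memL2 \<Omega> (u t)" if "t \<in> {0..T}" for t using cl that by (auto simp: CL2_def)
  have "\<exists>p. is_prox \<Omega> \<mu> (u t) (fst p) (snd p)" if "t \<in> {0..T}" for t
    using prox_exists[OF uL[OF that]] by auto
  then obtain p where p: "\<And>t. t \<in> {0..T} \<Longrightarrow> is_prox \<Omega> \<mu> (u t) (fst (p t)) (snd (p t))" by metis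
  define v where "v t = snd (p t)" for t
  have pv: "is_prox \<Omega> \<mu> (u t) (fst (p t)) (v t)" if "t \<in> {0..T}" for t using p[OF that] by (simp add: v_def)
  have vL: "memL2 \<Omega> (v t)" if "t \<in> {0..T}" for t by (rule is_proxD(3)[OF pv[OF that]])
  let ?H = "\<lambda>t. menv \<Omega> \<mu> (u t)"
  obtain B where B: "0 \<le> B" "\<And>t. t \<in> {0..T} \<Longrightarrow> L2norm \<Omega> (u t) \<le> B" using CL2_bounded[OF cl] by blast
  have HB: "sqrt (?H t) \<le> sqrt (\<mu> * B\<^sup>2)" if "t \<in> {0..T}" for t
  proof -
    have "?H t \<le> \<mu> * (L2norm \<Omega> (u t))\<^sup>2" by (rule menv_le_L2)
    also have "\<dots> \<le> \<mu> * B\<^sup>2" using B(2)[OF that] \<mu> by (intro mult_left_mono power_mono) auto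
    finally show ?thesis by simp
  qed
  \<comment> \<open>Finite since the envelope is at most \<mu> times the squared L2 norm, which is
    bounded on [0, T].\<close>
  define M where "M = Sup ((\<lambda>t. sqrt (?H t)) ` {0..T})"
  have M: "sqrt (?H t) \<le> M" if "t \<in> {0..T}" for t
    unfolding M_def by (rule cSup_upper) (use that HB in \<open>auto intro!: bdd_aboveI[of _ "sqrt (\<mu> * B\<^sup>2)"]\<close>)
  have M0: "0 \<le> M" using M[of 0] T menv_nonneg[of "u 0"] by (auto intro: order_trans[rotated])
  define K where "K = (\<integral>r. k r \<partial>lborel) + sqrt \<mu> * (\<integral>r. h r \<partial>lborel)"
  have ki: "integrable lborel (\<lambda>r. k r + sqrt \<mu> * h r)" "\<And>r. 0 \<le> k r + sqrt \<mu> * h r"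
    using k hi \<mu> by auto
  have Keq: "K = (\<integral>r. k r + sqrt \<mu> * h r \<partial>lborel)" using k hi by (simp add: K_def)
  have K0: "0 \<le> K" unfolding Keq by (rule Bochner_Integration.integral_nonneg) (use ki in auto)
  define \<rho> where "\<rho> r = 2 * M * (k r + sqrt \<mu> * h r)" for r
  have grow: "?H t - ?H 0 \<le> 2 * M * K" if t: "t \<in> {0..T}" for t
  proof -
    have "?H t - ?H 0 \<le> (LINT r:{0<..<t}|lborel. \<rho> r)"
    \<comment> \<open>The constants c and C come from \<open>menv_increment\<close>; D = 2 because u
      and, by nonexpansiveness, v contribute one each.\<close>
    proof (rule evolution_functional[OF \<Omega> T w uL ev, where \<Phi> = "\<lambda>s x. u s x - v s x" and c = "2 * \<mu>" and C = \<mu> and D = 2])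
      show "memL2 \<Omega> (\<lambda>x. u s x - v s x)" if "s \<in> {0..T}" for s by (intro memL2_diff uL vL that)
      show "L2norm \<Omega> (\<lambda>x. u s x - v s x - (u q x - v q x)) \<le> 2 * L2norm \<Omega> (\<lambda>x. u s x - u q x)" if "s \<in> {0..T}" "q \<in> {0..T}" for s q
      proof -
        have "(\<lambda>x. u s x - v s x - (u q x - v q x)) = (\<lambda>x. (u s x - u q x) - (v s x - v q x))" by (simp add: algebra_simps)
        then have "L2norm \<Omega> (\<lambda>x. u s x - v s x - (u q x - v q x)) \<le> L2norm \<Omega> (\<lambda>x. u s x - u q x) + L2norm \<Omega> (\<lambda>x. v s x - v q x)"
          using L2norm_triangle_diff[of \<Omega> "\<lambda>x. u s x - u q x" "\<lambda>x. v s x - v q x"] uL vL that by (simp add: memL2_diff)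
        then show ?thesis using prox_nonexpansive[OF pv[OF that(1)] uL[OF that(1)] pv[OF that(2)] uL[OF that(2)]] by simp
      qed
      show "?H q - ?H s \<le> 2 * \<mu> * Re (ip \<Omega> (\<lambda>x. u q x - u s x) (\<lambda>x. u s x - v s x)) + \<mu> * (L2norm \<Omega> (\<lambda>x. u q x - u s x))\<^sup>2"
        if "0 \<le> s" "s \<le> q" "q \<le> T" for s q
      proof -
        have s: "s \<in> {0..T}" "q \<in> {0..T}" using that by auto
        have "Re (ip \<Omega> (\<lambda>x. u s x - v s x) (\<lambda>x. u q x - u s x)) = Re (ip \<Omega> (\<lambda>x. u q x - u s x) (\<lambda>x. u s x - v s x))"
          by (subst ip_commute) simp
        then show ?thesis using menv_increment[OF pv[OF s(1)] uL[OF s(1)] uL[OF s(2)]] by (simp add: algebra_simps)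
      qed
      show "integrable lborel \<rho>" unfolding \<rho>_def using ki by simp
      show "AE r in lborel. r \<in> {0<..<t} \<longrightarrow> 2 * \<mu> * Re (ip \<Omega> (w r) (\<lambda>x. u r x - v r x)) \<le> \<rho> r"
        using sl f h
      proof eventually_elim
        case (elim r)
        show ?case
        proof
          assume "r \<in> {0<..<t}"
          then have r: "r \<in> {0<..<T}" "r \<in> {0..T}" using t by auto
          then obtain l U where A: "memH10 \<Omega> (u r)" "memL2 \<Omega> (w r)" "memL2 \<Omega> (g r)" "memL2 \<Omega> l" "weak_lap \<Omega> (u r) l"
            "memL2 \<Omega> U" "is_nonlin \<Omega> m (u r) U"
            "AE x in lebesgue_on \<Omega>. \<i> * w r x + l x + complex_of_real V * u r x + a * U x = g r x"
            "memH10 \<Omega> (f r)" "gnorm \<Omega> (wgrad \<Omega> (f r)) \<le> k r" "L2norm \<Omega> (\<lambda>x. g r x - f r x) \<le> h r"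
            using elim by blast
          have "\<mu> * Re (ip \<Omega> (\<lambda>x. u r x - v r x) (w r))
             \<le> sqrt (?H r) * (gnorm \<Omega> (wgrad \<Omega> (f r)) + sqrt \<mu> * L2norm \<Omega> (\<lambda>x. g r x - f r x))"
            by (rule prox_evolution[OF pv[OF r(2)] A(1,5,4,6,3,9) a m A(7) fin A(2,8)])
          also have "\<dots> \<le> M * (k r + sqrt \<mu> * h r)"
            using \<mu> M[OF r(2)] A(10,11) M0 by (intro mult_mono add_mono mult_left_mono) auto
          finally have "\<mu> * Re (ip \<Omega> (w r) (\<lambda>x. u r x - v r x)) \<le> M * (k r + sqrt \<mu> * h r)"
            by (subst ip_commute) simp
          then show "2 * \<mu> * Re (ip \<Omega> (w r) (\<lambda>x. u r x - v r x)) \<le> \<rho> r" by (simp add: \<rho>_def)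
        qed
      qed
    qed (use \<mu> t in auto)
    also have "\<dots> = 2 * M * (LINT r:{0<..<t}|lborel. k r + sqrt \<mu> * h r)"
      unfolding \<rho>_def by simp
    also have "\<dots> \<le> 2 * M * K"
      unfolding Keq using M0 by (intro mult_left_mono set_integral_nonneg_mono(2) ki) auto
    finally show ?thesis .
  qed
  have "M \<le> sqrt (?H 0 + 2 * M * K)"
    unfolding M_def[symmetric]
  proof (subst M_def, rule cSup_least)
    fix y assume "y \<in> (\<lambda>t. sqrt (?H t)) ` {0..T}"
    then obtain t where t: "t \<in> {0..T}" "y = sqrt (?H t)" by blast
    have "?H t \<le> ?H 0 + 2 * M * K" using grow[OF t(1)] by simp
    then show "y \<le> sqrt (?H 0 + 2 * M * K)" using t(2) by simp
  qed (use T in auto)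
  then have "M\<^sup>2 \<le> (sqrt (?H 0 + 2 * M * K))\<^sup>2" using M0 by (intro power_mono) auto
  then have M2: "M * M \<le> ?H 0 + 2 * M * K"
    using menv_nonneg[of "u 0"] M0 K0 by (simp add: power2_eq_square)
  \<comment> \<open>A larger M would contradict the quadratic inequality \<open>M2\<close>.\<close>
  have "M \<le> sqrt (?H 0) + 2 * K"
  proof (rule ccontr)
    assume "\<not> M \<le> sqrt (?H 0) + 2 * K"
    then have gt: "sqrt (?H 0) + 2 * K < M" by simp
    have h0: "0 \<le> sqrt (?H 0)" using menv_nonneg by simp
    have Mpos: "0 < M" using gt h0 K0 by linarith
    have "?H 0 = sqrt (?H 0) * sqrt (?H 0)" using menv_nonneg[of "u 0"] by simp
    also have "\<dots> \<le> sqrt (?H 0) * M" using gt K0 h0 by (intro mult_left_mono) linarith+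
    finally have "?H 0 + 2 * M * K \<le> M * (sqrt (?H 0) + 2 * K)" by (simp add: algebra_simps)
    also have "\<dots> < M * M" using gt Mpos by (intro mult_strict_left_mono)
    finally show False using M2 by simp
  qed
  then show ?thesis using M[OF t] by (simp add: K_def)
qed

section \<open>The energy inequality for strong solutions\<close>

lemma power_integral_rep:
  fixes \<Omega> :: "(real^'n::finite) set"
  assumes I: "open I" and \<Omega>: "open \<Omega>" and u: "jmeas I \<Omega> u" and p: "0 < p"
  obtains P :: "real \<Rightarrow> ennreal" where "P \<in> borel_measurable borel"
    "AE t in lborel. t \<in> I \<longrightarrow> P t = (\<integral>\<^sup>+x. ennreal (cmod (u t x) powr p) \<partial>lebesgue_on \<Omega>)"
proof -
  obtain u' where u': "(\<lambda>p. u' (fst p) (snd p)) \<in> borel_measurable borel"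
    "AE t in lborel. AE x in lborel. (if t \<in> I \<and> x \<in> \<Omega> then u t x else 0) = u' t x"
    using jmeas_borel_rep[OF I \<Omega> u] by blast
  define P where "P t = (\<integral>\<^sup>+x. ennreal (cmod (u' t x) powr p) \<partial>lborel)" for t
  have "(\<lambda>p. u' (fst p) (snd p)) \<in> borel_measurable (lborel \<Otimes>\<^sub>M lborel)" using u'(1) by (simp add: lborel_prod)
  then have "(\<lambda>q. ennreal (cmod (u' (fst q) (snd q)) powr p)) \<in> borel_measurable (lborel \<Otimes>\<^sub>M lborel)" by measurable
  then have "P \<in> borel_measurable lborel"
    unfolding P_def using lborel.borel_measurable_nn_integral[of "\<lambda>t x. ennreal (cmod (u' t x) powr p)" lborel]
    by (simp add: case_prod_beta')
  then have Pm: "P \<in> borel_measurable borel" by simp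
  have "AE t in lborel. t \<in> I \<longrightarrow> P t = (\<integral>\<^sup>+x. ennreal (cmod (u t x) powr p) \<partial>lebesgue_on \<Omega>)"
    using u'(2)
  proof eventually_elim
    case (elim t)
    show ?case
    proof
      assume t: "t \<in> I"
      have "(\<integral>\<^sup>+x. ennreal (cmod (u t x) powr p) \<partial>lebesgue_on \<Omega>) = (\<integral>\<^sup>+x. ennreal (cmod (u t x) powr p) * indicator \<Omega> x \<partial>lebesgue)"
        by (rule nn_integral_restrict_space) (use \<Omega> in \<open>simp add: borel_open\<close>)
      also have "\<dots> = (\<integral>\<^sup>+x. ennreal (cmod (u' t x) powr p) \<partial>lebesgue)"
        by (rule nn_integral_cong_AE, use AE_completion[OF elim] in eventually_elim)
          (use t p in \<open>auto simp: indicator_def split: if_splits\<close>)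
      finally show "P t = (\<integral>\<^sup>+x. ennreal (cmod (u t x) powr p) \<partial>lebesgue_on \<Omega>)"
        by (simp add: P_def nn_integral_completion)
    qed
  qed
  with Pm show ?thesis by (rule that)
qed

text \<open>The nonlinearity dissipates Im a times the integral of |u|^(1+m), and the forcing f
  takes back at most F times it. The dissipation appears only through a bounded Borel minorant q,
  which keeps its time integral finite; the distance h between g and f is an error term.\<close>

lemma strong_energy:
  fixes \<Omega> :: "(real^'n::finite) set"
  assumes \<Omega>: "open \<Omega>" and T: "0 < T" and a: "a \<in> Cset m" and m: "0 \<le> m" "m < 1"
    and sol: "strong_sol \<Omega> V a m T g u"
    and f: "AE r in lborel. r \<in> {0<..<T} \<longrightarrow> memL2 \<Omega> (f r)"
    and fF: "AE r in lborel. r \<in> {s<..<t} \<longrightarrow> (AE x in lebesgue_on \<Omega>. cmod (f r x) \<le> F)"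
    and mF: "m = 0 \<or> F = 0" and aF: "F \<le> Im a"
    and h: "AE r in lborel. r \<in> {0<..<T} \<longrightarrow> L2norm \<Omega> (\<lambda>x. g r x - f r x) \<le> h r"
    and hi: "integrable lborel h" "\<And>r. 0 \<le> h r"
    and B: "0 \<le> B" "\<And>t. t \<in> {0..T} \<Longrightarrow> L2norm \<Omega> (u t) \<le> B"
    and st: "0 \<le> s" "s \<le> t" "t \<le> T"
    and q: "q \<in> borel_measurable borel" "\<And>r. 0 \<le> q r" "\<And>r. q r \<le> k"
      "AE r in lborel. r \<in> {0<..<T} \<longrightarrow> ennreal (q r) \<le> (\<integral>\<^sup>+x. ennreal (cmod (u r x) powr (1 + m)) \<partial>lebesgue_on \<Omega>)"
  shows "2 * (Im a - F) * (LINT r:{s<..<t}|lborel. q r) \<le> (L2norm \<Omega> (u s))\<^sup>2 - (L2norm \<Omega> (u t))\<^sup>2 + 2 * B * (\<integral>r. h r \<partial>lborel)"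
proof -
  obtain w where w: "L1L2 {0<..<T} \<Omega> w" and
    ev: "\<forall>t\<in>{0..T}. AE x in lebesgue_on \<Omega>. integrable (lebesgue_on {0..t}) (\<lambda>s. w s x) \<and>
            u t x = u 0 x + integral\<^sup>L (lebesgue_on {0..t}) (\<lambda>s. w s x)" and
    sl: "AE r in lborel. r \<in> {0<..<T} \<longrightarrow> memH10 \<Omega> (u r) \<and> memL2 \<Omega> (w r) \<and> memL2 \<Omega> (g r) \<and>
        (\<exists>l U. memL2 \<Omega> l \<and> weak_lap \<Omega> (u r) l \<and> memL2 \<Omega> U \<and> is_nonlin \<Omega> m (u r) U \<and>
          (AE x in lebesgue_on \<Omega>. \<i> * w r x + l x + complex_of_real V * u r x + a * U x = g r x))"
    using strong_sol_slices[OF \<Omega> T Cset_nonzero[OF a] sol] by blast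
  have uL: "memL2 \<Omega> (u t)" if "t \<in> {0..T}" for t using strong_sol_CL2[OF sol] that by (auto simp: CL2_def)
  have k0: "0 \<le> k" using q(2,3)[of 0] by simp
  let ?q = "\<lambda>r. indicat_real {s<..<t} r *\<^sub>R q r"
  have qi: "integrable lborel ?q"
  proof (rule Bochner_Integration.integrable_bound[of _ "\<lambda>r. k * indicat_real {s<..<t} r"])
    show "integrable lborel (\<lambda>r. k * indicat_real {s<..<t} r)"
      by (intro integrable_mult_right integrable_real_indicator) (use st in auto)
  qed (use q k0 in \<open>auto simp: indicator_def\<close>)
  define \<rho> where "\<rho> r = 2 * B * h r - 2 * (Im a - F) * ?q r" for r
  have "(L2norm \<Omega> (u t))\<^sup>2 - (L2norm \<Omega> (u s))\<^sup>2 \<le> (LINT r:{s<..<t}|lborel. \<rho> r)"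
  proof (rule evolution_functional[OF \<Omega> T w uL ev, where \<Phi> = u and c = 2 and C = 1 and D = 1])
    show "(L2norm \<Omega> (u q))\<^sup>2 - (L2norm \<Omega> (u s))\<^sup>2 \<le> 2 * Re (ip \<Omega> (\<lambda>x. u q x - u s x) (u s)) + 1 * (L2norm \<Omega> (\<lambda>x. u q x - u s x))\<^sup>2"
      if "0 \<le> s" "s \<le> q" "q \<le> T" for s q
    proof -
      have m: "memL2 \<Omega> (u s)" "memL2 \<Omega> (u q)" using uL that by auto
      have "(L2norm \<Omega> (\<lambda>x. (u q x - u s x) + u s x))\<^sup>2 = (L2norm \<Omega> (\<lambda>x. u q x - u s x))\<^sup>2 + 2 * Re (ip \<Omega> (\<lambda>x. u q x - u s x) (u s)) + (L2norm \<Omega> (u s))\<^sup>2"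
        by (rule L2norm_add_sq) (intro memL2_diff m)+
      then show ?thesis by simp
    qed
    show "integrable lborel \<rho>" unfolding \<rho>_def using hi(1) qi by simp
    show "AE r in lborel. r \<in> {s<..<t} \<longrightarrow> 2 * Re (ip \<Omega> (w r) (u r)) \<le> \<rho> r"
      using sl f fF h q(4)
    proof eventually_elim
      case (elim r)
      show ?case
      proof
        assume r0: "r \<in> {s<..<t}"
        then have r: "r \<in> {0<..<T}" "r \<in> {0..T}" using st by auto
        then obtain l U where A: "memH10 \<Omega> (u r)" "memL2 \<Omega> (w r)" "memL2 \<Omega> (g r)" "memL2 \<Omega> l" "weak_lap \<Omega> (u r) l"
          "memL2 \<Omega> U" "is_nonlin \<Omega> m (u r) U"
          "AE x in lebesgue_on \<Omega>. \<i> * w r x + l x + complex_of_real V * u r x + a * U x = g r x"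
          "memL2 \<Omega> (f r)" "L2norm \<Omega> (\<lambda>x. g r x - f r x) \<le> h r"
          using elim by blast
        have fr: "AE x in lebesgue_on \<Omega>. cmod (f r x) \<le> F" using elim r0 by blast
        note uH = A(1) and uLr = uL[OF r(2)]
        note mem = A(2,3,4,6,9) uLr
        have "ip \<Omega> (w r) (u r) = ip \<Omega> (\<lambda>x. \<i> * (l x + complex_of_real V * u r x + a * U x - g r x)) (u r)"
        proof (rule ip_cong_AE)
          show "AE x in lebesgue_on \<Omega>. w r x = \<i> * (l x + complex_of_real V * u r x + a * U x - g r x)"
            using A(8)
          proof eventually_elim
            case (elim x)
            then have iw: "\<i> * w r x = g r x - (l x + complex_of_real V * u r x + a * U x)"
              by (simp only: eq_diff_eq add.assoc)
            have "w r x = - (\<i> * (\<i> * w r x))" by simp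
            also have "\<dots> = - (\<i> * (g r x - (l x + complex_of_real V * u r x + a * U x)))" by (simp only: iw)
            finally show ?case by (simp add: algebra_simps)
          qed
        qed (auto intro!: memL2_diff memL2_add memL2_cmult mem)
        also have "\<dots> = \<i> * (ip \<Omega> l (u r) + complex_of_real V * ip \<Omega> (u r) (u r) + a * ip \<Omega> U (u r) - ip \<Omega> (g r) (u r))"
          by (simp add: ip_cmult_left ip_add_left ip_diff_left memL2_add memL2_diff memL2_cmult mem)
        finally have wd: "Re (ip \<Omega> (w r) (u r)) = - Im (ip \<Omega> l (u r)) - V * Im (ip \<Omega> (u r) (u r)) - Im (a * ip \<Omega> U (u r)) + Im (ip \<Omega> (g r) (u r))"
          by simp
        have l0: "Im (ip \<Omega> l (u r)) = 0"
          unfolding weak_lap_H10[OF \<Omega> A(5,4) uH uH] by (simp add: gip_self del: of_real_power)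
        have u0: "Im (ip \<Omega> (u r) (u r)) = 0" by (simp add: ip_self del: of_real_power)
        have pm: "(\<lambda>x. cmod (u r x) powr (1 + m)) \<in> borel_measurable (lebesgue_on \<Omega>)"
        proof -
          have [measurable]: "u r \<in> borel_measurable (lebesgue_on \<Omega>)" using uLr by (simp add: memL2_def)
          show ?thesis by measurable
        qed
        \<comment> \<open>Integrability of |u|^(1+m) comes from the equation: it equals the product
          of two L2 functions, U and the conjugate of u.\<close>
        have Uu: "integrable (lebesgue_on \<Omega>) (\<lambda>x. complex_of_real (cmod (u r x) powr (1 + m)))"
          by (rule integrable_cong_AE_imp[OF ip_integrable[OF A(6) uLr]])
            (use pm is_nonlin_mult_cnj[OF A(7) m(1)] in auto)
        have pint: "integrable (lebesgue_on \<Omega>) (\<lambda>x. cmod (u r x) powr (1 + m))"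
          using integrable_Re[OF Uu] by simp
        define P where "P = (\<integral>x. cmod (u r x) powr (1 + m) \<partial>lebesgue_on \<Omega>)"
        have ipU: "ip \<Omega> U (u r) = complex_of_real P"
        proof -
          have "ip \<Omega> U (u r) = (\<integral>x. complex_of_real (cmod (u r x) powr (1 + m)) \<partial>lebesgue_on \<Omega>)"
            unfolding ip_def by (rule integral_cong_AE)
              (use is_nonlin_mult_cnj[OF A(7) m(1)] Uu ip_integrable[OF A(6) uLr] in \<open>auto dest: borel_measurable_integrable\<close>)
          then show ?thesis by (simp add: P_def)
        qed
        \<comment> \<open>For m = 0 the exponent 1 + m is 1 and the sup bound on f matches it; for m
          > 0, F = 0 and f vanishes.\<close>
        have fP: "cmod (ip \<Omega> (f r) (u r)) \<le> F * P"
        proof -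
          have "cmod (ip \<Omega> (f r) (u r)) \<le> (\<integral>x. cmod (f r x * cnj (u r x)) \<partial>lebesgue_on \<Omega>)"
            unfolding ip_def by (rule integral_norm_bound)
          also have "\<dots> \<le> (\<integral>x. F * cmod (u r x) powr (1 + m) \<partial>lebesgue_on \<Omega>)"
          proof (rule integral_mono_AE)
            show "integrable (lebesgue_on \<Omega>) (\<lambda>x. cmod (f r x * cnj (u r x)))"
              by (rule integrable_norm[OF ip_integrable[OF A(9) uLr]])
            show "integrable (lebesgue_on \<Omega>) (\<lambda>x. F * cmod (u r x) powr (1 + m))" using pint by simp
            show "AE x in lebesgue_on \<Omega>. cmod (f r x * cnj (u r x)) \<le> F * cmod (u r x) powr (1 + m)"
              using fr
            proof eventually_elim
              case (elim x)
              show ?case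
              proof (cases "m = 0")
                case True
                then show ?thesis using mult_right_mono[OF elim norm_ge_zero[of "u r x"]] by (simp add: norm_mult)
              next
                case False
                then have "f r x = 0" "F = 0" using elim mF by auto
                then show ?thesis by simp
              qed
            qed
          qed
          finally show ?thesis by (simp add: P_def)
        qed
        have gf: "cmod (ip \<Omega> (\<lambda>x. g r x - f r x) (u r)) \<le> h r * B"
        proof -
          have "cmod (ip \<Omega> (\<lambda>x. g r x - f r x) (u r)) \<le> L2norm \<Omega> (\<lambda>x. g r x - f r x) * L2norm \<Omega> (u r)"
            by (intro ip_cauchy_schwarz memL2_diff mem)
          also have "\<dots> \<le> h r * B" using A(10) B(2)[OF r(2)] B(1) hi(2) by (intro mult_mono) auto
          finally show ?thesis .
        qed
        have gsplit: "ip \<Omega> (g r) (u r) = ip \<Omega> (f r) (u r) + ip \<Omega> (\<lambda>x. g r x - f r x) (u r)"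
          using mem by (simp add: ip_diff_left)
        have "Im (ip \<Omega> (g r) (u r)) \<le> F * P + h r * B"
          unfolding gsplit using fP gf abs_Im_le_cmod[of "ip \<Omega> (f r) (u r)"] abs_Im_le_cmod[of "ip \<Omega> (\<lambda>x. g r x - f r x) (u r)"] by simp
        then have Re1: "Re (ip \<Omega> (w r) (u r)) \<le> h r * B - (Im a - F) * P"
          using wd l0 u0 ipU by (simp add: algebra_simps)
        have "ennreal (q r) \<le> ennreal P"
        proof -
          have "ennreal (q r) \<le> (\<integral>\<^sup>+x. ennreal (cmod (u r x) powr (1 + m)) \<partial>lebesgue_on \<Omega>)" using elim r by blast
          also have "\<dots> = ennreal P" unfolding P_def by (rule nn_integral_eq_integral[OF pint]) simp
          finally show ?thesis .
        qed
        moreover have "0 \<le> P" unfolding P_def by (rule Bochner_Integration.integral_nonneg) simp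
        ultimately have "q r \<le> P" by (simp add: ennreal_le_iff)
        then have "(Im a - F) * q r \<le> (Im a - F) * P" using aF by (intro mult_left_mono) auto
        then show "2 * Re (ip \<Omega> (w r) (u r)) \<le> \<rho> r" using Re1 r0 by (simp add: \<rho>_def algebra_simps)
      qed
    qed
  qed (use uL st in auto)
  also have "(LINT r:{s<..<t}|lborel. \<rho> r) \<le> 2 * B * (\<integral>r. h r \<partial>lborel) - 2 * (Im a - F) * (LINT r:{s<..<t}|lborel. q r)"
  proof -
    have "(LINT r:{s<..<t}|lborel. \<rho> r) = (\<integral>r. 2 * B * (indicat_real {s<..<t} r *\<^sub>R h r) - 2 * (Im a - F) * ?q r \<partial>lborel)"
      unfolding set_lebesgue_integral_def \<rho>_def by (rule Bochner_Integration.integral_cong) (auto simp: indicator_def)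
    also have "\<dots> = 2 * B * (LINT r:{s<..<t}|lborel. h r) - 2 * (Im a - F) * (LINT r:{s<..<t}|lborel. q r)"
    proof -
      have i: "integrable lborel (\<lambda>r. 2 * B * (indicat_real {s<..<t} r *\<^sub>R h r))" "integrable lborel (\<lambda>r. 2 * (Im a - F) * ?q r)"
        by (intro integrable_mult_right integrable_mult_indicator hi(1), simp) (rule integrable_mult_right[OF qi])
      show ?thesis unfolding set_lebesgue_integral_def Bochner_Integration.integral_diff[OF i] integral_mult_right_zero ..
    qed
    also have "2 * B * (LINT r:{s<..<t}|lborel. h r) \<le> 2 * B * (\<integral>r. h r \<partial>lborel)"
      using B(1) by (intro mult_left_mono set_integral_nonneg_mono(2)[OF hi]) auto
    finally show ?thesis by simp
  qed
  finally show ?thesis by simp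
qed

subsection \<open>Weak solutions\<close>

text \<open>A subsequence staying below y would have a further subsequence converging almost
  everywhere, and Fatou would contradict the assumption on g.\<close>

lemma L2_power_liminf:
  assumes m: "\<And>k. memL2 \<Omega> (f k)" and g: "memL2 \<Omega> g" and p: "0 < p"
    and lim: "(\<lambda>k. L2norm \<Omega> (\<lambda>x. f k x - g x)) \<longlonglongrightarrow> 0"
    and y: "y < (\<integral>\<^sup>+x. ennreal (cmod (g x) powr p) \<partial>lebesgue_on \<Omega>)"
  shows "\<forall>\<^sub>F k in sequentially. y < (\<integral>\<^sup>+x. ennreal (cmod (f k x) powr p) \<partial>lebesgue_on \<Omega>)"
proof (rule ccontr)
  let ?P = "\<lambda>g. \<integral>\<^sup>+x. ennreal (cmod (g x) powr p) \<partial>lebesgue_on \<Omega>"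
  assume "\<not> (\<forall>\<^sub>F k in sequentially. y < ?P (f k))"
  then obtain r :: "nat \<Rightarrow> nat" where r: "strict_mono r" "\<And>n. \<not> y < ?P (f (r n))"
    using not_eventually_sequentiallyD[of "\<lambda>k. y < ?P (f k)"] by auto
  have "(\<lambda>k. L2norm \<Omega> (\<lambda>x. f (r k) x - g x)) \<longlonglongrightarrow> 0"
    using LIMSEQ_subseq_LIMSEQ[OF lim r(1)] by (simp add: comp_def)
  then obtain r' :: "nat \<Rightarrow> nat" where r': "AE x in lebesgue_on \<Omega>. (\<lambda>k. f (r (r' k)) x) \<longlonglongrightarrow> g x"
    using L2_AE_convergent_subseq[of \<Omega> "\<lambda>k. f (r k)" g] m g by blast
  have [measurable]: "f k \<in> borel_measurable (lebesgue_on \<Omega>)" for k using m by (auto simp: memL2_def)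
  have "?P g = (\<integral>\<^sup>+x. liminf (\<lambda>k. ennreal (cmod (f (r (r' k)) x) powr p)) \<partial>lebesgue_on \<Omega>)"
  proof (rule nn_integral_cong_AE, use r' in eventually_elim)
    case (elim x)
    have "(\<lambda>k. cmod (f (r (r' k)) x) powr p) \<longlonglongrightarrow> cmod (g x) powr p"
      by (rule tendsto_powr'[OF tendsto_norm[OF elim] tendsto_const]) (use p in auto)
    from lim_imp_Liminf[OF trivial_limit_sequentially tendsto_ennrealI[OF this]] show ?case by (rule sym)
  qed
  also have "\<dots> \<le> liminf (\<lambda>k. ?P (f (r (r' k))))" by (rule nn_integral_liminf) measurable
  also have "\<dots> \<le> limsup (\<lambda>k. ?P (f (r (r' k))))" by (rule Liminf_le_Limsup) simp
  also have "\<dots> \<le> y" by (rule Limsup_bounded) (use r(2) in \<open>auto simp: not_less\<close>)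
  finally show False using y by simp
qed

lemma L1H10_borel_rep:
  fixes \<Omega> :: "(real^'n::finite) set"
  assumes \<Omega>: "open \<Omega>" and f: "L1H10 {0<..} \<Omega> f"
  obtains k where "integrable lborel k" "\<And>r::real. 0 \<le> k r"
    "AE r in lborel. r \<in> {0<..} \<longrightarrow> memH10 \<Omega> (f r) \<and> gnorm \<Omega> (wgrad \<Omega> (f r)) \<le> k r"
proof -
  have fH: "AE t in lebesgue_on {0<..}. memH10 \<Omega> (f t)" and fm: "(\<lambda>t. H1norm \<Omega> (f t)) \<in> borel_measurable (lebesgue_on {0<..})"
    and fi: "(\<integral>\<^sup>+ t. ennreal (H1norm \<Omega> (f t)) \<partial>lebesgue_on {0<..}) < \<infinity>"
    using f by (auto simp: L1H10_def)
  have S: "{0::real<..} \<in> sets lebesgue" by simp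
  have H0: "0 \<le> H1norm \<Omega> v" for v by (simp add: H1norm_def gradL2sq_eq_wgrad)
  have i: "integrable (lebesgue_on {0<..}) (\<lambda>t. H1norm \<Omega> (f t))"
    by (rule integrableI_bounded) (use fm fi H0 in auto)
  \<comment> \<open>The norm is viewed as a complex function to fit
    \<open>lebesgue_on_borel_rep\<close>; the modulus of the real part brings it back and is
    nonnegative everywhere.\<close>
  have cm: "(\<lambda>t. complex_of_real (H1norm \<Omega> (f t))) \<in> borel_measurable (lebesgue_on {0<..})" using fm by measurable
  obtain c where c: "c \<in> borel_measurable borel"
    "AE t in lborel. (if t \<in> {0<..} then complex_of_real (H1norm \<Omega> (f t)) else 0) = c t"
    using lebesgue_on_borel_rep[OF S cm] by blast
  define k where "k t = \<bar>Re (c t)\<bar>" for t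
  have ae: "AE t in lborel. (if t \<in> {0<..} then H1norm \<Omega> (f t) else 0) = k t"
    using c(2)
  proof eventually_elim
    case (elim t)
    then have "c t = complex_of_real (if t \<in> {0<..} then H1norm \<Omega> (f t) else 0)" by (simp split: if_splits)
    then show ?case using H0[of "f t"] by (simp add: k_def)
  qed
  have km: "k \<in> borel_measurable borel" unfolding k_def using c(1) by measurable
  have ki: "integrable lborel k" using lebesgue_on_integral_rep(2)[OF S km ae fm] i by simp
  have "AE r in lborel. r \<in> {0<..} \<longrightarrow> memH10 \<Omega> (f r) \<and> gnorm \<Omega> (wgrad \<Omega> (f r)) \<le> k r"
    using fH[unfolded AE_lebesgue_on_open_iff[OF open_greaterThan]] ae
  proof eventually_elim
    case (elim r)
    show ?case
    proof
      assume r: "r \<in> {0<..}"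
      then have h: "memH10 \<Omega> (f r)" "k r = H1norm \<Omega> (f r)" using elim by auto
      have "gnorm \<Omega> (wgrad \<Omega> (f r)) \<le> H1norm \<Omega> (f r)"
        unfolding H1norm_isgrad[OF \<Omega> memH10_isgrad[OF h(1)]] by (rule real_sqrt_sum_squares_ge2)
      then show "memH10 \<Omega> (f r) \<and> gnorm \<Omega> (wgrad \<Omega> (f r)) \<le> k r" using h by simp
    qed
  qed
  moreover have "0 \<le> k r" for r by (simp add: k_def)
  ultimately show ?thesis using that ki by blast
qed

text \<open>Turns the extended-real convergences of the definition into real ones, with a Borel
  majorant for the forcing error and a numerical bound for the uniform distance.\<close>

lemma weak_sol_approximants:
  fixes \<Omega> :: "(real^'n::finite) set"
  assumes \<Omega>: "open \<Omega>" and T: "0 < T" and sol: "weak_sol \<Omega> V a m f u0 u" and f: "L1H10 {0<..} \<Omega> f"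
  shows "\<exists>un fn h e. (\<forall>n::nat. strong_sol \<Omega> V a m T (fn n) (un n)) \<and>
    (\<forall>n. integrable lborel (h n) \<and> (\<forall>r. 0 \<le> h n r) \<and>
       (AE r in lborel. r \<in> {0<..<T} \<longrightarrow> L2norm \<Omega> (\<lambda>x. fn n r x - f r x) \<le> h n r)) \<and>
    (\<lambda>n. \<integral>r. h n r \<partial>lborel) \<longlonglongrightarrow> 0 \<and> e \<longlonglongrightarrow> 0 \<and>
    (\<forall>n. \<forall>t\<in>{0..T}. L2norm \<Omega> (\<lambda>x. un n t x - u t x) \<le> e n)"
proof -
  let ?I = "{0<..<T}"
  obtain un fn where s: "\<And>n. strong_sol \<Omega> V a m T (fn n) (un n)"
    and l1: "(\<lambda>n. (SUP t\<in>{0..T}. ennreal (L2norm \<Omega> (\<lambda>x. un n t x - u t x)))) \<longlonglongrightarrow> 0"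
    and l2: "(\<lambda>n. \<integral>\<^sup>+ t. ennreal (L2norm \<Omega> (\<lambda>x. fn n t x - f t x)) \<partial>lebesgue_on ?I) \<longlonglongrightarrow> 0"
    using sol T unfolding weak_sol_def by blast
  have fj: "jmeas ?I \<Omega> f"
  proof -
    have "(\<lambda>p. f (fst p) (snd p)) \<in> borel_measurable (lebesgue_on ({0<..} \<times> \<Omega>))" using f by (simp add: L1H10_def jmeas_def)
    then show ?thesis unfolding jmeas_def by (rule measurable_restrict_mono) auto
  qed
  have fL: "AE t in lebesgue_on ?I. memL2 \<Omega> (f t)"
    unfolding AE_lebesgue_on_open_iff[OF open_greaterThanLessThan]
  proof -
    have "AE t in lebesgue_on {0<..}. memH10 \<Omega> (f t)" using f by (simp add: L1H10_def)
    then show "AE t in lborel. t \<in> ?I \<longrightarrow> memL2 \<Omega> (f t)"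
      unfolding AE_lebesgue_on_open_iff[OF open_greaterThan] by eventually_elim (auto intro: memH10_memL2)
  qed
  have fn: "jmeas ?I \<Omega> (fn n)" "AE t in lebesgue_on ?I. memL2 \<Omega> (fn n t)" for n
    using s[of n] unfolding strong_sol_def L1L2_def by blast+
  have dj: "jmeas ?I \<Omega> (\<lambda>t x. fn n t x - f t x)" for n
    using fn(1)[of n] fj unfolding jmeas_def by (rule borel_measurable_diff)
  have dL: "AE t in lebesgue_on ?I. memL2 \<Omega> (\<lambda>x. fn n t x - f t x)" for n
    using fn(2)[of n] fL by eventually_elim (rule memL2_diff)
  have "\<exists>h. h \<in> borel_measurable borel \<and> (\<forall>t. 0 \<le> h t) \<and> (AE t in lborel. t \<in> ?I \<longrightarrow> h t = L2norm \<Omega> (\<lambda>x. fn n t x - f t x)) \<and>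
    (\<integral>\<^sup>+t. ennreal (h t) \<partial>lborel) = (\<integral>\<^sup>+t. ennreal (L2norm \<Omega> (\<lambda>x. fn n t x - f t x)) \<partial>lebesgue_on ?I)" for n
    by (rule L2norm_borel_rep[OF open_greaterThanLessThan \<Omega> dj dL]) blast
  then obtain h where h: "\<And>n. h n \<in> borel_measurable borel" "\<And>n t. 0 \<le> h n t"
    "\<And>n. AE t in lborel. t \<in> ?I \<longrightarrow> h n t = L2norm \<Omega> (\<lambda>x. fn n t x - f t x)"
    "\<And>n. (\<integral>\<^sup>+t. ennreal (h n t) \<partial>lborel) = (\<integral>\<^sup>+t. ennreal (L2norm \<Omega> (\<lambda>x. fn n t x - f t x)) \<partial>lebesgue_on ?I)"
    using choice[of "\<lambda>n h. h \<in> borel_measurable borel \<and> (\<forall>t. 0 \<le> h t) \<and> (AE t in lborel. t \<in> ?I \<longrightarrow> h t = L2norm \<Omega> (\<lambda>x. fn n t x - f t x)) \<and>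
    (\<integral>\<^sup>+t. ennreal (h t) \<partial>lborel) = (\<integral>\<^sup>+t. ennreal (L2norm \<Omega> (\<lambda>x. fn n t x - f t x)) \<partial>lebesgue_on ?I)"] by blast
  have l2': "(\<lambda>n. \<integral>\<^sup>+t. ennreal (h n t) \<partial>lborel) \<longlonglongrightarrow> 0" using l2 by (simp add: h(4))
  define S where "S n = (SUP t\<in>{0..T}. ennreal (L2norm \<Omega> (\<lambda>x. un n t x - u t x)))" for n
  have "\<forall>\<^sub>F n in sequentially. S n < 1 \<and> (\<integral>\<^sup>+t. ennreal (h n t) \<partial>lborel) < 1"
    using order_tendstoD(2)[OF l1[folded S_def], of 1] order_tendstoD(2)[OF l2', of 1] by (auto intro: eventually_conj)
  \<comment> \<open>Finitely many members may be at infinite distance; they are dropped by shifting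
    the index.\<close>
  then obtain N where N: "\<And>n. n \<ge> N \<Longrightarrow> S n < 1 \<and> (\<integral>\<^sup>+t. ennreal (h n t) \<partial>lborel) < 1"
    by (auto simp: eventually_sequentially)
  have Nfin: "S (n + N) < \<infinity>" "(\<integral>\<^sup>+t. ennreal (h (n + N) t) \<partial>lborel) < \<infinity>" for n
    using N[of "n + N"] by (auto intro: order.strict_trans)
  have hint: "integrable lborel (h (n + N))" for n
    by (rule integrableI_bounded) (use h Nfin in auto)
  have "(\<lambda>n. \<integral>r. h (n + N) r \<partial>lborel) \<longlonglongrightarrow> 0"
  proof -
    have "(\<lambda>n. \<integral>\<^sup>+t. ennreal (h (n + N) t) \<partial>lborel) \<longlonglongrightarrow> 0" using LIMSEQ_ignore_initial_segment[OF l2', of N] .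
    moreover have "(\<integral>\<^sup>+t. ennreal (h (n + N) t) \<partial>lborel) = ennreal (\<integral>r. h (n + N) r \<partial>lborel)" for n
      by (rule nn_integral_eq_integral[OF hint]) (use h in auto)
    ultimately have "(\<lambda>n. ennreal (\<integral>r. h (n + N) r \<partial>lborel)) \<longlonglongrightarrow> ennreal 0" by simp
    then show ?thesis by (rule tendsto_ennrealD) (use h in auto)
  qed
  moreover have "(\<lambda>n. enn2real (S (n + N))) \<longlonglongrightarrow> 0"
  proof -
    have "(\<lambda>n. S (n + N)) \<longlonglongrightarrow> ennreal 0" using LIMSEQ_ignore_initial_segment[OF l1[folded S_def], of N] by simp
    from tendsto_enn2real[OF this] show ?thesis by simp
  qed
  moreover have "L2norm \<Omega> (\<lambda>x. un (n + N) t x - u t x) \<le> enn2real (S (n + N))" if "t \<in> {0..T}" for n t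
  proof -
    have "ennreal (L2norm \<Omega> (\<lambda>x. un (n + N) t x - u t x)) \<le> S (n + N)"
      unfolding S_def by (rule SUP_upper[OF that])
    then have "enn2real (ennreal (L2norm \<Omega> (\<lambda>x. un (n + N) t x - u t x))) \<le> enn2real (S (n + N))"
      by (rule enn2real_mono) (use Nfin(1)[of n] in simp)
    then show ?thesis by simp
  qed
  moreover have "AE r in lborel. r \<in> ?I \<longrightarrow> L2norm \<Omega> (\<lambda>x. fn (n + N) r x - f r x) \<le> h (n + N) r" for n
    using h(3)[of "n + N"] by eventually_elim simp
  ultimately show ?thesis
    using s hint h(2)
    by (intro exI[of _ "\<lambda>n. un (n + N)"] exI[of _ "\<lambda>n. fn (n + N)"] exI[of _ "\<lambda>n. h (n + N)"] exI[of _ "\<lambda>n. enn2real (S (n + N))"]) auto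
qed

lemma weak_sol_CL2: "weak_sol \<Omega> V a m f u0 u \<Longrightarrow> 0 < T \<Longrightarrow> CL2 T \<Omega> u"
  by (simp add: weak_sol_def)

lemma weak_sol_memL2:
  assumes "weak_sol \<Omega> V a m f u0 u" "0 \<le> t"
  shows "memL2 \<Omega> (u t)"
  using weak_sol_CL2[OF assms(1), of "t + 1"] assms(2) by (simp add: CL2_def)

lemma weak_sol_continuous:
  assumes sol: "weak_sol \<Omega> V a m f u0 u" and t: "0 \<le> t" and x: "\<And>n. 0 \<le> x n" "x \<longlonglongrightarrow> t"
  shows "(\<lambda>n. L2norm \<Omega> (\<lambda>y. u (x n) y - u t y)) \<longlonglongrightarrow> 0"
proof -
  have cl: "CL2 (t + 1) \<Omega> u" by (rule weak_sol_CL2[OF sol]) (use t in simp)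
  let ?g = "\<lambda>s. L2norm \<Omega> (\<lambda>y. u s y - u t y)"
  have "continuous (at t within {0..t + 1}) ?g"
    unfolding continuous_within using CL2_tendsto[OF cl, of t] t by simp
  moreover have "\<forall>\<^sub>F n in sequentially. x n \<in> {0..t + 1}"
    using order_tendstoD(2)[OF x(2), of "t + 1"] by (auto elim!: eventually_mono intro: x(1) less_imp_le)
  ultimately have "(\<lambda>n. ?g (x n)) \<longlonglongrightarrow> ?g t" using x(2) by (rule continuous_within_tendsto_compose)
  then show ?thesis by simp
qed

text \<open>The order of limits decides: with \<mu> fixed, the approximants converge and the error
  sqrt \<mu> times the integral of \<open>h n\<close> disappears. The remaining bound M is free of
  \<mu>, which may then tend to infinity.\<close>

lemma weak_gradient_bound:
  fixes \<Omega> :: "(real^'n::finite) set"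
  assumes \<Omega>: "open \<Omega>" and a: "a \<in> Cset m" and m: "0 \<le> m" "m < 1"
    and fin: "m = 0 \<longrightarrow> emeasure lebesgue \<Omega> < \<infinity>" and sol: "weak_sol \<Omega> V a m f u0 u"
    and u0: "memH10 \<Omega> u0" and f: "L1H10 {0<..} \<Omega> f"
  shows "\<exists>M\<ge>0. \<forall>t\<ge>0. memH10 \<Omega> (u t) \<and> gradL2sq \<Omega> (u t) \<le> M\<^sup>2 \<and>
     (\<lambda>k. menv \<Omega> (real (Suc k)) (u t)) \<longlonglongrightarrow> gradL2sq \<Omega> (u t)"
proof -
  obtain k where k: "integrable lborel k" "\<And>r::real. 0 \<le> k r"
    "AE r in lborel. r \<in> {0<..} \<longrightarrow> memH10 \<Omega> (f r) \<and> gnorm \<Omega> (wgrad \<Omega> (f r)) \<le> k r"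
    by (rule L1H10_borel_rep[OF \<Omega> f]) blast
  define M where "M = sqrt (gradL2sq \<Omega> u0) + 2 * (\<integral>r. k r \<partial>lborel)"
  have g0: "0 \<le> gradL2sq \<Omega> v" for v by (simp add: gradL2sq_eq_wgrad)
  have M0: "0 \<le> M" unfolding M_def using g0 k by (intro add_nonneg_nonneg mult_nonneg_nonneg Bochner_Integration.integral_nonneg) auto
  have main: "menv \<Omega> \<mu> (u t) \<le> M\<^sup>2" if t: "0 \<le> t" and \<mu>: "0 < \<mu>" for t \<mu>
  proof -
    interpret moreau \<Omega> \<mu> using \<Omega> \<mu> by unfold_locales
    define T where "T = t + 1"
    have T: "0 < T" "t \<in> {0..T}" "0 \<in> {0..T}" using t by (auto simp: T_def)
    obtain un fn h e where s: "\<And>n::nat. strong_sol \<Omega> V a m T (fn n) (un n)"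
      and h: "\<And>n. integrable lborel (h n)" "\<And>n r. 0 \<le> h n r"
       "\<And>n. AE r in lborel. r \<in> {0<..<T} \<longrightarrow> L2norm \<Omega> (\<lambda>x. fn n r x - f r x) \<le> h n r"
      and lim: "(\<lambda>n. \<integral>r. h n r \<partial>lborel) \<longlonglongrightarrow> 0" "e \<longlonglongrightarrow> 0"
      and e: "\<And>n t. t \<in> {0..T} \<Longrightarrow> L2norm \<Omega> (\<lambda>x. un n t x - u t x) \<le> e n"
      using weak_sol_approximants[OF \<Omega> T(1) sol f] by blast
    have unL: "memL2 \<Omega> (un n s')" if "s' \<in> {0..T}" for n s' using strong_sol_CL2[OF s[of n]] that by (auto simp: CL2_def)
    have uL: "memL2 \<Omega> (u s')" if "s' \<in> {0..T}" for s' by (rule weak_sol_memL2[OF sol]) (use that in auto)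
    have conv: "(\<lambda>n. menv \<Omega> \<mu> (un n s')) \<longlonglongrightarrow> menv \<Omega> \<mu> (u s')" if s': "s' \<in> {0..T}" for s'
    proof (rule menv_tendsto[OF unL[OF s'] uL[OF s']])
      show "(\<lambda>n. L2norm \<Omega> (\<lambda>x. un n s' x - u s' x)) \<longlonglongrightarrow> 0"
        by (rule Lim_null_comparison[OF _ lim(2)]) (use e[OF s'] in auto)
    qed
    have kT: "AE r in lborel. r \<in> {0<..<T} \<longrightarrow> memH10 \<Omega> (f r) \<and> gnorm \<Omega> (wgrad \<Omega> (f r)) \<le> k r"
      using k(3) by eventually_elim auto
    have bound: "sqrt (menv \<Omega> \<mu> (un n t)) \<le> sqrt (menv \<Omega> \<mu> (un n 0)) + 2 * ((\<integral>r. k r \<partial>lborel) + sqrt \<mu> * (\<integral>r. h n r \<partial>lborel))" for n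
      by (rule strong_menv_bound[OF \<Omega> T(1) a m fin s \<mu> kT h(3) k(1,2) h(1,2) T(2)])
    have "sqrt (menv \<Omega> \<mu> (u t)) \<le> sqrt (menv \<Omega> \<mu> (u 0)) + 2 * ((\<integral>r. k r \<partial>lborel) + sqrt \<mu> * 0)"
    proof (rule LIMSEQ_le)
      show "(\<lambda>n. sqrt (menv \<Omega> \<mu> (un n t))) \<longlonglongrightarrow> sqrt (menv \<Omega> \<mu> (u t))" by (intro tendsto_intros conv T)
      show "(\<lambda>n. sqrt (menv \<Omega> \<mu> (un n 0)) + 2 * ((\<integral>r. k r \<partial>lborel) + sqrt \<mu> * (\<integral>r. h n r \<partial>lborel)))
        \<longlonglongrightarrow> sqrt (menv \<Omega> \<mu> (u 0)) + 2 * ((\<integral>r. k r \<partial>lborel) + sqrt \<mu> * 0)"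
        by (intro tendsto_intros conv T lim(1))
    qed (use bound in blast)
    moreover have "menv \<Omega> \<mu> (u 0) \<le> gradL2sq \<Omega> u0"
    proof -
      have ae: "AE x in lebesgue_on \<Omega>. u 0 x = u0 x" using sol by (simp add: weak_sol_def)
      have mem: "memL2 \<Omega> u0" "memL2 \<Omega> (u 0)" using memH10_memL2[OF u0] uL[OF T(3)] by auto
      have "L2norm \<Omega> (\<lambda>x. u 0 x - u0 x) = L2norm \<Omega> (\<lambda>x. 0)"
        by (rule L2norm_cong_AE) (use ae mem in \<open>auto simp: memL2_def\<close>)
      then have "menv \<Omega> \<mu> (u 0) - menv \<Omega> \<mu> u0 \<le> 0" using menv_diff_le[OF mem] by simp
      then show ?thesis using menv_le_gradL2sq[OF u0] by simp
    qed
    then have "sqrt (menv \<Omega> \<mu> (u 0)) \<le> sqrt (gradL2sq \<Omega> u0)" by simp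
    ultimately have "sqrt (menv \<Omega> \<mu> (u t)) \<le> M" unfolding M_def by argo
    then have "(sqrt (menv \<Omega> \<mu> (u t)))\<^sup>2 \<le> M\<^sup>2" using menv_nonneg by (intro power_mono) auto
    then show ?thesis using menv_nonneg by simp
  qed
  have "memH10 \<Omega> (u t) \<and> gradL2sq \<Omega> (u t) \<le> M\<^sup>2 \<and>
     (\<lambda>k. menv \<Omega> (real (Suc k)) (u t)) \<longlonglongrightarrow> gradL2sq \<Omega> (u t)" if t: "0 \<le> t" for t
  proof -
    have bd: "menv \<Omega> (real (Suc k)) (u t) \<le> M\<^sup>2" for k by (rule main[OF t]) simp
    note H = memH10_of_menv_bounded[OF \<Omega> weak_sol_memL2[OF sol t] bd]
    have "gradL2sq \<Omega> (u t) \<le> M\<^sup>2" by (rule LIMSEQ_le_const2[OF H(2)]) (use bd in blast)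
    then show ?thesis using H by blast
  qed
  then show ?thesis using M0 by blast
qed

text \<open>A pointwise bound alone says nothing about \<open>esssup\<close> without measurability
  in time; that comes from writing the squared gradient norm as a limit of envelopes, each
  continuous in time.\<close>

lemma grad_Linf_bound:
  fixes \<Omega> :: "(real^'n::finite) set"
  assumes \<Omega>: "open \<Omega>" and a: "a \<in> Cset m" and m: "0 \<le> m" "m < 1"
    and fin: "m = 0 \<longrightarrow> emeasure lebesgue \<Omega> < \<infinity>" and sol: "weak_sol \<Omega> V a m f u0 u"
    and u0: "memH10 \<Omega> u0" and f: "L1H10 {0<..} \<Omega> f"
  shows "grad_Linf \<Omega> u < \<infinity>"
    and "AE t in lborel. t \<in> {0<..} \<longrightarrow> memH10 \<Omega> (u t) \<and> sqrt (gradL2sq \<Omega> (u t)) \<le> real_of_ereal (grad_Linf \<Omega> u)"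
proof -
  obtain M where M: "0 \<le> M" "\<And>t. 0 \<le> t \<Longrightarrow> memH10 \<Omega> (u t)" "\<And>t. 0 \<le> t \<Longrightarrow> gradL2sq \<Omega> (u t) \<le> M\<^sup>2"
    and lim: "\<And>t. 0 \<le> t \<Longrightarrow> (\<lambda>k. menv \<Omega> (real (Suc k)) (u t)) \<longlonglongrightarrow> gradL2sq \<Omega> (u t)"
    using weak_gradient_bound[OF assms] by blast
  have S: "{0::real<..} \<in> sets lebesgue" by simp
  have sp: "space (lebesgue_on {0::real<..}) = {0<..}" by (simp add: space_restrict_space)
  have gn: "gradnorm \<Omega> (u t) = ereal (sqrt (gradL2sq \<Omega> (u t)))" if "t \<in> {0<..}" for t
    using M(2)[of t] that by (simp add: gradnorm_def memH10_def)
  have "(\<lambda>t. menv \<Omega> (real (Suc k)) (u t)) \<in> borel_measurable (lebesgue_on {0<..})" for k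
  proof (rule continuous_imp_measurable_on_sets_lebesgue[OF _ S])
    interpret moreau \<Omega> "real (Suc k)" using \<Omega> by unfold_locales auto
    show "continuous_on {0<..} (\<lambda>t. menv \<Omega> (real (Suc k)) (u t))"
      unfolding continuous_on_sequentially
    proof (intro allI ballI impI, elim conjE)
      fix x :: "nat \<Rightarrow> real" and t assume t: "t \<in> {0<..}" and x: "\<forall>n. x n \<in> {0<..}" "x \<longlonglongrightarrow> t"
      have "(\<lambda>n. menv \<Omega> (real (Suc k)) (u (x n))) \<longlonglongrightarrow> menv \<Omega> (real (Suc k)) (u t)"
        by (rule menv_tendsto[OF _ _ weak_sol_continuous[OF sol]])
          (use t x weak_sol_memL2[OF sol] in \<open>auto simp: less_imp_le\<close>)
      then show "((\<lambda>t. menv \<Omega> (real (Suc k)) (u t)) \<circ> x) \<longlonglongrightarrow> menv \<Omega> (real (Suc k)) (u t)" by (simp add: comp_def)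
    qed
  qed
  then have gm: "(\<lambda>t. gradL2sq \<Omega> (u t)) \<in> borel_measurable (lebesgue_on {0<..})"
    by (rule borel_measurable_LIMSEQ_real[where u = "\<lambda>k t. menv \<Omega> (real (Suc k)) (u t)", rotated])
      (use lim in \<open>simp add: sp del: of_nat_Suc\<close>)
  have "(\<lambda>t. ereal (sqrt (gradL2sq \<Omega> (u t)))) \<in> borel_measurable (lebesgue_on {0<..})" using gm by measurable
  then have gnm: "(\<lambda>t. gradnorm \<Omega> (u t)) \<in> borel_measurable (lebesgue_on {0<..})"
    by (subst measurable_cong[where g = "\<lambda>t. ereal (sqrt (gradL2sq \<Omega> (u t)))"]) (auto simp: sp gn)
  have "grad_Linf \<Omega> u \<le> ereal M"
    unfolding grad_Linf_def
  proof (rule esssup_I[OF gnm], rule AE_I2)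
    fix t assume "t \<in> space (lebesgue_on {0::real<..})"
    then have t: "t \<in> {0<..}" by (simp add: sp)
    have "sqrt (gradL2sq \<Omega> (u t)) \<le> M" by (rule real_le_lsqrt) (use M t in \<open>auto simp: gradL2sq_eq_wgrad\<close>)
    then show "gradnorm \<Omega> (u t) \<le> ereal M" using gn[OF t] by simp
  qed
  then show fin: "grad_Linf \<Omega> u < \<infinity>" by (rule order.strict_trans1) simp
  have "AE t in lebesgue_on {0<..}. gradnorm \<Omega> (u t) \<le> grad_Linf \<Omega> u"
    unfolding grad_Linf_def by (rule esssup_AE)
  then show "AE t in lborel. t \<in> {0<..} \<longrightarrow> memH10 \<Omega> (u t) \<and> sqrt (gradL2sq \<Omega> (u t)) \<le> real_of_ereal (grad_Linf \<Omega> u)"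
    unfolding AE_lebesgue_on_open_iff[OF open_greaterThan]
  proof eventually_elim
    case (elim t)
    show ?case
    proof
      assume t: "t \<in> {0<..}"
      then have "ereal (sqrt (gradL2sq \<Omega> (u t))) \<le> grad_Linf \<Omega> u" using elim gn by simp
      then have "sqrt (gradL2sq \<Omega> (u t)) \<le> real_of_ereal (grad_Linf \<Omega> u)"
        using fin by (cases "grad_Linf \<Omega> u") auto
      then show "memH10 \<Omega> (u t) \<and> sqrt (gradL2sq \<Omega> (u t)) \<le> real_of_ereal (grad_Linf \<Omega> u)" using M(2)[of t] t by simp
    qed
  qed
qed

text \<open>The dissipation of u enters through a constant lower bound k on (s, t). It suffices to
  transfer this bound to the approximants in the lower limit, with no convergence of their
  dissipation.\<close>

lemma weak_energy:
  fixes \<Omega> :: "(real^'n::finite) set"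
  assumes \<Omega>: "open \<Omega>" and a: "a \<in> Cset m" and m: "0 \<le> m" "m < 1"
    and sol: "weak_sol \<Omega> V a m f u0 u" and f: "L1H10 {0<..} \<Omega> f"
    and fF: "AE r in lborel. r \<in> {T0<..} \<longrightarrow> (AE x in lebesgue_on \<Omega>. cmod (f r x) \<le> F)"
    and mF: "m = 0 \<or> F = 0" and aF: "F < Im a" and T0: "0 \<le> T0" and st: "T0 \<le> s" "s \<le> t"
    and k0: "0 \<le> k"
    and k: "AE r in lborel. r \<in> {s<..<t} \<longrightarrow> ennreal k \<le> (\<integral>\<^sup>+x. ennreal (cmod (u r x) powr (1 + m)) \<partial>lebesgue_on \<Omega>)"
  shows "2 * (Im a - F) * (k * (t - s)) \<le> (L2norm \<Omega> (u s))\<^sup>2 - (L2norm \<Omega> (u t))\<^sup>2"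
proof -
  define T where "T = t + 1"
  have T: "0 < T" "0 \<le> s" "s \<le> t" "t \<le> T" using st T0 by (auto simp: T_def)
  obtain un fn h e where sn: "\<And>n::nat. strong_sol \<Omega> V a m T (fn n) (un n)"
    and h: "\<And>n. integrable lborel (h n)" "\<And>n r. 0 \<le> h n r"
     "\<And>n. AE r in lborel. r \<in> {0<..<T} \<longrightarrow> L2norm \<Omega> (\<lambda>x. fn n r x - f r x) \<le> h n r"
    and lim: "(\<lambda>n. \<integral>r. h n r \<partial>lborel) \<longlonglongrightarrow> 0" "e \<longlonglongrightarrow> 0"
    and e: "\<And>n t. t \<in> {0..T} \<Longrightarrow> L2norm \<Omega> (\<lambda>x. un n t x - u t x) \<le> e n"
    using weak_sol_approximants[OF \<Omega> T(1) sol f] by blast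
  have unL: "memL2 \<Omega> (un n r)" if "r \<in> {0..T}" for n r using strong_sol_CL2[OF sn[of n]] that by (auto simp: CL2_def)
  have uL: "memL2 \<Omega> (u r)" if "r \<in> {0..T}" for r by (rule weak_sol_memL2[OF sol]) (use that in auto)
  have ulim: "(\<lambda>n. L2norm \<Omega> (\<lambda>x. un n r x - u r x)) \<longlonglongrightarrow> 0" if "r \<in> {0..T}" for r
    by (rule Lim_null_comparison[OF _ lim(2)]) (use e[OF that] in auto)
  obtain Bu where Bu: "0 \<le> Bu" "\<And>r. r \<in> {0..T} \<Longrightarrow> L2norm \<Omega> (u r) \<le> Bu"
    using CL2_bounded[OF weak_sol_CL2[OF sol T(1)]] by blast
  have e0: "0 \<le> e n" for n by (rule order_trans[OF L2norm_nonneg e[of 0 n]]) (use T(1) in simp)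
  define B where "B n = Bu + e n" for n
  have B: "0 \<le> B n" "\<And>r. r \<in> {0..T} \<Longrightarrow> L2norm \<Omega> (un n r) \<le> B n" for n
  proof -
    show "0 \<le> B n" using Bu e0 by (simp add: B_def)
    fix r assume r: "r \<in> {0..T}"
    show "L2norm \<Omega> (un n r) \<le> B n"
      using L2norm_triangle_abs[OF unL[OF r, of n] uL[OF r]] e[OF r, of n] Bu(2)[OF r] by (simp add: B_def)
  qed
  have "\<exists>P::real \<Rightarrow> ennreal. P \<in> borel_measurable borel \<and>
    (AE r in lborel. r \<in> {0<..<T} \<longrightarrow> P r = (\<integral>\<^sup>+x. ennreal (cmod (un n r x) powr (1 + m)) \<partial>lebesgue_on \<Omega>))" for n
  proof -
    have j: "jmeas {0<..<T} \<Omega> (un n)" using sn[of n] unfolding strong_sol_def by blast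
    have p: "0 < 1 + m" using m by simp
    show ?thesis by (rule power_integral_rep[OF open_greaterThanLessThan \<Omega> j p]) blast
  qed
  then obtain P :: "nat \<Rightarrow> real \<Rightarrow> ennreal" where P[measurable]: "\<And>n. P n \<in> borel_measurable borel"
    and Peq: "\<And>n. AE r in lborel. r \<in> {0<..<T} \<longrightarrow> P n r = (\<integral>\<^sup>+x. ennreal (cmod (un n r x) powr (1 + m)) \<partial>lebesgue_on \<Omega>)"
    using choice[of "\<lambda>n P. P \<in> borel_measurable borel \<and>
    (AE r in lborel. r \<in> {0<..<T} \<longrightarrow> P r = (\<integral>\<^sup>+x. ennreal (cmod (un n r x) powr (1 + m)) \<partial>lebesgue_on \<Omega>))"] by blast
  \<comment> \<open>Truncation at k gives the bounded minorant that \<open>strong_energy\<close>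
    expects and costs nothing, as k is all that has to survive the lower limit.\<close>
  define q where "q n r = enn2real (min (P n r) (ennreal k))" for n r
  have qe: "ennreal (q n r) = min (P n r) (ennreal k)" for n r
    unfolding q_def by (rule ennreal_enn2real) (auto simp: min_less_iff_disj)
  have qm[measurable]: "q n \<in> borel_measurable borel" for n unfolding q_def by measurable
  have q0: "0 \<le> q n r" for n r by (simp add: q_def)
  have qk: "q n r \<le> k" for n r
  proof -
    have "ennreal (q n r) \<le> ennreal k" unfolding qe by simp
    then show ?thesis using k0 by (simp add: ennreal_le_iff)
  qed
  have qP: "AE r in lborel. r \<in> {0<..<T} \<longrightarrow> ennreal (q n r) \<le> (\<integral>\<^sup>+x. ennreal (cmod (un n r x) powr (1 + m)) \<partial>lebesgue_on \<Omega>)" for n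
    using Peq[of n] by eventually_elim (auto simp: qe)
  have fL: "AE r in lborel. r \<in> {0<..<T} \<longrightarrow> memL2 \<Omega> (f r)"
  proof -
    have "AE t in lebesgue_on {0<..}. memH10 \<Omega> (f t)" using f by (simp add: L1H10_def)
    then show ?thesis unfolding AE_lebesgue_on_open_iff[OF open_greaterThan] by eventually_elim (auto intro: memH10_memL2)
  qed
  have fF': "AE r in lborel. r \<in> {s<..<t} \<longrightarrow> (AE x in lebesgue_on \<Omega>. cmod (f r x) \<le> F)"
    using fF by eventually_elim (use st in auto)
  define c where "c = 2 * (Im a - F)"
  have c: "0 < c" using aF by (simp add: c_def)
  define D where "D n = (L2norm \<Omega> (un n s))\<^sup>2 - (L2norm \<Omega> (un n t))\<^sup>2 + 2 * B n * (\<integral>r. h n r \<partial>lborel)" for n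
  have en: "c * (LINT r:{s<..<t}|lborel. q n r) \<le> D n" for n
    unfolding c_def D_def
    by (rule strong_energy[OF \<Omega> T(1) a m sn fL fF' mF less_imp_le[OF aF] h(3) h(1) h(2) B T(2,3,4) qm q0 qk qP])
  have Dlim: "D \<longlonglongrightarrow> (L2norm \<Omega> (u s))\<^sup>2 - (L2norm \<Omega> (u t))\<^sup>2 + 2 * (Bu + 0) * 0"
    unfolding D_def B_def
    by (intro tendsto_intros lim tendsto_L2norm unL uL ulim) (use T in auto)
  have all: "AE r in lborel. \<forall>n. r \<in> {0<..<T} \<longrightarrow> P n r = (\<integral>\<^sup>+x. ennreal (cmod (un n r x) powr (1 + m)) \<partial>lebesgue_on \<Omega>)"
    unfolding AE_all_countable using Peq by blast
  have "ennreal (k * (t - s)) = (\<integral>\<^sup>+r. ennreal k * indicator {s<..<t} r \<partial>lborel)"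
    using T k0 by (simp add: nn_integral_cmult ennreal_mult)
  also have "\<dots> \<le> (\<integral>\<^sup>+r. liminf (\<lambda>n. ennreal (q n r) * indicator {s<..<t} r) \<partial>lborel)"
  proof (rule nn_integral_mono_AE)
    show "AE r in lborel. ennreal k * indicator {s<..<t} r \<le> liminf (\<lambda>n. ennreal (q n r) * indicator {s<..<t} r)"
      using all k
    proof eventually_elim
      case (elim r)
      show ?case
      proof (cases "r \<in> {s<..<t}")
        case True
        then have r: "r \<in> {0<..<T}" "r \<in> {0..T}" using T by auto
        have kr: "ennreal k \<le> (\<integral>\<^sup>+x. ennreal (cmod (u r x) powr (1 + m)) \<partial>lebesgue_on \<Omega>)" using elim True by blast
        have "ennreal k \<le> liminf (\<lambda>n. ennreal (q n r))"
          unfolding le_Liminf_iff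
        proof (intro allI impI)
          fix y assume y: "y < ennreal k"
          have "\<forall>\<^sub>F n in sequentially. y < (\<integral>\<^sup>+x. ennreal (cmod (un n r x) powr (1 + m)) \<partial>lebesgue_on \<Omega>)"
            by (rule L2_power_liminf[OF unL[OF r(2)] uL[OF r(2)] _ ulim[OF r(2)]]) (use m y kr in \<open>auto intro: order.strict_trans2\<close>)
          then show "\<forall>\<^sub>F n in sequentially. y < ennreal (q n r)"
            by eventually_elim (use y r elim in \<open>simp add: qe\<close>)
        qed
        then show ?thesis using True by simp
      qed simp
    qed
  qed
  also have "\<dots> \<le> liminf (\<lambda>n. \<integral>\<^sup>+r. ennreal (q n r) * indicator {s<..<t} r \<partial>lborel)"
    by (rule nn_integral_liminf) measurable
  also have "\<dots> \<le> liminf (\<lambda>n. ennreal (D n / c))"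
  proof (rule Liminf_mono, rule always_eventually, rule allI)
    fix n
    have qi: "integrable lborel (\<lambda>r. indicat_real {s<..<t} r *\<^sub>R q n r)"
    proof (rule Bochner_Integration.integrable_bound[of _ "\<lambda>r. k * indicat_real {s<..<t} r"])
      show "integrable lborel (\<lambda>r. k * indicat_real {s<..<t} r)"
        by (intro integrable_mult_right integrable_real_indicator) (use T in auto)
    qed (use q0 qk k0 in \<open>auto simp: indicator_def\<close>)
    have "(\<integral>\<^sup>+r. ennreal (q n r) * indicator {s<..<t} r \<partial>lborel) = (\<integral>\<^sup>+r. ennreal (indicat_real {s<..<t} r *\<^sub>R q n r) \<partial>lborel)"
      by (rule nn_integral_cong) (auto simp: indicator_def)
    also have "\<dots> = ennreal (LINT r:{s<..<t}|lborel. q n r)"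
      unfolding set_lebesgue_integral_def by (rule nn_integral_eq_integral[OF qi]) (use q0 in auto)
    also have "\<dots> \<le> ennreal (D n / c)" using en[of n] c by (intro ennreal_leI) (simp add: field_simps)
    finally show "(\<integral>\<^sup>+r. ennreal (q n r) * indicator {s<..<t} r \<partial>lborel) \<le> ennreal (D n / c)" .
  qed
  also have "\<dots> = ennreal (((L2norm \<Omega> (u s))\<^sup>2 - (L2norm \<Omega> (u t))\<^sup>2 + 2 * (Bu + 0) * 0) / c)"
    by (rule lim_imp_Liminf[OF trivial_limit_sequentially]) (intro tendsto_ennrealI tendsto_divide Dlim tendsto_const, use c in simp)
  finally have le: "ennreal (k * (t - s)) \<le> ennreal (((L2norm \<Omega> (u s))\<^sup>2 - (L2norm \<Omega> (u t))\<^sup>2) / c)" by simp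
  \<comment> \<open>\<open>ennreal\<close> sends negative numbers to 0, so the sign is needed to
    read the inequality back in the reals.\<close>
  have "0 \<le> (L2norm \<Omega> (u s))\<^sup>2 - (L2norm \<Omega> (u t))\<^sup>2"
  proof -
    have "0 \<le> D n" for n
    proof -
      have "0 \<le> (LINT r:{s<..<t}|lborel. q n r)"
        unfolding set_lebesgue_integral_def by (rule Bochner_Integration.integral_nonneg) (use q0 in auto)
      then show ?thesis using en[of n] c by (auto intro: order_trans[rotated])
    qed
    then have "0 \<le> (L2norm \<Omega> (u s))\<^sup>2 - (L2norm \<Omega> (u t))\<^sup>2 + 2 * (Bu + 0) * 0"
      by (intro LIMSEQ_le_const[OF Dlim]) auto
    then show ?thesis by simp
  qed
  then have "k * (t - s) \<le> ((L2norm \<Omega> (u s))\<^sup>2 - (L2norm \<Omega> (u t))\<^sup>2) / c"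
    using le c by (simp add: ennreal_le_iff)
  then show ?thesis using c by (simp add: c_def field_simps)
qed

subsection \<open>Decay\<close>

text \<open>The tangent bound of exp at 0. It replaces differentiation of powers in the discrete
  decay steps.\<close>

lemma powr_ge_ln: "1 + a * ln z \<le> z powr a" if "0 < z" for a z :: real
  using exp_ge_add_one_self[of "a * ln z"] that by (simp add: powr_def)

text \<open>The energy inequality carries the power of the end value y1. Replacing it by the start
  value y0 costs a relative error (1 + \<beta>)(y0 - y1)/y, which multiplies \<tau> and is therefore
  of second order.\<close>

lemma decay_step:
  fixes y0 y1 y \<tau> :: real
  assumes y: "0 < y" "y \<le> y1" "y1 \<le> y0" and \<kappa>: "0 < \<kappa>" and \<beta>: "0 \<le> \<beta>" and \<tau>: "0 \<le> \<tau>"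
    and st: "2 * \<kappa> * \<tau> * y1 powr (1 + \<beta>) \<le> y0 - y1"
  shows "2 * \<kappa> * \<tau> - 2 * \<kappa> * (1 + \<beta>) / y * (\<tau> + (y0 - y1))\<^sup>2 \<le> (y0 - y1) * y0 powr (- (1 + \<beta>))"
proof -
  define d where "d = y0 - y1"
  have y1: "0 < y1" "0 < y0" and d: "0 \<le> d" using y by (auto simp: d_def)
  have "ln (y0 / y1) \<le> y0 / y1 - 1" using y1 by (intro ln_le_minus_one) simp
  also have "y0 / y1 - 1 = d / y1" using y1 by (simp add: d_def field_simps)
  also have "\<dots> \<le> d / y" using y d by (intro divide_left_mono) auto
  finally have "ln (y0 / y1) \<le> d / y" .
  then have "(1 + \<beta>) * ln (y0 / y1) \<le> (1 + \<beta>) * (d / y)" using \<beta> by (intro mult_left_mono) auto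
  moreover have "(1 + \<beta>) * ln (y1 / y0) = - ((1 + \<beta>) * ln (y0 / y1))" using y1 by (simp add: ln_div algebra_simps)
  ultimately have le: "1 - (1 + \<beta>) * (d / y) \<le> (y1 / y0) powr (1 + \<beta>)"
    using powr_ge_ln[of "y1 / y0" "1 + \<beta>"] y1 by simp
  have "\<tau> * d \<le> (\<tau> + d)\<^sup>2" using \<tau> d by (simp add: power2_eq_square algebra_simps)
  then have "2 * \<kappa> * (1 + \<beta>) / y * (\<tau> * d) \<le> 2 * \<kappa> * (1 + \<beta>) / y * (\<tau> + d)\<^sup>2"
    using \<kappa> \<beta> y by (intro mult_left_mono) auto
  moreover have "2 * \<kappa> * \<tau> * (1 - (1 + \<beta>) * (d / y)) = 2 * \<kappa> * \<tau> - 2 * \<kappa> * (1 + \<beta>) / y * (\<tau> * d)"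
    by (simp add: algebra_simps)
  ultimately have "2 * \<kappa> * \<tau> - 2 * \<kappa> * (1 + \<beta>) / y * (\<tau> + d)\<^sup>2 \<le> 2 * \<kappa> * \<tau> * (1 - (1 + \<beta>) * (d / y))" by argo
  also have "\<dots> \<le> 2 * \<kappa> * \<tau> * (y1 / y0) powr (1 + \<beta>)" using le \<kappa> \<tau> by (intro mult_left_mono) auto
  also have "\<dots> = (2 * \<kappa> * \<tau> * y1 powr (1 + \<beta>)) * y0 powr (- (1 + \<beta>))"
    using powr_minus_divide[of y0 "1 + \<beta>"] y1 by (simp add: powr_divide del: minus_add_distrib)
  also have "\<dots> \<le> d * y0 powr (- (1 + \<beta>))" using st by (intro mult_right_mono) (auto simp: d_def)
  finally show ?thesis by (simp add: d_def)
qed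

text \<open>W dominates both the elapsed time and the decrease of Y, so the error terms of \<open>decay_step\<close> are
  quadratic in its increments.\<close>

lemma decay_increments:
  fixes L :: "real \<Rightarrow> real"
  assumes st: "s \<le> t" and \<kappa>: "0 < \<kappa>" and \<alpha>: "0 \<le> \<alpha>" and cont: "continuous_on {s..t} L" and L0: "\<And>p. 0 \<le> L p"
    and mono: "\<And>p q. s \<le> p \<Longrightarrow> p \<le> q \<Longrightarrow> q \<le> t \<Longrightarrow> L q \<le> L p"
    and inc: "\<And>p q. s \<le> p \<Longrightarrow> p \<le> q \<Longrightarrow> q \<le> t \<Longrightarrow> 2 * \<kappa> * (q - p) * L q powr (2 + \<alpha>) \<le> (L p)\<^sup>2 - (L q)\<^sup>2"
  shows "\<alpha> = 0 \<Longrightarrow> L t \<le> L s * exp (- \<kappa> * (t - s))"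
    and "0 < \<alpha> \<Longrightarrow> L t \<le> L s / (1 + \<alpha> * \<kappa> * L s powr \<alpha> * (t - s)) powr (1 / \<alpha>)"
proof -
  \<comment> \<open>The argument runs with Y = L^2, for which L^(2+\<alpha>) =
    Y^(1+\<beta>).\<close>
  define \<beta> where "\<beta> = \<alpha> / 2"
  have \<beta>: "0 \<le> \<beta>" using \<alpha> by (simp add: \<beta>_def)
  define Y where "Y p = (L p)\<^sup>2" for p
  have Ypow: "Y p powr c = L p powr (2 * c)" for p c
    using L0[of p] by (cases "L p = 0") (auto simp: Y_def powr_powr[symmetric])
  define W where "W p = p - Y p" for p
  have Wc: "continuous_on {s..t} W" unfolding W_def Y_def by (intro continuous_intros cont)
  have Ymono: "Y q \<le> Y p" if "s \<le> p" "p \<le> q" "q \<le> t" for p q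
    unfolding Y_def by (rule power_mono[OF mono[OF that] L0])
  have Wm: "W p \<le> W q" if "s \<le> p" "p \<le> q" "q \<le> t" for p q using Ymono[OF that] that by (simp add: W_def)
  have step: "2 * \<kappa> * (q - p) - 2 * \<kappa> * (1 + \<beta>) / Y t * (W q - W p)\<^sup>2 \<le> (Y p - Y q) * Y p powr (- (1 + \<beta>))"
    if Lt: "0 < L t" and pq: "s \<le> p" "p \<le> q" "q \<le> t" for p q
  proof -
    have e: "W q - W p = (q - p) + (Y p - Y q)" by (simp add: W_def)
    have "2 * \<kappa> * (q - p) * Y q powr (1 + \<beta>) \<le> Y p - Y q"
      using inc[OF pq] unfolding Ypow by (simp add: Y_def \<beta>_def algebra_simps)
    then show ?thesis unfolding e
      by (intro decay_step) (use Lt pq \<kappa> \<beta> Ymono[OF pq] Ymono[of q t] in \<open>auto simp: Y_def\<close>)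
  qed
  \<comment> \<open>If L vanishes at t the claims are trivial. Otherwise monotonicity keeps Y above
    Y t on the whole interval, which bounds the constant of the error term.\<close>
  have Yp: "0 < Y p" if "0 < L t" "s \<le> p" "p \<le> t" for p
    using mono[OF that(2,3)] that by (simp add: Y_def)
  show "L t \<le> L s * exp (- \<kappa> * (t - s))" if a: "\<alpha> = 0"
  proof (cases "0 < L t")
    case False
    then show ?thesis using L0[of t] L0[of s] by (auto intro: order_trans[OF _ mult_nonneg_nonneg])
  next
    case Lt: True
    \<comment> \<open>For \<beta> = 0 the logarithm is the function of Y that decreases linearly, up
      to quadratic errors.\<close>
    have "ln (Y t) - ln (Y s) \<le> (- 2 * \<kappa> * t) - (- 2 * \<kappa> * s)"
    proof (rule increment_refine[OF st _ Wc Wm, where C = "2 * \<kappa> / Y t"])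
      show "0 \<le> 2 * \<kappa> / Y t" using \<kappa> by (simp add: Y_def)
      fix p q assume pq: "s \<le> p" "p \<le> q" "q \<le> t"
      have pos: "0 < Y p" "0 < Y q" using Yp[OF Lt] pq by auto
      have "ln (Y q) - ln (Y p) = ln (Y q / Y p)" using pos by (simp add: ln_div)
      also have "\<dots> \<le> Y q / Y p - 1" using pos by (intro ln_le_minus_one) simp
      also have "\<dots> = - ((Y p - Y q) * Y p powr (- (1 + \<beta>)))"
        using pos a by (simp add: \<beta>_def powr_minus_divide field_simps)
      also have "\<dots> \<le> - (2 * \<kappa> * (q - p) - 2 * \<kappa> * (1 + \<beta>) / Y t * (W q - W p)\<^sup>2)" using step[OF Lt pq] by simp
      also have "\<dots> = (- 2 * \<kappa> * q) - (- 2 * \<kappa> * p) + 2 * \<kappa> / Y t * (W q - W p)\<^sup>2" using a by (simp add: \<beta>_def algebra_simps)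
      finally show "ln (Y q) - ln (Y p) \<le> (- 2 * \<kappa> * q) - (- 2 * \<kappa> * p) + 2 * \<kappa> / Y t * (W q - W p)\<^sup>2" .
    qed auto
    moreover have Ls: "0 < L s" using mono[OF order.refl st order.refl] Lt by simp
    ultimately have "ln (L t) \<le> ln (L s) + (- \<kappa> * (t - s))" using Lt by (simp add: Y_def ln_realpow algebra_simps)
    then have "exp (ln (L t)) \<le> exp (ln (L s) + (- \<kappa> * (t - s)))" by (simp only: exp_le_cancel_iff)
    then show ?thesis using Lt Ls unfolding exp_add by simp
  qed
  show "L t \<le> L s / (1 + \<alpha> * \<kappa> * L s powr \<alpha> * (t - s)) powr (1 / \<alpha>)" if a: "0 < \<alpha>"
  proof (cases "0 < L t")
    case False
    then show ?thesis using L0[of t] L0[of s] by (auto intro: order_trans[OF _ divide_nonneg_nonneg])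
  next
    case Lt: True
    have Ls: "0 < L s" using mono[OF order.refl st order.refl] Lt by simp
    \<comment> \<open>For \<beta> > 0 the linearising function is Y^(-\<beta>), which grows at least
      at rate 2 \<beta> \<kappa>; solving for L then gives the algebraic law.\<close>
    have "- (Y t powr (- \<beta>)) - - (Y s powr (- \<beta>)) \<le> (- 2 * \<beta> * \<kappa> * t) - (- 2 * \<beta> * \<kappa> * s)"
    proof (rule increment_refine[OF st _ Wc Wm, where C = "2 * \<beta> * \<kappa> * (1 + \<beta>) / Y t"])
      show "0 \<le> 2 * \<beta> * \<kappa> * (1 + \<beta>) / Y t" using \<kappa> \<beta> by (simp add: Y_def)
      fix p q assume pq: "s \<le> p" "p \<le> q" "q \<le> t"
      have pos: "0 < Y p" "0 < Y q" using Yp[OF Lt] pq by auto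
      have "1 + \<beta> * (1 - Y q / Y p) \<le> 1 + (- \<beta>) * ln (Y q / Y p)"
        using mult_left_mono[OF ln_le_minus_one[of "Y q / Y p"] \<beta>] pos by (simp add: algebra_simps)
      also have "\<dots> \<le> (Y q / Y p) powr (- \<beta>)" by (rule powr_ge_ln) (use pos in simp)
      finally have "Y p powr (- \<beta>) * (1 + \<beta> * (1 - Y q / Y p)) \<le> Y p powr (- \<beta>) * (Y q / Y p) powr (- \<beta>)"
        by (rule mult_left_mono) simp
      also have "\<dots> = Y q powr (- \<beta>)" using pos by (simp add: powr_divide)
      also have "Y p powr (- \<beta>) * (1 + \<beta> * (1 - Y q / Y p)) = Y p powr (- \<beta>) + \<beta> * ((Y p - Y q) * Y p powr (- (1 + \<beta>)))"
      proof -
        have "Y p powr (- (1 + \<beta>)) = Y p powr (- \<beta> - 1)" by (rule arg_cong[where f = "(powr) (Y p)"]) simp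
        also have "\<dots> = Y p powr (- \<beta>) / Y p" using pos by (simp add: powr_diff)
        finally have "Y p powr (- (1 + \<beta>)) = Y p powr (- \<beta>) / Y p" .
        then show ?thesis using pos by (simp add: field_simps)
      qed
      finally have "- (Y q powr (- \<beta>)) - - (Y p powr (- \<beta>)) \<le> - (\<beta> * ((Y p - Y q) * Y p powr (- (1 + \<beta>))))" by simp
      also have "\<dots> \<le> - (\<beta> * (2 * \<kappa> * (q - p) - 2 * \<kappa> * (1 + \<beta>) / Y t * (W q - W p)\<^sup>2))"
        using mult_left_mono[OF step[OF Lt pq] \<beta>] by simp
      also have "\<dots> = (- 2 * \<beta> * \<kappa> * q) - (- 2 * \<beta> * \<kappa> * p) + 2 * \<beta> * \<kappa> * (1 + \<beta>) / Y t * (W q - W p)\<^sup>2"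
        by (simp add: algebra_simps)
      finally show "- (Y q powr (- \<beta>)) - - (Y p powr (- \<beta>)) \<le>
          (- 2 * \<beta> * \<kappa> * q) - (- 2 * \<beta> * \<kappa> * p) + 2 * \<beta> * \<kappa> * (1 + \<beta>) / Y t * (W q - W p)\<^sup>2" .
    qed auto
    then have "L s powr (- \<alpha>) + \<alpha> * \<kappa> * (t - s) \<le> L t powr (- \<alpha>)"
      unfolding Ypow by (simp add: \<beta>_def algebra_simps)
    moreover have "L s powr (- \<alpha>) + \<alpha> * \<kappa> * (t - s) = L s powr (- \<alpha>) * (1 + \<alpha> * \<kappa> * L s powr \<alpha> * (t - s))"
      using Ls by (simp add: powr_minus_divide field_simps)
    ultimately have le: "L s powr (- \<alpha>) * (1 + \<alpha> * \<kappa> * L s powr \<alpha> * (t - s)) \<le> L t powr (- \<alpha>)" by simp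
    define Z where "Z = 1 + \<alpha> * \<kappa> * L s powr \<alpha> * (t - s)"
    have "0 \<le> \<alpha> * \<kappa> * L s powr \<alpha> * (t - s)" using a \<kappa> st by simp
    then have Z: "0 < Z" by (simp add: Z_def)
    have "L t = (L t powr (- \<alpha>)) powr (- (1 / \<alpha>))" using a Lt by (simp add: powr_powr)
    also have "\<dots> \<le> (L s powr (- \<alpha>) * Z) powr (- (1 / \<alpha>))"
      using le Ls Z a unfolding Z_def[symmetric] by (intro powr_mono2') auto
    also have "\<dots> = L s / Z powr (1 / \<alpha>)" using a Ls Z powr_minus_divide[of Z "1 / \<alpha>"] by (simp only: powr_mult powr_powr) simp
    finally show ?thesis by (simp add: Z_def)
  qed
qed

text \<open>The factors 4 and 8N are those of the interpolation inequality; \<open>1 + \<bar>G\<bar>\<close> keeps the base of the power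
  positive when the gradient bound G vanishes.\<close>

definition decay_const :: "nat \<Rightarrow> real \<Rightarrow> real \<Rightarrow> real \<Rightarrow> real" where
  "decay_const N m G \<delta> = \<delta> * 4 powr (- (1 + m)) * ((1 + \<bar>G\<bar>) * sqrt (8 * real N)) powr (- (real N * (1 - m) / 2))"

text \<open>The equation L' = -\<kappa> L^(1+\<alpha>) has the solution with 1 + \<alpha> \<kappa>
  L(0)^\<alpha> t in the denominator, so the constant of the algebraic law is \<alpha> \<kappa>; for
  N = 2 the exponential rate is \<kappa> itself.\<close>

definition decay_rate :: "nat \<Rightarrow> real \<Rightarrow> real \<Rightarrow> real \<Rightarrow> real" where
  "decay_rate N m G \<delta> = (if N = 2 then 1 else (1 - m) * (real N - 2) / 2) * decay_const N m G \<delta>"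

lemma decay_const_pos: "0 < \<delta> \<Longrightarrow> 0 < N \<Longrightarrow> 0 < decay_const N m G \<delta>"
  by (auto simp: decay_const_def)

lemma decay_rate_pos: "0 < \<delta> \<Longrightarrow> 2 \<le> N \<Longrightarrow> m < 1 \<Longrightarrow> 0 < decay_rate N m G \<delta>"
  using decay_const_pos[of \<delta> N m G] by (auto simp: decay_rate_def)

lemma continuous_on_decay_rate:
  assumes "0 < N" "continuous_on S m" "continuous_on S G" "continuous_on S \<delta>"
  shows "continuous_on S (\<lambda>p. decay_rate N (m p) (G p) (\<delta> p))"
proof (cases "N = 2")
  case True
  then show ?thesis unfolding decay_rate_def decay_const_def
    by (auto intro!: continuous_intros assms simp: add_nonneg_eq_0_iff)
next
  case False
  then show ?thesis unfolding decay_rate_def decay_const_def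
    using \<open>0 < N\<close> by (auto intro!: continuous_intros assms simp: add_nonneg_eq_0_iff)
qed

text \<open>Joins energy, interpolation and the essential gradient bound. That bound holds for
  almost every time only, which is enough because \<open>weak_energy\<close> asks for its lower
  bound almost everywhere.\<close>

lemma weak_sol_decay:
  fixes \<Omega> :: "(real^'n::finite) set"
  assumes N: "2 \<le> CARD('n)" and \<Omega>: "open \<Omega>" and a: "a \<in> Cset m" and m: "0 \<le> m" "m < 1"
    and fin: "m = 0 \<longrightarrow> emeasure lebesgue \<Omega> < \<infinity>" and sol: "weak_sol \<Omega> V a m f u0 u"
    and u0: "memH10 \<Omega> u0" and f: "L1H10 {0<..} \<Omega> f"
    and fF: "AE r in lborel. r \<in> {T0<..} \<longrightarrow> (AE x in lebesgue_on \<Omega>. cmod (f r x) \<le> F)"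
    and mF: "m = 0 \<or> F = 0" and aF: "F < Im a" and T0: "0 \<le> T0" "T0 \<le> t"
  shows "L2norm \<Omega> (u t) \<le> decay_bound CARD('n) m
     (decay_rate CARD('n) m (real_of_ereal (grad_Linf \<Omega> u)) (Im a - F)) (L2norm \<Omega> (u T0)) (t - T0)"
proof -
  define N where "N = CARD('n)"
  define \<alpha> where "\<alpha> = (1 - m) * (real N - 2) / 2"
  define G where "G = 1 + \<bar>real_of_ereal (grad_Linf \<Omega> u)\<bar>"
  define \<gamma> where "\<gamma> = real N * (1 - m) / 2"
  define c where "c = 4 powr (- (1 + m)) * (G * sqrt (8 * real N)) powr (- \<gamma>)"
  define \<kappa> where "\<kappa> = (Im a - F) * c"
  define L where "L p = L2norm \<Omega> (u p)" for p
  have N2: "2 \<le> N" using N by (simp add: N_def)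
  have \<alpha>: "0 \<le> \<alpha>" using N2 m by (simp add: \<alpha>_def)
  have G: "0 < G" unfolding G_def by (rule add_pos_nonneg[OF zero_less_one abs_ge_zero])
  have c: "0 < c" using G N2 by (simp add: c_def)
  have \<kappa>: "0 < \<kappa>" using c aF by (simp add: \<kappa>_def)
  have \<kappa>_eq: "decay_const N m (real_of_ereal (grad_Linf \<Omega> u)) (Im a - F) = \<kappa>"
    by (simp add: decay_const_def \<kappa>_def c_def G_def \<gamma>_def)
  \<comment> \<open>The power 1 + m of the dissipation and the power \<gamma> of the cube side,
    itself proportional to the norm, add up to the exponent of the decay inequality.\<close>
  have exps: "1 + m + \<gamma> = 2 + \<alpha>" by (simp add: \<gamma>_def \<alpha>_def field_simps)
  have grad: "AE t in lborel. t \<in> {0<..} \<longrightarrow> memH10 \<Omega> (u t) \<and> sqrt (gradL2sq \<Omega> (u t)) \<le> real_of_ereal (grad_Linf \<Omega> u)"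
    by (rule grad_Linf_bound(2)[OF \<Omega> a m fin sol u0 f])
  have L0: "0 \<le> L p" for p by (simp add: L_def)
  have energy: "2 * (Im a - F) * (k * (q - p)) \<le> (L p)\<^sup>2 - (L q)\<^sup>2"
    if "T0 \<le> p" "p \<le> q" "0 \<le> k"
      "AE r in lborel. r \<in> {p<..<q} \<longrightarrow> ennreal k \<le> (\<integral>\<^sup>+x. ennreal (cmod (u r x) powr (1 + m)) \<partial>lebesgue_on \<Omega>)" for p q k
    unfolding L_def by (rule weak_energy[OF \<Omega> a m sol f fF mF aF T0(1) that])
  \<comment> \<open>The energy inequality with lower bound 0.\<close>
  have mono: "L q \<le> L p" if "T0 \<le> p" "p \<le> q" for p q
  proof -
    have "(L q)\<^sup>2 \<le> (L p)\<^sup>2" using energy[OF that, of 0] by simp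
    then show ?thesis using L0 by (rule power2_le_imp_le)
  qed
  have inc: "2 * \<kappa> * (q - p) * L q powr (2 + \<alpha>) \<le> (L p)\<^sup>2 - (L q)\<^sup>2" if pq: "T0 \<le> p" "p \<le> q" for p q
  proof -
    have split: "c * l powr (2 + \<alpha>) = (l / 4) powr (1 + m) * (l / (G * sqrt (8 * real N))) powr \<gamma>" if "0 \<le> l" for l
    proof -
      have "l powr (2 + \<alpha>) = l powr (1 + m) * l powr \<gamma>" unfolding exps[symmetric] by (rule powr_add)
      then show ?thesis using powr_minus_divide[of 4 "1 + m"] powr_minus_divide[of "G * sqrt (8 * real N)" \<gamma>] that
        unfolding c_def by (simp only: powr_divide) simp
    qed
    have "AE r in lborel. r \<in> {p<..<q} \<longrightarrow>
        ennreal (c * L q powr (2 + \<alpha>)) \<le> (\<integral>\<^sup>+x. ennreal (cmod (u r x) powr (1 + m)) \<partial>lebesgue_on \<Omega>)"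
      using grad
    proof eventually_elim
      case (elim r)
      show ?case
      proof
        assume r: "r \<in> {p<..<q}"
        have "real_of_ereal (grad_Linf \<Omega> u) \<le> G"
          unfolding G_def by (rule order_trans[OF abs_ge_self]) simp
        then have H: "memH10 \<Omega> (u r)" "sqrt (gradL2sq \<Omega> (u r)) \<le> G" using r elim pq T0 by auto
        have "gradL2sq \<Omega> (u r) \<le> G\<^sup>2" using H(2) by (rule sqrt_le_D)
        then have "ennreal (c * L r powr (2 + \<alpha>)) \<le> (\<integral>\<^sup>+x. ennreal (cmod (u r x) powr (1 + m)) \<partial>lebesgue_on \<Omega>)"
          using gagliardo_nirenberg[OF \<Omega> H(1) G _ m] split[OF L0[of r]] by (simp add: L_def \<gamma>_def N_def)
        \<comment> \<open>On (p, q) the norm is at least its final value, which supplies the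
          constant lower bound for the dissipation.\<close>
        moreover have "c * L q powr (2 + \<alpha>) \<le> c * L r powr (2 + \<alpha>)"
          using mono[of r q] r pq c \<alpha> L0 by (intro mult_left_mono powr_mono2) auto
        ultimately show "ennreal (c * L q powr (2 + \<alpha>)) \<le> (\<integral>\<^sup>+x. ennreal (cmod (u r x) powr (1 + m)) \<partial>lebesgue_on \<Omega>)"
          by (meson ennreal_leI order_trans)
      qed
    qed
    then have "2 * (Im a - F) * (c * L q powr (2 + \<alpha>) * (q - p)) \<le> (L p)\<^sup>2 - (L q)\<^sup>2"
      by (rule energy[OF pq, rotated]) (use c in simp)
    then show ?thesis by (simp add: \<kappa>_def mult_ac)
  qed
  have "continuous_on {0..t + 1} L"
    unfolding L_def by (rule CL2_continuous_L2norm[OF weak_sol_CL2[OF sol]]) (use T0 in simp)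
  then have cont: "continuous_on {T0..t} L" by (rule continuous_on_subset) (use T0 in auto)
  note D = decay_increments[OF T0(2) \<kappa> \<alpha> cont L0 mono inc]
  show ?thesis
  proof (cases "N = 2")
    case True
    then show ?thesis using D(1) \<kappa>_eq by (simp add: \<alpha>_def decay_bound_def decay_rate_def N_def[symmetric] L_def)
  next
    case False
    then have "0 < \<alpha>" using N2 m by (simp add: \<alpha>_def)
    then show ?thesis using D(2) False by (simp add: \<alpha>_def decay_bound_def decay_rate_def \<kappa>_eq N_def[symmetric] L_def)
  qed
qed

lemma forcing_bound:
  fixes \<Omega> :: "(real^'n::finite) set"
  assumes \<Omega>: "open \<Omega>" and lt: "f_Linf \<Omega> T0 f < ereal A" and A: "0 < A"
  shows "real_of_ereal (f_Linf \<Omega> T0 f) < A"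
    and "AE r in lborel. r \<in> {T0<..} \<longrightarrow> (AE x in lebesgue_on \<Omega>. cmod (f r x) \<le> real_of_ereal (f_Linf \<Omega> T0 f))"
proof -
  \<comment> \<open>The value minus infinity is read as 0, which the positivity of A covers.\<close>
  show "real_of_ereal (f_Linf \<Omega> T0 f) < A" using lt A by (cases "f_Linf \<Omega> T0 f") auto
  have op: "open ({T0<..} \<times> \<Omega>)" by (rule open_Times[OF open_greaterThan \<Omega>])
  have "AE p in lborel. p \<in> {T0<..} \<times> \<Omega> \<longrightarrow> ereal (cmod (f (fst p) (snd p))) \<le> f_Linf \<Omega> T0 f"
    unfolding AE_lebesgue_on_open_iff[OF op, symmetric] f_Linf_def by (rule esssup_AE)
  then have "AE p in lborel. p \<in> {T0<..} \<times> \<Omega> \<longrightarrow> cmod (f (fst p) (snd p)) \<le> real_of_ereal (f_Linf \<Omega> T0 f)"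
    by eventually_elim (use lt in \<open>cases "f_Linf \<Omega> T0 f"; auto\<close>)
  from AE_lborel_swap(1)[OF this]
  show "AE r in lborel. r \<in> {T0<..} \<longrightarrow> (AE x in lebesgue_on \<Omega>. cmod (f r x) \<le> real_of_ereal (f_Linf \<Omega> T0 f))"
  proof eventually_elim
    case (elim r)
    then show ?case unfolding AE_lebesgue_on_open_iff[OF \<Omega>] by (auto elim: eventually_mono)
  qed
qed

text \<open>Choosing K before \<Omega>, V, a, f and the solution expresses that the constant depends
  on the listed quantities only; N is fixed by the type. The case m = 0 has its own K because its
  effective damping is reduced by the forcing. Finiteness of the gradient norm is asserted along
  with the decay because K takes its real value.\<close>

theorem theorem3p6:
  fixes dummy :: "real^'n::finite"
  assumes "CARD('n) \<ge> 2"
  shows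
    "(\<exists>K :: real \<times> real \<Rightarrow> real.
        continuous_on ({0..} \<times> {0<..}) K \<and> (\<forall>p \<in> {0..} \<times> {0<..}. K p > 0) \<and>
        (\<forall>(\<Omega> :: (real^'n) set) V a f u0 u T0.
           assumption_N1 \<Omega> V a 0 f u0 u T0 \<longrightarrow>
           grad_Linf \<Omega> u < \<infinity> \<and>
           (\<forall>t \<ge> T0. L2norm \<Omega> (u t) \<le>
              decay_bound CARD('n) 0
                (K (real_of_ereal (grad_Linf \<Omega> u), Im a - real_of_ereal (f_Linf \<Omega> T0 f)))
                (L2norm \<Omega> (u T0)) (t - T0)))) \<and>
     (\<exists>K :: real \<times> real \<times> real \<Rightarrow> real.
        continuous_on ({0..} \<times> {0<..} \<times> {0<..<1}) K \<and> (\<forall>p \<in> {0..} \<times> {0<..} \<times> {0<..<1}. K p > 0) \<and>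
        (\<forall>(\<Omega> :: (real^'n) set) V a m f u0 u T0.
           0 < m \<and> assumption_N1 \<Omega> V a m f u0 u T0 \<longrightarrow>
           grad_Linf \<Omega> u < \<infinity> \<and>
           (\<forall>t \<ge> T0. L2norm \<Omega> (u t) \<le>
              decay_bound CARD('n) m
                (K (real_of_ereal (grad_Linf \<Omega> u), Im a, m))
                (L2norm \<Omega> (u T0)) (t - T0))))"
proof (rule conjI; rule exI; intro conjI allI impI ballI)
  let ?K = "\<lambda>p. decay_rate CARD('n) 0 (fst p) (snd p)"
  show "continuous_on ({0..} \<times> {0<..}) ?K"
    by (rule continuous_on_decay_rate) (auto intro!: continuous_intros)
  show "0 < ?K p" if "p \<in> {0..} \<times> {0<..}" for p
    by (rule decay_rate_pos) (use that assms in auto)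
  fix \<Omega> :: "(real^'n) set" and V a f u0 u T0
  assume A: "assumption_N1 \<Omega> V a 0 f u0 u T0"
  note A' = A[unfolded assumption_N1_def]
  have B: "open \<Omega>" "a \<in> Cset 0" "(0::real) \<le> 0" "(0::real) < 1" "0 = (0::real) \<longrightarrow> emeasure lebesgue \<Omega> < \<infinity>"
    "weak_sol \<Omega> V a 0 f u0 u" "memH10 \<Omega> u0" "L1H10 {0<..} \<Omega> f"
    using A' by auto
  show "grad_Linf \<Omega> u < \<infinity>" by (rule grad_Linf_bound(1)[OF B])
  have lt: "f_Linf \<Omega> T0 f < ereal (Im a)" using A' by (simp add: f_Linf_def)
  have "0 < Im a" using B(2) by (simp add: Cset_def)
  note F = forcing_bound[OF B(1) lt this]
  fix t assume "T0 \<le> t"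
  then show "L2norm \<Omega> (u t) \<le> decay_bound CARD('n) 0
                (?K (real_of_ereal (grad_Linf \<Omega> u), Im a - real_of_ereal (f_Linf \<Omega> T0 f)))
                (L2norm \<Omega> (u T0)) (t - T0)"
    unfolding fst_conv snd_conv using A' by (intro weak_sol_decay[OF assms B F(2) _ F(1)]) auto
next
  let ?K = "\<lambda>p. decay_rate CARD('n) (snd (snd p)) (fst p) (fst (snd p))"
  show "continuous_on ({0..} \<times> {0<..} \<times> {0<..<1}) ?K"
    by (rule continuous_on_decay_rate) (auto intro!: continuous_intros)
  show "0 < ?K p" if "p \<in> {0..} \<times> {0<..} \<times> {0<..<1}" for p
    by (rule decay_rate_pos) (use that assms in auto)
  fix \<Omega> :: "(real^'n) set" and V a m f u0 u T0
  assume A: "0 < m \<and> assumption_N1 \<Omega> V a m f u0 u T0"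
  note A' = A[unfolded assumption_N1_def]
  have B: "open \<Omega>" "a \<in> Cset m" "0 \<le> m" "m < 1" "m = 0 \<longrightarrow> emeasure lebesgue \<Omega> < \<infinity>"
    "weak_sol \<Omega> V a m f u0 u" "memH10 \<Omega> u0" "L1H10 {0<..} \<Omega> f"
    using A' by (auto simp: Cint_def)
  show "grad_Linf \<Omega> u < \<infinity>" by (rule grad_Linf_bound(1)[OF B])
  have f: "AE r in lborel. r \<in> {T0<..} \<longrightarrow> (AE x in lebesgue_on \<Omega>. cmod (f r x) \<le> 0)"
    using A' unfolding AE_lebesgue_on_open_iff[OF open_greaterThan] by simp
  have a: "0 < Im a" using B(2) by (simp add: Cset_def)
  fix t assume "T0 \<le> t"
  then show "L2norm \<Omega> (u t) \<le> decay_bound CARD('n) m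
                (?K (real_of_ereal (grad_Linf \<Omega> u), Im a, m)) (L2norm \<Omega> (u T0)) (t - T0)"
    using weak_sol_decay[OF assms B f _ a, of t] A' by simp
qed

end
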